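(* Let $(B,g_B)$ be a non-degenerate semi-Riemannian manifold, let $(F_j,g_{F_j})$, $1\le j\le m$, be semi-regular semi-Riemannian manifolds, and let $b_j\in C^\infty(B)$. Fix $l\in\{1,\dots,m\}$ and $P\in\Gamma(TF_l)$, and let $\widehat R$ be the semi-symmetric non-metric curvature, with respect to $P$, of the multiply warped product $B\times_{b_1}F_1\times\cdots\times_{b_m}F_m$. For all $X,Y,Z,T\in\Gamma(TB)$ and all $U_k\in\Gamma(TF_k)$, $V_i\in\Gamma(TF_i)$, $W_j\in\Gamma(TF_j)$, $Q_s\in\Gamma(TF_s)$: (1) $\widehat R(X,Y,Z,T)=R_B(X,Y,Z,T)$; (2) if $j=l$: $\widehat R(X,Y,Z,W_j)=b_j^2g_{F_j}(W_j,P)\big(\mathcal K_B(X,Z,Y)-\mathcal K_B(Y,Z,X)\big)$; (3) if $j=l$: $\widehat R(X,Y,W_j,Z)=2b_jg_{F_j}(W_j,P)\big(X(b_j)g_B(Y,Z)-Y(b_j)g_B(X,Z)\big)$; (4) if $j=l$: $\widehat R(X,W_j,Y,Z)=\widehat R(W_j,X,Y,Z)=0$; (5) if $j\ne l$: $\widehat R(X,Y,Z,W_j)=\widehat R(X,Y,W_j,Z)=\widehat R(X,W_j,Y,Z)=\widehat R(W_j,X,Y,Z)=0$; (6) $\widehat R(X,Y,V_i,W_j)=\widehat R(V_i,W_j,X,Y)=0$; (7) if $i=j=l$: $\widehat R(V_i,X,W_j,Y)=-\widehat R(X,V_i,W_j,Y)=b_jXY(b_j)g_{F_j}(V_j,W_j)-b_jg_B^*(\nabla^\flat_XY,db_j)g_{F_j}(V_j,W_j)+b_j^2V_j(g_{F_j}(W_j,P))g_B(X,Y)$;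 (8) if $i=j\ne l$: $\widehat R(V_i,X,W_j,Y)=-\widehat R(X,V_i,W_j,Y)=b_jXY(b_j)g_{F_j}(V_j,W_j)-b_jg_B^*(\nabla^\flat_XY,db_j)g_{F_j}(V_j,W_j)$; (9) if $i=j=l$ or $i=j\ne l$: $\widehat R(V_i,X,Y,W_j)=-\widehat R(X,V_i,Y,W_j)=-b_jXY(b_j)g_{F_j}(V_j,W_j)+b_jg_B^*(\nabla^\flat_XY,db_j)g_{F_j}(V_j,W_j)$; (10) $\widehat R(V_i,X,W_j,Y)=\widehat R(V_i,X,Y,W_j)=0$ in all other cases; (11) if $i=j=k=l$: $\widehat R(X,V_i,W_j,U_k)=2b_j^3X(b_j)\big(g_{F_j}(V_j,U_j)g_{F_j}(W_j,P)+g_{F_j}(V_j,W_j)g_{F_j}(U_j,P)\big)$; (12) if $i=j\ne k=l$: $\widehat R(X,V_i,W_j,U_k)=2b_jb_k^2X(b_j)g_{F_j}(V_j,W_j)g_{F_k}(U_k,P)$; (13) if $i=j\ne k=l$: $\widehat R(X,V_i,U_k,W_j)=2b_kb_j^2X(b_k)g_{F_j}(V_j,W_j)g_{F_k}(U_k,P)$; (14) $\widehat R(X,V_i,W_j,U_k)=0$ in all cases not covered by (11), (12), (13), and $\widehat R(W_j,U_k,X,V_i)=\widehat R(W_j,U_k,V_i,X)=0$ for all $i,j,k$; (15) if $i=j=k=s=l$: $\widehat R(U_k,V_i,W_j,Q_s)=b_j^2R_{F_j}(U_j,V_j,W_j,Q_j)+b_j^2g_B^*(db_j,db_j)\big(g_{F_j}(U_j,W_j)g_{F_j}(V_j,Q_j)-g_{F_j}(V_j,W_j)g_{F_j}(U_j,Q_j)\big)+b_j^4g_{F_j}(Q_j,P)\big(\mathcal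 K_{F_j}(U_j,W_j,V_j)-\mathcal K_{F_j}(V_j,W_j,U_j)\big)+b_j^4U_j(g_{F_j}(W_j,P))g_{F_j}(V_j,Q_j)-b_j^4V_j(g_{F_j}(W_j,P))g_{F_j}(U_j,Q_j)$; (16) if $i=j=k=s\ne l$: $\widehat R(U_k,V_i,W_j,Q_s)=b_j^2R_{F_j}(U_j,V_j,W_j,Q_j)+b_j^2g_B^*(db_j,db_j)\big(g_{F_j}(U_j,W_j)g_{F_j}(V_j,Q_j)-g_{F_j}(V_j,W_j)g_{F_j}(U_j,Q_j)\big)$; (17) if $j=k\ne i=s=l$, or if $k=j$, $i=s$ and $j,i,l$ are pairwise different: $\widehat R(U_k,V_i,W_j,Q_s)=b_ib_jg_B^*(db_i,db_j)g_{F_i}(V_i,Q_i)g_{F_j}(U_j,W_j)$; (18) if $l=j=k\ne i=s$: $\widehat R(U_k,V_i,W_j,Q_s)=b_ib_jg_B^*(db_i,db_j)g_{F_i}(V_i,Q_i)g_{F_j}(U_j,W_j)+b_i^2b_j^2U_j(g_{F_j}(W_j,P))g_{F_i}(V_i,Q_i)$; (19) if $k=s\ne i=j=l$: $\widehat R(U_k,V_i,W_j,Q_s)=-b_jb_kg_B^*(db_j,db_k)g_{F_j}(V_j,W_j)g_{F_k}(U_k,Q_k)-b_j^2b_k^2V_j(g_{F_j}(W_j,P))g_{F_k}(U_k,Q_k)$; (20) if $l=k=s\ne i=j$, or if $k=s$, $i=j$ and $k,i,l$ are pairwise different: $\widehat R(U_k,V_i,W_j,Q_s)=-b_jb_kg_B^*(db_j,db_k)g_{F_j}(V_j,W_j)g_{F_k}(U_k,Q_k)$;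 (21) if $l=k\ne i=j=s$: $\widehat R(V_i,W_j,Q_s,U_k)=b_j^2b_k^2g_{F_k}(U_k,P)\big(\mathcal K_{F_j}(V_j,Q_j,W_j)-\mathcal K_{F_j}(W_j,Q_j,V_j)\big)$; (22) the value of $\widehat R$ on four vector fields each tangent to one of the $F$-factors is $0$ in all cases not covered by (15)–(21).
   Context: A singular semi-Riemannian manifold $(M,g)$ is a smooth manifold with a smooth symmetric bilinear form $g$ on $TM$, possibly degenerate and of variable signature; it is non-degenerate if $g$ is non-degenerate everywhere. Its Koszul form is $\mathcal K(X,Y,Z)=\frac12\{X(g(Y,Z))+Y(g(Z,X))-Z(g(X,Y))-g(X,[Y,Z])+g(Y,[Z,X])+g(Z,[X,Y])\}$, and $(\nabla^\flat_XY)(Z)=\mathcal K(X,Y,Z)$. Contraction: let $T_p^\bullet M=\{g_p(v,\cdot):v\in T_pM\}\subset T_p^*M$ with inner product $g_p^\bullet(g_p(v,\cdot),g_p(w,\cdot))=g_p(v,w)$. For 1-forms $\omega,\tau$ with values in $T^\bullet M$, $\omega(\bullet)\tau(\bullet)$ is the function $p\mapsto g^\bullet_p(\omega_p,\tau_p)$ on the dense open set where the rank of $g$ is locally constant; it is called smooth if it extends (uniquely) to a smooth function on $M$, and then the same symbol denotes the extension. $(M,g)$ is radical-stationary if $\mathcal K(X,Y,\cdot)$ takes values in $T^\bullet M$ for all vector fields $X,Y$, and semi-regular if moreover all $\mathcal K(X,Y,\bullet)\mathcal K(Z,T,\bullet)$ are smooth. On a semi-regular manifold $R(X,Y,Z,T)=X(\mathcal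 K(Y,Z,T))-Y(\mathcal K(X,Z,T))-\mathcal K([X,Y],Z,T)+\mathcal K(X,Z,\bullet)\mathcal K(Y,T,\bullet)-\mathcal K(Y,Z,\bullet)\mathcal K(X,T,\bullet)$. For a vector field $P$ on $M$, the semi-symmetric non-metric Koszul form is $\widehat{\mathcal K}(X,Y,Z)=\mathcal K(X,Y,Z)+g(Y,P)g(X,Z)$. The semi-symmetric non-metric curvature is $\widehat R(X,Y,Z,T)=(\widehat\nabla_X\widehat\nabla^\flat_YZ)(T)-(\widehat\nabla_Y\widehat\nabla^\flat_XZ)(T)-(\widehat\nabla^\flat_{[X,Y]}Z)(T)$ with $(\widehat\nabla^\flat_XY)(Z)=\widehat{\mathcal K}(X,Y,Z)$ and $(\widehat\nabla_X\omega)(T)=X(\omega(T))-(\widehat\nabla^\flat_XT)(\bullet)\,\omega(\bullet)$; that is, the formula for $R$ with $\mathcal K$ replaced everywhere by $\widehat{\mathcal K}$. Equivalently, $\widehat R(X,Y,Z,T)=R(X,Y,Z,T)+X(g(Z,P))g(Y,T)-Y(g(Z,P))g(X,T)-\widehat{\mathcal K}(Y,Z,X)g(P,T)+\widehat{\mathcal K}(X,Z,Y)g(P,T)$. One has $\widehat R(X,Y,Z,T)=-\widehat R(Y,X,Z,T)$; "cases covered" is understood up to this antisymmetry and renaming of the vector fields. The multiply warped product $B\times_{b_1}F_1\times\cdots\times_{b_m}F_m$ is $B\times F_1\times\cdots\times F_m$ with $g=\pi_B^*(g_B)+\sum_j(b_j\circ\pi_B)^2\pi_{F_j}^*(g_{F_j})$,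 where the $\pi$'s are the canonical projections; the $b_j$ may vanish. Under the hypotheses of the claim it is semi-regular. Vector fields in $\Gamma(TB)$, $\Gamma(TF_j)$ are identified with their lifts to the product, and functions and tensors on the factors with their pullbacks. Subscripts $B$, $F_j$ denote objects of that factor. When indices coincide, e.g. $i=j$, $V_i$ is also written $V_j$. $g_B^*$ is the inverse metric of $g_B$ on 1-forms of $B$; in $g_B^*(\nabla^\flat_XY,db_j)$, $\nabla^\flat_XY=\mathcal K_B(X,Y,\cdot)$. $XY(f)$ means $X(Y(f))$. *)

theory Defs
  imports "HOL-Analysis.Analysis" "HOL-Library.Function_Algebras"
begin

section \<open>Smooth manifolds\<close>

text \<open>
  The model space is \<open>\<real>\<^sup>I\<close> for a finite index set \<open>I\<close>, i.e. the functions in \<open>PiE I (\<lambda>_. UNIV)\<close> with the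
  product topology.  Finite index sets instead of \<open>{0..<n}\<close> make the charts of a product manifold
  plain concatenations (over the disjoint union of the index sets), and the dimension
  \<open>card I\<close> may vary within a family of manifolds of one type.
\<close>

definition partial_deriv :: "'k \<Rightarrow> (('k \<Rightarrow> real) \<Rightarrow> real) \<Rightarrow> ('k \<Rightarrow> real) \<Rightarrow> real" where
  "partial_deriv i f x = deriv (\<lambda>t. f (x(i := t))) (x i)"

text \<open>The set \<open>S\<close> is meant to be open in \<open>\<real>\<^sup>I\<close>.\<close>

primrec Ck_on :: "nat \<Rightarrow> 'k set \<Rightarrow> ('k \<Rightarrow> real) set \<Rightarrow> (('k \<Rightarrow> real) \<Rightarrow> real) \<Rightarrow> bool" where
  "Ck_on 0 I S f \<longleftrightarrow> continuous_map (subtopology (powertop_real I) S) euclideanreal f"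
| "Ck_on (Suc n) I S f \<longleftrightarrow>
     continuous_map (subtopology (powertop_real I) S) euclideanreal f \<and>
     (\<forall>i\<in>I. (\<forall>x\<in>S. (\<lambda>t. f (x(i := t))) differentiable (at (x i))) \<and>
            Ck_on n I S (partial_deriv i f))"

definition smooth_on :: "'k set \<Rightarrow> ('k \<Rightarrow> real) set \<Rightarrow> (('k \<Rightarrow> real) \<Rightarrow> real) \<Rightarrow> bool" where
  "smooth_on I S f \<longleftrightarrow> (\<forall>n. Ck_on n I S f)"

record ('a, 'k) mfd =
  mtop :: "'a topology"
  coords :: "'k set"
  atlas :: "('a set \<times> ('a \<Rightarrow> 'k \<Rightarrow> real)) set"

abbreviation points :: "('a, 'k) mfd \<Rightarrow> 'a set" where
  "points M \<equiv> topspace (mtop M)"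

definition smooth_manifold :: "('a, 'k) mfd \<Rightarrow> bool" where
  "smooth_manifold M \<longleftrightarrow>
     finite (coords M) \<and> Hausdorff_space (mtop M) \<and> second_countable (mtop M) \<and>
     (\<forall>(U, \<phi>) \<in> atlas M.
        openin (mtop M) U \<and> openin (powertop_real (coords M)) (\<phi> ` U) \<and>
        homeomorphic_map (subtopology (mtop M) U)
          (subtopology (powertop_real (coords M)) (\<phi> ` U)) \<phi>) \<and>
     (\<Union>(U, \<phi>) \<in> atlas M. U) = points M \<and>
     (\<forall>(U, \<phi>) \<in> atlas M. \<forall>(V, \<psi>) \<in> atlas M. \<forall>i \<in> coords M.
        smooth_on (coords M) (\<phi> ` (U \<inter> V)) (\<lambda>x. \<psi> (inv_into U \<phi> x) i))"

text \<open>\<open>C\<^sup>\<infinity>(M)\<close>; the values outside \<open>points M\<close> are unconstrained.\<close>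

definition smooth_funs :: "('a, 'k) mfd \<Rightarrow> ('a \<Rightarrow> real) set" where
  "smooth_funs M = {f. \<forall>(U, \<phi>) \<in> atlas M. smooth_on (coords M) (\<phi> ` U) (\<lambda>x. f (inv_into U \<phi> x))}"


section \<open>Tangent vectors and vector fields\<close>

type_synonym 'a tvec = "('a \<Rightarrow> real) \<Rightarrow> real"
type_synonym 'a vfield = "'a \<Rightarrow> 'a tvec"
type_synonym 'a form = "'a vfield \<Rightarrow> 'a \<Rightarrow> real"
type_synonym 'a covec = "'a tvec \<Rightarrow> real"
type_synonym 'a metric = "'a \<Rightarrow> 'a tvec \<Rightarrow> 'a tvec \<Rightarrow> real"

text \<open>
  \<open>T\<^sub>pM\<close> consists of the derivations of \<open>C\<^sup>\<infinity>(M)\<close> at \<open>p\<close>.  A derivation is made a total function by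
  the value 0 outside \<open>C\<^sup>\<infinity>(M)\<close>, so that each tangent vector has a single representative.
  (Functions that agree on \<open>points M\<close> get the same value: multiply with the indicator function of
  \<open>points M\<close>.)
\<close>

definition tangent_space :: "('a, 'k) mfd \<Rightarrow> 'a \<Rightarrow> 'a tvec set" where
  "tangent_space M p = {v.
     (\<forall>f. f \<notin> smooth_funs M \<longrightarrow> v f = 0) \<and>
     (\<forall>f\<in>smooth_funs M. \<forall>h\<in>smooth_funs M. v (\<lambda>q. f q + h q) = v f + v h) \<and>
     (\<forall>c. \<forall>f\<in>smooth_funs M. v (\<lambda>q. c * f q) = c * v f) \<and>
     (\<forall>f\<in>smooth_funs M. \<forall>h\<in>smooth_funs M. v (\<lambda>q. f q * h q) = f p * v h + h p * v f)}"

definition dir_deriv :: "'a vfield \<Rightarrow> ('a \<Rightarrow> real) \<Rightarrow> 'a \<Rightarrow> real" where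
  "dir_deriv X f = (\<lambda>p. X p f)"

definition vector_fields :: "('a, 'k) mfd \<Rightarrow> 'a vfield set" where
  "vector_fields M = {X. (\<forall>p\<in>points M. X p \<in> tangent_space M p) \<and>
                         (\<forall>f\<in>smooth_funs M. dir_deriv X f \<in> smooth_funs M)}"

definition lie_bracket :: "'a vfield \<Rightarrow> 'a vfield \<Rightarrow> 'a vfield" where
  "lie_bracket X Y = (\<lambda>p f. X p (dir_deriv Y f) - Y p (dir_deriv X f))"

text \<open>The differential of \<open>\<phi>\<close>, a map into \<open>N\<close>, on a tangent vector of the domain.\<close>

definition pushforward :: "('c, 'n) mfd \<Rightarrow> ('a \<Rightarrow> 'c) \<Rightarrow> 'a tvec \<Rightarrow> 'c tvec" where
  "pushforward N \<phi> v = (\<lambda>f. if f \<in> smooth_funs N then v (\<lambda>p. f (\<phi> p)) else 0)"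

definition differential :: "('a \<Rightarrow> real) \<Rightarrow> 'a form" where
  "differential f = (\<lambda>Z. dir_deriv Z f)"

text \<open>
  A 1-form is given by its action \<open>Z \<mapsto> \<omega>(Z)\<close> on vector fields.  Its value at \<open>p\<close> on \<open>w \<in> T\<^sub>pM\<close> is
  \<open>\<omega>(Z)(p)\<close> for a vector field \<open>Z\<close> extending \<open>w\<close>; for a \<open>C\<^sup>\<infinity>(M)\<close>-linear \<open>\<omega>\<close> this does not depend on \<open>Z\<close>.
\<close>

definition form_at :: "('a, 'k) mfd \<Rightarrow> 'a form \<Rightarrow> 'a \<Rightarrow> 'a covec" where
  "form_at M \<omega> p = (\<lambda>w. if w \<in> tangent_space M p
                        then \<omega> (SOME Z. Z \<in> vector_fields M \<and> Z p = w) p else 0)"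


section \<open>Singular semi-Riemannian manifolds\<close>

definition metric_fun :: "'a metric \<Rightarrow> 'a vfield \<Rightarrow> 'a vfield \<Rightarrow> 'a \<Rightarrow> real" where
  "metric_fun g X Y = (\<lambda>p. g p (X p) (Y p))"

definition singular_semi_riemannian :: "('a, 'k) mfd \<Rightarrow> 'a metric \<Rightarrow> bool" where
  "singular_semi_riemannian M g \<longleftrightarrow>
     smooth_manifold M \<and>
     (\<forall>p\<in>points M. \<forall>u\<in>tangent_space M p. \<forall>v\<in>tangent_space M p. \<forall>w\<in>tangent_space M p. \<forall>c.
        g p u v = g p v u \<and>
        g p (\<lambda>f. u f + v f) w = g p u w + g p v w \<and>
        g p (\<lambda>f. c * u f) w = c * g p u w) \<and>
     (\<forall>X\<in>vector_fields M. \<forall>Y\<in>vector_fields M. metric_fun g X Y \<in> smooth_funs M)"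

definition nondegenerate_semi_riemannian :: "('a, 'k) mfd \<Rightarrow> 'a metric \<Rightarrow> bool" where
  "nondegenerate_semi_riemannian M g \<longleftrightarrow>
     singular_semi_riemannian M g \<and>
     (\<forall>p\<in>points M. \<forall>v\<in>tangent_space M p. (\<forall>w\<in>tangent_space M p. g p v w = 0) \<longrightarrow> v = (\<lambda>f. 0))"

definition koszul :: "'a metric \<Rightarrow> 'a vfield \<Rightarrow> 'a vfield \<Rightarrow> 'a form" where
  "koszul g X Y Z = (\<lambda>p. (1/2) *
     (dir_deriv X (metric_fun g Y Z) p + dir_deriv Y (metric_fun g Z X) p
      - dir_deriv Z (metric_fun g X Y) p
      - metric_fun g X (lie_bracket Y Z) p + metric_fun g Y (lie_bracket Z X) p
      + metric_fun g Z (lie_bracket X Y) p))"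

definition flat_at :: "('a, 'k) mfd \<Rightarrow> 'a metric \<Rightarrow> 'a \<Rightarrow> 'a tvec \<Rightarrow> 'a covec" where
  "flat_at M g p v = (\<lambda>w. if w \<in> tangent_space M p then g p v w else 0)"

text \<open>\<open>T\<^sub>p\<^sup>\<bullet>M\<close> and its inner product \<open>g\<^sub>p\<^sup>\<bullet>\<close>.\<close>

definition bullet_space :: "('a, 'k) mfd \<Rightarrow> 'a metric \<Rightarrow> 'a \<Rightarrow> 'a covec set" where
  "bullet_space M g p = flat_at M g p ` tangent_space M p"

definition bullet_inner :: "('a, 'k) mfd \<Rightarrow> 'a metric \<Rightarrow> 'a \<Rightarrow> 'a covec \<Rightarrow> 'a covec \<Rightarrow> real" where
  "bullet_inner M g p \<alpha> \<beta> = (THE r. \<exists>v\<in>tangent_space M p. \<exists>w\<in>tangent_space M p.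
     \<alpha> = flat_at M g p v \<and> \<beta> = flat_at M g p w \<and> r = g p v w)"

text \<open>
  For non-degenerate \<open>g\<close> one has \<open>T\<^sub>p\<^sup>\<bullet>M = T\<^sub>p\<^sup>*M\<close>, and the following is the inverse metric
  \<open>g\<^sup>*(\<omega>, \<tau>) = g(\<omega>\<^sup>\<sharp>, \<tau>\<^sup>\<sharp>)\<close> on 1-forms.
\<close>

definition inverse_metric :: "('a, 'k) mfd \<Rightarrow> 'a metric \<Rightarrow> 'a form \<Rightarrow> 'a form \<Rightarrow> 'a \<Rightarrow> real" where
  "inverse_metric M g \<omega> \<tau> p = bullet_inner M g p (form_at M \<omega> p) (form_at M \<tau> p)"

definition metric_rank :: "('a, 'k) mfd \<Rightarrow> 'a metric \<Rightarrow> 'a \<Rightarrow> nat" where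
  "metric_rank M g p = vector_space.dim (\<lambda>(c::real) (\<alpha>::'a covec) w. c * \<alpha> w) (bullet_space M g p)"

definition regular_points :: "('a, 'k) mfd \<Rightarrow> 'a metric \<Rightarrow> 'a set" where
  "regular_points M g = {p. \<exists>U. openin (mtop M) U \<and> p \<in> U \<and>
                               (\<forall>q\<in>U. metric_rank M g q = metric_rank M g p)}"

definition extends_contraction ::
    "('a, 'k) mfd \<Rightarrow> 'a metric \<Rightarrow> 'a form \<Rightarrow> 'a form \<Rightarrow> ('a \<Rightarrow> real) \<Rightarrow> bool" where
  "extends_contraction M g \<omega> \<tau> h \<longleftrightarrow> h \<in> smooth_funs M \<and>
     (\<forall>p\<in>regular_points M g. h p = bullet_inner M g p (form_at M \<omega> p) (form_at M \<tau> p))"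

text \<open>
  \<open>\<omega>(\<bullet>)\<tau>(\<bullet>)\<close> in the extended sense.  If a smooth extension exists, its values on \<open>points M\<close> are unique
  since \<open>regular_points M g\<close> is dense.
\<close>

definition contraction :: "('a, 'k) mfd \<Rightarrow> 'a metric \<Rightarrow> 'a form \<Rightarrow> 'a form \<Rightarrow> 'a \<Rightarrow> real" where
  "contraction M g \<omega> \<tau> = (SOME h. extends_contraction M g \<omega> \<tau> h)"

definition radical_stationary :: "('a, 'k) mfd \<Rightarrow> 'a metric \<Rightarrow> bool" where
  "radical_stationary M g \<longleftrightarrow>
     singular_semi_riemannian M g \<and>
     (\<forall>X\<in>vector_fields M. \<forall>Y\<in>vector_fields M. \<forall>p\<in>points M.
        form_at M (koszul g X Y) p \<in> bullet_space M g p)"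

definition semi_regular :: "('a, 'k) mfd \<Rightarrow> 'a metric \<Rightarrow> bool" where
  "semi_regular M g \<longleftrightarrow>
     radical_stationary M g \<and>
     (\<forall>X\<in>vector_fields M. \<forall>Y\<in>vector_fields M. \<forall>Z\<in>vector_fields M. \<forall>T\<in>vector_fields M.
        \<exists>h. extends_contraction M g (koszul g X Y) (koszul g Z T) h)"

text \<open>The curvature formula with an arbitrary form \<open>K\<close> in place of the Koszul form.\<close>

definition curvature_of ::
    "('a, 'k) mfd \<Rightarrow> 'a metric \<Rightarrow> ('a vfield \<Rightarrow> 'a vfield \<Rightarrow> 'a form)
      \<Rightarrow> 'a vfield \<Rightarrow> 'a vfield \<Rightarrow> 'a vfield \<Rightarrow> 'a vfield \<Rightarrow> 'a \<Rightarrow> real" where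
  "curvature_of M g K X Y Z T = (\<lambda>p.
     dir_deriv X (K Y Z T) p - dir_deriv Y (K X Z T) p - K (lie_bracket X Y) Z T p
     + contraction M g (K X Z) (K Y T) p - contraction M g (K Y Z) (K X T) p)"

definition riemann :: "('a, 'k) mfd \<Rightarrow> 'a metric
      \<Rightarrow> 'a vfield \<Rightarrow> 'a vfield \<Rightarrow> 'a vfield \<Rightarrow> 'a vfield \<Rightarrow> 'a \<Rightarrow> real" where
  "riemann M g = curvature_of M g (koszul g)"

definition ssnm_koszul :: "'a metric \<Rightarrow> 'a vfield \<Rightarrow> 'a vfield \<Rightarrow> 'a vfield \<Rightarrow> 'a form" where
  "ssnm_koszul g P X Y Z = (\<lambda>p. koszul g X Y Z p + metric_fun g Y P p * metric_fun g X Z p)"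

definition ssnm_curvature :: "('a, 'k) mfd \<Rightarrow> 'a metric \<Rightarrow> 'a vfield
      \<Rightarrow> 'a vfield \<Rightarrow> 'a vfield \<Rightarrow> 'a vfield \<Rightarrow> 'a vfield \<Rightarrow> 'a \<Rightarrow> real" where
  "ssnm_curvature M g P = curvature_of M g (ssnm_koszul g P)"


section \<open>Multiply warped products\<close>

text \<open>
  The fibres are indexed by a finite type; their points lie in a common type (but in different
  carriers, with coordinate index sets of different cardinality).  Points of the product are
  pairs \<open>(x, y)\<close> with \<open>y j\<close> in the \<open>j\<close>-th fibre.
\<close>

definition product_chart :: "'k set \<Rightarrow> ('i \<Rightarrow> 'l set) \<Rightarrow> ('b \<Rightarrow> 'k \<Rightarrow> real) \<Rightarrow> ('i \<Rightarrow> 'f \<Rightarrow> 'l \<Rightarrow> real)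
      \<Rightarrow> 'b \<times> ('i \<Rightarrow> 'f) \<Rightarrow> 'k + 'i \<times> 'l \<Rightarrow> real" where
  "product_chart I J \<phi> \<psi> = (\<lambda>(x, y). \<lambda>c \<in> I <+> (SIGMA j:UNIV. J j).
     case c of Inl k \<Rightarrow> \<phi> x k | Inr (j, k) \<Rightarrow> \<psi> j (y j) k)"

definition product_mfd :: "('b, 'k) mfd \<Rightarrow> ('i::finite \<Rightarrow> ('f, 'l) mfd)
      \<Rightarrow> ('b \<times> ('i \<Rightarrow> 'f), 'k + 'i \<times> 'l) mfd" where
  "product_mfd B F =
     \<lparr> mtop = prod_topology (mtop B) (product_topology (\<lambda>j. mtop (F j)) UNIV),
       coords = coords B <+> (SIGMA j:UNIV. coords (F j)),
       atlas = {(U \<times> {y. \<forall>j. y j \<in> V j}, product_chart (coords B) (\<lambda>j. coords (F j)) \<phi> \<psi>) | U \<phi> V \<psi>.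
                  (U, \<phi>) \<in> atlas B \<and> (\<forall>j. (V j, \<psi> j) \<in> atlas (F j))} \<rparr>"

definition warped_metric :: "('b, 'k) mfd \<Rightarrow> 'b metric \<Rightarrow> ('i::finite \<Rightarrow> ('f, 'l) mfd)
      \<Rightarrow> ('i \<Rightarrow> 'f metric) \<Rightarrow> ('i \<Rightarrow> 'b \<Rightarrow> real) \<Rightarrow> ('b \<times> ('i \<Rightarrow> 'f)) metric" where
  "warped_metric B gB F gF b = (\<lambda>(x, y) v w.
     gB x (pushforward B fst v) (pushforward B fst w) +
     (\<Sum>j\<in>UNIV. (b j x)\<^sup>2 * gF j (y j) (pushforward (F j) (\<lambda>p. snd p j) v)
                                     (pushforward (F j) (\<lambda>p. snd p j) w)))"

text \<open>Lifts of vector fields: pushforwards along the inclusions of the factors through \<open>(x, y)\<close>.\<close>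

definition lift_base :: "('b, 'k) mfd \<Rightarrow> ('i::finite \<Rightarrow> ('f, 'l) mfd)
      \<Rightarrow> 'b vfield \<Rightarrow> ('b \<times> ('i \<Rightarrow> 'f)) vfield" where
  "lift_base B F X = (\<lambda>(x, y). pushforward (product_mfd B F) (\<lambda>x'. (x', y)) (X x))"

definition lift_fibre :: "('b, 'k) mfd \<Rightarrow> ('i::finite \<Rightarrow> ('f, 'l) mfd) \<Rightarrow> 'i
      \<Rightarrow> 'f vfield \<Rightarrow> ('b \<times> ('i \<Rightarrow> 'f)) vfield" where
  "lift_fibre B F j V = (\<lambda>(x, y). pushforward (product_mfd B F) (\<lambda>z. (x, y(j := z))) (V (y j)))"

end

theory Submission
  imports Defs
begin

text \<open>
  On lifts, the metric, the Lie brackets and hence \<open>\<K>\<close> and its semi-symmetric non-metric version are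
  explicit in the data of the factors.  The delicate term of the curvature is the contraction, which is
  determined by its values at the points where the rank of the metric is locally constant.  At such a
  point each form \<open>\<K>(A, C, \<bullet>)\<close> is represented by a tangent vector, for example by
  \<open>g(W, P) X + (X(b\<^sub>j) / b\<^sub>j) W\<close> for \<open>A = X \<in> \<Gamma>(TB)\<close> and \<open>C = W \<in> \<Gamma>(TF\<^sub>j)\<close>.  If \<open>b\<^sub>j = 0\<close> but
  \<open>d b\<^sub>j \<noteq> 0\<close> there, local constancy of the rank forces the metric of \<open>F\<^sub>j\<close> to vanish at that point; if \<open>b\<^sub>j \<noteq> 0\<close>, the
  point of \<open>F\<^sub>j\<close> is itself regular, so that the contraction given by semi-regularity of \<open>F\<^sub>j\<close> applies.
  In all cases the inner product of two representatives is the value of a function that is smooth on the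
  whole product, and since the regular points are dense this function is the contraction.  What remains is
  the Leibniz rule together with \<open>X(g(Y, Z)) = \<K>(X, Y, Z) + \<K>(X, Z, Y)\<close> and
  \<open>\<K>(X, Y, Z) - \<K>(Y, X, Z) = g([X, Y], Z)\<close>.
\<close>

section \<open>Calculus on open subsets of \<open>\<real>\<^sup>I\<close>\<close>

text \<open>Three obstacles shape the development. Tangent vectors are derivations of globally
  defined functions, so every local object (a coordinate, a frame field, an inverse) must be cut off
  by a bump function before a vector can act on it. The metric has neither constant rank nor a sign,
  so orthonormal frames are not at hand; dual systems of fields, obtained by Gauss elimination,
  replace them and give lower semicontinuity of the rank, hence density of the regular points. The
  representatives contain X(b_j) / b_j although b_j may vanish; the inner product carries b_j^2,
  which absorbs up to two such quotients, so the resulting function is smooth without any division.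
  Thus the existence of each contraction on the product is proved together with its value, one type
  of arguments at a time.

  The vector field P enters only through the summand g(Y,P) g(X,Z) of the form, which is represented
  by g(Y,P) X. On lifts, g(Y,P) is 0 unless Y is tangent to F_l, where it is b_l^2 times a function
  on F_l. All case distinctions on l, and the extra powers of b_l, stem from this.\<close>

lemma tendsto_fun_iff:
  fixes f :: "'a \<Rightarrow> 'b \<Rightarrow> 'c::topological_space"
  shows "(f \<longlongrightarrow> l) A \<longleftrightarrow> (\<forall>i. ((\<lambda>x. f x i) \<longlongrightarrow> l i) A)"
  using limitin_componentwise[of "\<lambda>_. euclidean" UNIV f l A]
  by (auto simp: euclidean_product_topology limitin_canonical_iff extensional_def)

text \<open>Points of S take the value \<open>undefined\<close> outside I, so the additional
  coordinates are constant on S and do not change the topology. This makes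
  \<open>continuous_on\<close> for the function type available for subsets of the model
  space.\<close>

lemma subtopology_powertop_eq:
  fixes S :: "('k \<Rightarrow> real) set"
  assumes "S \<subseteq> extensional I"
  shows "subtopology (powertop_real I) S = top_of_set S"
proof -
  have tS: "topspace (subtopology (powertop_real I) S) = S"
    using assms by (auto simp: PiE_def)
  have 1: "continuous_map (top_of_set S) (subtopology (powertop_real I) S) id"
    unfolding continuous_map_in_subtopology continuous_map_componentwise
    using assms by (auto intro: continuous_on_product_then_coordinatewise[OF continuous_on_id, unfolded id_def])
  have "continuous_map (subtopology (powertop_real I) S) (powertop_real UNIV) id"
    unfolding continuous_map_componentwise_UNIV
  proof
    fix k
    show "continuous_map (subtopology (powertop_real I) S) euclideanreal (\<lambda>x. id x k)"
    proof (cases "k \<in> I")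
      case True
      then show ?thesis
        by (auto intro!: continuous_map_from_subtopology continuous_map_product_coordinates)
    next
      case False
      have "continuous_map (subtopology (powertop_real I) S) euclideanreal (\<lambda>x. undefined)" by simp
      then show ?thesis
        by (rule continuous_map_eq) (use False assms in \<open>auto simp: extensional_def\<close>)
    qed
  qed
  then have 2: "continuous_map (subtopology (powertop_real I) S) (top_of_set S) id"
    by (auto simp: continuous_map_in_subtopology euclidean_product_topology)
  have "homeomorphic_map (subtopology (powertop_real I) S) (top_of_set S) id"
    using 1 2 tS by (auto simp: homeomorphic_map_maps homeomorphic_maps_def)
  then show ?thesis by simp
qed

lemma openin_powertop_ext: "openin (powertop_real I) S \<Longrightarrow> S \<subseteq> extensional I"
  using openin_subset[of "powertop_real I" S] by (auto simp: PiE_def)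

lemma Ck_on_0_iff:
  assumes "openin (powertop_real I) S"
  shows "Ck_on 0 I S f \<longleftrightarrow> continuous_on S f"
  by (simp add: subtopology_powertop_eq[OF openin_powertop_ext[OF assms]])

lemma openin_powertop_imp_top_of_set:
  assumes "openin (powertop_real I) S" "openin (powertop_real I) T" "T \<subseteq> S"
  shows "openin (top_of_set S) T"
  using openin_subtopology_Int[OF assms(2), of S] assms(3)
  by (simp add: subtopology_powertop_eq[OF openin_powertop_ext[OF assms(1)]] inf.absorb1)

text \<open>A basic neighbourhood restricts every coordinate to an open set; since I is finite, a
  single radius serves for all of them.\<close>

lemma powertop_box:
  assumes "finite I" "openin (powertop_real I) S" "x \<in> S"
  shows "\<exists>e>0. \<forall>z\<in>extensional I. (\<forall>i\<in>I. \<bar>z i - x i\<bar> \<le> e) \<longrightarrow> z \<in> S"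
proof -
  obtain U where U: "\<forall>i\<in>I. open (U i)" "x \<in> PiE I U" "PiE I U \<subseteq> S"
    using assms(2,3) unfolding openin_product_topology_alt by (metis open_openin)
  have "\<forall>i\<in>I. \<exists>e>0. \<forall>t. \<bar>t - x i\<bar> \<le> e \<longrightarrow> t \<in> U i"
  proof
    fix i assume "i \<in> I"
    then have "open (U i)" "x i \<in> U i" using U by (auto simp: PiE_def Pi_def)
    then obtain e where "e > 0" "cball (x i) e \<subseteq> U i" by (meson open_contains_cball)
    then show "\<exists>e>0. \<forall>t. \<bar>t - x i\<bar> \<le> e \<longrightarrow> t \<in> U i"
      by (intro exI[of _ e]) (auto simp: cball_def dist_real_def abs_minus_commute subset_iff)
  qed
  then obtain e where e: "\<forall>i\<in>I. e i > 0 \<and> (\<forall>t. \<bar>t - x i\<bar> \<le> e i \<longrightarrow> t \<in> U i)" by metis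
  \<comment> \<open>The 1 keeps the minimum defined and positive when I is empty.\<close>
  define d where "d = Min (insert 1 (e ` I))"
  have "d > 0" using e assms(1) by (auto simp: d_def)
  moreover have "d \<le> e i" if "i \<in> I" for i using that assms(1) by (auto simp: d_def)
  moreover have "z \<in> S" if z: "z \<in> extensional I" "\<forall>i\<in>I. \<bar>z i - x i\<bar> \<le> d" for z
  proof -
    have "z i \<in> U i" if "i \<in> I" for i
      using e z(2) that \<open>\<And>i. i \<in> I \<Longrightarrow> d \<le> e i\<close> by (meson order_trans)
    then show ?thesis using z(1) U(3) by (auto simp: PiE_def)
  qed
  ultimately show ?thesis by blast
qed

lemma openin_powertop_box:
  assumes "finite I"
  shows "openin (powertop_real I) {z \<in> extensional I. \<forall>i\<in>I. \<bar>z i - x i\<bar> < e}"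
proof -
  have "{z \<in> extensional I. \<forall>i\<in>I. \<bar>z i - x i\<bar> < e} = PiE I (\<lambda>i. {x i - e<..<x i + e})"
    by (auto simp: PiE_def Pi_def abs_less_iff; smt (verit))
  then show ?thesis
    using assms by (simp add: openin_PiE_gen)
qed

lemma upd_extensional: "x \<in> extensional I \<Longrightarrow> i \<in> I \<Longrightarrow> x(i := t) \<in> extensional I"
  by (auto simp: extensional_def)

lemma open_upd:
  assumes "openin (powertop_real I) S" "i \<in> I" "x \<in> S"
  shows "open {t. x(i := t) \<in> S}"
proof -
  have x: "x \<in> extensional I" using assms openin_powertop_ext by blast
  have "continuous_map euclideanreal (powertop_real I) (\<lambda>t. x(i := t))"
    unfolding continuous_map_componentwise
  proof (intro conjI ballI)
    show "(\<lambda>t. x(i := t)) ` topspace euclideanreal \<subseteq> extensional I"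
      using upd_extensional[OF x assms(2)] by auto
    show "continuous_map euclideanreal euclideanreal (\<lambda>t. (x(i := t)) k)" for k
      by (cases "k = i") auto
  qed
  from openin_continuous_map_preimage[OF this assms(1)] show ?thesis by simp
qed

lemma eventually_upd:
  assumes "openin (powertop_real I) S" "i \<in> I" "x \<in> S"
  shows "\<forall>\<^sub>F t in nhds (x i). x(i := t) \<in> S"
  using open_upd[OF assms] assms(3) by (auto simp: eventually_nhds)

section \<open>Functions of class \<open>Ck_on\<close>: locality and closure properties\<close>

lemma partial_deriv_cong:
  assumes "openin (powertop_real I) S" "i \<in> I" "x \<in> S" "\<And>z. z \<in> S \<Longrightarrow> f z = g z"
  shows "partial_deriv i f x = partial_deriv i g x"
  unfolding partial_deriv_def
  by (rule deriv_cong_ev) (use eventually_upd[OF assms(1-3)] assms(4) in \<open>auto elim: eventually_mono\<close>)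

lemma DERIV_upd_cong:
  assumes "openin (powertop_real I) S" "i \<in> I" "x \<in> S" "\<And>z. z \<in> S \<Longrightarrow> f z = g z"
    and "((\<lambda>t. f (x(i := t))) has_real_derivative D) (at (x i))"
  shows "((\<lambda>t. g (x(i := t))) has_real_derivative D) (at (x i))"
  by (rule has_field_derivative_transform_within_open[OF assms(5) open_upd[OF assms(1-3)]])
     (use assms in auto)

text \<open>As S is open, each coordinate line through a point of S stays in S for a while, so the
  partial derivatives in S only see the values in S. Chart expressions built with
  \<open>inv_into\<close> are meaningful on the chart image alone; this lemma allows their values
  elsewhere to be ignored.\<close>

lemma Ck_on_cong:
  assumes "openin (powertop_real I) S" "\<And>z. z \<in> S \<Longrightarrow> f z = g z" "Ck_on n I S f"
  shows "Ck_on n I S g"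
  using assms(2,3)
proof (induction n arbitrary: f g)
  case 0
  then show ?case
    unfolding Ck_on_0_iff[OF assms(1)] by (metis continuous_on_cong)
next
  case (Suc n)
  have c: "continuous_map (subtopology (powertop_real I) S) euclideanreal g"
    using Suc.prems by (auto intro!: continuous_map_eq[of _ _ f])
  have "(\<lambda>t. g (x(i := t))) differentiable at (x i)" if "i \<in> I" "x \<in> S" for i x
  proof -
    have "(\<lambda>t. f (x(i := t))) differentiable at (x i)" using Suc.prems(2) that by simp
    then obtain D where "((\<lambda>t. f (x(i := t))) has_real_derivative D) (at (x i))"
      by (auto simp: real_differentiable_def)
    from DERIV_upd_cong[OF assms(1) that Suc.prems(1) this] show ?thesis
      unfolding real_differentiable_def by blast
  qed
  moreover have "Ck_on n I S (partial_deriv i g)" if "i \<in> I" for i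
    by (rule Suc.IH[of "partial_deriv i f"])
       (use Suc.prems partial_deriv_cong[OF assms(1) that _ Suc.prems(1)] that in auto)
  ultimately show ?case using c by simp
qed

text \<open>The form used for all closure properties: the derivatives may be any explicit functions
  \<open>D i\<close> that are correct on S, whereas the definition speaks of
  \<open>partial_deriv\<close> as a function on the whole type.\<close>

lemma Ck_on_SucI:
  assumes "openin (powertop_real I) S" "continuous_on S f"
    and "\<And>i x. i \<in> I \<Longrightarrow> x \<in> S \<Longrightarrow> ((\<lambda>t. f (x(i := t))) has_real_derivative D i x) (at (x i))"
    and "\<And>i. i \<in> I \<Longrightarrow> Ck_on n I S (D i)"
  shows "Ck_on (Suc n) I S f"
proof -
  have "partial_deriv i f x = D i x" if "i \<in> I" "x \<in> S" for i x
    unfolding partial_deriv_def using assms(3)[OF that] by (rule DERIV_imp_deriv)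
  then have "Ck_on n I S (partial_deriv i f)" if "i \<in> I" for i
    using Ck_on_cong[OF assms(1), of "D i" "partial_deriv i f" n] assms(4) that by simp
  then show ?thesis
    using assms(3) assms(2)[folded Ck_on_0_iff[OF assms(1)]] by (auto simp: real_differentiable_def)
qed

lemma Ck_on_continuous:
  assumes "openin (powertop_real I) S" "Ck_on n I S f"
  shows "continuous_on S f"
  using assms(2) Ck_on_0_iff[OF assms(1), of f] by (cases n) auto

lemma Ck_on_DERIV:
  assumes "Ck_on (Suc n) I S f" "i \<in> I" "x \<in> S"
  shows "((\<lambda>t. f (x(i := t))) has_real_derivative partial_deriv i f x) (at (x i))"
  using assms by (simp add: partial_deriv_def DERIV_deriv_iff_real_differentiable)

lemma Ck_on_partial: "Ck_on (Suc n) I S f \<Longrightarrow> i \<in> I \<Longrightarrow> Ck_on n I S (partial_deriv i f)"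
  by simp

lemma Ck_on_Suc_imp: "Ck_on (Suc n) I S f \<Longrightarrow> Ck_on n I S f"
  by (induction n arbitrary: f) auto

lemma partial_deriv_DERIV:
  "((\<lambda>t. f (x(i := t))) has_real_derivative D) (at (x i)) \<Longrightarrow> partial_deriv i f x = D"
  by (simp add: partial_deriv_def DERIV_imp_deriv)

lemma Ck_on_const: "openin (powertop_real I) S \<Longrightarrow> Ck_on n I S (\<lambda>x. c)"
proof (induction n arbitrary: c)
  case (Suc n)
  show ?case
    by (rule Ck_on_SucI[where D="\<lambda>_ _. 0"]) (use Suc in \<open>auto\<close>)
qed (simp add: Ck_on_0_iff)

lemma Ck_on_coord:
  assumes "openin (powertop_real I) S" "k \<in> I"
  shows "Ck_on n I S (\<lambda>x. x k)"
proof -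
  have c: "continuous_on S (\<lambda>x. x k)"
    by (rule continuous_on_product_then_coordinatewise[OF continuous_on_id])
  show ?thesis
  proof (cases n)
    case (Suc m)
    show ?thesis unfolding Suc
    proof (rule Ck_on_SucI[OF assms(1) c])
      show "((\<lambda>t. (x(i := t)) k) has_real_derivative (if i = k then 1 else 0)) (at (x i))" for i x
        by auto
      show "Ck_on m I S (\<lambda>_. if i = k then 1 else 0)" for i
        by (rule Ck_on_const[OF assms(1)])
    qed
  qed (simp add: c Ck_on_0_iff[OF assms(1)] del: Ck_on.simps)
qed

lemma Ck_on_add:
  assumes "openin (powertop_real I) S" "Ck_on n I S f" "Ck_on n I S g"
  shows "Ck_on n I S (\<lambda>x. f x + g x)"
  using assms(2,3)
proof (induction n arbitrary: f g)
  case 0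
  then show ?case unfolding Ck_on_0_iff[OF assms(1)] by (intro continuous_intros)
next
  case (Suc n)
  show ?case
  proof (rule Ck_on_SucI[OF assms(1)])
    show "continuous_on S (\<lambda>x. f x + g x)"
      by (intro continuous_intros Ck_on_continuous[OF assms(1) Suc.prems(1)] Ck_on_continuous[OF assms(1) Suc.prems(2)])
    show "((\<lambda>t. f (x(i := t)) + g (x(i := t))) has_real_derivative
        partial_deriv i f x + partial_deriv i g x) (at (x i))" if "i \<in> I" "x \<in> S" for i x
      by (intro DERIV_add Ck_on_DERIV[OF Suc.prems(1) that] Ck_on_DERIV[OF Suc.prems(2) that])
    show "Ck_on n I S (\<lambda>x. partial_deriv i f x + partial_deriv i g x)" if "i \<in> I" for i
      by (rule Suc.IH[OF Ck_on_partial[OF Suc.prems(1) that] Ck_on_partial[OF Suc.prems(2) that]])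
  qed
qed

lemma Ck_on_mult:
  assumes "openin (powertop_real I) S" "Ck_on n I S f" "Ck_on n I S g"
  shows "Ck_on n I S (\<lambda>x. f x * g x)"
  using assms(2,3)
proof (induction n arbitrary: f g)
  case 0
  then show ?case unfolding Ck_on_0_iff[OF assms(1)] by (intro continuous_intros)
next
  case (Suc n)
  show ?case
  proof (rule Ck_on_SucI[OF assms(1)])
    show "continuous_on S (\<lambda>x. f x * g x)"
      by (intro continuous_intros Ck_on_continuous[OF assms(1) Suc.prems(1)] Ck_on_continuous[OF assms(1) Suc.prems(2)])
    show "((\<lambda>t. f (x(i := t)) * g (x(i := t))) has_real_derivative
        partial_deriv i f x * g x + partial_deriv i g x * f x) (at (x i))" if "i \<in> I" "x \<in> S" for i x
      using DERIV_mult[OF Ck_on_DERIV[OF Suc.prems(1) that] Ck_on_DERIV[OF Suc.prems(2) that]]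
      by (simp only: fun_upd_triv)
    show "Ck_on n I S (\<lambda>x. partial_deriv i f x * g x + partial_deriv i g x * f x)" if "i \<in> I" for i
      by (intro Ck_on_add[OF assms(1)] Suc.IH Ck_on_partial[OF _ that] Suc.prems
           Ck_on_Suc_imp[OF Suc.prems(1)] Ck_on_Suc_imp[OF Suc.prems(2)])
  qed
qed

text \<open>The derivative of 1/f is -f' (1/f)^2, so the claim for order n about the same f,
  together with the product rule, yields order n + 1.\<close>

lemma Ck_on_inverse:
  assumes "openin (powertop_real I) S" "Ck_on n I S f" "\<And>x. x \<in> S \<Longrightarrow> f x \<noteq> 0"
  shows "Ck_on n I S (\<lambda>x. inverse (f x))"
  using assms(2)
proof (induction n)
  case 0
  then show ?case using assms(3) unfolding Ck_on_0_iff[OF assms(1)] by (intro continuous_intros) auto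
next
  case (Suc n)
  note IH = Suc.IH[OF Ck_on_Suc_imp[OF Suc.prems]]
  show ?case
  proof (rule Ck_on_SucI[OF assms(1)])
    show "continuous_on S (\<lambda>x. inverse (f x))"
      by (intro continuous_intros Ck_on_continuous[OF assms(1) Suc.prems]) (use assms(3) in auto)
    show "((\<lambda>t. inverse (f (x(i := t)))) has_real_derivative
        (-1) * (partial_deriv i f x * (inverse (f x) * inverse (f x)))) (at (x i))" if "i \<in> I" "x \<in> S" for i x
      by (rule DERIV_cong[OF DERIV_inverse_fun[OF Ck_on_DERIV[OF Suc.prems that]]])
         (use assms(3)[OF that(2)] in \<open>auto simp: power2_eq_square\<close>)
    show "Ck_on n I S (\<lambda>x. (-1) * (partial_deriv i f x * (inverse (f x) * inverse (f x))))" if "i \<in> I" for i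
      by (intro Ck_on_mult[OF assms(1)] IH Ck_on_partial[OF _ that] Suc.prems Ck_on_const[OF assms(1)])
  qed
qed

lemma Ck_on_subset:
  assumes "openin (powertop_real I) T" "T \<subseteq> S" "openin (powertop_real I) S" "Ck_on n I S f"
  shows "Ck_on n I T f"
  using assms(4)
proof (induction n arbitrary: f)
  case 0
  then show ?case using assms(2) unfolding Ck_on_0_iff[OF assms(1)] Ck_on_0_iff[OF assms(3)]
    by (rule continuous_on_subset)
next
  case (Suc n)
  show ?case
    by (rule Ck_on_SucI[OF assms(1) continuous_on_subset[OF Ck_on_continuous[OF assms(3) Suc.prems] assms(2)]
         Ck_on_DERIV[OF Suc.prems] Suc.IH[OF Ck_on_partial[OF Suc.prems]]]) (use assms(2) in auto)
qed

lemma Ck_on_local: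
  assumes S: "openin (powertop_real I) S"
    and "\<And>x. x \<in> S \<Longrightarrow> \<exists>T. openin (powertop_real I) T \<and> x \<in> T \<and> T \<subseteq> S \<and> Ck_on n I T f"
  shows "Ck_on n I S f"
  using assms(2)
proof (induction n arbitrary: f)
  case 0
  define \<T> where "\<T> = {T. openin (powertop_real I) T \<and> T \<subseteq> S \<and> Ck_on 0 I T f}"
  have "continuous_map (top_of_set S) euclideanreal f"
  proof (rule pasting_lemma[where I=\<T> and T="\<lambda>T. T" and f="\<lambda>_. f"])
    show "openin (top_of_set S) T" if "T \<in> \<T>" for T
      using that openin_powertop_imp_top_of_set[OF S] by (auto simp: \<T>_def)
    show "continuous_map (subtopology (top_of_set S) T) euclideanreal f" if "T \<in> \<T>" for T
    proof -
      have "S \<inter> T = T" using that by (auto simp: \<T>_def)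
      then show ?thesis
        using that Ck_on_0_iff[of I T f] by (auto simp: \<T>_def subtopology_subtopology simp del: Ck_on.simps)
    qed
    show "\<exists>j. j \<in> \<T> \<and> x \<in> j \<and> f x = f x" if "x \<in> topspace (top_of_set S)" for x
      using 0[of x] that by (auto simp: \<T>_def simp del: Ck_on.simps)
  qed auto
  then show ?case unfolding Ck_on_0_iff[OF S] by simp
next
  case (Suc n)
  have cont: "Ck_on n I S f"
    by (rule Suc.IH) (use Suc.prems Ck_on_Suc_imp in metis)
  show ?case
  proof (rule Ck_on_SucI[OF S Ck_on_continuous[OF S cont]])
    show "((\<lambda>t. f (x(i := t))) has_real_derivative partial_deriv i f x) (at (x i))" if "i \<in> I" "x \<in> S" for i x
      using Suc.prems[OF that(2)] Ck_on_DERIV[OF _ that(1)] by metis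
    show "Ck_on n I S (partial_deriv i f)" if "i \<in> I" for i
      by (rule Suc.IH) (use Suc.prems Ck_on_partial[OF _ that] in metis)
  qed
qed

section \<open>The chain rule, derived from continuous partial derivatives\<close>

lemma mvt_segment:
  fixes F :: "real \<Rightarrow> real"
  assumes "\<And>s. s \<in> closed_segment u v \<Longrightarrow> (F has_real_derivative F' s) (at s)"
  shows "\<exists>s\<in>closed_segment u v. F v - F u = F' s * (v - u)"
proof -
  have *: "\<exists>s\<in>{u..v}. F v - F u = F' s * (v - u)"
    if "u < v" "\<And>s. s \<in> {u..v} \<Longrightarrow> (F has_real_derivative F' s) (at s)" for u v
    using MVT2[OF that(1), of F F'] that(2) by (force simp: mult.commute)
  consider "u < v" | "u = v" | "v < u" by linarith
  then show ?thesis
  proof cases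
    case 1
    then show ?thesis using *[OF 1] assms by (simp add: closed_segment_eq_real_ivl)
  next
    case 3
    then obtain s where "s \<in> {v..u}" "F u - F v = F' s * (u - v)"
      using *[OF 3] assms by (auto simp: closed_segment_eq_real_ivl)
    then show ?thesis using 3 by (intro bexI[of _ s]) (auto simp: closed_segment_eq_real_ivl algebra_simps)
  qed auto
qed

text \<open>\<open>Ck_on\<close> speaks of partial derivatives only, so differentiability along
  curves has to be proved. The increment of f along the curve is split by moving one coordinate at a
  time; each piece is a one-variable increment, governed by the mean value theorem, and continuity
  of the partial derivative gives its limit.\<close>

lemma curve_chain_rule:
  assumes I: "finite I" and S: "openin (powertop_real I) S" and f: "Ck_on (Suc 0) I S f"
    and \<gamma>: "\<And>i. i \<in> I \<Longrightarrow> ((\<lambda>t. \<gamma> t i) has_real_derivative \<gamma>' i) (at t0)"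
    and mem: "\<gamma> t0 \<in> S" and ext: "\<And>t. \<gamma> t \<in> extensional I"
  shows "((\<lambda>t. f (\<gamma> t)) has_real_derivative (\<Sum>i\<in>I. partial_deriv i f (\<gamma> t0) * \<gamma>' i)) (at t0)"
proof -
  define p where "p = \<gamma> t0"
  obtain e where e: "e > 0" and box: "\<And>z. z \<in> extensional I \<Longrightarrow> (\<And>i. i \<in> I \<Longrightarrow> \<bar>z i - p i\<bar> \<le> e) \<Longrightarrow> z \<in> S"
    using powertop_box[OF I S mem] unfolding p_def by blast
  have "\<forall>\<^sub>F t in at t0. \<bar>\<gamma> t i - p i\<bar> < e" if "i \<in> I" for i
  proof -
    have "((\<lambda>t. \<gamma> t i) \<longlongrightarrow> \<gamma> t0 i) (at t0)"
      using DERIV_isCont[OF \<gamma>[OF that]] by (simp add: isCont_def)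
    from tendstoD[OF this e] show ?thesis by (simp add: p_def dist_real_def)
  qed
  then have near: "\<forall>\<^sub>F t in at t0. \<forall>i\<in>I. \<bar>\<gamma> t i - p i\<bar> < e"
    using I by (simp add: eventually_ball_finite)
  \<comment> \<open>In \<open>G A t\<close> the coordinates in A have already moved along the curve
    while the others still rest at p; the induction on A moves them one by one.\<close>
  define G where "G A t = (\<lambda>i. if i \<in> A then \<gamma> t i else p i)" for A t
  have pext: "p \<in> extensional I" using ext p_def by auto
  have Gext: "G A t \<in> extensional I" if "A \<subseteq> I" for A t
    using ext[of t] pext that by (auto simp: G_def extensional_def)
  have "((\<lambda>t. f (G A t)) has_real_derivative (\<Sum>i\<in>A. partial_deriv i f p * \<gamma>' i)) (at t0)"
    if "finite A" "A \<subseteq> I" for A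
    using that
  proof (induction A)
    case empty
    then show ?case by (simp add: G_def)
  next
    case (insert a A)
    then have a: "a \<in> I" "a \<notin> A" and A: "A \<subseteq> I" by auto
    define D where "D t = f (G (insert a A) t) - f (G A t)" for t
    have upd: "G A t = (G A t)(a := p a)" "G (insert a A) t = (G A t)(a := \<gamma> t a)" for t
      using a by (auto simp: G_def)
    have ex: "\<exists>s. s \<in> closed_segment (p a) (\<gamma> t a) \<and>
        D t = partial_deriv a f ((G A t)(a := s)) * (\<gamma> t a - p a)"
      if t: "\<forall>i\<in>I. \<bar>\<gamma> t i - p i\<bar> < e" for t
    proof -
      have der: "((\<lambda>s. f ((G A t)(a := s))) has_real_derivative partial_deriv a f ((G A t)(a := s))) (at s)"
        if "s \<in> closed_segment (p a) (\<gamma> t a)" for s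
      proof -
        have "\<bar>s - p a\<bar> \<le> e"
          using t[rule_format, OF a(1)] that by (auto simp: closed_segment_eq_real_ivl split: if_splits)
        then have "(G A t)(a := s) \<in> S"
          using t e by (intro box upd_extensional Gext a A) (auto simp: G_def less_imp_le)
        from Ck_on_DERIV[OF f a(1) this] show ?thesis by simp
      qed
      from mvt_segment[OF der] show ?thesis by (subst D_def) (use upd in metis)
    qed
    define s where "s t = (SOME s. s \<in> closed_segment (p a) (\<gamma> t a) \<and>
        D t = partial_deriv a f ((G A t)(a := s)) * (\<gamma> t a - p a))" for t
    have s: "s t \<in> closed_segment (p a) (\<gamma> t a)" "D t = partial_deriv a f ((G A t)(a := s t)) * (\<gamma> t a - p a)"
      if "\<forall>i\<in>I. \<bar>\<gamma> t i - p i\<bar> < e" for t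
      using someI_ex[OF ex[OF that]] by (auto simp: s_def)
    define \<zeta> where "\<zeta> t = (G A t)(a := s t)" for t
    \<comment> \<open>The intermediate point is an arbitrary choice for each t. All that is needed
      of it is this squeeze, which forces \<zeta> t to tend to p.\<close>
    have sbound: "\<bar>s t - p a\<bar> \<le> \<bar>\<gamma> t a - p a\<bar>" if "\<forall>i\<in>I. \<bar>\<gamma> t i - p i\<bar> < e" for t
      using s(1)[OF that] by (auto simp: closed_segment_eq_real_ivl split: if_splits)
    have \<zeta>S: "\<forall>\<^sub>F t in at t0. \<zeta> t \<in> S"
      using near
    proof eventually_elim
      case (elim t)
      then have "\<bar>s t - p a\<bar> \<le> e" using sbound[OF elim] a(1) by force
      then show ?case unfolding \<zeta>_def
        using elim e by (intro box upd_extensional Gext a A) (auto simp: G_def less_imp_le)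
    qed
    have \<gamma>lim: "((\<lambda>t. \<gamma> t i) \<longlongrightarrow> p i) (at t0)" if "i \<in> I" for i
      using DERIV_isCont[OF \<gamma>[OF that]] by (simp add: isCont_def p_def)
    have slim: "(s \<longlongrightarrow> p a) (at t0)"
    proof (rule Lim_transform2)
      show "((\<lambda>t. \<gamma> t a) \<longlongrightarrow> p a) (at t0)" by (rule \<gamma>lim[OF a(1)])
      have "((\<lambda>t. \<bar>\<gamma> t a - p a\<bar>) \<longlongrightarrow> 0) (at t0)"
        using \<gamma>lim[OF a(1)] by (simp add: LIM_zero_iff tendsto_rabs_zero_iff)
      then have s0: "((\<lambda>t. s t - p a) \<longlongrightarrow> 0) (at t0)"
        by (rule Lim_null_comparison[rotated]) (use near sbound in \<open>auto elim: eventually_mono\<close>)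
      have "((\<lambda>t. \<gamma> t a - p a) \<longlongrightarrow> 0) (at t0)" using \<gamma>lim[OF a(1)] by (simp add: LIM_zero_iff)
      from tendsto_diff[OF this s0] show "((\<lambda>t. \<gamma> t a - s t) \<longlongrightarrow> 0) (at t0)" by simp
    qed
    have "(\<zeta> \<longlongrightarrow> p) (at t0)"
      unfolding tendsto_fun_iff
    proof
      fix i
      show "((\<lambda>t. \<zeta> t i) \<longlongrightarrow> p i) (at t0)"
        using slim \<gamma>lim[of i] A by (cases "i = a"; cases "i \<in> A") (auto simp: \<zeta>_def G_def)
    qed
    then have clim: "((\<lambda>t. partial_deriv a f (\<zeta> t)) \<longlongrightarrow> partial_deriv a f p) (at t0)"
      by (rule continuous_on_tendsto_compose[OF Ck_on_continuous[OF S Ck_on_partial[OF f a(1)]]])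
         (use \<zeta>S mem p_def in auto)
    have "((\<lambda>t. (\<gamma> t a - p a) / (t - t0)) \<longlongrightarrow> \<gamma>' a) (at t0)"
      using \<gamma>[OF a(1)] by (simp add: has_field_derivative_iff p_def)
    from tendsto_mult[OF clim this]
    have "((\<lambda>t. (D t - D t0) / (t - t0)) \<longlongrightarrow> partial_deriv a f p * \<gamma>' a) (at t0)"
    proof (rule Lim_transform_eventually)
      have "D t0 = 0" by (simp add: D_def G_def p_def if_distrib cong: if_cong)
      then show "\<forall>\<^sub>F t in at t0. partial_deriv a f (\<zeta> t) * ((\<gamma> t a - p a) / (t - t0)) = (D t - D t0) / (t - t0)"
        using near by (auto elim!: eventually_mono simp: s(2) \<zeta>_def)
    qed
    then have "(D has_real_derivative partial_deriv a f p * \<gamma>' a) (at t0)"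
      by (simp add: has_field_derivative_iff)
    from DERIV_add[OF this insert.IH[OF A]]
    show ?case using insert.hyps by (simp add: D_def)
  qed
  from this[OF I order_refl]
  have "((\<lambda>t. f (G I t)) has_real_derivative (\<Sum>i\<in>I. partial_deriv i f p * \<gamma>' i)) (at t0)" .
  moreover have "G I t = \<gamma> t" for t
    using ext[of t] pext by (auto simp: G_def extensional_def)
  ultimately show ?thesis by (simp add: p_def)
qed

lemma continuous_on_restrict_coords:
  fixes g :: "'k \<Rightarrow> 'a::topological_space \<Rightarrow> real"
  assumes "\<And>i. i \<in> I \<Longrightarrow> continuous_on S (g i)"
  shows "continuous_on S (\<lambda>x. \<lambda>i\<in>I. g i x)"
proof (rule continuous_on_coordinatewise_then_product)
  show "continuous_on S (\<lambda>x. (\<lambda>i\<in>I. g i x) k)" for k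
    using assms by (cases "k \<in> I") auto
qed

text \<open>The partial derivatives are sums of (partial derivative of f, composed with g) times
  (partial derivative of g); both factors have order n, the former by the induction hypothesis for
  another outer function, whence f is arbitrary in the induction. The restriction to I keeps the
  composed point extensional.\<close>

lemma Ck_on_compose:
  assumes I: "finite I" and S: "openin (powertop_real I) S" and S': "openin (powertop_real I') S'"
    and mem: "\<And>x. x \<in> S' \<Longrightarrow> (\<lambda>i\<in>I. g i x) \<in> S"
    and "\<And>i. i \<in> I \<Longrightarrow> Ck_on n I' S' (g i)" and "Ck_on n I S f"
  shows "Ck_on n I' S' (\<lambda>x. f (\<lambda>i\<in>I. g i x))"
  using assms(5,6)
proof (induction n arbitrary: f)
  case 0
  have "continuous_on S' (\<lambda>x. \<lambda>i\<in>I. g i x)"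
    by (rule continuous_on_restrict_coords) (use 0(1) Ck_on_0_iff[OF S'] in blast)
  with 0(2) show ?case unfolding Ck_on_0_iff[OF S'] Ck_on_0_iff[OF S]
    by (rule continuous_on_compose2) (use mem in auto)
next
  case (Suc n)
  have g: "Ck_on n I' S' (g i)" if "i \<in> I" for i
    using Ck_on_Suc_imp[OF Suc.prems(1)[OF that]] .
  have sum: "Ck_on n I' S' (\<lambda>x. \<Sum>i\<in>A. h i x)"
    if "finite A" "\<And>i. i \<in> A \<Longrightarrow> Ck_on n I' S' (h i)" for A and h :: "'a \<Rightarrow> ('b \<Rightarrow> real) \<Rightarrow> real"
    using that by (induction A) (auto intro!: Ck_on_add[OF S'] Ck_on_const[OF S'])
  have f1: "Ck_on (Suc 0) I S f"
    using Suc.prems(2) by (induction n) (auto dest: Ck_on_Suc_imp simp del: Ck_on.simps)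
  show ?case
  proof (rule Ck_on_SucI[OF S'])
    have "continuous_on S' (\<lambda>x. \<lambda>i\<in>I. g i x)"
      by (rule continuous_on_restrict_coords) (use Ck_on_continuous[OF S' g] in blast)
    with Ck_on_continuous[OF S Suc.prems(2)] show "continuous_on S' (\<lambda>x. f (\<lambda>i\<in>I. g i x))"
      by (rule continuous_on_compose2) (use mem in auto)
    show "((\<lambda>t. f (\<lambda>i\<in>I. g i (x(j := t)))) has_real_derivative
        (\<Sum>i\<in>I. partial_deriv i f (\<lambda>i\<in>I. g i x) * partial_deriv j (g i) x)) (at (x j))"
      if "j \<in> I'" "x \<in> S'" for j x
      using curve_chain_rule[OF I S f1, of "\<lambda>t. \<lambda>i\<in>I. g i (x(j := t))" "\<lambda>i. partial_deriv j (g i) x" "x j"]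
        Ck_on_DERIV[OF Suc.prems(1) that] mem[OF that(2)] by simp
    show "Ck_on n I' S' (\<lambda>x. \<Sum>i\<in>I. partial_deriv i f (\<lambda>i\<in>I. g i x) * partial_deriv j (g i) x)"
      if "j \<in> I'" for j
      by (intro sum[OF I] Ck_on_mult[OF S'] Suc.IH g Ck_on_partial[OF Suc.prems(2)]
           Ck_on_partial[OF Suc.prems(1) that])
  qed
qed

section \<open>Smooth functions on open subsets of the model space\<close>

lemma smooth_onI: "(\<And>n. Ck_on n I S f) \<Longrightarrow> smooth_on I S f"
  and smooth_onD: "smooth_on I S f \<Longrightarrow> Ck_on n I S f"
  by (auto simp: smooth_on_def)

lemma smooth_on_cong:
  assumes "openin (powertop_real I) S" "\<And>z. z \<in> S \<Longrightarrow> f z = g z" "smooth_on I S f"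
  shows "smooth_on I S g"
  using Ck_on_cong[OF assms(1,2)] assms(3) by (auto simp: smooth_on_def)

lemma smooth_on_const: "openin (powertop_real I) S \<Longrightarrow> smooth_on I S (\<lambda>x. c)"
  by (auto simp: smooth_on_def Ck_on_const)

lemma smooth_on_coord: "openin (powertop_real I) S \<Longrightarrow> k \<in> I \<Longrightarrow> smooth_on I S (\<lambda>x. x k)"
  by (auto simp: smooth_on_def Ck_on_coord)

lemma smooth_on_add:
  "openin (powertop_real I) S \<Longrightarrow> smooth_on I S f \<Longrightarrow> smooth_on I S g \<Longrightarrow> smooth_on I S (\<lambda>x. f x + g x)"
  by (auto simp: smooth_on_def Ck_on_add)

lemma smooth_on_mult:
  "openin (powertop_real I) S \<Longrightarrow> smooth_on I S f \<Longrightarrow> smooth_on I S g \<Longrightarrow> smooth_on I S (\<lambda>x. f x * g x)"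
  by (auto simp: smooth_on_def Ck_on_mult)

lemma smooth_on_diff:
  assumes "openin (powertop_real I) S" "smooth_on I S f" "smooth_on I S g"
  shows "smooth_on I S (\<lambda>x. f x - g x)"
  using smooth_on_add[OF assms(1,2) smooth_on_mult[OF assms(1) smooth_on_const[OF assms(1), of "-1"] assms(3)]]
  by simp

lemma smooth_on_inverse:
  "openin (powertop_real I) S \<Longrightarrow> smooth_on I S f \<Longrightarrow> (\<And>x. x \<in> S \<Longrightarrow> f x \<noteq> 0) \<Longrightarrow> smooth_on I S (\<lambda>x. inverse (f x))"
  by (auto simp: smooth_on_def Ck_on_inverse)

lemma smooth_on_sum:
  assumes "openin (powertop_real I) S" "\<And>i. i \<in> A \<Longrightarrow> smooth_on I S (f i)"
  shows "smooth_on I S (\<lambda>x. \<Sum>i\<in>A. f i x)"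
proof (cases "finite A")
  case True
  then show ?thesis using assms(2)
    by (induction A) (auto intro!: smooth_on_add[OF assms(1)] smooth_on_const[OF assms(1)])
qed (auto intro!: smooth_on_const[OF assms(1)])

lemma smooth_on_prod:
  assumes "openin (powertop_real I) S" "\<And>i. i \<in> A \<Longrightarrow> smooth_on I S (f i)"
  shows "smooth_on I S (\<lambda>x. \<Prod>i\<in>A. f i x)"
proof (cases "finite A")
  case True
  then show ?thesis using assms(2)
    by (induction A) (auto intro!: smooth_on_mult[OF assms(1)] smooth_on_const[OF assms(1)])
qed (auto intro!: smooth_on_const[OF assms(1)])

lemma smooth_on_subset:
  "openin (powertop_real I) T \<Longrightarrow> T \<subseteq> S \<Longrightarrow> openin (powertop_real I) S \<Longrightarrow> smooth_on I S f \<Longrightarrow> smooth_on I T f"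
  using Ck_on_subset unfolding smooth_on_def by blast

lemma smooth_on_local:
  assumes "openin (powertop_real I) S"
    and "\<And>x. x \<in> S \<Longrightarrow> \<exists>T. openin (powertop_real I) T \<and> x \<in> T \<and> T \<subseteq> S \<and> smooth_on I T f"
  shows "smooth_on I S f"
  by (rule smooth_onI, rule Ck_on_local[OF assms(1)]) (use assms(2) in \<open>unfold smooth_on_def, metis\<close>)

lemma smooth_on_compose:
  assumes "finite I" "openin (powertop_real I) S" "openin (powertop_real I') S'"
    and "\<And>x. x \<in> S' \<Longrightarrow> (\<lambda>i\<in>I. g i x) \<in> S"
    and "\<And>i. i \<in> I \<Longrightarrow> smooth_on I' S' (g i)" "smooth_on I S f"
  shows "smooth_on I' S' (\<lambda>x. f (\<lambda>i\<in>I. g i x))"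
  by (rule smooth_onI, rule Ck_on_compose[OF assms(1-4)]) (use assms(5,6) in \<open>auto intro: smooth_onD\<close>)

lemma smooth_on_partial: "smooth_on I S f \<Longrightarrow> i \<in> I \<Longrightarrow> smooth_on I S (partial_deriv i f)"
  unfolding smooth_on_def using Ck_on_partial by metis

lemma smooth_on_DERIV:
  assumes "smooth_on I S f" "i \<in> I" "x \<in> S"
  shows "((\<lambda>t. f (x(i := t))) has_real_derivative partial_deriv i f x) (at (x i))"
  using Ck_on_DERIV[OF _ assms(2,3), of 0 f] assms(1) by (auto simp: smooth_on_def simp del: Ck_on.simps)

lemma smooth_on_continuous: "openin (powertop_real I) S \<Longrightarrow> smooth_on I S f \<Longrightarrow> continuous_on S f"
  using Ck_on_continuous smooth_onD by blast

text \<open>The functions \<open>flat_exp k\<close>, \<open>k \<in> \<nat>\<close>, span a space that is closed under differentiation.\<close>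

definition flat_exp :: "nat \<Rightarrow> real \<Rightarrow> real" where
  "flat_exp k t = (if t > 0 then inverse t ^ k * exp (- inverse t) else 0)"

text \<open>Substituting u = 1/t turns the claim into the decay of u^k / exp u at infinity.\<close>

lemma flat_exp_tendsto: "(flat_exp k \<longlongrightarrow> 0) (at_right 0)"
proof -
  have "((\<lambda>u::real. u ^ k / exp u) \<longlongrightarrow> 0) at_top" by (rule tendsto_power_div_exp_0)
  from filterlim_compose[OF this filterlim_inverse_at_top_right]
  have "((\<lambda>t::real. inverse t ^ k / exp (inverse t)) \<longlongrightarrow> 0) (at_right 0)" .
  then show ?thesis
    by (rule Lim_transform_eventually)
       (auto simp: flat_exp_def eventually_at_right_field exp_minus divide_inverse intro!: exI[of _ 1])
qed

lemma flat_exp_DERIV: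
  "(flat_exp k has_real_derivative flat_exp (k + 2) t - real k * flat_exp (k + 1) t) (at t)"
proof -
  consider "t > 0" | "t < 0" | "t = 0" by linarith
  then show ?thesis
  proof cases
    case 1
    have "((\<lambda>t. inverse t ^ k * exp (- inverse t)) has_real_derivative
        flat_exp (k + 2) t - real k * flat_exp (k + 1) t) (at t)"
    proof (cases k)
      case 0
      show ?thesis using 1 unfolding 0
        by (auto intro!: derivative_eq_intros simp: flat_exp_def power2_eq_square field_simps)
    next
      case (Suc m)
      show ?thesis using 1 unfolding Suc
        by (auto intro!: derivative_eq_intros simp: flat_exp_def power2_eq_square field_simps; cases m; simp)
    qed
    then show ?thesis
      by (rule has_field_derivative_transform_within_open[of _ _ _ "{0<..}"]) (use 1 in \<open>auto simp: flat_exp_def\<close>)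
  next
    case 2
    have "((\<lambda>t. 0) has_real_derivative 0) (at t)" by simp
    then have "(flat_exp k has_real_derivative 0) (at t)"
      by (rule has_field_derivative_transform_within_open[of _ _ _ "{..<0}"]) (use 2 in \<open>auto simp: flat_exp_def\<close>)
    then show ?thesis using 2 by (simp add: flat_exp_def)
  next
    case 3
    \<comment> \<open>To the right of 0 the difference quotient of \<open>flat_exp k\<close> is
      \<open>flat_exp (Suc k)\<close>; to the left it is 0.\<close>
    have "((\<lambda>h. (flat_exp k h - flat_exp k 0) / (h - 0)) \<longlongrightarrow> 0) (at_right 0)"
      by (rule Lim_transform_eventually[OF flat_exp_tendsto[of "Suc k"]])
         (auto simp: flat_exp_def eventually_at_right_field divide_inverse intro!: exI[of _ 1])
    moreover have "((\<lambda>h. (flat_exp k h - flat_exp k 0) / (h - 0)) \<longlongrightarrow> 0) (at_left 0)"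
      by (rule Lim_transform_eventually[OF tendsto_const])
         (auto simp: flat_exp_def eventually_at_left_field intro!: exI[of _ "-1"])
    ultimately have "(flat_exp k has_real_derivative 0) (at 0)"
      unfolding has_field_derivative_iff by (simp add: filterlim_split_at)
    then show ?thesis using 3 by (simp add: flat_exp_def)
  qed
qed

lemma Ck_on_flat_exp:
  assumes "openin (powertop_real I) S" "Ck_on n I S f"
  shows "Ck_on n I S (\<lambda>x. flat_exp k (f x))"
  using assms(2)
proof (induction n arbitrary: k)
  have c: "continuous_on UNIV (flat_exp k)" for k
    using flat_exp_DERIV by (metis DERIV_isCont continuous_at_imp_continuous_on)
  {
    case 0
    then show ?case unfolding Ck_on_0_iff[OF assms(1)]
      by (rule continuous_on_compose2[OF c]) auto
  next
    case (Suc n)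
    show ?case
    proof (rule Ck_on_SucI[OF assms(1)])
      show "continuous_on S (\<lambda>x. flat_exp k (f x))"
        by (rule continuous_on_compose2[OF c Ck_on_continuous[OF assms(1) Suc.prems]]) auto
      show "((\<lambda>t. flat_exp k (f (x(i := t)))) has_real_derivative
          (flat_exp (k + 2) (f x) + (- real k) * flat_exp (k + 1) (f x)) * partial_deriv i f x) (at (x i))"
        if "i \<in> I" "x \<in> S" for i x
        using DERIV_chain2[OF flat_exp_DERIV[of k "f (x(i := x i))"] Ck_on_DERIV[OF Suc.prems that]]
        by (simp only: fun_upd_triv diff_conv_add_uminus mult_minus_left)
      show "Ck_on n I S (\<lambda>x. (flat_exp (k + 2) (f x) + (- real k) * flat_exp (k + 1) (f x)) * partial_deriv i f x)"
        if "i \<in> I" for i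
        by (intro Ck_on_mult[OF assms(1)] Ck_on_add[OF assms(1)] Ck_on_const[OF assms(1)]
             Suc.IH Ck_on_Suc_imp[OF Suc.prems] Ck_on_partial[OF Suc.prems that])
    qed
  }
qed

text \<open>The standard transition function e(t) / (e(t) + e(1-t)) with e(t) = exp(-1/t) for t > 0
  and 0 otherwise. The denominator is positive because t and 1 - t cannot both be at most 0.\<close>

definition smooth_step :: "real \<Rightarrow> real" where
  "smooth_step t = flat_exp 0 t * inverse (flat_exp 0 t + flat_exp 0 (1 - t))"

lemma smooth_step_0: "t \<le> 0 \<Longrightarrow> smooth_step t = 0"
  and smooth_step_1: "t \<ge> 1 \<Longrightarrow> smooth_step t = 1"
  by (auto simp: smooth_step_def flat_exp_def)

lemma smooth_on_step:
  assumes "openin (powertop_real I) S" "smooth_on I S f"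
  shows "smooth_on I S (\<lambda>x. smooth_step (f x))"
proof -
  have e: "smooth_on I S (\<lambda>x. flat_exp 0 (h x))" if "smooth_on I S h" for h
    using that Ck_on_flat_exp[OF assms(1)] by (auto simp: smooth_on_def)
  have pos: "flat_exp 0 t + flat_exp 0 (1 - t) \<noteq> 0" for t
    by (auto simp: flat_exp_def add_pos_pos pos_add_strict intro!: less_imp_neq[THEN not_sym])
  show ?thesis
    unfolding smooth_step_def
    by (intro smooth_on_mult[OF assms(1)] smooth_on_inverse[OF assms(1)] smooth_on_add[OF assms(1)] e
        smooth_on_diff[OF assms(1)] smooth_on_const[OF assms(1)] assms(2) pos)
qed

lemma smooth_plateau:
  assumes "finite I" "e > 0"
  obtains \<rho> :: "('k \<Rightarrow> real) \<Rightarrow> real" where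
    "\<And>S. openin (powertop_real I) S \<Longrightarrow> smooth_on I S \<rho>"
    "\<And>x. (\<And>i. i \<in> I \<Longrightarrow> \<bar>x i - p i\<bar> \<le> e / 2) \<Longrightarrow> \<rho> x = 1"
    "\<And>x i. i \<in> I \<Longrightarrow> \<bar>x i - p i\<bar> \<ge> e \<Longrightarrow> \<rho> x = 0"
proof
  \<comment> \<open>The square keeps the argument of the step polynomial in the coordinates. The
    constants are such that the argument is at least 3/2 for distance at most e/2 and at most 0 for
    distance at least e.\<close>
  define \<rho> where "\<rho> = (\<lambda>x. \<Prod>i\<in>I. smooth_step (2 - 2 / e\<^sup>2 * ((x i - p i) * (x i - p i))))"
  show "smooth_on I S \<rho>" if S: "openin (powertop_real I) S" for S
    unfolding \<rho>_def
    by (intro smooth_on_prod[OF S] smooth_on_step[OF S] smooth_on_diff[OF S] smooth_on_mult[OF S]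
        smooth_on_const[OF S] smooth_on_coord[OF S])
  show "\<rho> x = 1" if x: "\<And>i. i \<in> I \<Longrightarrow> \<bar>x i - p i\<bar> \<le> e / 2" for x
  proof -
    have "smooth_step (2 - 2 / e\<^sup>2 * ((x i - p i) * (x i - p i))) = 1" if "i \<in> I" for i
    proof (rule smooth_step_1)
      have "(x i - p i) * (x i - p i) \<le> (e / 2) * (e / 2)"
        using mult_mono[OF x[OF that] x[OF that]] assms(2) by (simp add: abs_mult[symmetric])
      then have "2 / e\<^sup>2 * ((x i - p i) * (x i - p i)) \<le> 2 / e\<^sup>2 * ((e / 2) * (e / 2))"
        by (rule mult_left_mono) simp
      also have "\<dots> \<le> 1" using assms(2) by (simp add: power2_eq_square)
      finally show "1 \<le> 2 - 2 / e\<^sup>2 * ((x i - p i) * (x i - p i))" by linarith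
    qed
    then show ?thesis by (simp add: \<rho>_def)
  qed
  show "\<rho> x = 0" if i: "i \<in> I" "\<bar>x i - p i\<bar> \<ge> e" for x i
  proof -
    have "e * e \<le> (x i - p i) * (x i - p i)"
      using mult_mono[OF i(2) i(2)] assms(2) by (simp add: abs_mult[symmetric])
    then have "2 / e\<^sup>2 * (e * e) \<le> 2 / e\<^sup>2 * ((x i - p i) * (x i - p i))"
      by (rule mult_left_mono) simp
    moreover have "2 / e\<^sup>2 * (e * e) = 2" using assms(2) by (simp add: power2_eq_square)
    ultimately have "smooth_step (2 - 2 / e\<^sup>2 * ((x i - p i) * (x i - p i))) = 0"
      by (intro smooth_step_0) linarith
    then show ?thesis using i(1) assms(1) by (auto simp: \<rho>_def)
  qed
qed

text \<open>Hadamard's lemma: the functions \<open>segment_mean p m u\<close> are closed under partial derivatives,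
  which only raise \<open>m\<close>; so no regularity is lost under the integral.\<close>

definition segment_pt :: "'k set \<Rightarrow> ('k \<Rightarrow> real) \<Rightarrow> ('k \<Rightarrow> real) \<Rightarrow> real \<Rightarrow> 'k \<Rightarrow> real" where
  "segment_pt I p x t = (\<lambda>i\<in>I. p i + t * (x i - p i))"

definition segment_mean :: "'k set \<Rightarrow> ('k \<Rightarrow> real) \<Rightarrow> nat \<Rightarrow> (('k \<Rightarrow> real) \<Rightarrow> real) \<Rightarrow> ('k \<Rightarrow> real) \<Rightarrow> real" where
  "segment_mean I p m u x = integral (cbox 0 1) (\<lambda>t. t ^ m * u (segment_pt I p x t))"

text \<open>An open cube about p. It is star-shaped with respect to p, so that the segments from p
  used in Hadamard's lemma stay inside.\<close>

locale coord_box =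
  fixes I :: "'k set" and p :: "'k \<Rightarrow> real" and e :: real
  assumes I: "finite I" and e: "e > 0" and p: "p \<in> extensional I"
begin

definition box :: "('k \<Rightarrow> real) set" where
  "box = {z \<in> extensional I. \<forall>i\<in>I. \<bar>z i - p i\<bar> < e}"

lemma box_open: "openin (powertop_real I) box"
  unfolding box_def by (rule openin_powertop_box[OF I])

lemma p_box: "p \<in> box" using p e by (simp add: box_def)

lemma segment_box: "x \<in> box \<Longrightarrow> t \<in> {0..1} \<Longrightarrow> segment_pt I p x t \<in> box"
  unfolding box_def segment_pt_def using mult_left_le_one_le[of _ t]
  by (auto simp: abs_mult) (smt (verit, best) mult_left_le_one_le)

lemma segment_cont: "continuous_on (A \<times> C) (\<lambda>(x, t). segment_pt I p x t)"
  unfolding case_prod_beta segment_pt_def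
proof (rule continuous_on_restrict_coords)
  have "continuous_on (A \<times> C) (\<lambda>z. fst z i)" for i
    by (rule continuous_on_compose2[OF continuous_on_product_then_coordinatewise[OF continuous_on_id]])
       (auto intro: continuous_on_fst)
  then show "continuous_on (A \<times> C) (\<lambda>z. p i + snd z * (fst z i - p i))" for i
    by (intro continuous_intros)
qed

lemma integrand_cont:
  assumes "continuous_on box u"
  shows "continuous_on (box \<times> cbox 0 1) (\<lambda>(x, t). t ^ m * u (segment_pt I p x t))"
proof -
  have "continuous_on (box \<times> cbox 0 1) (\<lambda>z. u (segment_pt I p (fst z) (snd z)))"
    using segment_cont[of box "cbox 0 1", unfolded case_prod_beta]
    by (rule continuous_on_compose2[OF assms]) (use segment_box in auto)
  then show ?thesis unfolding case_prod_beta by (intro continuous_intros)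
qed

lemma Ck_on_segment_mean:
  assumes "Ck_on n I box u"
  shows "Ck_on n I box (segment_mean I p m u)"
  using assms
proof (induction n arbitrary: u m)
  case 0
  then have u: "continuous_on box u" using Ck_on_0_iff[OF box_open] by blast
  show ?case unfolding Ck_on_0_iff[OF box_open] segment_mean_def
    by (rule integral_continuous_on_param[OF integrand_cont[OF u]])
next
  case (Suc n)
  have u: "continuous_on box u" by (rule Ck_on_continuous[OF box_open Suc.prems])
  have int: "(\<lambda>t. t ^ m * v (segment_pt I p x t)) integrable_on cbox 0 1"
    if "x \<in> box" "continuous_on box v" for x v and m :: nat
    by (rule integrable_continuous,
        rule continuous_on_compose2[OF integrand_cont[OF that(2)], where f="\<lambda>t. (x, t)", simplified])
       (use that in \<open>auto intro!: continuous_intros\<close>)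
  show ?case
  proof (rule Ck_on_SucI[OF box_open])
    show "continuous_on box (segment_mean I p m u)"
      unfolding segment_mean_def by (rule integral_continuous_on_param[OF integrand_cont[OF u]])
    show "Ck_on n I box (segment_mean I p (Suc m) (partial_deriv i u))" if "i \<in> I" for i
      by (rule Suc.IH[OF Ck_on_partial[OF Suc.prems that]])
    show "((\<lambda>s. segment_mean I p m u (x(i := s))) has_real_derivative
        segment_mean I p (Suc m) (partial_deriv i u) x) (at (x i))" if "i \<in> I" "x \<in> box" for i x
    proof -
      define J where "J = {p i - e<..<p i + e}"
      have xJ: "x i \<in> J" using that by (auto simp: box_def J_def abs_less_iff)
      have upd: "x(i := s) \<in> box" if "s \<in> J" for s
        using that \<open>x \<in> box\<close> \<open>i \<in> I\<close> by (auto simp: box_def J_def upd_extensional abs_less_iff)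
      have "((\<lambda>s. integral (cbox 0 1) (\<lambda>t. t ^ m * u (segment_pt I p (x(i := s)) t))) has_real_derivative
          integral (cbox 0 1) (\<lambda>t. t ^ Suc m * partial_deriv i u (segment_pt I p (x(i := x i)) t))) (at (x i) within J)"
      proof (rule leibniz_rule_field_derivative)
        show "convex J" by (simp add: J_def)
        show "x i \<in> J" by (rule xJ)
        show "(\<lambda>t. t ^ m * u (segment_pt I p (x(i := s)) t)) integrable_on cbox 0 1" if "s \<in> J" for s
          by (rule int[OF upd[OF that] u])
        have pu: "continuous_on box (partial_deriv i u)"
          by (rule Ck_on_continuous[OF box_open Ck_on_partial[OF Suc.prems that(1)]])
        show "continuous_on (J \<times> cbox 0 1) (\<lambda>(s, t). t ^ Suc m * partial_deriv i u (segment_pt I p (x(i := s)) t))"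
        proof -
          have "continuous_on (J \<times> cbox 0 (1::real)) (\<lambda>z. x(i := fst z))"
          proof (rule continuous_on_coordinatewise_then_product)
            show "continuous_on (J \<times> cbox 0 (1::real)) (\<lambda>z. (x(i := fst z)) k)" for k
              by (cases "k = i") (auto intro!: continuous_intros)
          qed
          then have "continuous_on (J \<times> cbox 0 (1::real)) (\<lambda>z. (x(i := fst z), snd z))"
            by (rule continuous_on_Pair[OF _ continuous_on_snd[OF continuous_on_id]])
          then have "continuous_on (J \<times> cbox 0 1)
              (\<lambda>z. (\<lambda>(x, t). t ^ Suc m * partial_deriv i u (segment_pt I p x t)) (x(i := fst z), snd z))"
            by (rule continuous_on_compose2[OF integrand_cont[OF pu, of "Suc m"]]) (use upd in auto)
          then show ?thesis unfolding case_prod_beta fst_conv snd_conv .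
        qed
        show "((\<lambda>s. t ^ m * u (segment_pt I p (x(i := s)) t)) has_real_derivative
            t ^ Suc m * partial_deriv i u (segment_pt I p (x(i := s)) t)) (at s within J)"
          if "s \<in> J" "t \<in> cbox 0 1" for s t
        proof -
          define w where "w = segment_pt I p (x(i := s)) t"
          have w: "w \<in> box" "w i = p i + t * (s - p i)"
            using segment_box[OF upd[OF that(1)]] that(2) \<open>i \<in> I\<close> by (auto simp: w_def segment_pt_def)
          have eq: "segment_pt I p (x(i := s')) t = w(i := p i + t * (s' - p i))" for s'
            using \<open>i \<in> I\<close> by (auto simp: w_def segment_pt_def)
          \<comment> \<open>Moving the i-th coordinate of the end point with speed 1 moves the point
            of the segment at parameter t with speed t; this is the factor that turns
            \<open>t ^ m\<close> into \<open>t ^ Suc m\<close>.\<close>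
          have "((\<lambda>s'. p i + t * (s' - p i)) has_real_derivative t) (at s)"
            by (auto intro!: derivative_eq_intros)
          from DERIV_chain2[OF Ck_on_DERIV[OF Suc.prems \<open>i \<in> I\<close> w(1), unfolded w(2)] this]
          have "((\<lambda>s'. u (w(i := p i + t * (s' - p i)))) has_real_derivative partial_deriv i u w * t) (at s)" .
          then have "((\<lambda>s'. t ^ m * u (w(i := p i + t * (s' - p i)))) has_real_derivative
              t ^ m * (partial_deriv i u w * t)) (at s)"
            by (rule DERIV_cmult)
          moreover have "w(i := p i + t * (s - p i)) = w" unfolding w(2)[symmetric] by simp
          ultimately show ?thesis
            unfolding eq by (simp add: mult_ac has_field_derivative_at_within)
        qed
      qed
      moreover have "at (x i) within J = at (x i)"
        by (rule at_within_open[OF xJ]) (simp add: J_def)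
      ultimately show ?thesis unfolding segment_mean_def by simp
    qed
  qed
qed

text \<open>The derivative of f along the segment from p to x is integrated; \<open>h i\<close> is
  the mean of the i-th partial derivative over the segment. For x = p the segment is constant, so
  the mean is the value at p.\<close>

lemma hadamard:
  assumes "smooth_on I box f"
  shows "\<exists>h. (\<forall>i\<in>I. smooth_on I box (h i) \<and> h i p = partial_deriv i f p) \<and>
             (\<forall>x\<in>box. f x = f p + (\<Sum>i\<in>I. (x i - p i) * h i x))"
proof (intro exI conjI ballI)
  let ?h = "\<lambda>i. segment_mean I p 0 (partial_deriv i f)"
  show "smooth_on I box (?h i)" if "i \<in> I" for i
    by (rule smooth_onI, rule Ck_on_segment_mean) (rule smooth_onD[OF smooth_on_partial[OF assms that]])
  have pp: "segment_pt I p p t = p" for t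
    using p by (auto simp: segment_pt_def extensional_def)
  show "?h i p = partial_deriv i f p" if "i \<in> I" for i
    by (simp add: segment_mean_def pp)
  fix x assume x: "x \<in> box"
  have "((\<lambda>t. \<Sum>i\<in>I. partial_deriv i f (segment_pt I p x t) * (x i - p i)) has_integral
      f (segment_pt I p x 1) - f (segment_pt I p x 0)) {0..1}"
  proof (rule fundamental_theorem_of_calculus)
    fix t :: real assume t: "t \<in> {0..1}"
    have "((\<lambda>t. f (segment_pt I p x t)) has_real_derivative
        (\<Sum>i\<in>I. partial_deriv i f (segment_pt I p x t) * (x i - p i))) (at t)"
    proof (rule curve_chain_rule[OF I box_open smooth_onD[OF assms]])
      show "((\<lambda>t. segment_pt I p x t i) has_real_derivative x i - p i) (at t)" if "i \<in> I" for i
        using that by (auto simp: segment_pt_def intro!: derivative_eq_intros)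
      show "segment_pt I p x t \<in> box" by (rule segment_box[OF x t])
      show "segment_pt I p x t \<in> extensional I" for t by (simp add: segment_pt_def)
    qed
    then show "((\<lambda>t. f (segment_pt I p x t)) has_vector_derivative
        (\<Sum>i\<in>I. partial_deriv i f (segment_pt I p x t) * (x i - p i))) (at t within {0..1})"
      by (simp add: has_real_derivative_iff_has_vector_derivative has_vector_derivative_at_within)
  qed simp
  moreover have "segment_pt I p x 1 = x" "segment_pt I p x 0 = p"
    using x p by (auto simp: segment_pt_def box_def extensional_def)
  moreover have "((\<lambda>t. \<Sum>i\<in>I. partial_deriv i f (segment_pt I p x t) * (x i - p i)) has_integral
      (\<Sum>i\<in>I. ?h i x * (x i - p i))) {0..1}"
  proof (intro has_integral_sum[OF I] has_integral_mult_left)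
    fix i assume i: "i \<in> I"
    have c: "continuous_on box (partial_deriv i f)"
      by (rule smooth_on_continuous[OF box_open smooth_on_partial[OF assms i]])
    have "continuous_on {0..1} (\<lambda>t. partial_deriv i f (segment_pt I p x t))"
      by (rule continuous_on_compose2[OF integrand_cont[OF c, of 0], where f="\<lambda>t. (x, t)", simplified])
         (use x in \<open>auto intro!: continuous_intros\<close>)
    then show "((\<lambda>t. partial_deriv i f (segment_pt I p x t)) has_integral ?h i x) {0..1}"
      unfolding segment_mean_def by (simp add: integrable_integral integrable_continuous_real)
  qed
  ultimately have "f x - f p = (\<Sum>i\<in>I. ?h i x * (x i - p i))"
    by (simp only: has_integral_unique)
  then show "f x = f p + (\<Sum>i\<in>I. (x i - p i) * ?h i x)"
    by (simp add: mult.commute)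
qed

end

section \<open>Smooth functions on manifolds\<close>

text \<open>\<^const>\<open>smooth_manifold\<close> without second countability, which would otherwise have to be verified
  for products.\<close>

locale manifold =
  fixes M :: "('a, 'k) mfd"
  assumes fin_coords: "finite (coords M)" and haus: "Hausdorff_space (mtop M)"
    and chart: "\<And>U \<phi>. (U, \<phi>) \<in> atlas M \<Longrightarrow> openin (mtop M) U \<and> openin (powertop_real (coords M)) (\<phi> ` U) \<and>
        homeomorphic_map (subtopology (mtop M) U) (subtopology (powertop_real (coords M)) (\<phi> ` U)) \<phi>"
    and cover: "(\<Union>(U, \<phi>) \<in> atlas M. U) = points M"
    and transition: "\<And>U \<phi> V \<psi> i. (U, \<phi>) \<in> atlas M \<Longrightarrow> (V, \<psi>) \<in> atlas M \<Longrightarrow> i \<in> coords M \<Longrightarrow>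
        smooth_on (coords M) (\<phi> ` (U \<inter> V)) (\<lambda>x. \<psi> (inv_into U \<phi> x) i)"

lemma smooth_manifold_manifold: "smooth_manifold M \<Longrightarrow> manifold M"
  unfolding smooth_manifold_def manifold_def by fastforce

context manifold
begin

lemma chart_open: "(U, \<phi>) \<in> atlas M \<Longrightarrow> openin (mtop M) U"
  and chart_image_open: "(U, \<phi>) \<in> atlas M \<Longrightarrow> openin (powertop_real (coords M)) (\<phi> ` U)"
  and chart_homeo: "(U, \<phi>) \<in> atlas M \<Longrightarrow>
    homeomorphic_map (subtopology (mtop M) U) (subtopology (powertop_real (coords M)) (\<phi> ` U)) \<phi>"
  using chart by auto

lemma chart_points: "(U, \<phi>) \<in> atlas M \<Longrightarrow> U \<subseteq> points M"
  using chart_open openin_subset by blast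

lemma chart_at: "p \<in> points M \<Longrightarrow> \<exists>U \<phi>. (U, \<phi>) \<in> atlas M \<and> p \<in> U"
proof -
  assume "p \<in> points M"
  then obtain c where "c \<in> atlas M" "p \<in> (case c of (U, \<phi>) \<Rightarrow> U)" using cover by blast
  then show ?thesis by (cases c) auto
qed

lemma chart_inj:
  assumes "(U, \<phi>) \<in> atlas M"
  shows "inj_on \<phi> U"
proof -
  have "topspace (subtopology (mtop M) U) = U" using chart_points[OF assms] by auto
  then show ?thesis using chart_homeo[OF assms] by (metis homeomorphic_imp_injective_map)
qed

lemma chart_inv [simp]: "(U, \<phi>) \<in> atlas M \<Longrightarrow> q \<in> U \<Longrightarrow> inv_into U \<phi> (\<phi> q) = q"
  by (simp add: chart_inj inv_into_f_f)

lemma chart_ext: "(U, \<phi>) \<in> atlas M \<Longrightarrow> q \<in> U \<Longrightarrow> \<phi> q \<in> extensional (coords M)"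
  using openin_powertop_ext[OF chart_image_open] by blast

lemma chart_image_openin:
  assumes "(U, \<phi>) \<in> atlas M" "openin (mtop M) N" "N \<subseteq> U"
  shows "openin (powertop_real (coords M)) (\<phi> ` N)"
proof -
  have "openin (subtopology (mtop M) U) N"
    using assms chart_open[OF assms(1)] by (simp add: openin_open_subtopology)
  then have "openin (subtopology (powertop_real (coords M)) (\<phi> ` U)) (\<phi> ` N)"
    using homeomorphic_imp_open_map[OF chart_homeo[OF assms(1)]] by (simp add: open_map_def)
  then show ?thesis using openin_open_subtopology[OF chart_image_open[OF assms(1)]] by blast
qed

lemma chart_preimage_open:
  assumes "(U, \<phi>) \<in> atlas M" "openin (powertop_real (coords M)) S"
  shows "openin (mtop M) {q \<in> U. \<phi> q \<in> S}"
proof -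
  have "continuous_map (subtopology (mtop M) U) (powertop_real (coords M)) \<phi>"
    using homeomorphic_imp_continuous_map[OF chart_homeo[OF assms(1)]] by (simp add: continuous_map_in_subtopology)
  from openin_continuous_map_preimage[OF this assms(2)]
  have "openin (subtopology (mtop M) U) {q \<in> U. \<phi> q \<in> S}"
    using chart_points[OF assms(1)] by (simp add: inf.absorb2 cong: conj_cong)
  then show ?thesis using openin_open_subtopology[OF chart_open[OF assms(1)]] by blast
qed

lemma smooth_funs_chart:
  "f \<in> smooth_funs M \<Longrightarrow> (U, \<phi>) \<in> atlas M \<Longrightarrow> smooth_on (coords M) (\<phi> ` U) (\<lambda>x. f (inv_into U \<phi> x))"
  unfolding smooth_funs_def by fastforce

text \<open>Membership in \<open>smooth_funs\<close> demands every chart, but near each point one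
  chart suffices, since any other expression arises from it by a smooth transition map.\<close>

lemma smooth_funs_chartI:
  assumes "\<And>p. p \<in> points M \<Longrightarrow> \<exists>U \<phi> N. (U, \<phi>) \<in> atlas M \<and> openin (mtop M) N \<and> p \<in> N \<and> N \<subseteq> U \<and>
      smooth_on (coords M) (\<phi> ` N) (\<lambda>x. f (inv_into U \<phi> x))"
  shows "f \<in> smooth_funs M"
proof -
  have "smooth_on (coords M) (\<psi> ` V) (\<lambda>x. f (inv_into V \<psi> x))" if V: "(V, \<psi>) \<in> atlas M" for V \<psi>
  proof (rule smooth_on_local[OF chart_image_open[OF V]])
    fix x assume "x \<in> \<psi> ` V"
    then obtain p where p: "p \<in> V" "x = \<psi> p" by auto
    then obtain U \<phi> N where U: "(U, \<phi>) \<in> atlas M" and N: "openin (mtop M) N" "p \<in> N" "N \<subseteq> U"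
      and sm: "smooth_on (coords M) (\<phi> ` N) (\<lambda>x. f (inv_into U \<phi> x))"
      using assms chart_points[OF V] by blast
    let ?T = "\<psi> ` (N \<inter> V)"
    have NV: "openin (mtop M) (N \<inter> V)" using N(1) chart_open[OF V] by blast
    have T: "openin (powertop_real (coords M)) ?T" by (rule chart_image_openin[OF V NV]) auto
    have VU: "openin (powertop_real (coords M)) (\<psi> ` (V \<inter> U))"
      by (rule chart_image_openin[OF V]) (use chart_open[OF V] chart_open[OF U] in auto)
    have eq: "(\<lambda>i\<in>coords M. \<phi> (inv_into V \<psi> x) i) = \<phi> r" if "r \<in> N" "r \<in> V" "x = \<psi> r" for x r
      using that chart_ext[OF U] N(3) V by (auto simp: extensional_restrict)
    have "smooth_on (coords M) ?T (\<lambda>x. (\<lambda>x. f (inv_into U \<phi> x)) (\<lambda>i\<in>coords M. \<phi> (inv_into V \<psi> x) i))"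
    proof (rule smooth_on_compose[OF fin_coords chart_image_openin[OF U N(1,3)] T _ _ sm])
      show "(\<lambda>i\<in>coords M. \<phi> (inv_into V \<psi> x) i) \<in> \<phi> ` N" if "x \<in> ?T" for x
        using that eq by auto
      show "smooth_on (coords M) ?T (\<lambda>x. \<phi> (inv_into V \<psi> x) i)" if "i \<in> coords M" for i
        by (rule smooth_on_subset[OF T _ VU transition[OF V U that]]) (use N(3) in auto)
    qed
    then have "smooth_on (coords M) ?T (\<lambda>x. f (inv_into V \<psi> x))"
      by (rule smooth_on_cong[OF T, rotated]) (use eq N(3) U V in auto)
    then show "\<exists>T. openin (powertop_real (coords M)) T \<and> x \<in> T \<and> T \<subseteq> \<psi> ` V \<and>
        smooth_on (coords M) T (\<lambda>x. f (inv_into V \<psi> x))"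
      using T p N(2) by blast
  qed
  then show ?thesis by (auto simp: smooth_funs_def)
qed

lemma smooth_funs_local:
  assumes "\<And>p. p \<in> points M \<Longrightarrow> \<exists>N h. openin (mtop M) N \<and> p \<in> N \<and> h \<in> smooth_funs M \<and> (\<forall>q\<in>N. f q = h q)"
  shows "f \<in> smooth_funs M"
proof (rule smooth_funs_chartI)
  fix p assume p: "p \<in> points M"
  obtain N h where N: "openin (mtop M) N" "p \<in> N" "h \<in> smooth_funs M" "\<And>q. q \<in> N \<Longrightarrow> f q = h q"
    using assms[OF p] by auto
  obtain U \<phi> where U: "(U, \<phi>) \<in> atlas M" "p \<in> U" using chart_at[OF p] by blast
  have NU: "openin (mtop M) (N \<inter> U)" using N(1) chart_open[OF U(1)] by blast
  have o: "openin (powertop_real (coords M)) (\<phi> ` (N \<inter> U))"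
    by (rule chart_image_openin[OF U(1) NU]) auto
  have "smooth_on (coords M) (\<phi> ` (N \<inter> U)) (\<lambda>x. h (inv_into U \<phi> x))"
    by (rule smooth_on_subset[OF o _ chart_image_open[OF U(1)] smooth_funs_chart[OF N(3) U(1)]]) auto
  then have "smooth_on (coords M) (\<phi> ` (N \<inter> U)) (\<lambda>x. f (inv_into U \<phi> x))"
    by (rule smooth_on_cong[OF o, rotated]) (use N(4) U in auto)
  then show "\<exists>U \<phi> N. (U, \<phi>) \<in> atlas M \<and> openin (mtop M) N \<and> p \<in> N \<and> N \<subseteq> U \<and>
      smooth_on (coords M) (\<phi> ` N) (\<lambda>x. f (inv_into U \<phi> x))"
    using U N(2) NU by blast
qed

lemma smooth_funs_cong:
  assumes "f \<in> smooth_funs M" "\<And>p. p \<in> points M \<Longrightarrow> f p = h p"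
  shows "h \<in> smooth_funs M"
  by (rule smooth_funs_local) (use assms in \<open>metis openin_topspace\<close>)

lemma smooth_funs_const [simp, intro]: "(\<lambda>p. c) \<in> smooth_funs M"
  by (auto simp: smooth_funs_def intro!: smooth_on_const chart_image_open)

lemma smooth_funs_add [intro]: "f \<in> smooth_funs M \<Longrightarrow> h \<in> smooth_funs M \<Longrightarrow> (\<lambda>p. f p + h p) \<in> smooth_funs M"
  unfolding smooth_funs_def by (auto intro!: smooth_on_add[OF chart_image_open])

lemma smooth_funs_mult [intro]: "f \<in> smooth_funs M \<Longrightarrow> h \<in> smooth_funs M \<Longrightarrow> (\<lambda>p. f p * h p) \<in> smooth_funs M"
  unfolding smooth_funs_def by (auto intro!: smooth_on_mult[OF chart_image_open])

lemma smooth_funs_diff [intro]: "f \<in> smooth_funs M \<Longrightarrow> h \<in> smooth_funs M \<Longrightarrow> (\<lambda>p. f p - h p) \<in> smooth_funs M"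
  unfolding smooth_funs_def by (auto intro!: smooth_on_diff[OF chart_image_open])

lemma smooth_funs_minus [intro]: "f \<in> smooth_funs M \<Longrightarrow> (\<lambda>p. - f p) \<in> smooth_funs M"
  using smooth_funs_diff[OF smooth_funs_const[of 0]] by simp

lemma smooth_funs_sum [intro]: "(\<And>i. i \<in> A \<Longrightarrow> f i \<in> smooth_funs M) \<Longrightarrow> (\<lambda>p. \<Sum>i\<in>A. f i p) \<in> smooth_funs M"
  unfolding smooth_funs_def by (auto intro!: smooth_on_sum[OF chart_image_open])

lemma smooth_funs_power [intro]: "f \<in> smooth_funs M \<Longrightarrow> (\<lambda>p. f p ^ n) \<in> smooth_funs M"
  by (induction n) auto

lemma smooth_funs_continuous:
  assumes f: "f \<in> smooth_funs M"
  shows "continuous_map (mtop M) euclideanreal f"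
proof (rule pasting_lemma[where I="atlas M" and T=fst and f="\<lambda>_. f"])
  fix c assume c: "c \<in> atlas M"
  obtain U \<phi> where U: "c = (U, \<phi>)" "(U, \<phi>) \<in> atlas M" using c by (cases c) auto
  show "openin (mtop M) (fst c)" using chart_open[OF U(2)] U(1) by simp
  have "continuous_map (subtopology (powertop_real (coords M)) (\<phi> ` U)) euclideanreal (\<lambda>x. f (inv_into U \<phi> x))"
    using smooth_onD[OF smooth_funs_chart[OF f U(2)], of 0] by simp
  from continuous_map_compose[OF homeomorphic_imp_continuous_map[OF chart_homeo[OF U(2)]] this]
  have "continuous_map (subtopology (mtop M) U) euclideanreal ((\<lambda>x. f (inv_into U \<phi> x)) \<circ> \<phi>)" .
  then show "continuous_map (subtopology (mtop M) (fst c)) euclideanreal f"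
    unfolding U(1) fst_conv by (rule continuous_map_eq) (use U in auto)
next
  fix p assume "p \<in> points M"
  then show "\<exists>j. j \<in> atlas M \<and> p \<in> fst j \<and> f p = f p" using chart_at by force
qed auto

lemma smooth_funs_neq_open:
  assumes "f \<in> smooth_funs M" "h \<in> smooth_funs M"
  shows "openin (mtop M) {p \<in> points M. f p \<noteq> h p}"
proof -
  have "openin euclideanreal (- {0})" by (simp add: open_Compl)
  from openin_continuous_map_preimage[OF smooth_funs_continuous[OF smooth_funs_diff[OF assms]] this]
  show ?thesis by simp
qed

text \<open>The bridge from local to global functions: multiplied by \<rho>, any function that is
  smooth in the coordinates of \<open>U \<inter> O'\<close> becomes a member of
  \<open>smooth_funs M\<close>, and it is unchanged on the neighbourhood N of p.\<close>

lemma chart_bump: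
  assumes U: "(U, \<phi>) \<in> atlas M" and p: "p \<in> U" and O: "openin (mtop M) O'" "p \<in> O'"
  obtains \<rho> N where "openin (mtop M) N" "p \<in> N" "N \<subseteq> U \<inter> O'" "\<And>q. q \<in> N \<Longrightarrow> \<rho> q = 1"
    "\<And>q. q \<notin> U \<inter> O' \<Longrightarrow> \<rho> q = 0"
    "\<And>u. smooth_on (coords M) (\<phi> ` (U \<inter> O')) u \<Longrightarrow> (\<lambda>q. \<rho> q * u (\<phi> q)) \<in> smooth_funs M"
    "\<rho> \<in> smooth_funs M"
proof -
  let ?W = "U \<inter> O'" and ?I = "coords M"
  have W: "openin (mtop M) ?W" using O chart_open[OF U] by blast
  have \<phi>W: "openin (powertop_real ?I) (\<phi> ` ?W)" by (rule chart_image_openin[OF U W]) auto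
  have "\<phi> p \<in> \<phi> ` ?W" using p O by auto
  from powertop_box[OF fin_coords \<phi>W this]
  obtain e where e: "e > 0"
    and box: "\<And>z. z \<in> extensional ?I \<Longrightarrow> (\<And>i. i \<in> ?I \<Longrightarrow> \<bar>z i - \<phi> p i\<bar> \<le> e) \<Longrightarrow> z \<in> \<phi> ` ?W"
    by blast
  obtain \<rho>0 where \<rho>0: "\<And>S. openin (powertop_real ?I) S \<Longrightarrow> smooth_on ?I S \<rho>0"
    "\<And>x. (\<And>i. i \<in> ?I \<Longrightarrow> \<bar>x i - \<phi> p i\<bar> \<le> e / 2) \<Longrightarrow> \<rho>0 x = 1"
    "\<And>x i. i \<in> ?I \<Longrightarrow> \<bar>x i - \<phi> p i\<bar> \<ge> e \<Longrightarrow> \<rho>0 x = 0"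
    using smooth_plateau[OF fin_coords e, where p="\<phi> p"] by metis
  define \<rho> where "\<rho> q = (if q \<in> ?W then \<rho>0 (\<phi> q) else 0)" for q
  define K where "K = PiE ?I (\<lambda>i. {\<phi> p i - e..\<phi> p i + e})"
  have KW: "K \<subseteq> \<phi> ` ?W"
  proof
    fix z assume z: "z \<in> K"
    have "z i \<in> {\<phi> p i - e..\<phi> p i + e}" if "i \<in> ?I" for i using z that by (auto simp: K_def)
    then have "\<bar>z i - \<phi> p i\<bar> \<le> e" if "i \<in> ?I" for i using that by (force simp: abs_le_iff)
    then show "z \<in> \<phi> ` ?W" by (intro box) (use z in \<open>auto simp: K_def PiE_def\<close>)
  qed
  have "compactin (powertop_real ?I) K"
    unfolding K_def by (simp add: compactin_PiE)
  then have K: "compactin (subtopology (powertop_real ?I) (\<phi> ` U)) K"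
    using KW by (auto simp: compactin_subtopology)
  obtain \<psi> where "homeomorphic_maps (subtopology (mtop M) U) (subtopology (powertop_real ?I) (\<phi> ` U)) \<phi> \<psi>"
    using chart_homeo[OF U] homeomorphic_map_maps by blast
  then have \<psi>: "continuous_map (subtopology (powertop_real ?I) (\<phi> ` U)) (subtopology (mtop M) U) \<psi>"
    "\<And>q. q \<in> U \<Longrightarrow> \<psi> (\<phi> q) = q"
    using chart_points[OF U] by (auto simp: homeomorphic_maps_def)
  have "compactin (subtopology (mtop M) U) (\<psi> ` K)" by (rule image_compactin[OF K \<psi>(1)])
  then have "compactin (mtop M) (\<psi> ` K)" by (simp add: compactin_subtopology)
  \<comment> \<open>Here the Hausdorff property enters: the support lies in the compact image of a
    closed cube, which is closed in M, so the extension by 0 is smooth on its open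
    complement.\<close>
  then have clo: "closedin (mtop M) (\<psi> ` K)" by (rule compactin_imp_closedin[OF haus])
  have off: "\<rho> q = 0" if "q \<notin> \<psi> ` K" for q
  proof (cases "q \<in> ?W")
    case True
    then have "\<phi> q \<notin> K" using that \<psi>(2) by (metis IntD1 image_eqI)
    then obtain i where "i \<in> ?I" "\<phi> q i \<notin> {\<phi> p i - e..\<phi> p i + e}"
      using chart_ext[OF U] True by (auto simp: K_def PiE_def Pi_def)
    then have "i \<in> ?I" "\<bar>\<phi> q i - \<phi> p i\<bar> \<ge> e" by auto
    then have "\<rho>0 (\<phi> q) = 0" by (rule \<rho>0(3))
    then show ?thesis by (simp add: \<rho>_def)
  qed (auto simp: \<rho>_def)
  define N where "N = {q \<in> U. \<phi> q \<in> {z \<in> extensional ?I. \<forall>i\<in>?I. \<bar>z i - \<phi> p i\<bar> < e / 2}}"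
  have N: "openin (mtop M) N"
    unfolding N_def by (rule chart_preimage_open[OF U openin_powertop_box[OF fin_coords]])
  have NW: "N \<subseteq> ?W"
  proof
    fix q assume q: "q \<in> N"
    have "\<phi> q \<in> \<phi> ` ?W"
    proof (rule box)
      show "\<phi> q \<in> extensional ?I" using q by (auto simp: N_def)
      fix i assume "i \<in> ?I"
      then have "\<bar>\<phi> q i - \<phi> p i\<bar> < e / 2" using q by (auto simp: N_def)
      then show "\<bar>\<phi> q i - \<phi> p i\<bar> \<le> e" using e by linarith
    qed
    then show "q \<in> ?W" using chart_inj[OF U] q by (auto simp: N_def inj_on_def)
  qed
  have main: "(\<lambda>q. \<rho> q * u (\<phi> q)) \<in> smooth_funs M" if u: "smooth_on ?I (\<phi> ` ?W) u" for u
  proof (rule smooth_funs_chartI)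
    fix r assume r: "r \<in> points M"
    show "\<exists>U \<phi>' N. (U, \<phi>') \<in> atlas M \<and> openin (mtop M) N \<and> r \<in> N \<and> N \<subseteq> U \<and>
      smooth_on ?I (\<phi>' ` N) (\<lambda>x. \<rho> (inv_into U \<phi>' x) * u (\<phi> (inv_into U \<phi>' x)))"
    proof (cases "r \<in> ?W")
      case True
      have "smooth_on ?I (\<phi> ` ?W) (\<lambda>x. \<rho>0 x * u x)"
        by (intro smooth_on_mult[OF \<phi>W] \<rho>0(1)[OF \<phi>W] u)
      then have "smooth_on ?I (\<phi> ` ?W) (\<lambda>x. \<rho> (inv_into U \<phi> x) * u (\<phi> (inv_into U \<phi> x)))"
        by (rule smooth_on_cong[OF \<phi>W, rotated]) (use U in \<open>auto simp: \<rho>_def\<close>)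
      then show ?thesis using U W True by blast
    next
      case False
      obtain V \<psi>' where V: "(V, \<psi>') \<in> atlas M" "r \<in> V" using chart_at[OF r] by blast
      let ?N = "V \<inter> (points M - \<psi> ` K)"
      have "\<psi> ` K \<subseteq> ?W" using KW \<psi>(2) by force
      then have rN: "r \<in> ?N" using False r V by blast
      have oN: "openin (mtop M) ?N" using clo chart_open[OF V(1)] by (auto simp: openin_diff)
      have o: "openin (powertop_real ?I) (\<psi>' ` ?N)" by (rule chart_image_openin[OF V(1) oN]) auto
      have "smooth_on ?I (\<psi>' ` ?N) (\<lambda>x. \<rho> (inv_into V \<psi>' x) * u (\<phi> (inv_into V \<psi>' x)))"
        by (rule smooth_on_cong[OF o _ smooth_on_const[OF o, of 0]]) (use V off in auto)
      then show ?thesis using V rN oN by blast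
    qed
  qed
  have "(\<lambda>q. \<rho> q * 1) \<in> smooth_funs M" by (rule main[OF smooth_on_const[OF \<phi>W]])
  then have "\<rho> \<in> smooth_funs M" by simp
  moreover have "p \<in> N" using p e chart_ext[OF U] by (auto simp: N_def)
  moreover have "\<rho> q = 1" if "q \<in> N" for q
    using that NW \<rho>0(2)[of "\<phi> q"] by (force simp: \<rho>_def N_def less_imp_le)
  moreover have "\<rho> q = 0" if "q \<notin> ?W" for q using that by (simp only: \<rho>_def if_False)
  ultimately show ?thesis using that[of N \<rho>] N NW main by blast
qed

lemma bump:
  assumes "openin (mtop M) O'" "p \<in> O'"
  obtains \<rho> N where "openin (mtop M) N" "p \<in> N" "N \<subseteq> O'" "\<And>q. q \<in> N \<Longrightarrow> \<rho> q = 1"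
    "\<And>q. q \<notin> O' \<Longrightarrow> \<rho> q = 0" "\<rho> \<in> smooth_funs M"
proof -
  have "p \<in> points M" using assms openin_subset by blast
  then obtain U \<phi> where U: "(U, \<phi>) \<in> atlas M" "p \<in> U" using chart_at by blast
  obtain \<rho> N where "openin (mtop M) N" "p \<in> N" "N \<subseteq> U \<inter> O'" "\<And>q. q \<in> N \<Longrightarrow> \<rho> q = 1"
    "\<And>q. q \<notin> U \<inter> O' \<Longrightarrow> \<rho> q = 0"
    "\<And>u. smooth_on (coords M) (\<phi> ` (U \<inter> O')) u \<Longrightarrow> (\<lambda>q. \<rho> q * u (\<phi> q)) \<in> smooth_funs M"
    "\<rho> \<in> smooth_funs M"
    by (rule chart_bump[OF U assms]) (rule that)
  then show ?thesis by (intro that[of N \<rho>]) auto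
qed

text \<open>The function 1/f is cut off by a bump function supported where f does not vanish. The
  result is globally smooth and inverts f near p, which is what normalises a new pair in the Gauss
  elimination.\<close>

lemma smooth_funs_local_inverse:
  assumes f: "f \<in> smooth_funs M" and p: "p \<in> points M" "f p \<noteq> 0"
  obtains h N where "h \<in> smooth_funs M" "openin (mtop M) N" "p \<in> N" "\<And>q. q \<in> N \<Longrightarrow> f q * h q = 1"
proof -
  let ?O = "{q \<in> points M. f q \<noteq> 0}"
  have O: "openin (mtop M) ?O" using smooth_funs_neq_open[OF f smooth_funs_const[of 0]] by simp
  obtain U \<phi> where U: "(U, \<phi>) \<in> atlas M" "p \<in> U" using chart_at[OF p(1)] by blast
  obtain \<rho> N where \<rho>: "openin (mtop M) N" "p \<in> N" "N \<subseteq> U \<inter> ?O" "\<And>q. q \<in> N \<Longrightarrow> \<rho> q = 1"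
    "\<And>q. q \<notin> U \<inter> ?O \<Longrightarrow> \<rho> q = 0"
    "\<And>u. smooth_on (coords M) (\<phi> ` (U \<inter> ?O)) u \<Longrightarrow> (\<lambda>q. \<rho> q * u (\<phi> q)) \<in> smooth_funs M"
    "\<rho> \<in> smooth_funs M"
    by (rule chart_bump[OF U O]) (use p in simp, rule that)
  have o: "openin (powertop_real (coords M)) (\<phi> ` (U \<inter> ?O))"
    by (rule chart_image_openin[OF U(1)]) (use O chart_open[OF U(1)] in auto)
  have "smooth_on (coords M) (\<phi> ` (U \<inter> ?O)) (\<lambda>x. f (inv_into U \<phi> x))"
    by (rule smooth_on_subset[OF o _ chart_image_open[OF U(1)] smooth_funs_chart[OF f U(1)]]) auto
  then have "smooth_on (coords M) (\<phi> ` (U \<inter> ?O)) (\<lambda>x. inverse (f (inv_into U \<phi> x)))"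
    by (rule smooth_on_inverse[OF o]) (use U in auto)
  from \<rho>(6)[OF this] have "(\<lambda>q. \<rho> q * inverse (f (inv_into U \<phi> (\<phi> q)))) \<in> smooth_funs M" .
  then show ?thesis
    by (rule that[OF _ \<rho>(1,2)]) (use \<rho>(3,4) U in \<open>auto dest!: subsetD\<close>)
qed

end

section \<open>Tangent vectors and vector fields\<close>

context manifold
begin

lemma tangent_undef: "v \<in> tangent_space M p \<Longrightarrow> f \<notin> smooth_funs M \<Longrightarrow> v f = 0"
  and tangent_add: "v \<in> tangent_space M p \<Longrightarrow> f \<in> smooth_funs M \<Longrightarrow> h \<in> smooth_funs M \<Longrightarrow>
    v (\<lambda>q. f q + h q) = v f + v h"
  and tangent_cmult: "v \<in> tangent_space M p \<Longrightarrow> f \<in> smooth_funs M \<Longrightarrow> v (\<lambda>q. c * f q) = c * v f"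
  and tangent_mult: "v \<in> tangent_space M p \<Longrightarrow> f \<in> smooth_funs M \<Longrightarrow> h \<in> smooth_funs M \<Longrightarrow>
    v (\<lambda>q. f q * h q) = f p * v h + h p * v f"
  by (auto simp: tangent_space_def)

lemma tangent_const [simp]: "v \<in> tangent_space M p \<Longrightarrow> v (\<lambda>q. c) = 0"
proof -
  assume v: "v \<in> tangent_space M p"
  have "v (\<lambda>q. 1 * 1) = 1 * v (\<lambda>q. 1) + 1 * v (\<lambda>q. 1)" by (rule tangent_mult[OF v]) auto
  then have 1: "v (\<lambda>q. 1) = 0" by simp
  have "v (\<lambda>q. c * 1) = c * v (\<lambda>q. 1)" by (rule tangent_cmult[OF v]) auto
  then show ?thesis by (simp add: 1)
qed

lemma tangent_diff:
  assumes "v \<in> tangent_space M p" "f \<in> smooth_funs M" "h \<in> smooth_funs M"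
  shows "v (\<lambda>q. f q - h q) = v f - v h"
proof -
  have "v (\<lambda>q. f q + (-1) * h q) = v f + v (\<lambda>q. (-1) * h q)"
    by (rule tangent_add[OF assms(1,2)]) (use assms in auto)
  then show ?thesis using tangent_cmult[OF assms(1,3), of "-1"] by simp
qed

lemma tangent_sum:
  assumes "v \<in> tangent_space M p" "\<And>i. i \<in> A \<Longrightarrow> f i \<in> smooth_funs M"
  shows "v (\<lambda>q. \<Sum>i\<in>A. f i q) = (\<Sum>i\<in>A. v (f i))"
proof (cases "finite A")
  case True
  then show ?thesis using assms(2)
  proof (induction A)
    case (insert a A)
    have "v (\<lambda>q. f a q + (\<Sum>i\<in>A. f i q)) = v (f a) + v (\<lambda>q. \<Sum>i\<in>A. f i q)"
      by (rule tangent_add[OF assms(1)]) (use insert in auto)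
    then show ?case using insert by simp
  qed (use tangent_const[OF assms(1)] in simp)
qed (use tangent_const[OF assms(1)] in simp)

text \<open>For a bump function \<rho> supported in N the product of \<rho> and f - h is 0
  everywhere; the Leibniz rule at p, where \<rho> = 1 and f = h, leaves v(f - h) = 0.\<close>

lemma tangent_local:
  assumes v: "v \<in> tangent_space M p" and f: "f \<in> smooth_funs M" and h: "h \<in> smooth_funs M"
    and N: "openin (mtop M) N" "p \<in> N" "\<And>q. q \<in> N \<Longrightarrow> f q = h q"
  shows "v f = v h"
proof -
  obtain \<rho> N' where \<rho>: "openin (mtop M) N'" "p \<in> N'" "N' \<subseteq> N" "\<And>q. q \<in> N' \<Longrightarrow> \<rho> q = 1"
    "\<And>q. q \<notin> N \<Longrightarrow> \<rho> q = 0" "\<rho> \<in> smooth_funs M"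
    using bump[OF N(1,2)] by metis
  have d: "(\<lambda>q. f q - h q) \<in> smooth_funs M" using f h by auto
  have "v (\<lambda>q. \<rho> q * (f q - h q)) = \<rho> p * v (\<lambda>q. f q - h q) + (f p - h p) * v \<rho>"
    by (rule tangent_mult[OF v \<rho>(6) d])
  moreover have "(\<lambda>q. \<rho> q * (f q - h q)) = (\<lambda>q. 0)" using \<rho>(5) N(3) by fastforce
  ultimately have "v (\<lambda>q. f q - h q) = 0"
    using tangent_const[OF v, of 0] \<rho>(2,4) N(2,3) by simp
  then show ?thesis using tangent_diff[OF v f h] by simp
qed

text \<open>Identities between functions hold on \<open>points M\<close> only, as values elsewhere
  are unconstrained. If one of the two functions is not smooth, neither is the other, and both
  values are the default 0.\<close>

lemma tangent_cong:
  assumes "v \<in> tangent_space M p" "p \<in> points M" "\<And>q. q \<in> points M \<Longrightarrow> f q = h q"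
  shows "v f = v h"
proof (cases "f \<in> smooth_funs M")
  case True
  have "h \<in> smooth_funs M" by (rule smooth_funs_cong[OF True]) (use assms in auto)
  then show ?thesis by (rule tangent_local[OF assms(1) True _ openin_topspace assms(2,3)])
next
  case False
  moreover have "h \<notin> smooth_funs M" using False smooth_funs_cong[of h f] assms(3) by metis
  ultimately show ?thesis using tangent_undef[OF assms(1)] by simp
qed

lemma tangent_lincomb:
  assumes "\<And>i. i \<in> A \<Longrightarrow> v i \<in> tangent_space M p"
  shows "(\<lambda>f. \<Sum>i\<in>A. c i * v i f) \<in> tangent_space M p"
  unfolding tangent_space_def mem_Collect_eq
proof (intro conjI allI ballI impI)
  show "(\<Sum>i\<in>A. c i * v i f) = 0" if "f \<notin> smooth_funs M" for f
    using that by (simp add: tangent_undef[OF assms])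
  show "(\<Sum>i\<in>A. c i * v i (\<lambda>q. f q + h q)) = (\<Sum>i\<in>A. c i * v i f) + (\<Sum>i\<in>A. c i * v i h)"
    if "f \<in> smooth_funs M" "h \<in> smooth_funs M" for f h
    using that by (simp add: tangent_add[OF assms] sum.distrib[symmetric] algebra_simps)
  show "(\<Sum>i\<in>A. c i * v i (\<lambda>q. d * f q)) = d * (\<Sum>i\<in>A. c i * v i f)" if "f \<in> smooth_funs M" for d f
    using that by (simp add: tangent_cmult[OF assms] sum_distrib_left algebra_simps)
  show "(\<Sum>i\<in>A. c i * v i (\<lambda>q. f q * h q)) = f p * (\<Sum>i\<in>A. c i * v i h) + h p * (\<Sum>i\<in>A. c i * v i f)"
    if "f \<in> smooth_funs M" "h \<in> smooth_funs M" for f h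
    using that by (simp add: tangent_mult[OF assms] sum.distrib[symmetric] sum_distrib_left algebra_simps)
qed

lemma tangent_zero: "(\<lambda>f. 0) \<in> tangent_space M p"
  using tangent_lincomb[of "{}"] by simp

lemma tangent_plus:
  assumes "u \<in> tangent_space M p" "v \<in> tangent_space M p"
  shows "(\<lambda>f. u f + v f) \<in> tangent_space M p"
  using tangent_lincomb[of "{True, False}" "\<lambda>b. if b then u else v" p "\<lambda>_. 1"] assms by simp

lemma tangent_scale:
  assumes "u \<in> tangent_space M p"
  shows "(\<lambda>f. c * u f) \<in> tangent_space M p"
  using tangent_lincomb[of "{()}" "\<lambda>_. u" p "\<lambda>_. c"] assms by simp

lemma vector_fieldsD: "X \<in> vector_fields M \<Longrightarrow> p \<in> points M \<Longrightarrow> X p \<in> tangent_space M p"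
  and vector_fields_smooth: "X \<in> vector_fields M \<Longrightarrow> f \<in> smooth_funs M \<Longrightarrow> dir_deriv X f \<in> smooth_funs M"
  by (auto simp: vector_fields_def)

lemma vf_lincomb:
  assumes "\<And>i. i \<in> A \<Longrightarrow> a i \<in> smooth_funs M" "\<And>i. i \<in> A \<Longrightarrow> X i \<in> vector_fields M"
  shows "(\<lambda>p f. \<Sum>i\<in>A. a i p * X i p f) \<in> vector_fields M"
proof -
  have "(\<lambda>p. \<Sum>i\<in>A. a i p * dir_deriv (X i) f p) \<in> smooth_funs M" if "f \<in> smooth_funs M" for f
    using assms that by (auto intro!: smooth_funs_sum smooth_funs_mult vector_fields_smooth)
  then show ?thesis
    using assms unfolding vector_fields_def by (auto intro!: tangent_lincomb simp: dir_deriv_def)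
qed

lemma vf_zero: "(\<lambda>p f. 0) \<in> vector_fields M"
  using vf_lincomb[of "{}"] by simp

lemma lie_bracket_vf:
  assumes X: "X \<in> vector_fields M" and Y: "Y \<in> vector_fields M"
  shows "lie_bracket X Y \<in> vector_fields M"
proof -
  have "lie_bracket X Y p \<in> tangent_space M p" if p: "p \<in> points M" for p
  proof -
    note XD = vector_fieldsD[OF X] and YD = vector_fieldsD[OF Y]
    note Xp = XD[OF p] and Yp = YD[OF p]
    have s: "dir_deriv X f \<in> smooth_funs M" "dir_deriv Y f \<in> smooth_funs M" if "f \<in> smooth_funs M" for f
      using X Y that vector_fields_smooth by auto
    have u: "lie_bracket X Y p f = 0" if "f \<notin> smooth_funs M" for f
    proof -
      have "X p (dir_deriv Y f) = X p (\<lambda>q. 0)" "Y p (dir_deriv X f) = Y p (\<lambda>q. 0)"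
        by (auto intro!: tangent_cong[OF Xp p] tangent_cong[OF Yp p] simp: dir_deriv_def tangent_undef[OF YD that] tangent_undef[OF XD that])
      then show ?thesis using Xp Yp by (simp add: lie_bracket_def)
    qed
    have add: "lie_bracket X Y p (\<lambda>q. f q + h q) = lie_bracket X Y p f + lie_bracket X Y p h"
      if "f \<in> smooth_funs M" "h \<in> smooth_funs M" for f h
    proof -
      have "X p (dir_deriv Y (\<lambda>q. f q + h q)) = X p (\<lambda>q. dir_deriv Y f q + dir_deriv Y h q)"
        "Y p (dir_deriv X (\<lambda>q. f q + h q)) = Y p (\<lambda>q. dir_deriv X f q + dir_deriv X h q)"
        by (auto intro!: tangent_cong[OF Xp p] tangent_cong[OF Yp p] simp: dir_deriv_def tangent_add[OF YD that] tangent_add[OF XD that])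
      then show ?thesis using that s by (simp add: lie_bracket_def tangent_add[OF Xp] tangent_add[OF Yp])
    qed
    have cm: "lie_bracket X Y p (\<lambda>q. c * f q) = c * lie_bracket X Y p f" if "f \<in> smooth_funs M" for c f
    proof -
      have "X p (dir_deriv Y (\<lambda>q. c * f q)) = X p (\<lambda>q. c * dir_deriv Y f q)"
        "Y p (dir_deriv X (\<lambda>q. c * f q)) = Y p (\<lambda>q. c * dir_deriv X f q)"
        by (auto intro!: tangent_cong[OF Xp p] tangent_cong[OF Yp p] simp: dir_deriv_def tangent_cmult[OF YD that] tangent_cmult[OF XD that])
      then show ?thesis using that s
        by (simp add: lie_bracket_def tangent_cmult[OF Xp] tangent_cmult[OF Yp] algebra_simps)
    qed
    \<comment> \<open>The mixed terms X(f) Y(h) + X(h) Y(f) occur in both iterated derivatives and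
      cancel.\<close>
    have mu: "lie_bracket X Y p (\<lambda>q. f q * h q) = f p * lie_bracket X Y p h + h p * lie_bracket X Y p f"
      if "f \<in> smooth_funs M" "h \<in> smooth_funs M" for f h
    proof -
      have *: "X p (dir_deriv Y (\<lambda>q. f q * h q)) = X p (\<lambda>q. f q * dir_deriv Y h q + h q * dir_deriv Y f q)"
        "Y p (dir_deriv X (\<lambda>q. f q * h q)) = Y p (\<lambda>q. f q * dir_deriv X h q + h q * dir_deriv X f q)"
        by (auto intro!: tangent_cong[OF Xp p] tangent_cong[OF Yp p] simp: dir_deriv_def tangent_mult[OF YD that] tangent_mult[OF XD that])
      have s': "(\<lambda>q. f q * dir_deriv Y h q) \<in> smooth_funs M" "(\<lambda>q. h q * dir_deriv Y f q) \<in> smooth_funs M"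
        "(\<lambda>q. f q * dir_deriv X h q) \<in> smooth_funs M" "(\<lambda>q. h q * dir_deriv X f q) \<in> smooth_funs M"
        using that s by auto
      show ?thesis using that s s' unfolding lie_bracket_def *
        by (simp add: tangent_add[OF Xp] tangent_add[OF Yp] tangent_mult[OF Xp] tangent_mult[OF Yp])
           (simp add: dir_deriv_def algebra_simps)
    qed
    show ?thesis unfolding tangent_space_def using u add cm mu by auto
  qed
  moreover have "dir_deriv (lie_bracket X Y) f \<in> smooth_funs M" if "f \<in> smooth_funs M" for f
  proof -
    have "(\<lambda>p. dir_deriv X (dir_deriv Y f) p - dir_deriv Y (dir_deriv X f) p) \<in> smooth_funs M"
      using X Y that by (auto intro!: vector_fields_smooth)
    then show ?thesis by (simp add: dir_deriv_def lie_bracket_def)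
  qed
  ultimately show ?thesis by (auto simp: vector_fields_def)
qed

text \<open>A tangent vector can be applied to members of \<open>smooth_funs\<close> only, so the
  chart coordinates are cut off. Near p the partial derivatives are still those of the coordinates,
  and applying a vector to \<xi> reads off its components.\<close>

lemma coord_fun:
  assumes U: "(U, \<phi>) \<in> atlas M" and p: "p \<in> U"
  obtains \<xi> N where "\<And>i. i \<in> coords M \<Longrightarrow> \<xi> i \<in> smooth_funs M" "openin (mtop M) N" "p \<in> N" "N \<subseteq> U"
    "\<And>i q. q \<in> N \<Longrightarrow> \<xi> i q = \<phi> q i"
    "\<And>i k q. i \<in> coords M \<Longrightarrow> k \<in> coords M \<Longrightarrow> q \<in> N \<Longrightarrow>
      partial_deriv i (\<lambda>x. \<xi> k (inv_into U \<phi> x)) (\<phi> q) = (if i = k then 1 else 0)"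
proof -
  obtain \<rho> N where \<rho>: "openin (mtop M) N" "p \<in> N" "N \<subseteq> U \<inter> points M" "\<And>q. q \<in> N \<Longrightarrow> \<rho> q = 1"
    "\<And>q. q \<notin> U \<inter> points M \<Longrightarrow> \<rho> q = 0"
    "\<And>u. smooth_on (coords M) (\<phi> ` (U \<inter> points M)) u \<Longrightarrow> (\<lambda>q. \<rho> q * u (\<phi> q)) \<in> smooth_funs M"
    "\<rho> \<in> smooth_funs M"
    by (rule chart_bump[OF U p openin_topspace]) (use chart_points[OF U] p in blast, rule that)
  have UM: "U \<inter> points M = U" using chart_points[OF U] by blast
  have N: "openin (powertop_real (coords M)) (\<phi> ` N)" by (rule chart_image_openin[OF U]) (use \<rho> in auto)
  show ?thesis
  proof (rule that[of "\<lambda>i q. \<rho> q * \<phi> q i" N])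
    show "(\<lambda>q. \<rho> q * \<phi> q i) \<in> smooth_funs M" if "i \<in> coords M" for i
      using \<rho>(6)[OF smooth_on_coord[OF _ that]] chart_image_open[OF U] by (simp add: UM)
    fix i k q assume ik: "i \<in> coords M" "k \<in> coords M" and q: "q \<in> N"
    have "partial_deriv i (\<lambda>x. \<rho> (inv_into U \<phi> x) * \<phi> (inv_into U \<phi> x) k) (\<phi> q) = partial_deriv i (\<lambda>x. x k) (\<phi> q)"
      by (rule partial_deriv_cong[OF N ik(1)]) (use q \<rho>(3,4) U in \<open>auto dest: subsetD\<close>)
    also have "\<dots> = (if i = k then 1 else 0)"
      by (rule partial_deriv_DERIV) auto
    finally show "partial_deriv i (\<lambda>x. \<rho> (inv_into U \<phi> x) * \<phi> (inv_into U \<phi> x) k) (\<phi> q) = (if i = k then 1 else 0)" .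
  qed (use \<rho> in auto)
qed

text \<open>Hadamard's lemma writes f near p as a constant plus products of x_i - p_i with smooth
  functions. A derivation kills the constant, and as x_i - p_i vanishes at p, the Leibniz rule
  leaves the partial derivatives of f weighted by v(x_i - p_i).\<close>

lemma tangent_coord:
  assumes U: "(U, \<phi>) \<in> atlas M" and p: "p \<in> U" and v: "v \<in> tangent_space M p"
  shows "\<exists>c. \<forall>f\<in>smooth_funs M. v f = (\<Sum>i\<in>coords M. c i * partial_deriv i (\<lambda>x. f (inv_into U \<phi> x)) (\<phi> p))"
proof -
  let ?I = "coords M"
  have "\<phi> p \<in> \<phi> ` U" using p by blast
  from powertop_box[OF fin_coords chart_image_open[OF U] this]
  obtain e where e: "e > 0"
    and bx: "\<And>z. z \<in> extensional ?I \<Longrightarrow> (\<And>i. i \<in> ?I \<Longrightarrow> \<bar>z i - \<phi> p i\<bar> \<le> e) \<Longrightarrow> z \<in> \<phi> ` U"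
    by blast
  interpret cb: coord_box ?I "\<phi> p" e
    by unfold_locales (use fin_coords e chart_ext[OF U p] in auto)
  have boxU: "cb.box \<subseteq> \<phi> ` U" using bx by (auto simp: cb.box_def less_imp_le)
  let ?O = "{q \<in> U. \<phi> q \<in> cb.box}"
  have O: "openin (mtop M) ?O" by (rule chart_preimage_open[OF U cb.box_open])
  have UO: "U \<inter> ?O = ?O" "\<phi> ` ?O = cb.box" using boxU by auto
  obtain \<rho> N where \<rho>: "openin (mtop M) N" "p \<in> N" "N \<subseteq> U \<inter> ?O" "\<And>q. q \<in> N \<Longrightarrow> \<rho> q = 1"
    "\<And>q. q \<notin> U \<inter> ?O \<Longrightarrow> \<rho> q = 0"
    "\<And>u. smooth_on (coords M) (\<phi> ` (U \<inter> ?O)) u \<Longrightarrow> (\<lambda>q. \<rho> q * u (\<phi> q)) \<in> smooth_funs M"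
    "\<rho> \<in> smooth_funs M"
    by (rule chart_bump[OF U p O]) (use p cb.p_box in simp, rule that)
  define c where "c i = v (\<lambda>q. \<rho> q * (\<phi> q i - \<phi> p i))" for i
  have cs: "(\<lambda>q. \<rho> q * (\<phi> q i - \<phi> p i)) \<in> smooth_funs M" if "i \<in> ?I" for i
    by (rule \<rho>(6)) (auto simp: UO intro!: smooth_on_diff smooth_on_coord smooth_on_const cb.box_open that)
  have "v f = (\<Sum>i\<in>?I. c i * partial_deriv i (\<lambda>x. f (inv_into U \<phi> x)) (\<phi> p))" if f: "f \<in> smooth_funs M" for f
  proof -
    have "smooth_on ?I cb.box (\<lambda>x. f (inv_into U \<phi> x))"
      by (rule smooth_on_subset[OF cb.box_open boxU chart_image_open[OF U] smooth_funs_chart[OF f U]])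
    from cb.hadamard[OF this] obtain h where h: "\<And>i. i \<in> ?I \<Longrightarrow> smooth_on ?I cb.box (h i)"
      "\<And>i. i \<in> ?I \<Longrightarrow> h i (\<phi> p) = partial_deriv i (\<lambda>x. f (inv_into U \<phi> x)) (\<phi> p)"
      "\<And>x. x \<in> cb.box \<Longrightarrow> f (inv_into U \<phi> x) = f (inv_into U \<phi> (\<phi> p)) + (\<Sum>i\<in>?I. (x i - \<phi> p i) * h i x)"
      by blast
    have hs: "(\<lambda>q. \<rho> q * h i (\<phi> q)) \<in> smooth_funs M" if "i \<in> ?I" for i
      by (rule \<rho>(6)) (simp add: UO h(1)[OF that])
    \<comment> \<open>There is one factor \<rho> for each of the two functions, so that both are
      globally smooth and the Leibniz rule applies to their product.\<close>
    define F where "F q = f p + (\<Sum>i\<in>?I. (\<rho> q * (\<phi> q i - \<phi> p i)) * (\<rho> q * h i (\<phi> q)))" for q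
    have sm: "(\<lambda>q. (\<rho> q * (\<phi> q i - \<phi> p i)) * (\<rho> q * h i (\<phi> q))) \<in> smooth_funs M" if "i \<in> ?I" for i
      by (rule smooth_funs_mult[OF cs[OF that] hs[OF that]])
    have F: "F \<in> smooth_funs M" unfolding F_def by (intro smooth_funs_add smooth_funs_const smooth_funs_sum sm)
    have "v f = v F"
    proof (rule tangent_local[OF v f F \<rho>(1,2)])
      fix q assume q: "q \<in> N"
      then have "q \<in> U" "\<phi> q \<in> cb.box" using \<rho>(3) by auto
      then show "f q = F q" using h(3)[of "\<phi> q"] U p \<rho>(4)[OF q] by (simp add: F_def)
    qed
    also have "v F = v (\<lambda>q. f p) + v (\<lambda>q. \<Sum>i\<in>?I. (\<rho> q * (\<phi> q i - \<phi> p i)) * (\<rho> q * h i (\<phi> q)))"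
      unfolding F_def by (rule tangent_add[OF v]) (auto intro!: smooth_funs_sum sm)
    also have "\<dots> = (\<Sum>i\<in>?I. v (\<lambda>q. (\<rho> q * (\<phi> q i - \<phi> p i)) * (\<rho> q * h i (\<phi> q))))"
      using tangent_sum[OF v, of ?I "\<lambda>i q. (\<rho> q * (\<phi> q i - \<phi> p i)) * (\<rho> q * h i (\<phi> q))"] sm v by simp
    also have "\<dots> = (\<Sum>i\<in>?I. c i * partial_deriv i (\<lambda>x. f (inv_into U \<phi> x)) (\<phi> p))"
    proof (rule sum.cong[OF refl])
      fix i assume i: "i \<in> ?I"
      show "v (\<lambda>q. (\<rho> q * (\<phi> q i - \<phi> p i)) * (\<rho> q * h i (\<phi> q))) =
          c i * partial_deriv i (\<lambda>x. f (inv_into U \<phi> x)) (\<phi> p)"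
        using tangent_mult[OF v cs[OF i] hs[OF i]] \<rho>(2,4) h(2)[OF i] by (simp add: c_def)
    qed
    finally show ?thesis .
  qed
  then show ?thesis by blast
qed

text \<open>The coefficients are unique and near a point are obtained by applying X to the cut-off
  coordinates; hence they are smooth.\<close>

lemma vf_chart:
  assumes X: "X \<in> vector_fields M" and U: "(U, \<phi>) \<in> atlas M"
  obtains a where "\<And>i. i \<in> coords M \<Longrightarrow> smooth_on (coords M) (\<phi> ` U) (a i)"
    "\<And>q f. q \<in> U \<Longrightarrow> f \<in> smooth_funs M \<Longrightarrow>
      X q f = (\<Sum>i\<in>coords M. a i (\<phi> q) * partial_deriv i (\<lambda>x. f (inv_into U \<phi> x)) (\<phi> q))"
proof -
  let ?I = "coords M"
  have "\<forall>q\<in>U. \<exists>c. \<forall>f\<in>smooth_funs M. X q f = (\<Sum>i\<in>?I. c i * partial_deriv i (\<lambda>x. f (inv_into U \<phi> x)) (\<phi> q))"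
    using tangent_coord[OF U] vector_fieldsD[OF X] chart_points[OF U] by blast
  then obtain c where c: "\<And>q f. q \<in> U \<Longrightarrow> f \<in> smooth_funs M \<Longrightarrow>
      X q f = (\<Sum>i\<in>?I. c q i * partial_deriv i (\<lambda>x. f (inv_into U \<phi> x)) (\<phi> q))"
    by metis
  define a where "a i x = c (inv_into U \<phi> x) i" for i x
  have "smooth_on ?I (\<phi> ` U) (a i)" if i: "i \<in> ?I" for i
  proof (rule smooth_on_local[OF chart_image_open[OF U]])
    fix x assume "x \<in> \<phi> ` U"
    then obtain p where p: "p \<in> U" "x = \<phi> p" by blast
    obtain \<xi> N where \<xi>: "\<And>i. i \<in> coords M \<Longrightarrow> \<xi> i \<in> smooth_funs M" "openin (mtop M) N" "p \<in> N" "N \<subseteq> U"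
      "\<And>i q. q \<in> N \<Longrightarrow> \<xi> i q = \<phi> q i"
      "\<And>i k q. i \<in> coords M \<Longrightarrow> k \<in> coords M \<Longrightarrow> q \<in> N \<Longrightarrow>
        partial_deriv i (\<lambda>x. \<xi> k (inv_into U \<phi> x)) (\<phi> q) = (if i = k then 1 else 0)"
      using coord_fun[OF U p(1)] by metis
    have T: "openin (powertop_real ?I) (\<phi> ` N)" by (rule chart_image_openin[OF U \<xi>(2,4)])
    have "smooth_on ?I (\<phi> ` N) (\<lambda>x. dir_deriv X (\<xi> i) (inv_into U \<phi> x))"
      by (rule smooth_on_subset[OF T _ chart_image_open[OF U] smooth_funs_chart[OF vector_fields_smooth[OF X \<xi>(1)[OF i]] U]])
         (use \<xi>(4) in auto)
    then have "smooth_on ?I (\<phi> ` N) (a i)"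
    proof (rule smooth_on_cong[OF T, rotated])
      fix z assume "z \<in> \<phi> ` N"
      then obtain q where q: "q \<in> N" "z = \<phi> q" by blast
      then have qU: "q \<in> U" using \<xi>(4) by blast
      have "X q (\<xi> i) = (\<Sum>k\<in>?I. c q k * (if k = i then 1 else 0))"
        unfolding c[OF qU \<xi>(1)[OF i]] using \<xi>(6)[OF _ i q(1)] by (intro sum.cong) auto
      also have "\<dots> = c q i" using i fin_coords by (simp add: if_distrib cong: if_cong)
      finally show "dir_deriv X (\<xi> i) (inv_into U \<phi> z) = a i z"
        using q(2) U qU by (simp add: a_def dir_deriv_def)
    qed
    then show "\<exists>T. openin (powertop_real ?I) T \<and> x \<in> T \<and> T \<subseteq> \<phi> ` U \<and> smooth_on ?I T (a i)"
      using T p \<xi>(3,4) by blast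
  qed
  then show ?thesis by (rule that) (use c U in \<open>auto simp: a_def\<close>)
qed

text \<open>The coordinate fields and coordinates of a chart, both cut off so that they are global
  objects. On N the fields form a frame, and the components of v in it are the numbers
  \<open>v (\<xi> i)\<close>.\<close>

lemma local_frame:
  assumes p: "p \<in> points M"
  obtains N \<xi> E where "openin (mtop M) N" "p \<in> N" "\<And>i. i \<in> coords M \<Longrightarrow> \<xi> i \<in> smooth_funs M"
    "\<And>i. i \<in> coords M \<Longrightarrow> E i \<in> vector_fields M"
    "\<And>q v. q \<in> N \<Longrightarrow> v \<in> tangent_space M q \<Longrightarrow> v = (\<lambda>f. \<Sum>i\<in>coords M. v (\<xi> i) * E i q f)"
    "\<And>q i k. q \<in> N \<Longrightarrow> i \<in> coords M \<Longrightarrow> k \<in> coords M \<Longrightarrow> E i q (\<xi> k) = (if i = k then 1 else 0)"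
proof -
  let ?I = "coords M"
  obtain U \<phi> where U: "(U, \<phi>) \<in> atlas M" "p \<in> U" using chart_at[OF p] by blast
  obtain \<xi> N1 where \<xi>: "\<And>i. i \<in> coords M \<Longrightarrow> \<xi> i \<in> smooth_funs M" "openin (mtop M) N1" "p \<in> N1" "N1 \<subseteq> U"
    "\<And>i q. q \<in> N1 \<Longrightarrow> \<xi> i q = \<phi> q i"
    "\<And>i k q. i \<in> coords M \<Longrightarrow> k \<in> coords M \<Longrightarrow> q \<in> N1 \<Longrightarrow>
      partial_deriv i (\<lambda>x. \<xi> k (inv_into U \<phi> x)) (\<phi> q) = (if i = k then 1 else 0)"
    using coord_fun[OF U] by metis
  have UN: "U \<inter> N1 = N1" using \<xi>(4) by auto
  obtain \<rho> N where \<rho>: "openin (mtop M) N" "p \<in> N" "N \<subseteq> U \<inter> N1" "\<And>q. q \<in> N \<Longrightarrow> \<rho> q = 1"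
    "\<And>q. q \<notin> U \<inter> N1 \<Longrightarrow> \<rho> q = 0"
    "\<And>u. smooth_on (coords M) (\<phi> ` (U \<inter> N1)) u \<Longrightarrow> (\<lambda>q. \<rho> q * u (\<phi> q)) \<in> smooth_funs M"
    "\<rho> \<in> smooth_funs M"
    by (rule chart_bump[OF U \<xi>(2,3)]) (rule that)
  define E where "E i q f = (if f \<in> smooth_funs M then \<rho> q * partial_deriv i (\<lambda>x. f (inv_into U \<phi> x)) (\<phi> q) else 0)"
    for i q f
  have \<phi>N: "openin (powertop_real ?I) (\<phi> ` N1)" by (rule chart_image_openin[OF U(1) \<xi>(2,4)])
  have E: "E i \<in> vector_fields M" if i: "i \<in> ?I" for i
  proof -
    have "dir_deriv (E i) f \<in> smooth_funs M" if f: "f \<in> smooth_funs M" for f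
    proof -
      have "smooth_on ?I (\<phi> ` (U \<inter> N1)) (partial_deriv i (\<lambda>x. f (inv_into U \<phi> x)))"
        unfolding UN
        by (rule smooth_on_subset[OF \<phi>N _ chart_image_open[OF U(1)]
             smooth_on_partial[OF smooth_funs_chart[OF f U(1)] i]]) (use \<xi>(4) in auto)
      from \<rho>(6)[OF this] show ?thesis using f by (simp add: dir_deriv_def E_def)
    qed
    moreover have "E i q \<in> tangent_space M q" for q
    proof (cases "q \<in> U")
      case True
      note d = smooth_on_DERIV[OF smooth_funs_chart[OF _ U(1)] i imageI[OF True]]
      have q: "(\<phi> q)(i := \<phi> q i) = \<phi> q" by simp
      have "partial_deriv i (\<lambda>x. f (inv_into U \<phi> x) + h (inv_into U \<phi> x)) (\<phi> q) =
          partial_deriv i (\<lambda>x. f (inv_into U \<phi> x)) (\<phi> q) + partial_deriv i (\<lambda>x. h (inv_into U \<phi> x)) (\<phi> q)"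
        if "f \<in> smooth_funs M" "h \<in> smooth_funs M" for f h
        by (rule partial_deriv_DERIV[OF DERIV_add[OF d[OF that(1)] d[OF that(2)]]])
      moreover have "partial_deriv i (\<lambda>x. c * f (inv_into U \<phi> x)) (\<phi> q) =
          c * partial_deriv i (\<lambda>x. f (inv_into U \<phi> x)) (\<phi> q)"
        if "f \<in> smooth_funs M" for c f
        by (rule partial_deriv_DERIV[OF DERIV_cmult[OF d[OF that]]])
      moreover have "partial_deriv i (\<lambda>x. f (inv_into U \<phi> x) * h (inv_into U \<phi> x)) (\<phi> q) =
          f q * partial_deriv i (\<lambda>x. h (inv_into U \<phi> x)) (\<phi> q) + h q * partial_deriv i (\<lambda>x. f (inv_into U \<phi> x)) (\<phi> q)"
        if "f \<in> smooth_funs M" "h \<in> smooth_funs M" for f h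
        using partial_deriv_DERIV[OF DERIV_mult[OF d[OF that(1)] d[OF that(2)]]] U(1) True
        by (simp add: q mult.commute del: fun_upd_apply)
      ultimately show ?thesis
        unfolding tangent_space_def by (auto simp: E_def smooth_funs_add smooth_funs_mult algebra_simps)
    next
      case False
      then have "E i q = (\<lambda>f. 0)" using \<rho>(5) by (auto simp: E_def)
      then show ?thesis using tangent_zero by simp
    qed
    ultimately show ?thesis by (simp add: vector_fields_def)
  qed
  have \<delta>: "E i q (\<xi> k) = (if i = k then 1 else 0)" if "q \<in> N" "i \<in> ?I" "k \<in> ?I" for q i k
    using \<xi>(6)[OF that(2,3)] \<rho>(3,4) that \<xi>(1) by (auto simp: E_def dest: subsetD)
  have "v = (\<lambda>f. \<Sum>i\<in>?I. v (\<xi> i) * E i q f)" if q: "q \<in> N" and v: "v \<in> tangent_space M q" for q v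
  proof
    fix f
    show "v f = (\<Sum>i\<in>?I. v (\<xi> i) * E i q f)"
    proof (cases "f \<in> smooth_funs M")
      case True
      have qU: "q \<in> U" "q \<in> N1" using q \<rho>(3) by auto
      obtain c where c: "\<And>f. f \<in> smooth_funs M \<Longrightarrow>
          v f = (\<Sum>i\<in>?I. c i * partial_deriv i (\<lambda>x. f (inv_into U \<phi> x)) (\<phi> q))"
        using tangent_coord[OF U(1) qU(1) v] by blast
      have "v (\<xi> k) = c k" if k: "k \<in> ?I" for k
      proof -
        have "v (\<xi> k) = (\<Sum>i\<in>?I. c i * (if i = k then 1 else 0))"
          unfolding c[OF \<xi>(1)[OF k]] using \<xi>(6)[OF _ k qU(2)] by (intro sum.cong) auto
        also have "\<dots> = c k" using k fin_coords by (simp add: if_distrib cong: if_cong)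
        finally show ?thesis .
      qed
      then show ?thesis using True c[OF True] \<rho>(4)[OF q] by (simp add: E_def)
    qed (use v in \<open>simp add: tangent_undef E_def\<close>)
  qed
  then show ?thesis using that[of N \<xi> E] \<rho>(1,2) \<xi>(1) E \<delta> by blast
qed

text \<open>The frame fields are combined with the constant components of w. This provides the
  witness for the choice in \<open>form_at\<close>.\<close>

lemma extend_tangent:
  assumes "p \<in> points M" "w \<in> tangent_space M p"
  shows "\<exists>Z. Z \<in> vector_fields M \<and> Z p = w"
proof -
  obtain N \<xi> E where N: "p \<in> N" and E: "\<And>i. i \<in> coords M \<Longrightarrow> E i \<in> vector_fields M"
    and f: "\<And>q v. q \<in> N \<Longrightarrow> v \<in> tangent_space M q \<Longrightarrow> v = (\<lambda>f. \<Sum>i\<in>coords M. v (\<xi> i) * E i q f)"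
    by (rule local_frame[OF assms(1)]) (rule that)
  have "(\<lambda>q f. \<Sum>i\<in>coords M. w (\<xi> i) * E i q f) \<in> vector_fields M"
    by (rule vf_lincomb[where a="\<lambda>i q. w (\<xi> i)"]) (use E in auto)
  then show ?thesis using f[OF N assms(2)] by (intro exI[of _ "\<lambda>q f. \<Sum>i\<in>coords M. w (\<xi> i) * E i q f"]) simp
qed

end

section \<open>Singular semi-Riemannian metrics\<close>

text \<open>Built on \<open>manifold\<close> and not on \<open>smooth_manifold\<close>, so that the
  product with its warped metric can be an instance.\<close>

locale semi_riem = manifold M for M :: "('a, 'k) mfd" +
  fixes g :: "'a metric"
  assumes g_sym: "\<And>p u v. p \<in> points M \<Longrightarrow> u \<in> tangent_space M p \<Longrightarrow> v \<in> tangent_space M p \<Longrightarrow> g p u v = g p v u"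
    and g_plus: "\<And>p u v w. p \<in> points M \<Longrightarrow> u \<in> tangent_space M p \<Longrightarrow> v \<in> tangent_space M p \<Longrightarrow> w \<in> tangent_space M p \<Longrightarrow>
        g p (\<lambda>f. u f + v f) w = g p u w + g p v w"
    and g_scale: "\<And>p u w c. p \<in> points M \<Longrightarrow> u \<in> tangent_space M p \<Longrightarrow> w \<in> tangent_space M p \<Longrightarrow>
        g p (\<lambda>f. c * u f) w = c * g p u w"
    and g_smooth: "\<And>X Y. X \<in> vector_fields M \<Longrightarrow> Y \<in> vector_fields M \<Longrightarrow> metric_fun g X Y \<in> smooth_funs M"

lemma singular_semi_riem: "singular_semi_riemannian M g \<Longrightarrow> semi_riem M g"
  unfolding singular_semi_riemannian_def semi_riem_def semi_riem_axioms_def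
  using smooth_manifold_manifold by blast

context manifold
begin

text \<open>C^infinity-linearity on vector fields. The equation is required on
  \<open>points M\<close> only, because the values of functions and fields elsewhere are
  unconstrained.\<close>

definition tensor_form :: "'a form \<Rightarrow> bool" where
  "tensor_form \<omega> \<longleftrightarrow> (\<forall>X\<in>vector_fields M. \<omega> X \<in> smooth_funs M) \<and>
     (\<forall>p\<in>points M. \<forall>X\<in>vector_fields M. \<forall>Y\<in>vector_fields M. \<forall>a\<in>smooth_funs M. \<forall>b\<in>smooth_funs M.
        \<omega> (\<lambda>q f. a q * X q f + b q * Y q f) p = a p * \<omega> X p + b p * \<omega> Y p)"

section \<open>1-forms depend on vector fields pointwise\<close>

lemma tangent_comb:
  assumes "u \<in> tangent_space M p" "v \<in> tangent_space M p"
  shows "(\<lambda>f. a * u f + b * v f) \<in> tangent_space M p"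
  using tangent_lincomb[of "{True, False}" "\<lambda>i. if i then u else v" p "\<lambda>i. if i then a else b"] assms by simp

lemma vf_comb:
  assumes "X \<in> vector_fields M" "Y \<in> vector_fields M" "a \<in> smooth_funs M" "b \<in> smooth_funs M"
  shows "(\<lambda>q f. a q * X q f + b q * Y q f) \<in> vector_fields M"
  using vf_lincomb[of "{True, False}" "\<lambda>i. if i then a else b" "\<lambda>i. if i then X else Y"] assms by simp

lemma tensor_form_smooth: "tensor_form \<omega> \<Longrightarrow> X \<in> vector_fields M \<Longrightarrow> \<omega> X \<in> smooth_funs M"
  and tensor_form_comb: "tensor_form \<omega> \<Longrightarrow> p \<in> points M \<Longrightarrow> X \<in> vector_fields M \<Longrightarrow> Y \<in> vector_fields M \<Longrightarrow>
    a \<in> smooth_funs M \<Longrightarrow> b \<in> smooth_funs M \<Longrightarrow>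
    \<omega> (\<lambda>q f. a q * X q f + b q * Y q f) p = a p * \<omega> X p + b p * \<omega> Y p"
  by (auto simp: tensor_form_def)

lemma tensor_form_lincomb:
  assumes \<omega>: "tensor_form \<omega>" and p: "p \<in> points M" and A: "finite A"
    and "\<And>i. i \<in> A \<Longrightarrow> a i \<in> smooth_funs M" "\<And>i. i \<in> A \<Longrightarrow> X i \<in> vector_fields M"
  shows "\<omega> (\<lambda>q f. \<Sum>i\<in>A. a i q * X i q f) p = (\<Sum>i\<in>A. a i p * \<omega> (X i) p)"
  using A assms(4,5)
proof (induction A)
  case empty
  show ?case
    using tensor_form_comb[OF \<omega> p vf_zero vf_zero, of "\<lambda>_. 0" "\<lambda>_. 0"] by simp
next
  case (insert i A)
  have "\<omega> (\<lambda>q f. a i q * X i q f + 1 * (\<Sum>i\<in>A. a i q * X i q f)) p =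
      a i p * \<omega> (X i) p + 1 * \<omega> (\<lambda>q f. \<Sum>i\<in>A. a i q * X i q f) p"
    by (rule tensor_form_comb[OF \<omega> p _ _ _ smooth_funs_const]) (use insert in \<open>auto intro!: vf_lincomb\<close>)
  then show ?case using insert by simp
qed

text \<open>A field that vanishes at p has, after multiplication by a bump function, a global
  expansion in a local frame with coefficients vanishing at p; linearity over functions gives the
  claim.\<close>

lemma tensor_form_zero:
  assumes \<omega>: "tensor_form \<omega>" and p: "p \<in> points M" and X: "X \<in> vector_fields M" and 0: "X p = (\<lambda>f. 0)"
  shows "\<omega> X p = 0"
proof -
  obtain N \<xi> E where N: "openin (mtop M) N" "p \<in> N" and \<xi>: "\<And>i. i \<in> coords M \<Longrightarrow> \<xi> i \<in> smooth_funs M"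
    and E: "\<And>i. i \<in> coords M \<Longrightarrow> E i \<in> vector_fields M"
    and f: "\<And>q v. q \<in> N \<Longrightarrow> v \<in> tangent_space M q \<Longrightarrow> v = (\<lambda>f. \<Sum>i\<in>coords M. v (\<xi> i) * E i q f)"
    by (rule local_frame[OF p]) (rule that)
  obtain \<rho> N' where \<rho>: "p \<in> N'" "\<And>q. q \<in> N' \<Longrightarrow> \<rho> q = 1" "\<And>q. q \<notin> N \<Longrightarrow> \<rho> q = 0" "\<rho> \<in> smooth_funs M"
    by (rule bump[OF N]) (rule that)
  have s: "(\<lambda>q. \<rho> q * dir_deriv X (\<xi> i) q) \<in> smooth_funs M" if "i \<in> coords M" for i
    using \<rho> vector_fields_smooth[OF X \<xi>[OF that]] by auto
  \<comment> \<open>The identity holds for all q, as \<rho> = 0 outside N; so it is an equality of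
    vector fields and may be substituted into \<omega>. The summand with factor 0 only gives the
    left side the shape required by \<open>tensor_form_comb\<close>.\<close>
  have "(\<lambda>q f. \<rho> q * X q f + 0 * X q f) = (\<lambda>q f. \<Sum>i\<in>coords M. (\<rho> q * dir_deriv X (\<xi> i) q) * E i q f)"
  proof (intro ext)
    fix q f
    show "\<rho> q * X q f + 0 * X q f = (\<Sum>i\<in>coords M. (\<rho> q * dir_deriv X (\<xi> i) q) * E i q f)"
    proof (cases "q \<in> N")
      case True
      then have "X q \<in> tangent_space M q" using vector_fieldsD[OF X] openin_subset[OF N(1)] by blast
      from f[OF True this] have "X q f = (\<Sum>i\<in>coords M. X q (\<xi> i) * E i q f)" by metis
      then show ?thesis by (simp add: dir_deriv_def sum_distrib_left mult.assoc)
    qed (simp add: \<rho>(3))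
  qed
  then have "\<omega> (\<lambda>q f. \<rho> q * X q f + 0 * X q f) p = (\<Sum>i\<in>coords M. (\<rho> p * dir_deriv X (\<xi> i) p) * \<omega> (E i) p)"
    using tensor_form_lincomb[OF \<omega> p fin_coords, of "\<lambda>i q. \<rho> q * dir_deriv X (\<xi> i) q" E] s E by simp
  moreover have "\<omega> (\<lambda>q f. \<rho> q * X q f + 0 * X q f) p = \<rho> p * \<omega> X p + 0 * \<omega> X p"
    by (rule tensor_form_comb[OF \<omega> p X X \<rho>(4) smooth_funs_const])
  ultimately show ?thesis using \<rho>(1,2) 0 by (simp add: dir_deriv_def)
qed

lemma tensor_form_pt:
  assumes \<omega>: "tensor_form \<omega>" and p: "p \<in> points M" and X: "X \<in> vector_fields M" "Y \<in> vector_fields M"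
    and eq: "X p = Y p"
  shows "\<omega> X p = \<omega> Y p"
proof -
  have "\<omega> (\<lambda>q f. 1 * X q f + (-1) * Y q f) p = 0"
    by (rule tensor_form_zero[OF \<omega> p vf_comb[OF X]]) (use eq in auto)
  moreover have "\<omega> (\<lambda>q f. 1 * X q f + (-1) * Y q f) p = 1 * \<omega> X p + (-1) * \<omega> Y p"
    by (rule tensor_form_comb[OF \<omega> p X]) auto
  ultimately show ?thesis by simp
qed

text \<open>The extension chosen in \<open>form_at\<close> is immaterial, since the value of the
  form depends only on the vector at p.\<close>

lemma form_at_vf:
  assumes "tensor_form \<omega>" "p \<in> points M" "X \<in> vector_fields M"
  shows "form_at M \<omega> p (X p) = \<omega> X p"
proof -
  let ?Z = "SOME Z. Z \<in> vector_fields M \<and> Z p = X p"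
  have "?Z \<in> vector_fields M \<and> ?Z p = X p" by (rule someI[of _ X]) (use assms in simp)
  then show ?thesis
    using tensor_form_pt[OF assms(1,2) _ assms(3), of ?Z] vector_fieldsD[OF assms(3,2)] by (simp add: form_at_def)
qed

lemma tensor_form_differential:
  assumes "f \<in> smooth_funs M"
  shows "tensor_form (differential f)"
  using assms vector_fields_smooth unfolding tensor_form_def by (auto simp: differential_def dir_deriv_def)

lemma tensor_form_add:
  assumes "tensor_form \<omega>" "tensor_form \<tau>"
  shows "tensor_form (\<lambda>Z p. \<omega> Z p + \<tau> Z p)"
  using assms unfolding tensor_form_def by (auto intro!: smooth_funs_add simp: algebra_simps)

lemma tensor_form_mult:
  assumes "tensor_form \<omega>" "h \<in> smooth_funs M"
  shows "tensor_form (\<lambda>Z p. h p * \<omega> Z p)"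
  using assms unfolding tensor_form_def by (auto intro!: smooth_funs_mult simp: algebra_simps)

end

text \<open>The vector space in which \<open>metric_rank\<close> measures the dimension of the
  bullet space.\<close>

interpretation covec: vector_space "\<lambda>(c::real) (\<alpha>::'a covec) w. c * \<alpha> w"
  by unfold_locales (auto simp: fun_eq_iff algebra_simps)

lemma sum_covec_apply: "(\<Sum>i\<in>A. f i) w = (\<Sum>i\<in>A. f i w)" for f :: "'b \<Rightarrow> 'a covec"
  by (induction A rule: infinite_finite_induct) auto

lemma covec_span_sum: "\<alpha> = (\<Sum>i\<in>A. (\<lambda>w. c i * F i w)) \<Longrightarrow> \<alpha> \<in> covec.span (F ` A)"
  by (simp only:) (intro covec.span_sum covec.span_scale covec.span_base imageI)

lemma sum_mult_delta:
  fixes h :: "'b \<Rightarrow> real"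
  assumes "finite A" "j \<in> A"
  shows "(\<Sum>i\<in>A. h i * (if i = j then 1 else 0)) = h j"
proof -
  have "(\<Sum>i\<in>A. h i * (if i = j then 1 else 0)) = (\<Sum>i\<in>A. if i = j then h i else 0)"
    by (rule sum.cong) auto
  then show ?thesis using assms by simp
qed

context semi_riem
begin

section \<open>Linear algebra of a possibly degenerate metric\<close>

lemma g_lincomb:
  assumes "p \<in> points M" "w \<in> tangent_space M p" "\<And>i. i \<in> A \<Longrightarrow> v i \<in> tangent_space M p"
  shows "g p (\<lambda>f. \<Sum>i\<in>A. c i * v i f) w = (\<Sum>i\<in>A. c i * g p (v i) w)"
proof -
  have z: "g p (\<lambda>f. 0) w = 0"
    using g_scale[OF assms(1) tangent_zero assms(2), of 0] by simp
  show ?thesis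
  proof (cases "finite A")
    case True
    then show ?thesis using assms(3)
    proof (induction A)
      case (insert a A)
      have "g p (\<lambda>f. c a * v a f + (\<Sum>i\<in>A. c i * v i f)) w = g p (\<lambda>f. c a * v a f) w + g p (\<lambda>f. \<Sum>i\<in>A. c i * v i f) w"
        by (rule g_plus) (use assms(1,2) insert in \<open>auto intro!: tangent_scale tangent_lincomb\<close>)
      then show ?case using insert assms(1,2) by (simp add: g_scale)
    qed (simp add: z)
  qed (simp add: z)
qed

lemma g_lincomb_right:
  assumes "p \<in> points M" "w \<in> tangent_space M p" "\<And>i. i \<in> A \<Longrightarrow> v i \<in> tangent_space M p"
  shows "g p w (\<lambda>f. \<Sum>i\<in>A. c i * v i f) = (\<Sum>i\<in>A. c i * g p w (v i))"
proof -
  have "g p w (\<lambda>f. \<Sum>i\<in>A. c i * v i f) = g p (\<lambda>f. \<Sum>i\<in>A. c i * v i f) w"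
    by (rule g_sym) (use assms in \<open>auto intro!: tangent_lincomb\<close>)
  also have "\<dots> = (\<Sum>i\<in>A. c i * g p (v i) w)" by (rule g_lincomb[OF assms])
  also have "\<dots> = (\<Sum>i\<in>A. c i * g p w (v i))"
    using assms by (intro sum.cong) (auto simp: g_sym)
  finally show ?thesis .
qed

lemma g_comb:
  assumes "p \<in> points M" "u \<in> tangent_space M p" "v \<in> tangent_space M p" "w \<in> tangent_space M p"
  shows "g p (\<lambda>f. a * u f + b * v f) w = a * g p u w + b * g p v w"
    and "g p w (\<lambda>f. a * u f + b * v f) = a * g p w u + b * g p w v"
  using g_lincomb[OF assms(1,4), of "{True, False}" "\<lambda>i. if i then u else v" "\<lambda>i. if i then a else b"]
    g_lincomb_right[OF assms(1,4), of "{True, False}" "\<lambda>i. if i then u else v" "\<lambda>i. if i then a else b"] assms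
  by auto

lemma g_zero:
  assumes "p \<in> points M" "w \<in> tangent_space M p"
  shows "g p (\<lambda>f. 0) w = 0" "g p w (\<lambda>f. 0) = 0"
  using g_lincomb[OF assms, of "{}"] g_lincomb_right[OF assms, of "{}"] by auto

lemma g_scale_right:
  assumes "p \<in> points M" "u \<in> tangent_space M p" "w \<in> tangent_space M p"
  shows "g p w (\<lambda>f. c * u f) = c * g p w u"
  using g_comb(2)[OF assms(1,2,2,3), of c 0] by simp

lemma g_diff:
  assumes "p \<in> points M" "u \<in> tangent_space M p" "v \<in> tangent_space M p" "w \<in> tangent_space M p"
  shows "g p (\<lambda>f. u f - v f) w = g p u w - g p v w" "g p w (\<lambda>f. u f - v f) = g p w u - g p w v"
  using g_comb[OF assms, of 1 "-1"] by auto

lemma metric_fun_sym: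
  assumes "p \<in> points M" "X \<in> vector_fields M" "Y \<in> vector_fields M"
  shows "metric_fun g X Y p = metric_fun g Y X p"
  unfolding metric_fun_def by (rule g_sym) (use assms vector_fieldsD in auto)

lemma tensor_form_metric:
  assumes "Y \<in> vector_fields M"
  shows "tensor_form (metric_fun g Y)"
  using assms g_smooth unfolding tensor_form_def
  by (auto simp: metric_fun_def g_comb vector_fieldsD)

lemma koszul_smooth:
  assumes "X \<in> vector_fields M" "Y \<in> vector_fields M" "Z \<in> vector_fields M"
  shows "koszul g X Y Z \<in> smooth_funs M"
  unfolding koszul_def using assms
  by (intro smooth_funs_mult smooth_funs_const smooth_funs_add smooth_funs_diff g_smooth vector_fields_smooth lie_bracket_vf)

text \<open>The Leibniz rule of the bracket. The factors 1 present the right side as a combination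
  of two tangent vectors, the shape to which \<open>g_comb\<close> applies.\<close>

lemma lie_bracket_comb:
  assumes X: "X \<in> vector_fields M" and Y: "Y \<in> vector_fields M" "Z \<in> vector_fields M" and p: "p \<in> points M"
    and a: "a \<in> smooth_funs M" "b \<in> smooth_funs M"
  shows "lie_bracket X (\<lambda>q f. a q * Y q f + b q * Z q f) p =
    (\<lambda>f. 1 * (a p * lie_bracket X Y p f + b p * lie_bracket X Z p f) + 1 * (X p a * Y p f + X p b * Z p f))"
proof
  fix f
  let ?L = "\<lambda>q f. a q * Y q f + b q * Z q f"
  note Xp = vector_fieldsD[OF X p] and Yp = vector_fieldsD[OF Y(1) p] and Zp = vector_fieldsD[OF Y(2) p]
  have L: "?L \<in> vector_fields M" by (rule vf_comb[OF Y a])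
  show "lie_bracket X ?L p f = 1 * (a p * lie_bracket X Y p f + b p * lie_bracket X Z p f) + 1 * (X p a * Y p f + X p b * Z p f)"
  proof (cases "f \<in> smooth_funs M")
    case True
    have s: "dir_deriv Y f \<in> smooth_funs M" "dir_deriv Z f \<in> smooth_funs M"
      using True Y vector_fields_smooth by auto
    have "X p (\<lambda>q. a q * dir_deriv Y f q + b q * dir_deriv Z f q) =
        (a p * X p (dir_deriv Y f) + dir_deriv Y f p * X p a) + (b p * X p (dir_deriv Z f) + dir_deriv Z f p * X p b)"
      using s a by (simp add: tangent_add[OF Xp] tangent_mult[OF Xp] smooth_funs_mult)
    moreover have "dir_deriv ?L f = (\<lambda>q. a q * dir_deriv Y f q + b q * dir_deriv Z f q)"
      by (simp add: dir_deriv_def)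
    ultimately show ?thesis by (simp add: lie_bracket_def dir_deriv_def algebra_simps)
  next
    case False
    have "lie_bracket X V p f = 0" if "V \<in> vector_fields M" for V
      using vector_fieldsD[OF lie_bracket_vf[OF X that] p] tangent_undef False by blast
    then show ?thesis using L Y False Yp Zp by (simp add: tangent_undef)
  qed
qed

lemma lie_bracket_swap: "lie_bracket X Y p = (\<lambda>f. (-1) * lie_bracket Y X p f)"
  by (auto simp: lie_bracket_def)

text \<open>Replacing Z by aZ, the derivatives of a are X(a) g(Y,Z) + Y(a) g(Z,X) from the first two
  terms; the terms with [Y,aZ] and [aZ,X] contribute their negatives. Everything else is
  linear.\<close>

lemma tensor_form_koszul:
  assumes X: "X \<in> vector_fields M" and Y: "Y \<in> vector_fields M"
  shows "tensor_form (koszul g X Y)"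
  unfolding tensor_form_def
proof (intro conjI ballI)
  show "koszul g X Y Z \<in> smooth_funs M" if "Z \<in> vector_fields M" for Z by (rule koszul_smooth[OF X Y that])
  fix p Z W a b
  assume p: "p \<in> points M" and Z: "Z \<in> vector_fields M" "W \<in> vector_fields M" and a: "a \<in> smooth_funs M" "b \<in> smooth_funs M"
  define L where "L = (\<lambda>q f. a q * Z q f + b q * W q f)"
  have L: "L \<in> vector_fields M" unfolding L_def by (rule vf_comb[OF Z a])
  note D = vector_fieldsD
  have mL: "metric_fun g V L q = a q * metric_fun g V Z q + b q * metric_fun g V W q"
    "metric_fun g L V q = a q * metric_fun g V Z q + b q * metric_fun g V W q"
    if "V \<in> vector_fields M" "q \<in> points M" for V q
    using that Z g_sym[OF that(2)] by (auto simp: metric_fun_def L_def g_comb D)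
  have dL: "V p (metric_fun g V' L) = V p a * metric_fun g V' Z p + V p b * metric_fun g V' W p
        + a p * V p (metric_fun g V' Z) + b p * V p (metric_fun g V' W)"
    if V: "V \<in> vector_fields M" "V' \<in> vector_fields M" for V V'
  proof -
    note Vp = D[OF V(1) p]
    have "V p (metric_fun g V' L) = V p (\<lambda>q. a q * metric_fun g V' Z q + b q * metric_fun g V' W q)"
      by (rule tangent_cong[OF Vp p]) (use mL V in auto)
    also have "\<dots> = (a p * V p (metric_fun g V' Z) + metric_fun g V' Z p * V p a) + (b p * V p (metric_fun g V' W) + metric_fun g V' W p * V p b)"
      using a V Z by (simp add: tangent_add[OF Vp] tangent_mult[OF Vp] smooth_funs_mult g_smooth)
    finally show ?thesis by (simp add: algebra_simps)
  qed
  have dL': "V p (metric_fun g L V') = V p (metric_fun g V' L)" if V: "V \<in> vector_fields M" "V' \<in> vector_fields M" for V V'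
    by (rule tangent_cong[OF D[OF V(1) p] p]) (use metric_fun_sym L V in auto)
  have dZ: "V p (metric_fun g V'' V') = V p (metric_fun g V' V'')" if V: "V \<in> vector_fields M" "V' \<in> vector_fields M" "V'' \<in> vector_fields M" for V V' V''
    by (rule tangent_cong[OF D[OF V(1) p] p]) (use metric_fun_sym V in auto)
  have bL: "metric_fun g V (lie_bracket V' L) p = a p * metric_fun g V (lie_bracket V' Z) p + b p * metric_fun g V (lie_bracket V' W) p
       + (V' p a * metric_fun g V Z p + V' p b * metric_fun g V W p)"
    if V: "V \<in> vector_fields M" "V' \<in> vector_fields M" for V V'
  proof -
    note Vp = D[OF V(1) p] and Zp = D[OF Z(1) p] and Wp = D[OF Z(2) p]
      and BZ = D[OF lie_bracket_vf[OF V(2) Z(1)] p] and BW = D[OF lie_bracket_vf[OF V(2) Z(2)] p]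
    show ?thesis
      unfolding metric_fun_def L_def lie_bracket_comb[OF V(2) Z p a]
        g_comb(2)[OF p tangent_comb[OF BZ BW] tangent_comb[OF Zp Wp] Vp]
      by (simp only: g_comb(2)[OF p BZ BW Vp] g_comb(2)[OF p Zp Wp Vp] mult_1)
  qed
  have sw: "metric_fun g V (lie_bracket V' V'') p = - metric_fun g V (lie_bracket V'' V') p"
    if V: "V \<in> vector_fields M" "V' \<in> vector_fields M" "V'' \<in> vector_fields M" for V V' V''
    unfolding metric_fun_def lie_bracket_swap[of V' V'' p]
    using g_scale_right[OF p D[OF lie_bracket_vf[OF V(3,2)] p] D[OF V(1) p], of "-1"] by simp
  have "koszul g X Y L p = a p * koszul g X Y Z p + b p * koszul g X Y W p"
    unfolding koszul_def dir_deriv_def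
    using X Y Z L p
    by (simp add: dL' dL mL bL sw[of Y _ X] sw[of Y _ X] dZ[of Y _ X] lie_bracket_vf)
       (simp add: L_def algebra_simps metric_fun_sym[of p _ X] metric_fun_sym[of p "lie_bracket X Y"] lie_bracket_vf)
  then show "koszul g X Y (\<lambda>q f. a q * Z q f + b q * W q f) p = a p * koszul g X Y Z p + b p * koszul g X Y W p"
    by (simp add: L_def)
qed

lemma tensor_form_ssnm:
  assumes "X \<in> vector_fields M" "Y \<in> vector_fields M" "P \<in> vector_fields M"
  shows "tensor_form (ssnm_koszul g P X Y)"
  unfolding ssnm_koszul_def
  by (rule tensor_form_add[OF tensor_form_koszul[OF assms(1,2)] tensor_form_mult[OF tensor_form_metric[OF assms(1)] g_smooth[OF assms(2,3)]]])

text \<open>The number g(v,w) depends on v and w only through their flats: one argument is replaced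
  at a time, using the symmetry of g. Hence the definite description denotes this number.\<close>

lemma bullet_inner_flat:
  assumes p: "p \<in> points M" and v: "v \<in> tangent_space M p" and w: "w \<in> tangent_space M p"
  shows "bullet_inner M g p (flat_at M g p v) (flat_at M g p w) = g p v w"
  unfolding bullet_inner_def
proof (rule the_equality)
  show "\<exists>va\<in>tangent_space M p. \<exists>wa\<in>tangent_space M p. flat_at M g p v = flat_at M g p va \<and> flat_at M g p w = flat_at M g p wa \<and> g p v w = g p va wa"
    using v w by blast
  fix r
  assume "\<exists>va\<in>tangent_space M p. \<exists>wa\<in>tangent_space M p. flat_at M g p v = flat_at M g p va \<and> flat_at M g p w = flat_at M g p wa \<and> r = g p va wa"
  then obtain v' w' where *: "v' \<in> tangent_space M p" "w' \<in> tangent_space M p"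
    "flat_at M g p v = flat_at M g p v'" "flat_at M g p w = flat_at M g p w'" "r = g p v' w'" by blast
  have "g p v w' = g p v' w'" using fun_cong[OF *(3), of w'] * by (simp add: flat_at_def)
  moreover have "g p w v = g p w' v" using fun_cong[OF *(4), of v] v by (simp add: flat_at_def)
  ultimately show "r = g p v w" using * v w g_sym[OF p] by metis
qed

lemma form_at_flat:
  assumes "tensor_form \<omega>" "p \<in> points M" "v \<in> tangent_space M p"
    and "\<And>Z. Z \<in> vector_fields M \<Longrightarrow> \<omega> Z p = g p v (Z p)"
  shows "form_at M \<omega> p = flat_at M g p v"
proof
  fix w
  show "form_at M \<omega> p w = flat_at M g p v w"
  proof (cases "w \<in> tangent_space M p")
    case True
    then obtain Z where Z: "Z \<in> vector_fields M" "Z p = w" using extend_tangent[OF assms(2)] by blast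
    then show ?thesis using form_at_vf[OF assms(1,2) Z(1)] assms(4)[OF Z(1)] True by (simp add: flat_at_def)
  qed (simp add: form_at_def flat_at_def)
qed

section \<open>Dual systems, rank and regular points\<close>

lemma flat_at_comb:
  assumes "p \<in> points M" "\<And>i. i \<in> A \<Longrightarrow> v i \<in> tangent_space M p"
  shows "flat_at M g p (\<lambda>f. \<Sum>i\<in>A. c i * v i f) = (\<Sum>i\<in>A. (\<lambda>w. c i * flat_at M g p (v i) w))"
proof
  fix w
  show "flat_at M g p (\<lambda>f. \<Sum>i\<in>A. c i * v i f) w = (\<Sum>i\<in>A. (\<lambda>w. c i * flat_at M g p (v i) w)) w"
    unfolding sum_covec_apply using assms by (auto simp: flat_at_def g_lincomb)
qed

text \<open>Two dual families take the place of an orthonormal one: for an indefinite and degenerate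
  form they can be built by elimination without diagonalising, and they survive multiplication by
  smooth factors.\<close>

definition biorth :: "'a \<Rightarrow> 'i set \<Rightarrow> ('i \<Rightarrow> 'a tvec) \<Rightarrow> ('i \<Rightarrow> 'a tvec) \<Rightarrow> bool" where
  "biorth p A v w \<longleftrightarrow> finite A \<and> (\<forall>i\<in>A. v i \<in> tangent_space M p \<and> w i \<in> tangent_space M p) \<and>
     (\<forall>i\<in>A. \<forall>j\<in>A. g p (v i) (w j) = (if i = j then 1 else 0))"

text \<open>A rank factorisation of the bilinear form. For a dual pair it says that the flats of the
  v_i span the bullet space, so that the number of pairs is the rank.\<close>

definition spanning :: "'a \<Rightarrow> 'i set \<Rightarrow> ('i \<Rightarrow> 'a tvec) \<Rightarrow> ('i \<Rightarrow> 'a tvec) \<Rightarrow> bool" where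
  "spanning p A v w \<longleftrightarrow> (\<forall>z\<in>tangent_space M p. \<forall>u\<in>tangent_space M p.
     g p z u = (\<Sum>i\<in>A. g p z (w i) * g p (v i) u))"

text \<open>Duality is demanded on the whole open set. The expansion property is kept apart in
  \<open>spanning_fields\<close>, because it is obtained at a single point and spreads to a
  neighbourhood only where the rank is constant.\<close>

definition dual_fields :: "'a set \<Rightarrow> nat \<Rightarrow> (nat \<Rightarrow> 'a vfield) \<Rightarrow> (nat \<Rightarrow> 'a vfield) \<Rightarrow> bool" where
  "dual_fields N r v w \<longleftrightarrow> openin (mtop M) N \<and> (\<forall>i<r. v i \<in> vector_fields M \<and> w i \<in> vector_fields M) \<and>
     (\<forall>q\<in>N. biorth q {..<r} (\<lambda>i. v i q) (\<lambda>i. w i q))"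

definition spanning_fields :: "'a \<Rightarrow> nat \<Rightarrow> (nat \<Rightarrow> 'a vfield) \<Rightarrow> (nat \<Rightarrow> 'a vfield) \<Rightarrow> bool" where
  "spanning_fields p r v w \<longleftrightarrow> spanning p {..<r} (\<lambda>i. v i p) (\<lambda>i. w i p)"

lemma dual_fieldsD:
  assumes "dual_fields N r v w"
  shows "openin (mtop M) N" "\<And>i. i < r \<Longrightarrow> v i \<in> vector_fields M" "\<And>i. i < r \<Longrightarrow> w i \<in> vector_fields M"
    "\<And>q. q \<in> N \<Longrightarrow> biorth q {..<r} (\<lambda>i. v i q) (\<lambda>i. w i q)" "\<And>q. q \<in> N \<Longrightarrow> q \<in> points M"
  using assms openin_subset by (auto simp: dual_fields_def)

text \<open>Evaluating a linear relation between the flats of the v_i at w_j isolates the j-th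
  coefficient.\<close>

lemma biorth_independent:
  assumes p: "p \<in> points M" and b: "biorth p A v w"
  shows "inj_on (\<lambda>i. flat_at M g p (v i)) A" "\<not> covec.dependent ((\<lambda>i. flat_at M g p (v i)) ` A)"
proof -
  let ?F = "\<lambda>i. flat_at M g p (v i)"
  have ev: "?F i (w j) = (if i = j then 1 else 0)" if "i \<in> A" "j \<in> A" for i j
    using b that by (auto simp: biorth_def flat_at_def)
  show inj: "inj_on ?F A"
  proof (rule inj_onI, rule ccontr)
    fix i j assume ij: "i \<in> A" "j \<in> A" "?F i = ?F j" "i \<noteq> j"
    have "?F i (w j) = ?F j (w j)" by (simp only: ij(3))
    then show False using ev[OF ij(1,2)] ev[OF ij(2,2)] ij(4) by simp
  qed
  have fin: "finite A" using b by (simp add: biorth_def)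
  show "\<not> covec.dependent (?F ` A)"
  proof
    assume "covec.dependent (?F ` A)"
    then obtain c x where s: "(\<Sum>x\<in>?F ` A. (\<lambda>w. c x * x w)) = 0" and x: "x \<in> ?F ` A" and cx: "c x \<noteq> 0"
      unfolding covec.dependent_finite[OF finite_imageI[OF fin]] by blast
    from x obtain j where j: "j \<in> A" "x = ?F j" by blast
    have "0 = (\<Sum>x\<in>?F ` A. (\<lambda>w. c x * x w)) (w j)" using s by simp
    also have "\<dots> = (\<Sum>i\<in>A. c (?F i) * ?F i (w j))"
      unfolding sum_covec_apply by (simp add: sum.reindex[OF inj])
    also have "\<dots> = (\<Sum>i\<in>A. c (?F i) * (if i = j then 1 else 0))"
      by (rule sum.cong) (use ev j in auto)
    also have "\<dots> = c x" unfolding sum_mult_delta[OF fin j(1)] j(2) by (rule refl)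
    finally show False using cx by simp
  qed
qed

lemma spanning_span:
  assumes p: "p \<in> points M" and b: "biorth p A v w" and s: "spanning p A v w"
  shows "bullet_space M g p \<subseteq> covec.span ((\<lambda>i. flat_at M g p (v i)) ` A)"
proof
  fix \<alpha> assume "\<alpha> \<in> bullet_space M g p"
  then obtain z where z: "z \<in> tangent_space M p" "\<alpha> = flat_at M g p z" by (auto simp: bullet_space_def)
  have v: "\<And>i. i \<in> A \<Longrightarrow> v i \<in> tangent_space M p" using b by (simp add: biorth_def)
  have "\<alpha> = (\<Sum>i\<in>A. (\<lambda>u. g p z (w i) * flat_at M g p (v i) u))"
  proof
    fix u show "\<alpha> u = (\<Sum>i\<in>A. (\<lambda>u. g p z (w i) * flat_at M g p (v i) u)) u"
      unfolding sum_covec_apply using s z by (auto simp: flat_at_def spanning_def)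
  qed
  then show "\<alpha> \<in> covec.span ((\<lambda>i. flat_at M g p (v i)) ` A)"
    by (rule covec_span_sum)
qed

lemma biorth_rank:
  assumes p: "p \<in> points M" and b: "biorth p A v w" and s: "spanning p A v w"
  shows "metric_rank M g p = card A"
  unfolding metric_rank_def
proof (rule covec.dim_unique)
  let ?F = "\<lambda>i. flat_at M g p (v i)"
  show "?F ` A \<subseteq> bullet_space M g p" using b by (auto simp: biorth_def bullet_space_def)
  show "bullet_space M g p \<subseteq> covec.span (?F ` A)" by (rule spanning_span[OF assms])
  show "covec.independent (?F ` A)" by (rule biorth_independent[OF p b])
  show "card (?F ` A) = card A" by (rule card_image[OF biorth_independent(1)[OF p b]])
qed

lemma biorth_card_le:
  assumes p: "p \<in> points M" and b: "biorth p A v w" and T: "finite T" "bullet_space M g p \<subseteq> covec.span T"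
  shows "card A \<le> card T"
proof -
  let ?F = "\<lambda>i. flat_at M g p (v i)"
  have "?F ` A \<subseteq> bullet_space M g p" using b by (auto simp: biorth_def bullet_space_def)
  then have "card (?F ` A) \<le> card T"
    using covec.independent_span_bound[OF T(1) biorth_independent(2)[OF p b]] T(2) by blast
  then show ?thesis by (simp add: card_image[OF biorth_independent(1)[OF p b]])
qed

text \<open>The flats of a local frame span the bullet space. The bound makes maximal dual systems
  exist and bounds the rank.\<close>

lemma biorth_card_coords:
  assumes p: "p \<in> points M" and b: "biorth p A v w"
  shows "card A \<le> card (coords M)"
proof -
  obtain N \<xi> E where N: "p \<in> N" and E: "\<And>i. i \<in> coords M \<Longrightarrow> E i \<in> vector_fields M"
    and f: "\<And>q v. q \<in> N \<Longrightarrow> v \<in> tangent_space M q \<Longrightarrow> v = (\<lambda>f. \<Sum>i\<in>coords M. v (\<xi> i) * E i q f)"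
    by (rule local_frame[OF p]) (rule that)
  let ?T = "(\<lambda>i. flat_at M g p (E i p)) ` coords M"
  have "bullet_space M g p \<subseteq> covec.span ?T"
  proof
    fix \<alpha> assume "\<alpha> \<in> bullet_space M g p"
    then obtain z where z: "z \<in> tangent_space M p" "\<alpha> = flat_at M g p z" by (auto simp: bullet_space_def)
    have "\<alpha> = flat_at M g p (\<lambda>f. \<Sum>i\<in>coords M. z (\<xi> i) * E i p f)" using f[OF N z(1)] z(2) by simp
    also have "\<dots> = (\<Sum>i\<in>coords M. (\<lambda>w. z (\<xi> i) * flat_at M g p (E i p) w))"
      by (rule flat_at_comb[OF p]) (use E vector_fieldsD p in auto)
    finally show "\<alpha> \<in> covec.span ?T"
      by (rule covec_span_sum)
  qed
  then have "card A \<le> card ?T" using fin_coords by (intro biorth_card_le[OF p b]) auto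
  also have "\<dots> \<le> card (coords M)" by (rule card_image_le[OF fin_coords])
  finally show ?thesis .
qed

text \<open>Gauss elimination: a dual pair of systems is extended by a pair of vectors that does not
  yet satisfy the expansion \<^term>\<open>spanning\<close>.\<close>

lemma biorth_extend:
  assumes p: "p \<in> points M" and b: "biorth p {..<r} v w" and z: "z \<in> tangent_space M p" and u: "u \<in> tangent_space M p"
    and z': "z' = (\<lambda>f. z f - (\<Sum>i<r. g p z (w i) * v i f))" and u': "u' = (\<lambda>f. u f - (\<Sum>i<r. g p (v i) u * w i f))"
  shows "g p z' u' = g p z u - (\<Sum>i<r. g p z (w i) * g p (v i) u)"
    and "h * g p z' u' = 1 \<Longrightarrow> biorth p {..<Suc r} (v(r := z')) (w(r := (\<lambda>f. h * u' f)))"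
proof -
  have v: "\<And>i. i < r \<Longrightarrow> v i \<in> tangent_space M p" and w: "\<And>i. i < r \<Longrightarrow> w i \<in> tangent_space M p"
    and \<delta>: "\<And>i j. i < r \<Longrightarrow> j < r \<Longrightarrow> g p (v i) (w j) = (if i = j then 1 else 0)"
    using b unfolding biorth_def by simp_all
  have sv: "(\<lambda>f. \<Sum>i<r. g p z (w i) * v i f) \<in> tangent_space M p" and sw: "(\<lambda>f. \<Sum>i<r. g p (v i) u * w i f) \<in> tangent_space M p"
    using v w by (auto intro!: tangent_lincomb)
  have z'T: "z' \<in> tangent_space M p" and u'T: "u' \<in> tangent_space M p"
    unfolding z' u' using tangent_plus[OF z tangent_scale[OF sv, of "-1"]] tangent_plus[OF u tangent_scale[OF sw, of "-1"]] by auto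
  have lv: "g p (\<lambda>f. \<Sum>i<r. g p z (w i) * v i f) y = (\<Sum>i<r. g p z (w i) * g p (v i) y)" if "y \<in> tangent_space M p" for y
    by (rule g_lincomb[OF p that]) (use v in auto)
  have lw: "g p y (\<lambda>f. \<Sum>i<r. g p (v i) u * w i f) = (\<Sum>i<r. g p (v i) u * g p y (w i))" if "y \<in> tangent_space M p" for y
    by (rule g_lincomb_right[OF p that]) (use w in auto)
  have zw: "g p z' (w j) = 0" if j: "j < r" for j
  proof -
    have "(\<Sum>i<r. g p z (w i) * g p (v i) (w j)) = (\<Sum>i<r. g p z (w i) * (if i = j then 1 else 0))"
      by (rule sum.cong) (use \<delta> j in auto)
    also have "\<dots> = g p z (w j)" by (rule sum_mult_delta) (use j in auto)
    finally show ?thesis unfolding z' using j w z p sv by (simp add: g_diff lv)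
  qed
  have vu: "g p (v j) u' = 0" if j: "j < r" for j
  proof -
    have "(\<Sum>i<r. g p (v i) u * g p (v j) (w i)) = (\<Sum>i<r. g p (v i) u * (if i = j then 1 else 0))"
      by (rule sum.cong) (use \<delta> j in auto)
    also have "\<dots> = g p (v j) u" by (rule sum_mult_delta) (use j in auto)
    finally show ?thesis unfolding u' using j v u p sw by (simp add: g_diff lw)
  qed
  have "g p z' u' = g p z' u - (\<Sum>i<r. g p (v i) u * g p z' (w i))"
    unfolding u' using p z'T u sw by (simp add: g_diff lw)
  also have "\<dots> = g p z' u" by (simp add: zw)
  also have "\<dots> = g p z u - (\<Sum>i<r. g p z (w i) * g p (v i) u)"
    unfolding z' using p z u sv by (simp add: g_diff lv)
  finally show "g p z' u' = g p z u - (\<Sum>i<r. g p z (w i) * g p (v i) u)" .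
  show "biorth p {..<Suc r} (v(r := z')) (w(r := (\<lambda>f. h * u' f)))" if "h * g p z' u' = 1"
    unfolding biorth_def
    using that p v w z'T u'T zw vu \<delta> by (auto simp: less_Suc_eq tangent_scale g_scale_right)
qed

text \<open>A dual system of fields near p of maximal length is spanning at p: vectors violating the
  expansion could be extended to fields, made orthogonal to the system and normalised near p, giving
  a longer system.\<close>

lemma local_biorth:
  assumes p: "p \<in> points M"
  shows "\<exists>N r v w. p \<in> N \<and> dual_fields N r v w \<and> spanning_fields p r v w"
proof -
  define Q where "Q r \<longleftrightarrow> (\<exists>v w N. p \<in> N \<and> dual_fields N r v w)" for r
  have "dual_fields (points M) 0 undefined undefined"
    by (simp add: dual_fields_def biorth_def)
  then have Q0: "Q 0" using p unfolding Q_def by blast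
  have bd: "r < Suc (card (coords M))" if "Q r" for r
    using that unfolding Q_def
  proof (elim exE conjE)
    fix v w N assume pN: "p \<in> N" and Q: "dual_fields N r v w"
    from biorth_card_coords[OF p dual_fieldsD(4)[OF Q pN]] show ?thesis by simp
  qed
  have "\<exists>r. Q r \<and> (\<forall>y. Q y \<longrightarrow> y \<le> r)"
    by (rule ex_has_greatest_nat[of Q 0 "\<lambda>r. r" "Suc (card (coords M))"]) (use Q0 bd in auto)
  then obtain r where r: "Q r" and mx: "\<forall>r'. Q r' \<longrightarrow> r' \<le> r" by (elim exE conjE)
  obtain v w N where pN: "p \<in> N" and Q: "dual_fields N r v w" using r unfolding Q_def by (elim exE conjE)
  note N = dual_fieldsD(1)[OF Q] pN and v = dual_fieldsD(2)[OF Q] and w = dual_fieldsD(3)[OF Q] and b = dual_fieldsD(4)[OF Q]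
  have "spanning p {..<r} (\<lambda>i. v i p) (\<lambda>i. w i p)"
  proof (rule ccontr)
    assume "\<not> spanning p {..<r} (\<lambda>i. v i p) (\<lambda>i. w i p)"
    then obtain z u where zu: "z \<in> tangent_space M p" "u \<in> tangent_space M p"
      "g p z u \<noteq> (\<Sum>i<r. g p z (w i p) * g p (v i p) u)" by (auto simp: spanning_def)
    obtain Z where Z: "Z \<in> vector_fields M" "Z p = z" using extend_tangent[OF p zu(1)] by blast
    obtain W where W: "W \<in> vector_fields M" "W p = u" using extend_tangent[OF p zu(2)] by blast
    \<comment> \<open>Z' and W' are the corrected vectors of \<open>biorth_extend\<close>, taken at
      every point at once; the coefficients are values of the metric and hence smooth.\<close>
    define Z' where "Z' = (\<lambda>q f. 1 * Z q f + (-1) * (\<Sum>i<r. metric_fun g Z (w i) q * v i q f))"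
    define W' where "W' = (\<lambda>q f. 1 * W q f + (-1) * (\<Sum>i<r. metric_fun g (v i) W q * w i q f))"
    have Z': "Z' \<in> vector_fields M" unfolding Z'_def
      by (rule vf_comb) (use Z v w in \<open>auto intro!: vf_lincomb g_smooth\<close>)
    have W': "W' \<in> vector_fields M" unfolding W'_def
      by (rule vf_comb) (use W v w in \<open>auto intro!: vf_lincomb g_smooth\<close>)
    have eq: "Z' q = (\<lambda>f. Z q f - (\<Sum>i<r. g q (Z q) (w i q) * v i q f))" "W' q = (\<lambda>f. W q f - (\<Sum>i<r. g q (v i q) (W q) * w i q f))" for q
      by (auto simp: Z'_def W'_def metric_fun_def)
    have Np: "q \<in> points M" if "q \<in> N" for q using that openin_subset[OF N(1)] by blast
    note ext = biorth_extend[OF Np b vector_fieldsD[OF Z(1) Np] vector_fieldsD[OF W(1) Np] eq]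
    have "metric_fun g Z' W' p \<noteq> 0"
      using ext(1)[OF N(2) N(2) N(2) N(2)] zu(3) Z(2) W(2) by (simp add: metric_fun_def)
    then obtain h N' where h: "h \<in> smooth_funs M" "openin (mtop M) N'" "p \<in> N'" "\<And>q. q \<in> N' \<Longrightarrow> metric_fun g Z' W' q * h q = 1"
      using smooth_funs_local_inverse[OF g_smooth[OF Z' W'] p] by metis
    define hW where "hW = (\<lambda>q f. h q * W' q f + 0 * W' q f)"
    have hW: "hW \<in> vector_fields M" unfolding hW_def by (rule vf_comb) (use W' h in auto)
    have "dual_fields (N \<inter> N') (Suc r) (v(r := Z')) (w(r := hW))"
      unfolding dual_fields_def
    proof (intro conjI allI impI ballI)
      show "openin (mtop M) (N \<inter> N')" using N h by blast
      show "(v(r := Z')) i \<in> vector_fields M" "(w(r := hW)) i \<in> vector_fields M" if "i < Suc r" for i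
        using that v w Z' hW by (auto simp: less_Suc_eq)
      fix q assume q: "q \<in> N \<inter> N'"
      then have "h q * g q (Z' q) (W' q) = 1" using h(4)[of q] by (simp add: metric_fun_def mult.commute)
      from ext(2)[of q, OF _ _ _ _ this] q
      have "biorth q {..<Suc r} ((\<lambda>i. v i q)(r := Z' q)) ((\<lambda>i. w i q)(r := (\<lambda>f. h q * W' q f)))" by simp
      moreover have "(\<lambda>i. v i q)(r := Z' q) = (\<lambda>i. (v(r := Z')) i q)" "(\<lambda>i. w i q)(r := (\<lambda>f. h q * W' q f)) = (\<lambda>i. (w(r := hW)) i q)"
        by (auto simp: hW_def)
      ultimately show "biorth q {..<Suc r} (\<lambda>i. (v(r := Z')) i q) (\<lambda>i. (w(r := hW)) i q)" by simp
    qed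
    then have "Q (Suc r)" using N(2) h(3) unfolding Q_def by blast
    then have "Suc r \<le> r" by (rule mx[rule_format])
    then show False by simp
  qed
  then show ?thesis using Q pN unfolding spanning_fields_def by blast
qed

lemma rank_biorth:
  assumes p: "p \<in> points M"
  obtains v w where "biorth p {..<metric_rank M g p} v w" "spanning p {..<metric_rank M g p} v w"
proof -
  obtain N r v w where pN: "p \<in> N" and Q: "dual_fields N r v w" and s: "spanning_fields p r v w"
    using local_biorth[OF p] by (elim exE conjE)
  note * = pN dual_fieldsD(4)[OF Q pN] s[unfolded spanning_fields_def]
  have "metric_rank M g p = r" using biorth_rank[OF p *(2,3)] by simp
  then show ?thesis using that *(2,3) by simp
qed

lemma biorth_le_rank:
  assumes p: "p \<in> points M" and b: "biorth p A v w"
  shows "card A \<le> metric_rank M g p"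
proof -
  obtain v' w' where *: "biorth p {..<metric_rank M g p} v' w'" "spanning p {..<metric_rank M g p} v' w'"
    by (rule rank_biorth[OF p])
  have "card A \<le> card ((\<lambda>i. flat_at M g p (v' i)) ` {..<metric_rank M g p})"
    by (rule biorth_card_le[OF p b _ spanning_span[OF p *]]) simp
  also have "\<dots> \<le> metric_rank M g p" using card_image_le[of "{..<metric_rank M g p}"] by simp
  finally show ?thesis .
qed

lemma rank_le_coords: "p \<in> points M \<Longrightarrow> metric_rank M g p \<le> card (coords M)"
  by (metis rank_biorth biorth_card_coords card_lessThan)

text \<open>A dual system whose length is the rank at p is still dual at nearby points, where it
  bounds the rank from below.\<close>

lemma rank_lower_semicontinuous:
  assumes p: "p \<in> points M"
  obtains N where "openin (mtop M) N" "p \<in> N" "\<And>q. q \<in> N \<Longrightarrow> metric_rank M g p \<le> metric_rank M g q"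
proof -
  obtain N r v w where pN: "p \<in> N" and Q: "dual_fields N r v w" and s: "spanning_fields p r v w"
    using local_biorth[OF p] by (elim exE conjE)
  note * = dual_fieldsD(1)[OF Q] pN dual_fieldsD(4)[OF Q] s[unfolded spanning_fields_def]
  have "metric_rank M g p = r" using biorth_rank[OF p *(3)[OF *(2)] *(4)] by simp
  moreover have "r \<le> metric_rank M g q" if "q \<in> N" for q
    using biorth_le_rank[OF _ *(3)[OF that]] openin_subset[OF *(1)] that by auto
  ultimately show ?thesis using that[of N] *(1,2) by simp
qed

text \<open>The rank is bounded, so it attains a maximum on S; at a maximum point, lower
  semicontinuity makes it locally constant.\<close>

lemma regular_dense:
  assumes "openin (mtop M) S" "q \<in> S"
  shows "\<exists>p\<in>S. p \<in> regular_points M g"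
proof -
  have S: "S \<subseteq> points M" using assms openin_subset by blast
  obtain p where p: "p \<in> S" "\<And>p'. p' \<in> S \<Longrightarrow> metric_rank M g p' \<le> metric_rank M g p"
    using ex_has_greatest_nat[of "\<lambda>p. p \<in> S" q "metric_rank M g" "Suc (card (coords M))"] assms(2) rank_le_coords S
    by (auto simp: less_Suc_eq_le)
  obtain N where N: "openin (mtop M) N" "p \<in> N" "\<And>q. q \<in> N \<Longrightarrow> metric_rank M g p \<le> metric_rank M g q"
    using rank_lower_semicontinuous S p(1) by blast
  have "openin (mtop M) (N \<inter> S)" using N assms by blast
  moreover have "metric_rank M g q = metric_rank M g p" if "q \<in> N \<inter> S" for q using N(3) p(2) that by (simp add: antisym)
  ultimately show ?thesis using p(1) N(2) unfolding regular_points_def by blast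
qed

lemma regular_points_subset: "regular_points M g \<subseteq> points M"
  unfolding regular_points_def using openin_subset by blast

lemma smooth_eq_of_regular:
  assumes h: "h1 \<in> smooth_funs M" "h2 \<in> smooth_funs M" and eq: "\<And>p. p \<in> regular_points M g \<Longrightarrow> h1 p = h2 p"
    and p: "p \<in> points M"
  shows "h1 p = h2 p"
proof (rule ccontr)
  assume "h1 p \<noteq> h2 p"
  then obtain q where "q \<in> {p \<in> points M. h1 p \<noteq> h2 p}" "q \<in> regular_points M g"
    using regular_dense[OF smooth_funs_neq_open[OF h], of p] p by blast
  then show False using eq by blast
qed

text \<open>Two smooth extensions agree on the dense set of regular points, so the choice in
  \<open>contraction\<close> does not affect the values on \<open>points M\<close>.\<close>

lemma contraction_eq:
  assumes "extends_contraction M g \<omega> \<tau> h" "p \<in> points M"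
  shows "contraction M g \<omega> \<tau> p = h p"
proof -
  have e: "extends_contraction M g \<omega> \<tau> (contraction M g \<omega> \<tau>)"
    unfolding contraction_def by (rule someI[of "extends_contraction M g \<omega> \<tau>" h]) (rule assms(1))
  show ?thesis
    by (rule smooth_eq_of_regular[OF _ _ _ assms(2)]) (use e assms(1) in \<open>auto simp: extends_contraction_def\<close>)
qed

text \<open>If the expansion failed at a point near p, the dual system could be enlarged there, and
  the rank at that point would exceed the rank at p.\<close>

lemma spanning_near_regular:
  assumes p: "p \<in> regular_points M g"
  shows "\<exists>N r v w. p \<in> N \<and> dual_fields N r v w \<and> (\<forall>q\<in>N. spanning_fields q r v w)"
proof -
  have pM: "p \<in> points M" using p regular_points_subset by blast
  obtain U where U: "openin (mtop M) U" "p \<in> U" "\<And>q. q \<in> U \<Longrightarrow> metric_rank M g q = metric_rank M g p"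
    using p by (auto simp: regular_points_def)
  obtain N r v w where pN: "p \<in> N" and Q: "dual_fields N r v w" and s: "spanning_fields p r v w"
    using local_biorth[OF pM] by (elim exE conjE)
  note * = dual_fieldsD(1)[OF Q] pN dual_fieldsD(2,3,4)[OF Q] s[unfolded spanning_fields_def]
  have r: "metric_rank M g p = r" using biorth_rank[OF pM *(5)[OF *(2)] *(6)] by simp
  have "spanning q {..<r} (\<lambda>i. v i q) (\<lambda>i. w i q)" if q: "q \<in> N \<inter> U" for q
  proof (rule ccontr)
    assume "\<not> spanning q {..<r} (\<lambda>i. v i q) (\<lambda>i. w i q)"
    then obtain z u where zu: "z \<in> tangent_space M q" "u \<in> tangent_space M q"
      "g q z u \<noteq> (\<Sum>i<r. g q z (w i q) * g q (v i q) u)" by (auto simp: spanning_def)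
    have qM: "q \<in> points M" using q openin_subset[OF *(1)] by blast
    note ext = biorth_extend[OF qM *(5) zu(1,2) refl refl]
    have ne: "g q z u - (\<Sum>i<r. g q z (w i q) * g q (v i q) u) \<noteq> 0" using zu(3) by simp
    have "\<exists>v' w'. biorth q {..<Suc r} v' w'"
      using ext(2)[of "inverse (g q z u - (\<Sum>i<r. g q z (w i q) * g q (v i q) u))"] ext(1) q ne by fastforce
    then have "Suc r \<le> metric_rank M g q" using biorth_le_rank[OF qM] by (metis card_lessThan)
    then show False using U(3)[of q] r q by simp
  qed
  then have "\<forall>q\<in>N \<inter> U. spanning_fields q r v w" by (simp add: spanning_fields_def)
  moreover have "dual_fields (N \<inter> U) r v w" using Q U(1) by (auto simp: dual_fields_def)
  ultimately show ?thesis using pN U(2) by blast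
qed

end

section \<open>Non-degenerate metrics: every point is regular\<close>

locale nondegenerate = semi_riem +
  assumes nondeg: "\<And>p v. p \<in> points M \<Longrightarrow> v \<in> tangent_space M p \<Longrightarrow>
    (\<And>w. w \<in> tangent_space M p \<Longrightarrow> g p v w = 0) \<Longrightarrow> v = (\<lambda>f. 0)"
begin

text \<open>Non-degeneracy makes the flats of a frame linearly independent, and they span the bullet
  space; so the rank is the dimension everywhere.\<close>

lemma rank_nondegenerate:
  assumes p: "p \<in> points M"
  shows "metric_rank M g p = card (coords M)"
proof -
  let ?I = "coords M"
  obtain N \<xi> E where N: "p \<in> N" and \<xi>: "\<And>i. i \<in> coords M \<Longrightarrow> \<xi> i \<in> smooth_funs M"
    and E: "\<And>i. i \<in> coords M \<Longrightarrow> E i \<in> vector_fields M"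
    and f: "\<And>q v. q \<in> N \<Longrightarrow> v \<in> tangent_space M q \<Longrightarrow> v = (\<lambda>f. \<Sum>i\<in>coords M. v (\<xi> i) * E i q f)"
    and \<delta>: "\<And>q i k. q \<in> N \<Longrightarrow> i \<in> coords M \<Longrightarrow> k \<in> coords M \<Longrightarrow> E i q (\<xi> k) = (if i = k then 1 else 0)"
    by (rule local_frame[OF p]) (rule that)
  let ?F = "\<lambda>i. flat_at M g p (E i p)"
  have ET: "E i p \<in> tangent_space M p" if "i \<in> ?I" for i using E that p vector_fieldsD by blast
  have li: "c i = 0" if 0: "(\<Sum>i\<in>?I. (\<lambda>w. c i * ?F i w)) = 0" and i: "i \<in> ?I" for c i
  proof -
    let ?z = "\<lambda>f. \<Sum>i\<in>?I. c i * E i p f"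
    have zT: "?z \<in> tangent_space M p" using ET by (auto intro!: tangent_lincomb)
    have "flat_at M g p ?z = (\<lambda>w. 0)" using flat_at_comb[OF p ET, where c=c] 0 by (simp add: zero_fun_def)
    then have "g p ?z w = 0" if "w \<in> tangent_space M p" for w
      using that by (auto simp: flat_at_def fun_eq_iff split: if_splits)
    from nondeg[OF p zT this] have "?z (\<xi> i) = 0" by metis
    then have "(\<Sum>j\<in>?I. c j * (if j = i then 1 else 0)) = 0"
      using \<delta>[OF N _ i] by (simp cong: sum.cong)
    then show ?thesis by (simp only: sum_mult_delta[OF fin_coords i])
  qed
  have inj: "inj_on ?F ?I"
  proof (rule inj_onI, rule ccontr)
    fix i j assume ij: "i \<in> ?I" "j \<in> ?I" "?F i = ?F j" "i \<noteq> j"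
    have "(\<Sum>k\<in>?I. (\<lambda>w. ((if k = i then 1 else 0) - (if k = j then 1 else 0)) * ?F k w)) = 0"
    proof
      fix w
      show "(\<Sum>k\<in>?I. (\<lambda>w. ((if k = i then 1 else 0) - (if k = j then 1 else 0)) * ?F k w)) w = 0 w"
        unfolding sum_covec_apply
        using ij fin_coords by (simp add: left_diff_distrib sum_subtractf if_distrib[of "\<lambda>x. x * _"] cong: if_cong)
    qed
    from li[OF this ij(1)] ij(4) show False by simp
  qed
  have "metric_rank M g p = card (?F ` ?I)"
    unfolding metric_rank_def
  proof (rule covec.dim_unique[OF _ _ _ refl])
    show "?F ` ?I \<subseteq> bullet_space M g p" using ET by (auto simp: bullet_space_def)
    show "bullet_space M g p \<subseteq> covec.span (?F ` ?I)"
    proof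
      fix \<alpha> assume "\<alpha> \<in> bullet_space M g p"
      then obtain z where z: "z \<in> tangent_space M p" "\<alpha> = flat_at M g p z" by (auto simp: bullet_space_def)
      have "\<alpha> = flat_at M g p (\<lambda>f. \<Sum>i\<in>?I. z (\<xi> i) * E i p f)" using f[OF N z(1)] z(2) by simp
      also have "\<dots> = (\<Sum>i\<in>?I. (\<lambda>w. z (\<xi> i) * ?F i w))" by (rule flat_at_comb[OF p ET])
      finally show "\<alpha> \<in> covec.span (?F ` ?I)" by (rule covec_span_sum)
    qed
    show "covec.independent (?F ` ?I)"
    proof
      assume "covec.dependent (?F ` ?I)"
      then obtain c x where s: "(\<Sum>x\<in>?F ` ?I. (\<lambda>w. c x * x w)) = 0" and x: "x \<in> ?F ` ?I" and cx: "c x \<noteq> 0"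
        unfolding covec.dependent_finite[OF finite_imageI[OF fin_coords]] by blast
      from x obtain j where j: "j \<in> ?I" "x = ?F j" by blast
      have "(\<Sum>i\<in>?I. (\<lambda>w. c (?F i) * ?F i w)) = 0" using s by (simp add: sum.reindex[OF inj])
      from li[OF this j(1)] show False using cx j(2) by simp
    qed
  qed
  then show ?thesis using card_image[OF inj] by simp
qed

lemma all_regular: "regular_points M g = points M"
proof -
  have "p \<in> regular_points M g" if "p \<in> points M" for p
    unfolding regular_points_def mem_Collect_eq
    by (rule exI[of _ "points M"]) (use that rank_nondegenerate in auto)
  then show ?thesis using regular_points_subset by blast
qed

text \<open>The difference of both sides is orthogonal to every vector by the expansion of g, so
  non-degeneracy upgrades the expansion of the form to one of vectors.\<close>

lemma spanning_expand:
  assumes p: "p \<in> points M" and b: "biorth p A v w" and s: "spanning p A v w" and u: "u \<in> tangent_space M p"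
  shows "u = (\<lambda>f. \<Sum>i\<in>A. g p (v i) u * w i f)"
proof -
  have w: "\<And>i. i \<in> A \<Longrightarrow> w i \<in> tangent_space M p" and v: "\<And>i. i \<in> A \<Longrightarrow> v i \<in> tangent_space M p"
    using b by (auto simp: biorth_def)
  let ?s = "\<lambda>f. \<Sum>i\<in>A. g p (v i) u * w i f"
  have sT: "?s \<in> tangent_space M p" using w by (auto intro!: tangent_lincomb)
  have "(\<lambda>f. u f - ?s f) = (\<lambda>f. 0)"
  proof (rule nondeg[OF p])
    show "(\<lambda>f. u f - ?s f) \<in> tangent_space M p" using tangent_plus[OF u tangent_scale[OF sT, of "-1"]] by simp
    fix z assume z: "z \<in> tangent_space M p"
    have "g p (\<lambda>f. u f - ?s f) z = g p u z - (\<Sum>i\<in>A. g p (v i) u * g p (w i) z)"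
      using p u sT z w by (simp add: g_diff g_lincomb)
    also have "\<dots> = g p z u - (\<Sum>i\<in>A. g p z (w i) * g p (v i) u)"
      using p u z w by (simp add: g_sym[of p _ z] mult.commute cong: sum.cong)
    also have "\<dots> = 0" using s z u by (simp add: spanning_def)
    finally show "g p (\<lambda>f. u f - ?s f) z = 0" .
  qed
  then show ?thesis by (auto simp: fun_eq_iff)
qed

lemma tensor_form_expand:
  assumes Q: "dual_fields N r v w" "p \<in> N" and s: "spanning_fields p r v w"
    and \<omega>: "tensor_form \<omega>" and Z: "Z \<in> vector_fields M"
  shows "\<omega> Z p = (\<Sum>i<r. g p (v i p) (Z p) * \<omega> (w i) p)"
proof -
  note p = dual_fieldsD(5)[OF Q] and w = dual_fieldsD(3)[OF Q(1)]
  have L: "(\<lambda>q f. \<Sum>i<r. g p (v i p) (Z p) * w i q f) \<in> vector_fields M"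
    by (rule vf_lincomb[where a="\<lambda>i q. g p (v i p) (Z p)"]) (use w in auto)
  have "\<omega> Z p = \<omega> (\<lambda>q f. \<Sum>i<r. g p (v i p) (Z p) * w i q f) p"
    by (rule tensor_form_pt[OF \<omega> p Z L])
       (rule spanning_expand[OF p dual_fieldsD(4)[OF Q] s[unfolded spanning_fields_def] vector_fieldsD[OF Z p]])
  also have "\<dots> = (\<Sum>i<r. g p (v i p) (Z p) * \<omega> (w i) p)"
    by (rule tensor_form_lincomb[OF \<omega> p, where a="\<lambda>i q. g p (v i p) (Z p)"]) (use w in auto)
  finally show ?thesis .
qed

text \<open>The representing vector is the sum of \<omega>(w_i) v_i over a dual system that spans at
  p.\<close>

lemma sharp_ex:
  assumes p: "p \<in> points M" and \<omega>: "tensor_form \<omega>"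
  shows "\<exists>s\<in>tangent_space M p. \<forall>Z\<in>vector_fields M. \<omega> Z p = g p s (Z p)"
proof -
  have "p \<in> regular_points M g" using p all_regular by simp
  then obtain N r v w where pN: "p \<in> N" and Q: "dual_fields N r v w" and s: "\<forall>q\<in>N. spanning_fields q r v w"
    by (elim exE conjE spanning_near_regular[elim_format])
  note * = dual_fieldsD(1)[OF Q] pN dual_fieldsD(2,3,4)[OF Q] s[unfolded spanning_fields_def, rule_format]
  show ?thesis
  proof (intro bexI ballI)
    show sT: "(\<lambda>f. \<Sum>i<r. \<omega> (w i) p * v i p f) \<in> tangent_space M p"
      using *(3) vector_fieldsD p by (auto intro!: tangent_lincomb)
    fix Z assume Z: "Z \<in> vector_fields M"
    have "\<omega> Z p = (\<Sum>i<r. g p (v i p) (Z p) * \<omega> (w i) p)"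
      by (rule tensor_form_expand[OF Q pN s[rule_format, OF pN] \<omega> Z])
    moreover have "g p (\<lambda>f. \<Sum>i<r. \<omega> (w i) p * v i p f) (Z p) = (\<Sum>i<r. \<omega> (w i) p * g p (v i p) (Z p))"
      by (rule g_lincomb[OF p vector_fieldsD[OF Z p]]) (use *(3) vector_fieldsD p in auto)
    ultimately show "\<omega> Z p = g p (\<lambda>f. \<Sum>i<r. \<omega> (w i) p * v i p f) (Z p)"
      by (simp add: mult.commute)
  qed
qed

lemma inverse_metric_eq:
  assumes p: "p \<in> points M" and \<omega>: "tensor_form \<omega>" "tensor_form \<tau>"
    and s: "s \<in> tangent_space M p" "\<And>Z. Z \<in> vector_fields M \<Longrightarrow> \<omega> Z p = g p s (Z p)"
    and t: "t \<in> tangent_space M p" "\<And>Z. Z \<in> vector_fields M \<Longrightarrow> \<tau> Z p = g p t (Z p)"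
  shows "inverse_metric M g \<omega> \<tau> p = g p s t"
proof -
  have "form_at M \<omega> p = flat_at M g p s" by (rule form_at_flat[OF \<omega>(1) p s(1)]) (rule s(2))
  moreover have "form_at M \<tau> p = flat_at M g p t" by (rule form_at_flat[OF \<omega>(2) p t(1)]) (rule t(2))
  ultimately show ?thesis unfolding inverse_metric_def by (simp only: bullet_inner_flat[OF p s(1) t(1)])
qed

text \<open>Near each point the inverse metric equals the sum of \<omega>(w_i) \<tau>(v_i) over a
  dual system that is spanning on a neighbourhood.\<close>

lemma inverse_metric_smooth:
  assumes \<omega>: "tensor_form \<omega>" "tensor_form \<tau>"
  shows "inverse_metric M g \<omega> \<tau> \<in> smooth_funs M"
proof (rule smooth_funs_local)
  fix p assume p: "p \<in> points M"
  then have "p \<in> regular_points M g" using all_regular by simp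
  then obtain N r v w where pN: "p \<in> N" and Q: "dual_fields N r v w" and s: "\<forall>q\<in>N. spanning_fields q r v w"
    by (elim exE conjE spanning_near_regular[elim_format])
  note * = dual_fieldsD(1)[OF Q] pN dual_fieldsD(2,3,4)[OF Q] s[unfolded spanning_fields_def, rule_format]
  have "inverse_metric M g \<omega> \<tau> q = (\<Sum>i<r. \<omega> (w i) q * \<tau> (v i) q)" if q: "q \<in> N" for q
  proof -
    have qM: "q \<in> points M" using q openin_subset[OF *(1)] by blast
    obtain s where s: "s \<in> tangent_space M q" "\<And>Z. Z \<in> vector_fields M \<Longrightarrow> \<omega> Z q = g q s (Z q)"
      using sharp_ex[OF qM \<omega>(1)] by blast
    obtain t where t: "t \<in> tangent_space M q" "\<And>Z. Z \<in> vector_fields M \<Longrightarrow> \<tau> Z q = g q t (Z q)"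
      using sharp_ex[OF qM \<omega>(2)] by blast
    have "g q s t = (\<Sum>i<r. g q s (w i q) * g q (v i q) t)"
      using *(6)[OF q] s(1) t(1) by (simp add: spanning_def)
    also have "\<dots> = (\<Sum>i<r. \<omega> (w i) q * \<tau> (v i) q)"
    proof (rule sum.cong[OF refl])
      fix i assume "i \<in> {..<r}"
      then have i: "v i \<in> vector_fields M" "w i \<in> vector_fields M" using *(3,4) by auto
      show "g q s (w i q) * g q (v i q) t = \<omega> (w i) q * \<tau> (v i) q"
        unfolding s(2)[OF i(2)] t(2)[OF i(1)] g_sym[OF qM t(1) vector_fieldsD[OF i(1) qM]] by (rule refl)
    qed
    finally show ?thesis using inverse_metric_eq[OF qM \<omega> s t] by simp
  qed
  moreover have "(\<lambda>q. \<Sum>i<r. \<omega> (w i) q * \<tau> (v i) q) \<in> smooth_funs M"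
    using *(3,4) \<omega> tensor_form_smooth by (auto intro!: smooth_funs_sum smooth_funs_mult)
  ultimately show "\<exists>N h. openin (mtop M) N \<and> p \<in> N \<and> h \<in> smooth_funs M \<and> (\<forall>q\<in>N. inverse_metric M g \<omega> \<tau> q = h q)"
    using *(1,2) by blast
qed

lemma contraction_nondegenerate:
  assumes "tensor_form \<omega>" "tensor_form \<tau>" "p \<in> points M"
  shows "contraction M g \<omega> \<tau> p = inverse_metric M g \<omega> \<tau> p"
proof (rule contraction_eq[OF _ assms(3)])
  show "extends_contraction M g \<omega> \<tau> (inverse_metric M g \<omega> \<tau>)"
    unfolding extends_contraction_def
    by (rule conjI[OF inverse_metric_smooth[OF assms(1,2)]]) (simp add: inverse_metric_def)
qed

end

lemma nondegenerate_semi_riemannian_imp: "nondegenerate_semi_riemannian M g \<Longrightarrow> nondegenerate M g"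
  unfolding nondegenerate_semi_riemannian_def nondegenerate_def nondegenerate_axioms_def
  using singular_semi_riem by blast

section \<open>Products of manifolds\<close>

lemma (in manifold) chart_inv_continuous:
  assumes "(U, \<phi>) \<in> atlas M"
  shows "continuous_map (subtopology (powertop_real (coords M)) (\<phi> ` U)) (mtop M) (inv_into U \<phi>)"
proof -
  obtain \<psi> where h: "homeomorphic_maps (subtopology (mtop M) U) (subtopology (powertop_real (coords M)) (\<phi> ` U)) \<phi> \<psi>"
    using chart_homeo[OF assms] homeomorphic_map_maps by blast
  then have c: "continuous_map (subtopology (powertop_real (coords M)) (\<phi> ` U)) (mtop M) \<psi>"
    by (simp add: homeomorphic_maps_def continuous_map_in_subtopology)
  have "\<psi> (\<phi> q) = q" if "q \<in> U" for q
    using h that chart_points[OF assms] by (auto simp: homeomorphic_maps_def)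
  then show ?thesis
    by (intro continuous_map_eq[OF c]) (use assms in auto)
qed

section \<open>Charts of the product\<close>

definition base_coords :: "'k set \<Rightarrow> ('k + 'i \<times> 'l \<Rightarrow> real) \<Rightarrow> 'k \<Rightarrow> real" where
  "base_coords I z = (\<lambda>k\<in>I. z (Inl k))"

definition fibre_coords :: "('i \<Rightarrow> 'l set) \<Rightarrow> 'i \<Rightarrow> ('k + 'i \<times> 'l \<Rightarrow> real) \<Rightarrow> 'l \<Rightarrow> real" where
  "fibre_coords J j z = (\<lambda>k\<in>J j. z (Inr (j, k)))"

locale manifold_product = B: manifold B for B :: "('b, 'k) mfd" +
  fixes F :: "'i::finite \<Rightarrow> ('f, 'l) mfd"
  assumes fib: "\<And>j. manifold (F j)"
begin

abbreviation PM where "PM \<equiv> product_mfd B F"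
abbreviation rB where "rB \<equiv> base_coords (coords B)"
abbreviation rF where "rF \<equiv> fibre_coords (\<lambda>j. coords (F j))"

lemma coords_PM: "coords PM = coords B <+> (SIGMA j:UNIV. coords (F j))"
  and mtop_PM: "mtop PM = prod_topology (mtop B) (product_topology (\<lambda>j. mtop (F j)) UNIV)"
  by (simp_all add: product_mfd_def)

lemma points_PM: "points PM = {(x, y). x \<in> points B \<and> (\<forall>j. y j \<in> points (F j))}"
  by (auto simp: mtop_PM)

lemma points_PM_iff [simp]: "(x, y) \<in> points PM \<longleftrightarrow> x \<in> points B \<and> (\<forall>j. y j \<in> points (F j))"
  by (simp add: points_PM)

lemma finite_coords_PM: "finite (coords PM)"
  unfolding coords_PM using B.fin_coords manifold.fin_coords[OF fib] by auto

lemma Inl_coords [simp]: "Inl k \<in> coords PM \<longleftrightarrow> k \<in> coords B"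
  by (auto simp: coords_PM)

lemma Inr_coords [simp]: "Inr (j, k) \<in> coords PM \<longleftrightarrow> k \<in> coords (F j)"
  by (auto simp: coords_PM)

lemma fst_continuous: "continuous_map (mtop PM) (mtop B) fst"
  by (simp add: mtop_PM continuous_map_fst)

lemma snd_continuous: "continuous_map (mtop PM) (mtop (F j)) (\<lambda>p. snd p j)"
  using continuous_map_compose[OF continuous_map_snd continuous_map_product_projection, of j UNIV "mtop B" "\<lambda>j. mtop (F j)"]
  by (simp add: mtop_PM o_def)

lemma slice_base_continuous:
  assumes "(x, y) \<in> points PM"
  shows "continuous_map (mtop B) (mtop PM) (\<lambda>x'. (x', y))"
  using assms unfolding mtop_PM by (auto simp: continuous_map_pairedI continuous_map_componentwise_UNIV continuous_map_const)

lemma slice_fibre_continuous: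
  assumes "(x, y) \<in> points PM"
  shows "continuous_map (mtop (F j)) (mtop PM) (\<lambda>z. (x, y(j := z)))"
proof -
  have "continuous_map (mtop (F j)) (mtop (F k)) (\<lambda>z. (y(j := z)) k)" for k
    using assms by (cases "k = j") auto
  then show ?thesis
    using assms unfolding mtop_PM by (intro continuous_map_pairedI) (auto simp: continuous_map_componentwise_UNIV simp del: fun_upd_apply)
qed

end

locale prod_chart = manifold_product +
  fixes U \<phi> V \<psi>
  assumes U: "(U, \<phi>) \<in> atlas B" and V: "\<And>j. (V j, \<psi> j) \<in> atlas (F j)"
begin

definition W where "W = U \<times> {y. \<forall>j. y j \<in> V j}"
definition \<Phi> where "\<Phi> = product_chart (coords B) (\<lambda>j. coords (F j)) \<phi> \<psi>"

lemma chart_mem: "(W, \<Phi>) \<in> atlas PM"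
  unfolding W_def \<Phi>_def product_mfd_def using U V by auto

lemma W_iff: "(x, y) \<in> W \<longleftrightarrow> x \<in> U \<and> (\<forall>j. y j \<in> V j)"
  by (auto simp: W_def)

lemma W_points: "W \<subseteq> points PM"
  using B.chart_points[OF U] manifold.chart_points[OF fib V] by (fastforce simp: W_def points_PM)

lemma \<Phi>_Inl: "k \<in> coords B \<Longrightarrow> \<Phi> (x, y) (Inl k) = \<phi> x k"
  by (auto simp: \<Phi>_def product_chart_def coords_PM)

lemma \<Phi>_Inr: "k \<in> coords (F j) \<Longrightarrow> \<Phi> (x, y) (Inr (j, k)) = \<psi> j (y j) k"
  and \<Phi>_ext: "\<Phi> (x, y) \<in> extensional (coords PM)"
  by (auto simp: \<Phi>_def product_chart_def coords_PM)

lemma rB_\<Phi>: "x \<in> U \<Longrightarrow> rB (\<Phi> (x, y)) = \<phi> x"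
  using B.chart_ext[OF U] by (auto simp: base_coords_def \<Phi>_Inl extensional_def)

lemma rF_\<Phi>: "y j \<in> V j \<Longrightarrow> rF j (\<Phi> (x, y)) = \<psi> j (y j)"
  using manifold.chart_ext[OF fib V] by (auto simp: fibre_coords_def \<Phi>_Inr extensional_def)

lemma ext_eqI:
  assumes "z \<in> extensional (coords PM)" "z' \<in> extensional (coords PM)" "rB z = rB z'" "\<And>j. rF j z = rF j z'"
  shows "z = z'"
proof (rule extensionalityI[OF assms(1,2)])
  fix c assume c: "c \<in> coords PM"
  show "z c = z' c"
  proof (cases c)
    case (Inl k)
    then show ?thesis using c fun_cong[OF assms(3), of k] by (simp add: base_coords_def)
  next
    case (Inr d)
    then obtain j k where "c = Inr (j, k)" by (cases d) auto
    then show ?thesis using c fun_cong[OF assms(4)[of j], of k] by (simp add: fibre_coords_def)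
  qed
qed

lemma \<Phi>_image: "\<Phi> ` W = {z \<in> extensional (coords PM). rB z \<in> \<phi> ` U \<and> (\<forall>j. rF j z \<in> \<psi> j ` V j)}"
proof (intro equalityI subsetI)
  fix z assume "z \<in> \<Phi> ` W"
  then obtain x y where "z = \<Phi> (x, y)" "x \<in> U" "\<And>j. y j \<in> V j" by (auto simp: W_def)
  then show "z \<in> {z \<in> extensional (coords PM). rB z \<in> \<phi> ` U \<and> (\<forall>j. rF j z \<in> \<psi> j ` V j)}"
    by (simp add: rB_\<Phi> rF_\<Phi> \<Phi>_ext)
next
  fix z assume z: "z \<in> {z \<in> extensional (coords PM). rB z \<in> \<phi> ` U \<and> (\<forall>j. rF j z \<in> \<psi> j ` V j)}"
  then obtain x where x: "x \<in> U" "rB z = \<phi> x" by auto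
  from z have "\<forall>j. \<exists>w. w \<in> V j \<and> rF j z = \<psi> j w" by blast
  then obtain y where y: "\<And>j. y j \<in> V j" "\<And>j. rF j z = \<psi> j (y j)" by metis
  have "z = \<Phi> (x, y)"
    by (rule ext_eqI) (use z x y in \<open>auto simp: \<Phi>_ext rB_\<Phi> rF_\<Phi>\<close>)
  then show "z \<in> \<Phi> ` W" using x(1) y(1) by (auto simp: W_def)
qed

lemma \<Phi>_inj: "inj_on \<Phi> W"
proof (rule inj_onI, clarify)
  fix x y x' y' assume a: "(x, y) \<in> W" "(x', y') \<in> W" "\<Phi> (x, y) = \<Phi> (x', y')"
  then have m: "x \<in> U" "x' \<in> U" "\<And>j. y j \<in> V j" "\<And>j. y' j \<in> V j" by (auto simp: W_def)
  have 1: "\<phi> x = \<phi> x'"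
    using arg_cong[OF a(3), of rB] by (simp only: rB_\<Phi>[OF m(1)] rB_\<Phi>[OF m(2)])
  have 2: "\<psi> j (y j) = \<psi> j (y' j)" for j
    using arg_cong[OF a(3), of "rF j"] by (simp only: rF_\<Phi>[where y=y, OF m(3)] rF_\<Phi>[where y=y', OF m(4)])
  have "y j = y' j" for j
    by (rule inj_onD[OF manifold.chart_inj[OF fib V] 2 m(3,4)])
  then show "x = x' \<and> y = y'"
    using inj_onD[OF B.chart_inj[OF U] 1 m(1,2)] by (simp add: fun_eq_iff)
qed

lemma inv_\<Phi> [simp]: "q \<in> W \<Longrightarrow> inv_into W \<Phi> (\<Phi> q) = q"
  by (simp add: \<Phi>_inj)

lemma inv_\<Phi>_eq:
  assumes "z \<in> \<Phi> ` W"
  shows "inv_into W \<Phi> z = (inv_into U \<phi> (rB z), \<lambda>j. inv_into (V j) (\<psi> j) (rF j z))"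
proof -
  obtain x y where q: "(x, y) \<in> W" "z = \<Phi> (x, y)" using assms by auto
  then have m: "x \<in> U" "\<And>j. y j \<in> V j" by (auto simp: W_iff)
  have "(\<lambda>j. inv_into (V j) (\<psi> j) (rF j (\<Phi> (x, y)))) = y"
    by (rule ext) (simp only: rF_\<Phi>[where y=y, OF m(2)] manifold.chart_inv[OF fib V m(2)])
  then show ?thesis
    unfolding q(2) inv_\<Phi>[OF q(1)] by (simp add: rB_\<Phi>[OF m(1)] B.chart_inv[OF U m(1)])
qed

lemma rB_continuous: "continuous_map (powertop_real (coords PM)) (powertop_real (coords B)) rB"
  unfolding continuous_map_componentwise base_coords_def
  by (auto intro!: continuous_map_product_coordinates)

lemma rF_continuous: "continuous_map (powertop_real (coords PM)) (powertop_real (coords (F j))) (rF j)"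
  unfolding continuous_map_componentwise fibre_coords_def
  by (auto intro!: continuous_map_product_coordinates)

lemma W_open: "openin (mtop PM) W"
proof -
  have "W = U \<times> PiE UNIV V" by (auto simp: W_def)
  moreover have "openin (product_topology (\<lambda>j. mtop (F j)) UNIV) (PiE UNIV V)"
    using manifold.chart_open[OF fib V] by (simp add: openin_PiE_gen)
  ultimately show ?thesis
    unfolding mtop_PM using B.chart_open[OF U] by (simp add: openin_prod_Times_iff)
qed

lemma \<Phi>_image_open: "openin (powertop_real (coords PM)) (\<Phi> ` W)"
proof -
  let ?T = "topspace (powertop_real (coords PM))"
  have "\<Phi> ` W = {z \<in> ?T. rB z \<in> \<phi> ` U} \<inter> (\<Inter>j\<in>UNIV. {z \<in> ?T. rF j z \<in> \<psi> j ` V j})"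
    unfolding \<Phi>_image by (auto simp: PiE_def)
  moreover have "openin (powertop_real (coords PM)) {z \<in> ?T. rB z \<in> \<phi> ` U}"
    by (rule openin_continuous_map_preimage[OF rB_continuous B.chart_image_open[OF U]])
  moreover have "openin (powertop_real (coords PM)) {z \<in> ?T. rF j z \<in> \<psi> j ` V j}" for j
    by (rule openin_continuous_map_preimage[OF rF_continuous manifold.chart_image_open[OF fib V]])
  ultimately show ?thesis by (auto intro!: openin_Int openin_INT2)
qed

lemma \<Phi>_homeo: "homeomorphic_map (subtopology (mtop PM) W) (subtopology (powertop_real (coords PM)) (\<Phi> ` W)) \<Phi>"
proof -
  have tW: "topspace (subtopology (mtop PM) W) = W" using W_points by auto
  have tI: "topspace (subtopology (powertop_real (coords PM)) (\<Phi> ` W)) = \<Phi> ` W"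
    using openin_subset[OF \<Phi>_image_open] by auto
  have cf: "continuous_map (subtopology (mtop PM) W) (powertop_real (coords PM)) \<Phi>"
    unfolding continuous_map_componentwise tW
  proof (intro conjI ballI)
    show "\<Phi> ` W \<subseteq> extensional (coords PM)" using \<Phi>_ext by auto
    fix c assume c: "c \<in> coords PM"
    show "continuous_map (subtopology (mtop PM) W) euclideanreal (\<lambda>p. \<Phi> p c)"
    proof (cases c)
      case (Inl k)
      have 1: "continuous_map (subtopology (mtop PM) W) (subtopology (mtop B) U) fst"
        unfolding continuous_map_in_subtopology tW
        by (auto intro!: continuous_map_from_subtopology fst_continuous simp: W_def)
      have "continuous_map (subtopology (mtop B) U) (powertop_real (coords B)) \<phi>"
        using homeomorphic_imp_continuous_map[OF B.chart_homeo[OF U]] by (simp add: continuous_map_in_subtopology)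
      then have 2: "continuous_map (subtopology (mtop B) U) euclideanreal (\<lambda>x. \<phi> x k)"
        using c Inl unfolding continuous_map_componentwise by auto
      show ?thesis
        by (rule continuous_map_eq[OF continuous_map_compose[OF 1 2]]) (use c Inl in \<open>auto simp: \<Phi>_Inl\<close>)
    next
      case (Inr d)
      obtain j k where d: "d = (j, k)" by (cases d) auto
      have 1: "continuous_map (subtopology (mtop PM) W) (subtopology (mtop (F j)) (V j)) (\<lambda>p. snd p j)"
        unfolding continuous_map_in_subtopology tW
        by (auto intro!: continuous_map_from_subtopology snd_continuous simp: W_def)
      have "continuous_map (subtopology (mtop (F j)) (V j)) (powertop_real (coords (F j))) (\<psi> j)"
        using homeomorphic_imp_continuous_map[OF manifold.chart_homeo[OF fib V]] by (simp add: continuous_map_in_subtopology)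
      then have 2: "continuous_map (subtopology (mtop (F j)) (V j)) euclideanreal (\<lambda>x. \<psi> j x k)"
        using c Inr d unfolding continuous_map_componentwise by auto
      show ?thesis
        by (rule continuous_map_eq[OF continuous_map_compose[OF 1 2]]) (use c Inr d in \<open>auto simp: \<Phi>_Inr\<close>)
    qed
  qed
  have "continuous_map (subtopology (powertop_real (coords PM)) (\<Phi> ` W)) (mtop PM) (inv_into W \<Phi>)"
  proof (rule continuous_map_eq)
    let ?S = "subtopology (powertop_real (coords PM)) (\<Phi> ` W)"
    have 1: "continuous_map ?S (subtopology (powertop_real (coords B)) (\<phi> ` U)) rB"
      unfolding continuous_map_in_subtopology tI
      by (auto intro!: continuous_map_from_subtopology rB_continuous simp: \<Phi>_image)
    have 2: "continuous_map ?S (subtopology (powertop_real (coords (F j))) (\<psi> j ` V j)) (rF j)" for j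
      unfolding continuous_map_in_subtopology tI
      by (auto intro!: continuous_map_from_subtopology rF_continuous simp: \<Phi>_image)
    show "continuous_map ?S (mtop PM) (\<lambda>z. (inv_into U \<phi> (rB z), \<lambda>j. inv_into (V j) (\<psi> j) (rF j z)))"
      unfolding mtop_PM
      using continuous_map_compose[OF 1 B.chart_inv_continuous[OF U]]
        continuous_map_compose[OF 2 manifold.chart_inv_continuous[OF fib V]]
      by (intro continuous_map_pairedI) (auto simp: continuous_map_componentwise_UNIV o_def)
  qed (simp add: tI inv_\<Phi>_eq)
  then have cg: "continuous_map (subtopology (powertop_real (coords PM)) (\<Phi> ` W)) (subtopology (mtop PM) W) (inv_into W \<Phi>)"
    unfolding continuous_map_in_subtopology tI by (auto simp: inv_into_into)
  show ?thesis
    unfolding homeomorphic_map_maps homeomorphic_maps_def tW tI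
    using cf cg by (intro exI[of _ "inv_into W \<Phi>"]) (auto simp: continuous_map_in_subtopology tW f_inv_into_f)
qed

lemma smooth_on_base_coords:
  assumes "openin (powertop_real (coords B)) S" "openin (powertop_real (coords PM)) T" "\<And>z. z \<in> T \<Longrightarrow> rB z \<in> S" "smooth_on (coords B) S u"
  shows "smooth_on (coords PM) T (\<lambda>z. u (rB z))"
  using smooth_on_compose[OF B.fin_coords assms(1,2), of "\<lambda>k z. z (Inl k)"] assms(3,4) smooth_on_coord[OF assms(2)]
  unfolding base_coords_def by simp

lemma smooth_on_fibre_coords:
  assumes "openin (powertop_real (coords (F j))) S" "openin (powertop_real (coords PM)) T" "\<And>z. z \<in> T \<Longrightarrow> rF j z \<in> S" "smooth_on (coords (F j)) S u"
  shows "smooth_on (coords PM) T (\<lambda>z. u (rF j z))"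
  using smooth_on_compose[OF manifold.fin_coords[OF fib] assms(1,2), of "\<lambda>k z. z (Inr (j, k))"] assms(3,4) smooth_on_coord[OF assms(2)]
  unfolding fibre_coords_def by simp

lemma rB_upd_Inl: "k \<in> coords B \<Longrightarrow> rB (z(Inl k := t)) = (rB z)(k := t)"
  and rF_upd_Inl: "rF j (z(Inl k := t)) = rF j z"
  and rB_upd_Inr: "rB (z(Inr (i, m) := t)) = rB z"
  and rF_upd_Inr: "m \<in> coords (F i) \<Longrightarrow> rF j (z(Inr (i, m) := t)) = (if j = i then (rF i z)(m := t) else rF j z)"
  by (auto simp: base_coords_def fibre_coords_def fun_eq_iff)

text \<open>Varying the coordinate \<open>Inl k\<close> in a product chart moves only the base
  point, so both sides are derivatives of functions of t that agree near the point. This links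
  derivations of the base to those of the product.\<close>

lemma partial_slice_base:
  assumes q: "(x, y) \<in> W" and k: "k \<in> coords B"
  shows "partial_deriv k (\<lambda>x'. f (inv_into U \<phi> x', y)) (\<phi> x) = partial_deriv (Inl k) (\<lambda>z. f (inv_into W \<Phi> z)) (\<Phi> (x, y))"
proof -
  have xy: "x \<in> U" "\<And>j. y j \<in> V j" using q by (auto simp: W_def)
  have "\<forall>\<^sub>F t in nhds (\<Phi> (x, y) (Inl k)). (\<Phi> (x, y))(Inl k := t) \<in> \<Phi> ` W"
    by (rule eventually_upd[OF \<Phi>_image_open]) (use k q in auto)
  then have "\<forall>\<^sub>F t in nhds (\<phi> x k). f (inv_into U \<phi> ((\<phi> x)(k := t)), y) = f (inv_into W \<Phi> ((\<Phi> (x, y))(Inl k := t)))"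
    unfolding \<Phi>_Inl[OF k]
  proof eventually_elim
    case (elim t)
    have "(\<lambda>j. inv_into (V j) (\<psi> j) (\<psi> j (y j))) = y" using manifold.chart_inv[OF fib V] xy by auto
    then show ?case
      unfolding inv_\<Phi>_eq[OF elim] using k xy by (simp add: rB_upd_Inl rF_upd_Inl rB_\<Phi> rF_\<Phi>)
  qed
  then show ?thesis unfolding partial_deriv_def \<Phi>_Inl[OF k] by (rule deriv_cong_ev) simp
qed

lemma partial_slice_fibre:
  assumes q: "(x, y) \<in> W" and k: "k \<in> coords (F j)"
  shows "partial_deriv k (\<lambda>z. f (x, y(j := inv_into (V j) (\<psi> j) z))) (\<psi> j (y j)) = partial_deriv (Inr (j, k)) (\<lambda>z. f (inv_into W \<Phi> z)) (\<Phi> (x, y))"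
proof -
  have xy: "x \<in> U" "\<And>j. y j \<in> V j" using q by (auto simp: W_def)
  have "\<forall>\<^sub>F t in nhds (\<Phi> (x, y) (Inr (j, k))). (\<Phi> (x, y))(Inr (j, k) := t) \<in> \<Phi> ` W"
    by (rule eventually_upd[OF \<Phi>_image_open]) (use k q in auto)
  then have "\<forall>\<^sub>F t in nhds (\<psi> j (y j) k). f (x, y(j := inv_into (V j) (\<psi> j) ((\<psi> j (y j))(k := t)))) = f (inv_into W \<Phi> ((\<Phi> (x, y))(Inr (j, k) := t)))"
    unfolding \<Phi>_Inr[OF k]
  proof eventually_elim
    case (elim t)
    have rf: "rF i (\<Phi> (x, y)) = \<psi> i (y i)" for i by (rule rF_\<Phi>[where y=y, OF xy(2)])
    have "(\<lambda>i. inv_into (V i) (\<psi> i) (rF i ((\<Phi> (x, y))(Inr (j, k) := t)))) = y(j := inv_into (V j) (\<psi> j) ((\<psi> j (y j))(k := t)))"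
      using manifold.chart_inv[OF fib V] xy by (auto simp: rF_upd_Inr[OF k] rf)
    then show ?case
      unfolding inv_\<Phi>_eq[OF elim] using xy U by (simp add: rB_upd_Inr rB_\<Phi>)
  qed
  then show ?thesis unfolding partial_deriv_def \<Phi>_Inr[OF k] by (rule deriv_cong_ev) simp
qed

lemma rB_image: "z \<in> \<Phi> ` W \<Longrightarrow> rB z \<in> \<phi> ` U"
  and rF_image: "z \<in> \<Phi> ` W \<Longrightarrow> rF j z \<in> \<psi> j ` V j"
  using \<Phi>_image by blast+

lemma pullback_base_chart:
  assumes "f \<in> smooth_funs B"
  shows "smooth_on (coords PM) (\<Phi> ` W) (\<lambda>z. f (fst (inv_into W \<Phi> z)))"
  by (rule smooth_on_cong[OF \<Phi>_image_open _ smooth_on_base_coords[OF B.chart_image_open[OF U] \<Phi>_image_open rB_image B.smooth_funs_chart[OF assms U]]])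
     (simp_all only: inv_\<Phi>_eq fst_conv)

lemma pullback_fibre_chart:
  assumes "f \<in> smooth_funs (F j)"
  shows "smooth_on (coords PM) (\<Phi> ` W) (\<lambda>z. f (snd (inv_into W \<Phi> z) j))"
  by (rule smooth_on_cong[OF \<Phi>_image_open _ smooth_on_fibre_coords[OF manifold.chart_image_open[OF fib V] \<Phi>_image_open rF_image manifold.smooth_funs_chart[OF fib assms V]]])
     (simp_all only: inv_\<Phi>_eq snd_conv)

end

context manifold_product
begin

lemma atlas_PM:
  assumes "(W, \<Phi>) \<in> atlas PM"
  obtains U \<phi> V \<psi> where "prod_chart B F U \<phi> V \<psi>" "W = prod_chart.W U V" "\<Phi> = prod_chart.\<Phi> B F \<phi> \<psi>"
proof -
  obtain U \<phi> V \<psi> where *: "W = U \<times> {y. \<forall>j. y j \<in> V j}" "\<Phi> = product_chart (coords B) (\<lambda>j. coords (F j)) \<phi> \<psi>"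
    "(U, \<phi>) \<in> atlas B" "\<And>j. (V j, \<psi> j) \<in> atlas (F j)"
    using assms unfolding product_mfd_def by auto
  interpret prod_chart B F U \<phi> V \<psi> by unfold_locales (use * in auto)
  show ?thesis by (rule that[of U \<phi> V \<psi>]) (use * W_def \<Phi>_def prod_chart_axioms in auto)
qed

lemma prod_chart_at:
  assumes "(x, y) \<in> points PM"
  obtains U \<phi> V \<psi> where "prod_chart B F U \<phi> V \<psi>" "(x, y) \<in> prod_chart.W U V"
proof -
  obtain U \<phi> where U: "(U, \<phi>) \<in> atlas B" "x \<in> U" using B.chart_at[of x] assms unfolding points_PM_iff by blast
  have "\<forall>j. \<exists>V \<psi>. (V, \<psi>) \<in> atlas (F j) \<and> y j \<in> V" using manifold.chart_at[OF fib] assms by auto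
  then obtain V \<psi> where V: "\<And>j. (V j, \<psi> j) \<in> atlas (F j) \<and> y j \<in> V j" by metis
  have *: "prod_chart B F U \<phi> V \<psi>" by unfold_locales (use U V in auto)
  moreover have "(x, y) \<in> prod_chart.W U V" using prod_chart.W_iff[OF *] U V by simp
  ultimately show ?thesis by (rule that)
qed

lemma manifold_PM: "manifold PM"
proof
  show "finite (coords PM)" by (rule finite_coords_PM)
  show "Hausdorff_space (mtop PM)"
    unfolding mtop_PM using B.haus manifold.haus[OF fib]
    by (simp add: Hausdorff_space_prod_topology Hausdorff_space_product_topology)
  show "openin (mtop PM) W \<and> openin (powertop_real (coords PM)) (\<Phi> ` W) \<and>
      homeomorphic_map (subtopology (mtop PM) W) (subtopology (powertop_real (coords PM)) (\<Phi> ` W)) \<Phi>"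
    if a: "(W, \<Phi>) \<in> atlas PM" for W \<Phi>
  proof -
    obtain U \<phi> V \<psi> where *: "prod_chart B F U \<phi> V \<psi>" "W = prod_chart.W U V" "\<Phi> = prod_chart.\<Phi> B F \<phi> \<psi>"
      by (rule atlas_PM[OF a])
    show ?thesis
      unfolding *(2,3) using prod_chart.W_open[OF *(1)] prod_chart.\<Phi>_image_open[OF *(1)] prod_chart.\<Phi>_homeo[OF *(1)] by blast
  qed
  show "(\<Union>(U, \<phi>) \<in> atlas PM. U) = points PM"
  proof (intro equalityI subsetI)
    fix p assume "p \<in> (\<Union>(U, \<phi>) \<in> atlas PM. U)"
    then obtain W \<Phi> where W: "(W, \<Phi>) \<in> atlas PM" "p \<in> W" by auto
    obtain U \<phi> V \<psi> where *: "prod_chart B F U \<phi> V \<psi>" "W = prod_chart.W U V" "\<Phi> = prod_chart.\<Phi> B F \<phi> \<psi>"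
      by (rule atlas_PM[OF W(1)])
    show "p \<in> points PM" using prod_chart.W_points[OF *(1)] W *(2) by blast
  next
    fix p assume "p \<in> points PM"
    then obtain x y where p: "p = (x, y)" "(x, y) \<in> points PM" by (cases p) auto
    obtain U \<phi> V \<psi> where *: "prod_chart B F U \<phi> V \<psi>" "(x, y) \<in> prod_chart.W U V"
      by (rule prod_chart_at[OF p(2)])
    then have "p \<in> prod_chart.W U V" using p by simp
    then show "p \<in> (\<Union>(U, \<phi>) \<in> atlas PM. U)" using prod_chart.chart_mem[OF *(1)] by blast
  qed
  fix W \<Phi> W' \<Phi>' c
  assume W: "(W, \<Phi>) \<in> atlas PM" and W': "(W', \<Phi>') \<in> atlas PM" and c: "c \<in> coords PM"
  obtain U \<phi> V \<psi> where 1: "prod_chart B F U \<phi> V \<psi>" "W = prod_chart.W U V" "\<Phi> = prod_chart.\<Phi> B F \<phi> \<psi>"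
    by (rule atlas_PM[OF W])
  obtain U' \<phi>' V' \<psi>' where 2: "prod_chart B F U' \<phi>' V' \<psi>'" "W' = prod_chart.W U' V'" "\<Phi>' = prod_chart.\<Phi> B F \<phi>' \<psi>'"
    by (rule atlas_PM[OF W'])
  interpret c1: prod_chart B F U \<phi> V \<psi> by (rule 1)
  interpret c2: prod_chart B F U' \<phi>' V' \<psi>' by (rule 2)
  define V12 where "V12 j = V j \<inter> V' j" for j
  let ?T = "\<Phi> ` (W \<inter> W')"
  have T: "openin (powertop_real (coords PM)) ?T"
  proof -
    have "openin (subtopology (mtop PM) W) (W \<inter> W')"
      unfolding 1 2 using c1.W_open c2.W_open by (simp add: openin_open_subtopology openin_Int)
    then have "openin (subtopology (powertop_real (coords PM)) (\<Phi> ` W)) ?T"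
      using homeomorphic_imp_open_map[OF c1.\<Phi>_homeo] unfolding 1 open_map_def by blast
    then show ?thesis unfolding 1 using openin_open_subtopology[OF c1.\<Phi>_image_open] by blast
  qed
  have Tz: "rB z \<in> \<phi> ` (U \<inter> U')" "rF j z \<in> \<psi> j ` (V j \<inter> V' j)" "z \<in> c1.\<Phi> ` c1.W" if z: "z \<in> ?T" for z j
  proof -
    obtain x y where q: "(x, y) \<in> W" "(x, y) \<in> W'" "z = \<Phi> (x, y)" using z by auto
    then show "rB z \<in> \<phi> ` (U \<inter> U')" "rF j z \<in> \<psi> j ` (V j \<inter> V' j)" "z \<in> c1.\<Phi> ` c1.W"
      unfolding 1 2 by (auto simp: c1.W_iff c2.W_iff c1.rB_\<Phi> c1.rF_\<Phi>)
  qed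
  \<comment> \<open>Each coordinate of the transition map involves a single factor and is a
    transition map of that factor, read in its own block of coordinates.\<close>
  show "smooth_on (coords PM) ?T (\<lambda>z. \<Phi>' (inv_into W \<Phi> z) c)"
  proof (cases c)
    case (Inl k)
    have k: "k \<in> coords B" using c Inl by simp
    have o: "openin (powertop_real (coords B)) (\<phi> ` (U \<inter> U'))"
      by (rule B.chart_image_openin[OF c1.U]) (use B.chart_open[OF c1.U] B.chart_open[OF c2.U] in auto)
    have "smooth_on (coords PM) ?T (\<lambda>z. \<phi>' (inv_into U \<phi> (rB z)) k)"
      by (rule c1.smooth_on_base_coords[OF o T Tz(1) B.transition[OF c1.U c2.U k]])
    then show ?thesis
      by (rule smooth_on_cong[OF T, rotated]) (use Tz(3) k in \<open>simp add: 1 2 Inl c1.inv_\<Phi>_eq c2.\<Phi>_Inl\<close>)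
  next
    case (Inr d)
    obtain j k where d: "d = (j, k)" by (cases d) auto
    have k: "k \<in> coords (F j)" using c Inr d by simp
    have o: "openin (powertop_real (coords (F j))) (\<psi> j ` (V j \<inter> V' j))"
      by (rule manifold.chart_image_openin[OF fib c1.V])
         (use manifold.chart_open[OF fib c1.V] manifold.chart_open[OF fib c2.V] in auto)
    have "smooth_on (coords PM) ?T (\<lambda>z. \<psi>' j (inv_into (V j) (\<psi> j) (rF j z)) k)"
      by (rule c1.smooth_on_fibre_coords[OF o T Tz(2) manifold.transition[OF fib c1.V c2.V k]])
    then show ?thesis
      by (rule smooth_on_cong[OF T, rotated]) (use Tz(3) k in \<open>simp add: 1 2 Inr d c1.inv_\<Phi>_eq c2.\<Phi>_Inr\<close>)
  qed
qed

sublocale P: manifold PM by (rule manifold_PM)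

lemma smooth_PM_base:
  assumes "f \<in> smooth_funs B"
  shows "(\<lambda>p. f (fst p)) \<in> smooth_funs PM"
  unfolding smooth_funs_def
proof (rule CollectI, clarify)
  fix W \<Phi> assume "(W, \<Phi>) \<in> atlas PM"
  then obtain U \<phi> V \<psi> where *: "prod_chart B F U \<phi> V \<psi>" "W = prod_chart.W U V" "\<Phi> = prod_chart.\<Phi> B F \<phi> \<psi>"
    by (rule atlas_PM)
  show "smooth_on (coords PM) (\<Phi> ` W) (\<lambda>z. f (fst (inv_into W \<Phi> z)))"
    unfolding *(2,3) by (rule prod_chart.pullback_base_chart[OF *(1) assms])
qed

lemma smooth_PM_fibre:
  assumes "f \<in> smooth_funs (F j)"
  shows "(\<lambda>p. f (snd p j)) \<in> smooth_funs PM"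
  unfolding smooth_funs_def
proof (rule CollectI, clarify)
  fix W \<Phi> assume "(W, \<Phi>) \<in> atlas PM"
  then obtain U \<phi> V \<psi> where *: "prod_chart B F U \<phi> V \<psi>" "W = prod_chart.W U V" "\<Phi> = prod_chart.\<Phi> B F \<phi> \<psi>"
    by (rule atlas_PM)
  show "smooth_on (coords PM) (\<Phi> ` W) (\<lambda>z. f (snd (inv_into W \<Phi> z) j))"
    unfolding *(2,3) by (rule prod_chart.pullback_fibre_chart[OF *(1) assms])
qed

lemma smooth_slice_base:
  assumes f: "f \<in> smooth_funs PM" and y: "\<And>j. y j \<in> points (F j)"
  shows "(\<lambda>x. f (x, y)) \<in> smooth_funs B"
  unfolding smooth_funs_def
proof (rule CollectI, clarify)
  fix U \<phi> assume U: "(U, \<phi>) \<in> atlas B"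
  have "\<forall>j. \<exists>V \<psi>. (V, \<psi>) \<in> atlas (F j) \<and> y j \<in> V" using manifold.chart_at[OF fib] y by auto
  then obtain V \<psi> where VV: "\<And>j. (V j, \<psi> j) \<in> atlas (F j)" "\<And>j. y j \<in> V j" by metis
  interpret prod_chart B F U \<phi> V \<psi> by unfold_locales (use U VV in auto)
  note o = B.chart_image_open[OF U]
  let ?g = "\<lambda>c x. case c of Inl k \<Rightarrow> x k | Inr (j, k) \<Rightarrow> \<psi> j (y j) k"
  have eq: "(\<lambda>c\<in>coords PM. ?g c (\<phi> x)) = \<Phi> (x, y)" for x
    by (auto simp: \<Phi>_def product_chart_def coords_PM fun_eq_iff split: sum.splits)
  have "smooth_on (coords B) (\<phi> ` U) (\<lambda>x. (\<lambda>z. f (inv_into W \<Phi> z)) (\<lambda>c\<in>coords PM. ?g c x))"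
  proof (rule smooth_on_compose[OF finite_coords_PM \<Phi>_image_open o _ _ P.smooth_funs_chart[OF f chart_mem]])
    show "(\<lambda>c\<in>coords PM. ?g c x) \<in> \<Phi> ` W" if "x \<in> \<phi> ` U" for x
      using that VV(2) eq by (auto simp: W_iff)
    show "smooth_on (coords B) (\<phi> ` U) (?g c)" if "c \<in> coords PM" for c
      using that by (cases c) (auto simp: coords_PM intro!: smooth_on_coord[OF o] smooth_on_const[OF o])
  qed
  then show "smooth_on (coords B) (\<phi> ` U) (\<lambda>x. f (inv_into U \<phi> x, y))"
    by (rule smooth_on_cong[OF o, rotated]) (use eq VV(2) U in \<open>auto simp: W_iff\<close>)
qed

lemma smooth_slice_fibre:
  assumes f: "f \<in> smooth_funs PM" and p: "(x, y) \<in> points PM"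
  shows "(\<lambda>z. f (x, y(j := z))) \<in> smooth_funs (F j)"
  unfolding smooth_funs_def
proof (rule CollectI, clarify)
  fix Vj \<psi>j assume Vj: "(Vj, \<psi>j) \<in> atlas (F j)"
  obtain U \<phi> where UU: "(U, \<phi>) \<in> atlas B" "x \<in> U" using B.chart_at[of x] p unfolding points_PM_iff by blast
  have "\<forall>i. \<exists>V \<psi>. (V, \<psi>) \<in> atlas (F i) \<and> y i \<in> V" using manifold.chart_at[OF fib] p by auto
  then obtain V0 \<psi>0 where V0: "\<And>i. (V0 i, \<psi>0 i) \<in> atlas (F i)" "\<And>i. y i \<in> V0 i" by metis
  \<comment> \<open>The j-th chart is the one under test; in the other fibres any charts around the
    fixed points will do.\<close>
  define V where "V = V0(j := Vj)"
  define \<psi> where "\<psi> = \<psi>0(j := \<psi>j)"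
  have VV: "(V i, \<psi> i) \<in> atlas (F i)" for i using V0 Vj by (auto simp: V_def \<psi>_def)
  interpret prod_chart B F U \<phi> V \<psi> by unfold_locales (use UU VV in auto)
  have o: "openin (powertop_real (coords (F j))) (\<psi>j ` Vj)" by (rule manifold.chart_image_open[OF fib Vj])
  let ?g = "\<lambda>c z. case c of Inl k \<Rightarrow> \<phi> x k | Inr (i, k) \<Rightarrow> (if i = j then z k else \<psi> i (y i) k)"
  have eq: "(\<lambda>c\<in>coords PM. ?g c (\<psi>j w)) = \<Phi> (x, y(j := w))" for w
    unfolding \<Phi>_def product_chart_def coords_PM by (auto simp: \<psi>_def fun_eq_iff split: sum.splits)
  have mW: "(x, y(j := w)) \<in> W" if "w \<in> Vj" for w
    unfolding W_iff using that UU(2) V0(2) by (auto simp: V_def)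
  have "smooth_on (coords (F j)) (\<psi>j ` Vj) (\<lambda>z. (\<lambda>z. f (inv_into W \<Phi> z)) (\<lambda>c\<in>coords PM. ?g c z))"
  proof (rule smooth_on_compose[OF finite_coords_PM \<Phi>_image_open o _ _ P.smooth_funs_chart[OF f chart_mem]])
    show "(\<lambda>c\<in>coords PM. ?g c z) \<in> \<Phi> ` W" if "z \<in> \<psi>j ` Vj" for z
      using that mW eq by auto
    show "smooth_on (coords (F j)) (\<psi>j ` Vj) (?g c)" if "c \<in> coords PM" for c
    proof (cases c)
      case (Inl k)
      then show ?thesis by (simp add: smooth_on_const[OF o])
    next
      case (Inr d)
      obtain i k where d: "d = (i, k)" by (cases d) auto
      then show ?thesis using that Inr
        by (cases "i = j") (auto intro!: smooth_on_coord[OF o] smooth_on_const[OF o])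
    qed
  qed
  then show "smooth_on (coords (F j)) (\<psi>j ` Vj) (\<lambda>z. f (x, y(j := inv_into Vj \<psi>j z)))"
    by (rule smooth_on_cong[OF o, rotated]) (use eq mW manifold.chart_inv[OF fib Vj] in auto)
qed

end

section \<open>Pulling back a metric along a projection\<close>

lemma pushforward_tangent:
  assumes "manifold N" "v \<in> tangent_space M p" "\<And>f. f \<in> smooth_funs N \<Longrightarrow> (\<lambda>q. f (h q)) \<in> smooth_funs M"
  shows "pushforward N h v \<in> tangent_space N (h p)"
  using assms(2,3) unfolding tangent_space_def pushforward_def
  by (auto simp: manifold.smooth_funs_add[OF assms(1)] manifold.smooth_funs_mult[OF assms(1)]
      manifold.smooth_funs_const[OF assms(1)])

lemma pushforward_plus: "pushforward N h (\<lambda>f. u f + v f) = (\<lambda>f. pushforward N h u f + pushforward N h v f)"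
  and pushforward_scale: "pushforward N h (\<lambda>f. c * u f) = (\<lambda>f. c * pushforward N h u f)"
  by (auto simp: pushforward_def)

text \<open>The pushed forward vectors along \<pi> are not values of a vector field on N. In a local
  frame of N their components are X applied to the pulled back coordinates, and these, as well as
  the pulled back metric coefficients, are smooth on M.\<close>

lemma pullback_metric_smooth:
  assumes M: "manifold M" and N: "semi_riem N g" and \<pi>: "continuous_map (mtop M) (mtop N) \<pi>"
    and sm: "\<And>f. f \<in> smooth_funs N \<Longrightarrow> (\<lambda>q. f (\<pi> q)) \<in> smooth_funs M"
    and X: "X \<in> vector_fields M" and Y: "Y \<in> vector_fields M"
  shows "(\<lambda>q. g (\<pi> q) (pushforward N \<pi> (X q)) (pushforward N \<pi> (Y q))) \<in> smooth_funs M"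
proof (rule manifold.smooth_funs_local[OF M])
  interpret M: manifold M by (rule M)
  interpret N: semi_riem N g by (rule N)
  fix p assume p: "p \<in> points M"
  have \<pi>p: "\<pi> q \<in> points N" if "q \<in> points M" for q
    using \<pi> that by (auto simp: continuous_map_def)
  obtain S \<xi> E where S: "openin (mtop N) S" "\<pi> p \<in> S" and \<xi>: "\<And>i. i \<in> coords N \<Longrightarrow> \<xi> i \<in> smooth_funs N"
    and E: "\<And>i. i \<in> coords N \<Longrightarrow> E i \<in> vector_fields N"
    and f: "\<And>q v. q \<in> S \<Longrightarrow> v \<in> tangent_space N q \<Longrightarrow> v = (\<lambda>f. \<Sum>i\<in>coords N. v (\<xi> i) * E i q f)"
    by (rule N.local_frame[OF \<pi>p[OF p]]) (rule that)
  let ?a = "\<lambda>X i q. dir_deriv X (\<lambda>q. \<xi> i (\<pi> q)) q"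
  let ?h = "\<lambda>q. \<Sum>i\<in>coords N. \<Sum>k\<in>coords N. ?a X i q * (?a Y k q * metric_fun g (E i) (E k) (\<pi> q))"
  have h: "?h \<in> smooth_funs M"
    by (intro M.smooth_funs_sum M.smooth_funs_mult M.vector_fields_smooth X Y sm \<xi> N.g_smooth E)
  have eq: "g (\<pi> q) (pushforward N \<pi> (X q)) (pushforward N \<pi> (Y q)) = ?h q" if q: "q \<in> points M" "\<pi> q \<in> S" for q
  proof -
    note \<pi>q = \<pi>p[OF q(1)]
    have ET: "E i (\<pi> q) \<in> tangent_space N (\<pi> q)" if "i \<in> coords N" for i using E[OF that] \<pi>q by (rule N.vector_fieldsD)
    have ex: "pushforward N \<pi> (X q) = (\<lambda>f. \<Sum>i\<in>coords N. ?a X i q * E i (\<pi> q) f)" if X: "X \<in> vector_fields M" for X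
    proof -
      have T: "pushforward N \<pi> (X q) \<in> tangent_space N (\<pi> q)"
        by (rule pushforward_tangent[OF N.manifold_axioms M.vector_fieldsD[OF X q(1)] sm])
      show ?thesis
      proof
        fix u
        have "pushforward N \<pi> (X q) u = (\<Sum>i\<in>coords N. pushforward N \<pi> (X q) (\<xi> i) * E i (\<pi> q) u)"
          by (rule fun_cong[OF f[OF q(2) T]])
        also have "\<dots> = (\<Sum>i\<in>coords N. ?a X i q * E i (\<pi> q) u)"
          by (rule sum.cong) (use \<xi> in \<open>auto simp: pushforward_def dir_deriv_def\<close>)
        finally show "pushforward N \<pi> (X q) u = (\<Sum>i\<in>coords N. ?a X i q * E i (\<pi> q) u)" .
      qed
    qed
    have LT: "(\<lambda>f. \<Sum>i\<in>coords N. ?a Y i q * E i (\<pi> q) f) \<in> tangent_space N (\<pi> q)"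
      by (rule N.tangent_lincomb[OF ET])
    have "g (\<pi> q) (\<lambda>f. \<Sum>i\<in>coords N. ?a X i q * E i (\<pi> q) f) (\<lambda>f. \<Sum>i\<in>coords N. ?a Y i q * E i (\<pi> q) f)
        = (\<Sum>i\<in>coords N. ?a X i q * g (\<pi> q) (E i (\<pi> q)) (\<lambda>f. \<Sum>i\<in>coords N. ?a Y i q * E i (\<pi> q) f))"
      by (rule N.g_lincomb[OF \<pi>q LT]) (rule ET)
    also have "\<dots> = (\<Sum>i\<in>coords N. ?a X i q * (\<Sum>k\<in>coords N. ?a Y k q * g (\<pi> q) (E i (\<pi> q)) (E k (\<pi> q))))"
    proof (rule sum.cong[OF refl])
      fix i assume i: "i \<in> coords N"
      have "g (\<pi> q) (E i (\<pi> q)) (\<lambda>f. \<Sum>k\<in>coords N. ?a Y k q * E k (\<pi> q) f)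
          = (\<Sum>k\<in>coords N. ?a Y k q * g (\<pi> q) (E i (\<pi> q)) (E k (\<pi> q)))"
        by (rule N.g_lincomb_right[OF \<pi>q ET[OF i]]) (rule ET)
      then show "?a X i q * g (\<pi> q) (E i (\<pi> q)) (\<lambda>f. \<Sum>i\<in>coords N. ?a Y i q * E i (\<pi> q) f)
          = ?a X i q * (\<Sum>k\<in>coords N. ?a Y k q * g (\<pi> q) (E i (\<pi> q)) (E k (\<pi> q)))" by (simp only:)
    qed
    finally show ?thesis
      unfolding ex[OF X] ex[OF Y] metric_fun_def sum_distrib_left .
  qed
  have "openin (mtop M) {q \<in> points M. \<pi> q \<in> S}" by (rule openin_continuous_map_preimage[OF \<pi> S(1)])
  then show "\<exists>S h. openin (mtop M) S \<and> p \<in> S \<and> h \<in> smooth_funs M \<and>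
      (\<forall>q\<in>S. g (\<pi> q) (pushforward N \<pi> (X q)) (pushforward N \<pi> (Y q)) = h q)"
    using h eq p S(2) by (intro exI[of _ "{q \<in> points M. \<pi> q \<in> S}"] exI[of _ ?h]) simp
qed

context manifold_product
begin

section \<open>Tangent spaces of the product and lifts\<close>

abbreviation dB where "dB v \<equiv> pushforward B fst v"
abbreviation dF where "dF j v \<equiv> pushforward (F j) (\<lambda>p. snd p j) v"

text \<open>The inverse of the isomorphism from the tangent space of the product to the direct sum
  of the tangent spaces of the factors.\<close>

definition join :: "'b \<Rightarrow> ('i \<Rightarrow> 'f) \<Rightarrow> 'b tvec \<Rightarrow> ('i \<Rightarrow> 'f tvec) \<Rightarrow> ('b \<times> ('i \<Rightarrow> 'f)) tvec" where
  "join x y a c = (\<lambda>f. if f \<in> smooth_funs PM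
     then a (\<lambda>x'. f (x', y)) + (\<Sum>j\<in>UNIV. c j (\<lambda>z. f (x, y(j := z)))) else 0)"

lemma dB_tangent: "v \<in> tangent_space PM (x, y) \<Longrightarrow> dB v \<in> tangent_space B x"
  using pushforward_tangent[OF B.manifold_axioms, of v PM "(x, y)" fst] smooth_PM_base by simp

lemma dF_tangent: "v \<in> tangent_space PM (x, y) \<Longrightarrow> dF j v \<in> tangent_space (F j) (y j)"
  using pushforward_tangent[OF fib, of v PM "(x, y)" j "\<lambda>p. snd p j"] smooth_PM_fibre by simp

lemma incl_base_tangent:
  assumes "(x, y) \<in> points PM" "a \<in> tangent_space B x"
  shows "pushforward PM (\<lambda>x'. (x', y)) a \<in> tangent_space PM (x, y)"
  by (rule pushforward_tangent[OF P.manifold_axioms assms(2)]) (use smooth_slice_base assms(1) in auto)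

lemma incl_fibre_tangent:
  assumes "(x, y) \<in> points PM" "c \<in> tangent_space (F j) (y j)"
  shows "pushforward PM (\<lambda>z. (x, y(j := z))) c \<in> tangent_space PM (x, y)"
  using pushforward_tangent[OF P.manifold_axioms assms(2), of "\<lambda>z. (x, y(j := z))"] smooth_slice_fibre[OF _ assms(1)] by simp

lemma join_tangent:
  assumes p: "(x, y) \<in> points PM" and a: "a \<in> tangent_space B x" and c: "\<And>j. c j \<in> tangent_space (F j) (y j)"
  shows "join x y a c \<in> tangent_space PM (x, y)"
proof -
  have "join x y a c = (\<lambda>f. pushforward PM (\<lambda>x'. (x', y)) a f + (\<Sum>j\<in>UNIV. 1 * pushforward PM (\<lambda>z. (x, y(j := z))) (c j) f))"
    by (auto simp: join_def pushforward_def)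
  also have "\<dots> \<in> tangent_space PM (x, y)"
    by (intro P.tangent_plus P.tangent_lincomb incl_base_tangent[OF p a] incl_fibre_tangent[OF p c])
  finally show ?thesis .
qed

lemma dB_join:
  assumes a: "a \<in> tangent_space B x" and c: "\<And>j. c j \<in> tangent_space (F j) (y j)"
  shows "dB (join x y a c) = a"
proof
  fix f show "dB (join x y a c) f = a f"
    using manifold.tangent_const[OF fib c] B.tangent_undef[OF a] by (auto simp: pushforward_def join_def smooth_PM_base)
qed

lemma dF_join:
  assumes a: "a \<in> tangent_space B x" and c: "\<And>j. c j \<in> tangent_space (F j) (y j)"
  shows "dF i (join x y a c) = c i"
proof
  fix f show "dF i (join x y a c) f = c i f"
  proof (cases "f \<in> smooth_funs (F i)")
    case True
    have "c j (\<lambda>z. f ((y(j := z)) i)) = (if j = i then c i f else 0)" for j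
      using manifold.tangent_const[OF fib c] by (cases "j = i") auto
    then have "(\<Sum>j\<in>UNIV. c j (\<lambda>z. f ((y(j := z)) i))) = c i f" by (simp del: fun_upd_apply)
    then show ?thesis using True B.tangent_const[OF a] by (simp add: pushforward_def join_def smooth_PM_fibre del: fun_upd_apply)
  qed (use manifold.tangent_undef[OF fib c] in \<open>simp add: pushforward_def\<close>)
qed

lemma sum_coords_PM:
  fixes h :: "'k + 'i \<times> 'l \<Rightarrow> real"
  shows "(\<Sum>c\<in>coords PM. h c) = (\<Sum>k\<in>coords B. h (Inl k)) + (\<Sum>j\<in>UNIV. \<Sum>k\<in>coords (F j). h (Inr (j, k)))"
proof -
  have "finite (SIGMA j:UNIV. coords (F j))" using manifold.fin_coords[OF fib] by auto
  then show ?thesis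
    unfolding coords_PM using B.fin_coords manifold.fin_coords[OF fib] by (simp add: sum.Plus sum.Sigma o_def case_prod_beta)
qed

text \<open>In a product chart v is a combination of partial derivatives. The base block and each
  fibre block can be recovered by letting the corresponding projection of v act on a slice of
  f.\<close>

lemma tangent_split:
  assumes p: "(x, y) \<in> points PM" and v: "v \<in> tangent_space PM (x, y)"
  shows "v = join x y (dB v) (\<lambda>j. dF j v)"
proof
  fix f
  show "v f = join x y (dB v) (\<lambda>j. dF j v) f"
  proof (cases "f \<in> smooth_funs PM")
    case f: True
    obtain U \<phi> V \<psi> where pc: "prod_chart B F U \<phi> V \<psi>" "(x, y) \<in> prod_chart.W U V"
      by (rule prod_chart_at[OF p])
    interpret prod_chart B F U \<phi> V \<psi> by (rule pc)
    note q = pc(2)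
    obtain \<gamma> where \<gamma>: "\<And>f. f \<in> smooth_funs PM \<Longrightarrow> v f = (\<Sum>c\<in>coords PM. \<gamma> c * partial_deriv c (\<lambda>z. f (inv_into W \<Phi> z)) (\<Phi> (x, y)))"
      using P.tangent_coord[OF chart_mem q v] by blast
    have const0: "partial_deriv k (\<lambda>z. d) w = 0" for k :: 'z and d w
      by (simp add: partial_deriv_def)
    have fB: "(\<lambda>x'. f (x', y)) \<in> smooth_funs B" using smooth_slice_base[OF f] p by simp
    have fF: "(\<lambda>z. f (x, y(j := z))) \<in> smooth_funs (F j)" for j by (rule smooth_slice_fibre[OF f p])
    let ?p = "\<lambda>c. partial_deriv c (\<lambda>z. f (inv_into W \<Phi> z)) (\<Phi> (x, y))"
    \<comment> \<open>The slice, pulled back by \<open>fst\<close>, has the same base derivatives as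
      f at the point, and its fibre derivatives vanish.\<close>
    have 1: "dB v (\<lambda>x'. f (x', y)) = (\<Sum>k\<in>coords B. \<gamma> (Inl k) * ?p (Inl k))"
    proof -
      have "partial_deriv (Inl k) (\<lambda>z. f (fst (inv_into W \<Phi> z), y)) (\<Phi> (x, y)) = ?p (Inl k)" if "k \<in> coords B" for k
        using partial_slice_base[OF q that, of "\<lambda>p. f (fst p, y)"] partial_slice_base[OF q that, of f] by simp
      moreover have "partial_deriv (Inr (j, k)) (\<lambda>z. f (fst (inv_into W \<Phi> z), y)) (\<Phi> (x, y)) = 0" if "k \<in> coords (F j)" for j k
        using partial_slice_fibre[OF q that, of "\<lambda>p. f (fst p, y)"] by (simp add: const0)
      ultimately show ?thesis
        using fB \<gamma>[OF smooth_PM_base[OF fB]] by (simp add: pushforward_def sum_coords_PM)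
    qed
    have 2: "dF j v (\<lambda>z. f (x, y(j := z))) = (\<Sum>k\<in>coords (F j). \<gamma> (Inr (j, k)) * ?p (Inr (j, k)))" for j
    proof -
      have a: "partial_deriv (Inl k) (\<lambda>z. f (x, y(j := snd (inv_into W \<Phi> z) j))) (\<Phi> (x, y)) = 0" if "k \<in> coords B" for k
        using partial_slice_base[OF q that, of "\<lambda>p. f (x, y(j := snd p j))"] by (simp add: const0)
      have b: "partial_deriv (Inr (i, k)) (\<lambda>z. f (x, y(j := snd (inv_into W \<Phi> z) j))) (\<Phi> (x, y)) = (if i = j then ?p (Inr (i, k)) else 0)"
        if "k \<in> coords (F i)" for i k
        using partial_slice_fibre[OF q that, of "\<lambda>p. f (x, y(j := snd p j))"] partial_slice_fibre[OF q that, of f]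
        by (auto simp: const0)
      have "(\<Sum>i\<in>UNIV. \<Sum>k\<in>coords (F i). \<gamma> (Inr (i, k)) * (if i = j then ?p (Inr (i, k)) else 0))
          = (\<Sum>i\<in>UNIV. if i = j then \<Sum>k\<in>coords (F j). \<gamma> (Inr (j, k)) * ?p (Inr (j, k)) else 0)"
        by (rule sum.cong) auto
      then show ?thesis
        using fF \<gamma>[OF smooth_PM_fibre[OF fF]] by (simp add: pushforward_def sum_coords_PM a b)
    qed
    show ?thesis using f by (simp add: join_def 1 2 \<gamma>[OF f] sum_coords_PM)
  qed (use P.tangent_undef[OF v] in \<open>simp add: join_def\<close>)
qed

definition lift :: "'b vfield \<Rightarrow> ('i \<Rightarrow> 'f vfield) \<Rightarrow> ('b \<times> ('i \<Rightarrow> 'f)) vfield" where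
  "lift X V = (\<lambda>(x, y). join x y (X x) (\<lambda>j. V j (y j)))"

text \<open>Smoothness of the derivative in each slice would not give joint smoothness in (x, y). It
  is read off from the coordinate expression, whose coefficients each depend on one factor.\<close>

lemma lift_vf:
  assumes X: "X \<in> vector_fields B" and V: "\<And>j. V j \<in> vector_fields (F j)"
  shows "lift X V \<in> vector_fields PM"
proof -
  have "lift X V p \<in> tangent_space PM p" if "p \<in> points PM" for p
  proof -
    obtain x y where p: "p = (x, y)" by (cases p) auto
    show ?thesis unfolding p lift_def prod.case
      by (rule join_tangent) (use that p B.vector_fieldsD[OF X] manifold.vector_fieldsD[OF fib V] in auto)
  qed
  moreover have "dir_deriv (lift X V) f \<in> smooth_funs PM" if f: "f \<in> smooth_funs PM" for f
  proof (rule P.smooth_funs_chartI)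
    fix p assume pM: "p \<in> points PM"
    obtain x y where p: "p = (x, y)" by (cases p) auto
    obtain U \<phi> V' \<psi> where pc: "prod_chart B F U \<phi> V' \<psi>" "(x, y) \<in> prod_chart.W U V'"
      by (rule prod_chart_at) (use pM p in auto)
    interpret pc: prod_chart B F U \<phi> V' \<psi> by (rule pc)
    note o = pc.\<Phi>_image_open
    let ?W = pc.W and ?\<Phi> = pc.\<Phi>
    obtain a where a: "\<And>i. i \<in> coords B \<Longrightarrow> smooth_on (coords B) (\<phi> ` U) (a i)"
      "\<And>q f. q \<in> U \<Longrightarrow> f \<in> smooth_funs B \<Longrightarrow> X q f = (\<Sum>i\<in>coords B. a i (\<phi> q) * partial_deriv i (\<lambda>x. f (inv_into U \<phi> x)) (\<phi> q))"
      by (rule B.vf_chart[OF X pc.U]) (rule that)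
    define R where "R j c \<longleftrightarrow> (\<forall>i\<in>coords (F j). smooth_on (coords (F j)) (\<psi> j ` V' j) (c i)) \<and>
      (\<forall>q\<in>V' j. \<forall>f\<in>smooth_funs (F j). V j q f = (\<Sum>i\<in>coords (F j). c i (\<psi> j q) * partial_deriv i (\<lambda>x. f (inv_into (V' j) (\<psi> j) x)) (\<psi> j q)))" for j c
    have "\<exists>c. R j c" for j
    proof -
      obtain c where "\<And>i. i \<in> coords (F j) \<Longrightarrow> smooth_on (coords (F j)) (\<psi> j ` V' j) (c i)"
        "\<And>q f. q \<in> V' j \<Longrightarrow> f \<in> smooth_funs (F j) \<Longrightarrow> V j q f = (\<Sum>i\<in>coords (F j). c i (\<psi> j q) * partial_deriv i (\<lambda>x. f (inv_into (V' j) (\<psi> j) x)) (\<psi> j q))"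
        by (rule manifold.vf_chart[OF fib V pc.V[of j]]) (rule that)
      then have "R j c" by (simp add: R_def)
      then show ?thesis by blast
    qed
    then obtain c where "\<And>j. R j (c j)" by metis
    then have c: "\<And>j i. i \<in> coords (F j) \<Longrightarrow> smooth_on (coords (F j)) (\<psi> j ` V' j) (c j i)"
      "\<And>j q f. q \<in> V' j \<Longrightarrow> f \<in> smooth_funs (F j) \<Longrightarrow> V j q f = (\<Sum>i\<in>coords (F j). c j i (\<psi> j q) * partial_deriv i (\<lambda>x. f (inv_into (V' j) (\<psi> j) x)) (\<psi> j q))"
      by (simp_all add: R_def)
    let ?p = "\<lambda>d. partial_deriv d (\<lambda>z. f (inv_into ?W ?\<Phi> z))"
    have sp: "smooth_on (coords PM) (?\<Phi> ` ?W) (?p d)" if "d \<in> coords PM" for d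
      by (rule smooth_on_partial[OF P.smooth_funs_chart[OF f pc.chart_mem] that])
    have "smooth_on (coords PM) (?\<Phi> ` ?W) (\<lambda>z. (\<Sum>k\<in>coords B. a k (rB z) * ?p (Inl k) z) +
        (\<Sum>j\<in>UNIV. \<Sum>k\<in>coords (F j). c j k (rF j z) * ?p (Inr (j, k)) z))"
      by (intro smooth_on_add[OF o] smooth_on_sum[OF o] smooth_on_mult[OF o] sp
          pc.smooth_on_base_coords[OF B.chart_image_open[OF pc.U] o pc.rB_image a(1)]
          pc.smooth_on_fibre_coords[OF manifold.chart_image_open[OF fib pc.V] o pc.rF_image c(1)]) auto
    then have "smooth_on (coords PM) (?\<Phi> ` ?W) (\<lambda>z. dir_deriv (lift X V) f (inv_into ?W ?\<Phi> z))"
    proof (rule smooth_on_cong[OF o, rotated])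
      fix z assume "z \<in> ?\<Phi> ` ?W"
      then obtain x y where q: "(x, y) \<in> ?W" "z = ?\<Phi> (x, y)" by auto
      then have m: "x \<in> U" "\<And>j. y j \<in> V' j" by (auto simp: pc.W_iff)
      have xyP: "(x, y) \<in> points PM" using q pc.W_points by blast
      have fB: "(\<lambda>x'. f (x', y)) \<in> smooth_funs B" using smooth_slice_base[OF f] xyP by simp
      have fF: "(\<lambda>z. f (x, y(j := z))) \<in> smooth_funs (F j)" for j by (rule smooth_slice_fibre[OF f xyP])
      have "X x (\<lambda>x'. f (x', y)) = (\<Sum>k\<in>coords B. a k (rB z) * ?p (Inl k) z)"
        unfolding a(2)[OF m(1) fB] q(2) using pc.partial_slice_base[OF q(1), of _ f] pc.rB_\<Phi>[OF m(1)] by simp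
      moreover have "V j (y j) (\<lambda>z. f (x, y(j := z))) = (\<Sum>k\<in>coords (F j). c j k (rF j z) * ?p (Inr (j, k)) z)" for j
        unfolding c(2)[OF m(2) fF] q(2) using pc.partial_slice_fibre[OF q(1), of _ j f] pc.rF_\<Phi>[where y=y, OF m(2)] by simp
      ultimately show "(\<Sum>k\<in>coords B. a k (rB z) * ?p (Inl k) z) + (\<Sum>j\<in>UNIV. \<Sum>k\<in>coords (F j). c j k (rF j z) * ?p (Inr (j, k)) z)
          = dir_deriv (lift X V) f (inv_into ?W ?\<Phi> z)"
        using pc.inv_\<Phi>[OF q(1)] q(2) f by (simp add: dir_deriv_def lift_def join_def)
    qed
    then show "\<exists>U \<phi> N. (U, \<phi>) \<in> atlas PM \<and> openin (mtop PM) N \<and> p \<in> N \<and> N \<subseteq> U \<and>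
        smooth_on (coords PM) (\<phi> ` N) (\<lambda>x. dir_deriv (lift X V) f (inv_into U \<phi> x))"
      using pc.chart_mem pc.W_open pc(2) p by blast
  qed
  ultimately show ?thesis by (simp add: vector_fields_def)
qed

text \<open>Both kinds of lifts are instances of \<open>lift\<close>, so that being a vector field
  has to be shown once.\<close>

lemma lift_base_eq: "lift_base B F X = lift X (\<lambda>j p f. 0)"
  by (auto simp: lift_base_def lift_def join_def pushforward_def fun_eq_iff)

lemma lift_fibre_eq: "lift_fibre B F j V = lift (\<lambda>p f. 0) (\<lambda>i. if i = j then V else (\<lambda>p f. 0))"
proof (intro ext, clarify)
  fix x :: 'b and y :: "'i \<Rightarrow> 'f" and f
  have "(\<Sum>i\<in>UNIV. (if i = j then V else (\<lambda>p f. 0)) (y i) (\<lambda>z. f (x, y(i := z)))) =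
     (\<Sum>i\<in>UNIV. if i = j then V (y j) (\<lambda>z. f (x, y(j := z))) else 0)"
    by (rule sum.cong) auto
  then show "lift_fibre B F j V (x, y) f = lift (\<lambda>p f. 0) (\<lambda>i. if i = j then V else (\<lambda>p f. 0)) (x, y) f"
    by (auto simp: lift_fibre_def lift_def join_def pushforward_def)
qed

lemma lift_base_vf: "X \<in> vector_fields B \<Longrightarrow> lift_base B F X \<in> vector_fields PM"
  unfolding lift_base_eq by (rule lift_vf) (auto simp: manifold.vf_zero[OF fib])

lemma lift_fibre_vf: "V \<in> vector_fields (F j) \<Longrightarrow> lift_fibre B F j V \<in> vector_fields PM"
  unfolding lift_fibre_eq by (rule lift_vf) (auto simp: B.vf_zero manifold.vf_zero[OF fib])

end

section \<open>Warped metrics\<close>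

lemma (in semi_riem) metric_rank_0:
  assumes "p \<in> points M" "metric_rank M g p = 0" "u \<in> tangent_space M p" "v \<in> tangent_space M p"
  shows "g p u v = 0"
proof -
  obtain v' w' where "spanning p {..<metric_rank M g p} v' w'" by (rule rank_biorth[OF assms(1)])
  then show ?thesis using assms by (simp add: spanning_def)
qed

locale warped = manifold_product B F + BG: nondegenerate B gB
  for B :: "('b, 'k) mfd" and gB :: "'b metric" and F :: "'i::finite \<Rightarrow> ('f, 'l) mfd" +
  fixes gF :: "'i \<Rightarrow> 'f metric" and b :: "'i \<Rightarrow> 'b \<Rightarrow> real"
  assumes sreg: "\<And>j. semi_regular (F j) (gF j)" and b_smooth: "\<And>j. b j \<in> smooth_funs B"
begin

abbreviation g where "g \<equiv> warped_metric B gB F gF b"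
abbreviation hl where "hl \<equiv> lift_base B F"
abbreviation vl where "vl \<equiv> lift_fibre B F"

lemma radical_stationary_F: "radical_stationary (F j) (gF j)"
  using sreg by (simp add: semi_regular_def)

lemma FG: "semi_riem (F j) (gF j)"
  by (rule singular_semi_riem) (use radical_stationary_F[of j] in \<open>simp add: radical_stationary_def\<close>)

lemma g_eval: "g (x, y) v w = gB x (dB v) (dB w) + (\<Sum>j\<in>UNIV. (b j x)\<^sup>2 * gF j (y j) (dF j v) (dF j w))"
  by (simp add: warped_metric_def)

lemma semi_riem_PM: "semi_riem PM g"
proof
  fix p u v
  assume p: "p \<in> points PM" and u: "u \<in> tangent_space PM p" and v: "v \<in> tangent_space PM p"
  obtain x y where xy: "p = (x, y)" by (cases p) auto
  have x: "x \<in> points B" and y: "y j \<in> points (F j)" for j using p xy by auto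
  note uB = dB_tangent[OF u[unfolded xy]] and vB = dB_tangent[OF v[unfolded xy]]
  note uF = dF_tangent[OF u[unfolded xy]] and vF = dF_tangent[OF v[unfolded xy]]
  show "g p u v = g p v u"
    unfolding xy g_eval using BG.g_sym[OF x uB vB] semi_riem.g_sym[OF FG y uF vF] by simp
  show "g p (\<lambda>f. c * u f) v = c * g p u v" for c
    unfolding xy g_eval pushforward_scale BG.g_scale[OF x uB vB] semi_riem.g_scale[OF FG y uF vF]
    by (simp add: sum_distrib_left algebra_simps)
  fix w assume w: "w \<in> tangent_space PM p"
  note wB = dB_tangent[OF w[unfolded xy]] and wF = dF_tangent[OF w[unfolded xy]]
  show "g p (\<lambda>f. u f + v f) w = g p u w + g p v w"
    unfolding xy g_eval pushforward_plus BG.g_plus[OF x uB vB wB] semi_riem.g_plus[OF FG y uF vF wF]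
    by (simp add: sum.distrib algebra_simps)
next
  fix X Y assume XY: "X \<in> vector_fields PM" "Y \<in> vector_fields PM"
  have "(\<lambda>q. gB (fst q) (dB (X q)) (dB (Y q)) +
      (\<Sum>j\<in>UNIV. (b j (fst q))\<^sup>2 * gF j (snd q j) (dF j (X q)) (dF j (Y q)))) \<in> smooth_funs PM"
    by (intro P.smooth_funs_add P.smooth_funs_sum P.smooth_funs_mult P.smooth_funs_power smooth_PM_base b_smooth
        pullback_metric_smooth[OF P.manifold_axioms BG.semi_riem_axioms fst_continuous smooth_PM_base XY]
        pullback_metric_smooth[OF P.manifold_axioms FG snd_continuous smooth_PM_fibre XY])
  moreover have "metric_fun g X Y = (\<lambda>q. gB (fst q) (dB (X q)) (dB (Y q)) +
      (\<Sum>j\<in>UNIV. (b j (fst q))\<^sup>2 * gF j (snd q j) (dF j (X q)) (dF j (Y q))))"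
    by (auto simp: metric_fun_def fun_eq_iff g_eval)
  ultimately show "metric_fun g X Y \<in> smooth_funs PM" by simp
qed

sublocale G: semi_riem PM g by (rule semi_riem_PM)

section \<open>The rank of the warped metric and its regular points\<close>

definition jB where "jB x y a = join x y a (\<lambda>j f. 0)"
definition jF where "jF x y j c = join x y (\<lambda>f. 0) (\<lambda>i. if i = j then c else (\<lambda>f. 0))"

context
  fixes x y
  assumes p: "(x, y) \<in> points PM"
begin

lemma x_pt: "x \<in> points B" and y_pt: "y j \<in> points (F j)"
  using p by auto

lemma jB_tangent: "a \<in> tangent_space B x \<Longrightarrow> jB x y a \<in> tangent_space PM (x, y)"
  unfolding jB_def by (rule join_tangent[OF p]) (auto simp: manifold.tangent_zero[OF fib])

lemma jF_tangent: "c \<in> tangent_space (F j) (y j) \<Longrightarrow> jF x y j c \<in> tangent_space PM (x, y)"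
  unfolding jF_def by (rule join_tangent[OF p]) (auto simp: manifold.tangent_zero[OF fib] B.tangent_zero)

lemma dB_jB: "a \<in> tangent_space B x \<Longrightarrow> dB (jB x y a) = a"
  and dF_jB: "a \<in> tangent_space B x \<Longrightarrow> dF i (jB x y a) = (\<lambda>f. 0)"
  unfolding jB_def by (auto intro!: dB_join dF_join simp: manifold.tangent_zero[OF fib])

lemma dB_jF: "c \<in> tangent_space (F j) (y j) \<Longrightarrow> dB (jF x y j c) = (\<lambda>f. 0)"
  unfolding jF_def by (rule dB_join) (auto simp: manifold.tangent_zero[OF fib] B.tangent_zero)

lemma dF_jF: "c \<in> tangent_space (F j) (y j) \<Longrightarrow> dF i (jF x y j c) = (if i = j then c else (\<lambda>f. 0))"
  unfolding jF_def by (rule dF_join) (auto simp: manifold.tangent_zero[OF fib] B.tangent_zero)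

lemma g_jB:
  assumes "a \<in> tangent_space B x" "w \<in> tangent_space PM (x, y)"
  shows "g (x, y) (jB x y a) w = gB x a (dB w)" "g (x, y) w (jB x y a) = gB x (dB w) a"
  using semi_riem.g_zero[OF FG y_pt dF_tangent[OF assms(2)]] by (simp_all add: g_eval dB_jB dF_jB assms(1))

lemma g_jF:
  assumes "c \<in> tangent_space (F j) (y j)" "w \<in> tangent_space PM (x, y)"
  shows "g (x, y) (jF x y j c) w = (b j x)\<^sup>2 * gF j (y j) c (dF j w)" "g (x, y) w (jF x y j c) = (b j x)\<^sup>2 * gF j (y j) (dF j w) c"
proof -
  have 1: "(b i x)\<^sup>2 * gF i (y i) (dF i (jF x y j c)) (dF i w) = (if i = j then (b j x)\<^sup>2 * gF j (y j) c (dF j w) else 0)" for i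
    using semi_riem.g_zero[OF FG y_pt dF_tangent[OF assms(2)]] by (auto simp: dF_jF assms(1))
  have 2: "(b i x)\<^sup>2 * gF i (y i) (dF i w) (dF i (jF x y j c)) = (if i = j then (b j x)\<^sup>2 * gF j (y j) (dF j w) c else 0)" for i
    using semi_riem.g_zero[OF FG y_pt dF_tangent[OF assms(2)]] by (auto simp: dF_jF assms(1))
  show "g (x, y) (jF x y j c) w = (b j x)\<^sup>2 * gF j (y j) c (dF j w)" "g (x, y) w (jF x y j c) = (b j x)\<^sup>2 * gF j (y j) (dF j w) c"
    unfolding g_eval 1 2 dB_jF[OF assms(1)] using BG.g_zero[OF x_pt dB_tangent[OF assms(2)]] by simp_all
qed

text \<open>The metric is block diagonal at a point. The dual systems of the base and of the fibres
  with nonzero b_j are joined to one of the product; the blocks with b_j = 0 vanish.\<close>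

lemma rank_PM: "metric_rank PM g (x, y) = card (coords B) + (\<Sum>j | b j x \<noteq> 0. metric_rank (F j) (gF j) (y j))"
proof -
  let ?r = "\<lambda>j. metric_rank (F j) (gF j) (y j)" and ?n = "metric_rank B gB x"
  obtain vB wB where B: "BG.biorth x {..<?n} vB wB" "BG.spanning x {..<?n} vB wB" by (rule BG.rank_biorth[OF x_pt])
  have "\<forall>j. \<exists>v w. semi_riem.biorth (F j) (gF j) (y j) {..<?r j} v w \<and> semi_riem.spanning (F j) (gF j) (y j) {..<?r j} v w"
  proof
    fix j
    obtain v w where "semi_riem.biorth (F j) (gF j) (y j) {..<?r j} v w" "semi_riem.spanning (F j) (gF j) (y j) {..<?r j} v w"
      by (rule semi_riem.rank_biorth[OF FG y_pt[of j]])
    then show "\<exists>v w. semi_riem.biorth (F j) (gF j) (y j) {..<?r j} v w \<and> semi_riem.spanning (F j) (gF j) (y j) {..<?r j} v w" by blast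
  qed
  then obtain vF wF where Fb: "\<And>j. semi_riem.biorth (F j) (gF j) (y j) {..<?r j} (vF j) (wF j)"
    and Fs: "\<And>j. semi_riem.spanning (F j) (gF j) (y j) {..<?r j} (vF j) (wF j)" by metis
  have vB: "\<And>a. a < ?n \<Longrightarrow> vB a \<in> tangent_space B x" and wB: "\<And>a. a < ?n \<Longrightarrow> wB a \<in> tangent_space B x"
    and \<delta>B: "\<And>a c. a < ?n \<Longrightarrow> c < ?n \<Longrightarrow> gB x (vB a) (wB c) = (if a = c then 1 else 0)"
    using B(1) unfolding BG.biorth_def by simp_all
  have vF: "\<And>j a. a < ?r j \<Longrightarrow> vF j a \<in> tangent_space (F j) (y j)" and wF: "\<And>j a. a < ?r j \<Longrightarrow> wF j a \<in> tangent_space (F j) (y j)"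
    and \<delta>F: "\<And>j a c. a < ?r j \<Longrightarrow> c < ?r j \<Longrightarrow> gF j (y j) (vF j a) (wF j c) = (if a = c then 1 else 0)"
    using Fb unfolding semi_riem.biorth_def[OF FG] by simp_all
  let ?J = "{j. b j x \<noteq> 0}"
  define A where "A = {..<?n} <+> (SIGMA j:?J. {..<?r j})"
  define v where "v c = (case c of Inl a \<Rightarrow> jB x y (vB a) | Inr (j, a) \<Rightarrow> jF x y j (vF j a))" for c
  \<comment> \<open>The factor compensates the warping b_j^2; it is placed on one of the two
    families only.\<close>
  define w where "w c = (case c of Inl a \<Rightarrow> jB x y (wB a) | Inr (j, a) \<Rightarrow> jF x y j (\<lambda>f. inverse ((b j x)\<^sup>2) * wF j a f))" for c
  have wF': "(\<lambda>f. inverse ((b j x)\<^sup>2) * wF j a f) \<in> tangent_space (F j) (y j)" if "a < ?r j" for j a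
    by (rule manifold.tangent_scale[OF fib wF[OF that]])
  have vT: "v c \<in> tangent_space PM (x, y)" and wT: "w c \<in> tangent_space PM (x, y)" if "c \<in> A" for c
    using that vB wB vF wF' by (auto simp: A_def v_def w_def intro!: jB_tangent jF_tangent)
  have "G.biorth (x, y) A v w"
    unfolding G.biorth_def
  proof (intro conjI ballI)
    show "finite A" by (simp add: A_def)
    show "v c \<in> tangent_space PM (x, y)" "w c \<in> tangent_space PM (x, y)" if "c \<in> A" for c using vT wT that by auto
    fix c d assume c: "c \<in> A" and d: "d \<in> A"
    show "g (x, y) (v c) (w d) = (if c = d then 1 else 0)"
    proof (cases c)
      case (Inl a)
      then have a: "a < ?n" using c by (auto simp: A_def)
      have "g (x, y) (v c) (w d) = gB x (vB a) (dB (w d))"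
        unfolding Inl v_def sum.case by (rule g_jB[OF vB[OF a] wT[OF d]])
      also have "\<dots> = (if c = d then 1 else 0)"
      proof (cases d)
        case d': (Inl a')
        then have "a' < ?n" using d by (auto simp: A_def)
        then show ?thesis using a by (simp add: Inl d' w_def dB_jB[OF wB] \<delta>B)
      next
        case d': (Inr ja)
        obtain j' a' where ja: "ja = (j', a')" by (cases ja) auto
        then have "a' < ?r j'" using d d' by (auto simp: A_def)
        then show ?thesis using BG.g_zero[OF x_pt vB[OF a]] by (simp add: Inl d' ja w_def dB_jF[OF wF'])
      qed
      finally show ?thesis .
    next
      case (Inr ja)
      obtain j a where ja: "ja = (j, a)" by (cases ja) auto
      then have a: "a < ?r j" and bj: "b j x \<noteq> 0" using c Inr by (auto simp: A_def)
      have "g (x, y) (v c) (w d) = (b j x)\<^sup>2 * gF j (y j) (vF j a) (dF j (w d))"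
        unfolding Inr ja v_def sum.case prod.case by (rule g_jF[OF vF[OF a] wT[OF d]])
      also have "\<dots> = (if c = d then 1 else 0)"
      proof (cases d)
        case d': (Inl a')
        then have "a' < ?n" using d by (auto simp: A_def)
        then show ?thesis using semi_riem.g_zero[OF FG y_pt vF[OF a]] by (simp add: Inr ja d' w_def dF_jB[OF wB])
      next
        case d': (Inr ja')
        obtain j' a' where ja': "ja' = (j', a')" by (cases ja') auto
        then have a': "a' < ?r j'" using d d' by (auto simp: A_def)
        have "dF j (w d) = (if j = j' then (\<lambda>f. inverse ((b j' x)\<^sup>2) * wF j' a' f) else (\<lambda>f. 0))"
          unfolding d' ja' w_def sum.case prod.case by (rule dF_jF[OF wF'[OF a']])
        then show ?thesis
          using semi_riem.g_zero[OF FG y_pt vF[OF a]] a a' bj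
            semi_riem.g_scale_right[OF FG y_pt wF vF[OF a]]
          by (auto simp: Inr ja d' ja' \<delta>F)
      qed
      finally show ?thesis .
    qed
  qed
  moreover have "G.spanning (x, y) A v w"
    unfolding G.spanning_def
  proof (intro ballI)
    fix z u assume z: "z \<in> tangent_space PM (x, y)" and u: "u \<in> tangent_space PM (x, y)"
    have fin: "finite (SIGMA j:?J. {..<?r j})" by simp
    have "(\<Sum>c\<in>A. g (x, y) z (w c) * g (x, y) (v c) u) =
        (\<Sum>a<?n. g (x, y) z (w (Inl a)) * g (x, y) (v (Inl a)) u) +
        (\<Sum>j\<in>?J. \<Sum>a<?r j. g (x, y) z (w (Inr (j, a))) * g (x, y) (v (Inr (j, a))) u)"
      unfolding A_def by (simp add: sum.Plus[OF _ fin] sum.Sigma case_prod_beta)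
    also have "(\<Sum>a<?n. g (x, y) z (w (Inl a)) * g (x, y) (v (Inl a)) u) = (\<Sum>a<?n. gB x (dB z) (wB a) * gB x (vB a) (dB u))"
      by (rule sum.cong) (auto simp: v_def w_def g_jB[OF vB u] g_jB[OF wB z])
    also have "\<dots> = gB x (dB z) (dB u)"
      using B(2) dB_tangent[OF z] dB_tangent[OF u] by (simp add: BG.spanning_def)
    also have "(\<Sum>j\<in>?J. \<Sum>a<?r j. g (x, y) z (w (Inr (j, a))) * g (x, y) (v (Inr (j, a))) u) =
        (\<Sum>j\<in>?J. (b j x)\<^sup>2 * gF j (y j) (dF j z) (dF j u))"
    proof (rule sum.cong[OF refl])
      fix j assume j: "j \<in> ?J"
      have "g (x, y) z (w (Inr (j, a))) * g (x, y) (v (Inr (j, a))) u = (b j x)\<^sup>2 * (gF j (y j) (dF j z) (wF j a) * gF j (y j) (vF j a) (dF j u))"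
        if "a < ?r j" for a
        using j that g_jF[OF wF'[OF that] z] g_jF[OF vF[OF that] u] semi_riem.g_scale_right[OF FG y_pt wF[OF that] dF_tangent[OF z]]
        by (simp add: v_def w_def)
      then have "(\<Sum>a<?r j. g (x, y) z (w (Inr (j, a))) * g (x, y) (v (Inr (j, a))) u) =
          (b j x)\<^sup>2 * (\<Sum>a<?r j. gF j (y j) (dF j z) (wF j a) * gF j (y j) (vF j a) (dF j u))"
        by (simp add: sum_distrib_left)
      also have "\<dots> = (b j x)\<^sup>2 * gF j (y j) (dF j z) (dF j u)"
        using Fs[of j] dF_tangent[OF z, of j] dF_tangent[OF u, of j] by (simp add: semi_riem.spanning_def[OF FG])
      finally show "(\<Sum>a<?r j. g (x, y) z (w (Inr (j, a))) * g (x, y) (v (Inr (j, a))) u) = (b j x)\<^sup>2 * gF j (y j) (dF j z) (dF j u)" .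
    qed
    also have "\<dots> = (\<Sum>j\<in>UNIV. (b j x)\<^sup>2 * gF j (y j) (dF j z) (dF j u))"
      by (rule sum.mono_neutral_left) auto
    finally show "g (x, y) z u = (\<Sum>c\<in>A. g (x, y) z (w c) * g (x, y) (v c) u)" by (simp add: g_eval)
  qed
  ultimately have "metric_rank PM g (x, y) = card A" by (rule G.biorth_rank[OF p])
  also have "\<dots> = ?n + (\<Sum>j\<in>?J. ?r j)" unfolding A_def by (simp add: card_Plus)
  finally show ?thesis by (simp add: BG.rank_nondegenerate[OF x_pt])
qed

end

text \<open>Moving only the j-th fibre point changes only the j-th summand of the rank formula,
  which is present as b_j is nonzero at x. Constancy of the total rank thus passes to this
  summand.\<close>

lemma regular_fibre:
  assumes r: "(x, y) \<in> regular_points PM g" and bj: "b j x \<noteq> 0"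
  shows "y j \<in> regular_points (F j) (gF j)"
proof -
  have p: "(x, y) \<in> points PM" using r G.regular_points_subset by blast
  obtain U where U: "openin (mtop PM) U" "(x, y) \<in> U" "\<And>q. q \<in> U \<Longrightarrow> metric_rank PM g q = metric_rank PM g (x, y)"
    using r by (auto simp: regular_points_def)
  let ?N = "{z \<in> points (F j). (x, y(j := z)) \<in> U}"
  have N: "openin (mtop (F j)) ?N"
    by (rule openin_continuous_map_preimage[OF slice_fibre_continuous[OF p] U(1)])
  let ?R = "\<lambda>y i. metric_rank (F i) (gF i) (y i)"
  have "?R (y(j := z)) j = ?R y j" if z: "z \<in> ?N" for z
  proof -
    have "(x, y(j := z)) \<in> points PM" using p z by auto
    from rank_PM[OF this] rank_PM[OF p] U(3)[of "(x, y(j := z))"] z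
    have "(\<Sum>i | b i x \<noteq> 0. ?R (y(j := z)) i) = (\<Sum>i | b i x \<noteq> 0. ?R y i)" by simp
    moreover have split: "(\<Sum>i | b i x \<noteq> 0. ?R y' i) = ?R y' j + (\<Sum>i\<in>{i. b i x \<noteq> 0} - {j}. ?R y' i)" for y'
      by (rule sum.remove) (use bj in auto)
    moreover have "(\<Sum>i\<in>{i. b i x \<noteq> 0} - {j}. ?R (y(j := z)) i) = (\<Sum>i\<in>{i. b i x \<noteq> 0} - {j}. ?R y i)"
      by (rule sum.cong) auto
    ultimately show ?thesis using split[of y] split[of "y(j := z)"] by linarith
  qed
  then have a: "\<forall>z\<in>?N. metric_rank (F j) (gF j) z = metric_rank (F j) (gF j) (y j)"
    by (simp only: fun_upd_same) blast
  have b: "y j \<in> ?N" using p U(2) by simp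
  show ?thesis
    unfolding regular_points_def by (rule CollectI, rule exI[of _ ?N], rule conjI[OF N conjI[OF b a]])
qed

text \<open>Near \<open>x\<close> there are points \<open>x'\<close> with \<open>b\<^sub>j(x') \<noteq> 0\<close>, where \<open>F\<^sub>j\<close> contributes to the rank.\<close>

lemma regular_degenerate:
  assumes r: "(x, y) \<in> regular_points PM g" and bj: "b j x = 0" and X: "X \<in> tangent_space B x" "X (b j) \<noteq> 0"
    and uv: "u \<in> tangent_space (F j) (y j)" "v \<in> tangent_space (F j) (y j)"
  shows "gF j (y j) u v = 0"
proof -
  have p: "(x, y) \<in> points PM" using r G.regular_points_subset by blast
  obtain U where U: "openin (mtop PM) U" "(x, y) \<in> U" "\<And>q. q \<in> U \<Longrightarrow> metric_rank PM g q = metric_rank PM g (x, y)"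
    using r by (auto simp: regular_points_def)
  let ?J = "\<lambda>x. {i. b i x \<noteq> 0}"
  \<comment> \<open>Besides staying in the region of constant rank, points of N keep those b_i
    nonzero that are nonzero at x; so no summand of the rank formula is lost on moving from x to a
    point of N.\<close>
  let ?N = "{x' \<in> points B. (x', y) \<in> U} \<inter> (\<Inter>i\<in>?J x. {x' \<in> points B. b i x' \<noteq> 0})"
  have "openin (mtop B) {x' \<in> points B. (x', y) \<in> U}"
    by (rule openin_continuous_map_preimage[OF slice_base_continuous[OF p] U(1)])
  moreover have "openin (mtop B) {x' \<in> points B. b i x' \<noteq> 0}" for i
    using B.smooth_funs_neq_open[OF b_smooth B.smooth_funs_const[of 0]] .
  ultimately have N: "openin (mtop B) ?N"
    by (cases "?J x = {}") (auto intro!: openin_Int openin_INT2)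
  have xN: "x \<in> ?N" using p U(2) by auto
  \<comment> \<open>If b_j vanished on all of N, the derivation X would kill it.\<close>
  have "\<exists>x'\<in>?N. b j x' \<noteq> 0"
  proof (rule ccontr)
    assume "\<not> (\<exists>x'\<in>?N. b j x' \<noteq> 0)"
    then have "X (b j) = X (\<lambda>x. 0)"
      by (intro B.tangent_local[OF X(1) b_smooth B.smooth_funs_const N xN]) auto
    then show False using X B.tangent_const[OF X(1)] by simp
  qed
  then obtain x' where x': "x' \<in> ?N" "b j x' \<noteq> 0" by blast
  let ?R = "\<lambda>i. metric_rank (F i) (gF i) (y i)"
  have "(x', y) \<in> points PM" using p x' by auto
  from rank_PM[OF this] rank_PM[OF p] U(3)[of "(x', y)"] x'
  have eq: "(\<Sum>i\<in>?J x'. ?R i) = (\<Sum>i\<in>?J x. ?R i)" by simp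
  have "?R j + (\<Sum>i\<in>?J x. ?R i) = (\<Sum>i\<in>insert j (?J x). ?R i)" using bj by simp
  also have "\<dots> \<le> (\<Sum>i\<in>?J x'. ?R i)" by (rule sum_mono2) (use x' in auto)
  finally have "?R j = 0" using eq by simp
  then show ?thesis using semi_riem.metric_rank_0[OF FG _ _ uv] p by simp
qed

lemma lift_sum: "lift T Q = (\<lambda>q f. 1 * hl T q f + 1 * (\<Sum>j\<in>UNIV. 1 * vl j (Q j) q f))"
  by (auto simp: lift_def join_def lift_base_def lift_fibre_def pushforward_def fun_eq_iff)

text \<open>Every tangent vector of the product at (x, y) is the value of a sum of lifts, and a
  tensorial form sees only that value; so a vector representing the form on lifts represents it
  everywhere.\<close>

lemma rep_form_at:
  assumes \<omega>: "P.tensor_form \<omega>" and p: "(x, y) \<in> points PM"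
    and s: "s \<in> tangent_space B x" and t: "\<And>j. t j \<in> tangent_space (F j) (y j)"
    and H: "\<And>T. T \<in> vector_fields B \<Longrightarrow> \<omega> (hl T) (x, y) = gB x s (T x)"
    and V: "\<And>j Q. Q \<in> vector_fields (F j) \<Longrightarrow> \<omega> (vl j Q) (x, y) = (b j x)\<^sup>2 * gF j (y j) (t j) (Q (y j))"
  shows "form_at PM \<omega> (x, y) = flat_at PM g (x, y) (join x y s t)"
proof (rule G.form_at_flat[OF \<omega> p join_tangent[OF p s t]])
  fix Z assume Z: "Z \<in> vector_fields PM"
  note Zp = P.vector_fieldsD[OF Z p]
  obtain T where T: "T \<in> vector_fields B" "T x = dB (Z (x, y))"
    using B.extend_tangent[OF _ dB_tangent[OF Zp]] p by auto
  have "\<forall>j. \<exists>Q. Q \<in> vector_fields (F j) \<and> Q (y j) = dF j (Z (x, y))"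
    using manifold.extend_tangent[OF fib _ dF_tangent[OF Zp]] p by auto
  then obtain Q where Q: "\<And>j. Q j \<in> vector_fields (F j)" "\<And>j. Q j (y j) = dF j (Z (x, y))" by metis
  have L: "lift T Q \<in> vector_fields PM" by (rule lift_vf[OF T(1) Q(1)])
  have "Z (x, y) = lift T Q (x, y)"
    unfolding lift_def prod.case T(2) Q(2) by (rule tangent_split[OF p Zp])
  then have "\<omega> Z (x, y) = \<omega> (lift T Q) (x, y)" by (rule P.tensor_form_pt[OF \<omega> p Z L])
  also have "\<dots> = 1 * \<omega> (hl T) (x, y) + 1 * \<omega> (\<lambda>q f. \<Sum>j\<in>UNIV. 1 * vl j (Q j) q f) (x, y)"
    unfolding lift_sum
    by (rule P.tensor_form_comb[OF \<omega> p lift_base_vf[OF T(1)] P.vf_lincomb[where a="\<lambda>_ _. 1"]])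
       (auto intro!: lift_fibre_vf Q(1))
  also have "\<omega> (\<lambda>q f. \<Sum>j\<in>UNIV. 1 * vl j (Q j) q f) (x, y) = (\<Sum>j\<in>UNIV. 1 * \<omega> (vl j (Q j)) (x, y))"
    by (rule P.tensor_form_lincomb[OF \<omega> p, where a="\<lambda>_ _. 1"]) (auto intro!: lift_fibre_vf Q(1))
  finally have "\<omega> Z (x, y) = gB x s (T x) + (\<Sum>j\<in>UNIV. (b j x)\<^sup>2 * gF j (y j) (t j) (Q j (y j)))"
    using H[OF T(1)] V[OF Q(1)] by simp
  then show "\<omega> Z (x, y) = g (x, y) (join x y s t) (Z (x, y))"
    by (simp add: g_eval dB_join[OF s t] dF_join[OF s t] T(2) Q(2))
qed

end

section \<open>The Koszul form on lifts\<close>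

context semi_riem
begin

lemma bullet_inner_sym:
  assumes "p \<in> points M"
  shows "bullet_inner M g p \<alpha> \<beta> = bullet_inner M g p \<beta> \<alpha>"
  unfolding bullet_inner_def using g_sym[OF assms] by (intro arg_cong[where f=The] ext) metis

lemma contraction_sym: "contraction M g \<omega> \<tau> = contraction M g \<tau> \<omega>"
proof -
  have "extends_contraction M g \<omega> \<tau> h = extends_contraction M g \<tau> \<omega> h" for h
    using bullet_inner_sym regular_points_subset by (auto simp: extends_contraction_def)
  then show ?thesis by (simp add: contraction_def)
qed

text \<open>Brackets of lifts are lifts of brackets on the points of the product only; the form must
  not distinguish such fields.\<close>

lemma koszul_cong1:
  assumes eq: "\<And>q. q \<in> points M \<Longrightarrow> X q = X' q"
    and X: "X \<in> vector_fields M" "X' \<in> vector_fields M" and Y: "Y \<in> vector_fields M" "Z \<in> vector_fields M" and p: "p \<in> points M"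
  shows "koszul g X Y Z p = koszul g X' Y Z p"
proof -
  note Yp = vector_fieldsD[OF Y(1) p] and Zp = vector_fieldsD[OF Y(2) p]
  have 1: "Y p (metric_fun g Z X) = Y p (metric_fun g Z X')" "Z p (metric_fun g X Y) = Z p (metric_fun g X' Y)"
    by (auto intro!: tangent_cong[OF Yp p] tangent_cong[OF Zp p] simp: metric_fun_def eq)
  have d: "dir_deriv X f q = dir_deriv X' f q" if "q \<in> points M" for f q
    using eq[OF that] by (simp add: dir_deriv_def)
  have 2: "lie_bracket V X p = lie_bracket V X' p" "lie_bracket X V p = lie_bracket X' V p" if V: "V \<in> vector_fields M" for V
    unfolding lie_bracket_def eq[OF p] using tangent_cong[OF vector_fieldsD[OF V p] p d] by simp_all
  show ?thesis
    unfolding koszul_def dir_deriv_def using 1 2[OF Y(1)] 2[OF Y(2)] eq[OF p] by (simp add: metric_fun_def)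
qed

lemma koszul_zero1:
  assumes Y: "Y \<in> vector_fields M" "Z \<in> vector_fields M" and p: "p \<in> points M"
  shows "koszul g (\<lambda>q f. 0) Y Z p = 0"
proof -
  note Yp = vector_fieldsD[OF Y(1) p] and Zp = vector_fieldsD[OF Y(2) p]
  have "Y p (metric_fun g Z (\<lambda>q f. 0)) = Y p (\<lambda>q. 0)" "Z p (metric_fun g (\<lambda>q f. 0) Y) = Z p (\<lambda>q. 0)"
    by (auto intro!: tangent_cong[OF Yp p] tangent_cong[OF Zp p] simp: metric_fun_def g_zero vector_fieldsD Y)
  then show ?thesis
    unfolding koszul_def dir_deriv_def metric_fun_def[of g _ "lie_bracket _ _"]
    using Yp Zp tangent_const[OF Yp] tangent_const[OF Zp] vector_fieldsD[OF lie_bracket_vf[OF Y] p]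
    by (simp add: lie_bracket_def dir_deriv_def g_zero[OF p])
qed

end

context warped
begin

lemma hl_jB: "hl X (x, y) = jB x y (X x)"
  by (simp add: lift_base_eq lift_def jB_def)

lemma vl_jF: "vl j V (x, y) = jF x y j (V (y j))"
  unfolding lift_fibre_eq lift_def jF_def prod.case by (intro arg_cong[where f="join x y (\<lambda>f. 0)"] ext) simp

lemmas vfB = B.vector_fieldsD
lemmas vfF = manifold.vector_fieldsD[OF fib]

context
  fixes x y assumes p: "(x, y) \<in> points PM"
begin

lemma xp: "x \<in> points B" and yp: "\<And>j. y j \<in> points (F j)"
  using p by auto

lemma m_HH: "X \<in> vector_fields B \<Longrightarrow> Y \<in> vector_fields B \<Longrightarrow> metric_fun g (hl X) (hl Y) (x, y) = metric_fun gB X Y x"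
  unfolding metric_fun_def hl_jB by (simp add: g_jB[OF p] jB_tangent[OF p] dB_jB[OF p] vfB[OF _ xp])

lemma m_HV: "X \<in> vector_fields B \<Longrightarrow> V \<in> vector_fields (F j) \<Longrightarrow> metric_fun g (hl X) (vl j V) (x, y) = 0"
  unfolding metric_fun_def hl_jB vl_jF
  by (simp add: g_jB[OF p] jF_tangent[OF p] dB_jF[OF p] vfB[OF _ xp] vfF[OF _ yp] BG.g_zero[OF xp])

lemma m_VH: "X \<in> vector_fields B \<Longrightarrow> V \<in> vector_fields (F j) \<Longrightarrow> metric_fun g (vl j V) (hl X) (x, y) = 0"
  using G.metric_fun_sym[OF p lift_fibre_vf lift_base_vf] m_HV by metis

lemma m_VV: "V \<in> vector_fields (F i) \<Longrightarrow> W \<in> vector_fields (F j) \<Longrightarrow>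
    metric_fun g (vl i V) (vl j W) (x, y) = (if i = j then (b j x)\<^sup>2 * metric_fun (gF j) V W (y j) else 0)"
  unfolding metric_fun_def vl_jF
  by (simp add: g_jF[OF p] jF_tangent[OF p] dF_jF[OF p] vfF[OF _ yp] semi_riem.g_zero[OF FG yp])

lemma hl_tangent: "X \<in> vector_fields B \<Longrightarrow> hl X (x, y) \<in> tangent_space PM (x, y)"
  and vl_tangent: "V \<in> vector_fields (F j) \<Longrightarrow> vl j V (x, y) \<in> tangent_space PM (x, y)"
  using P.vector_fieldsD[OF _ p] lift_base_vf lift_fibre_vf by auto

lemma hl_base: "f \<in> smooth_funs B \<Longrightarrow> hl X (x, y) (\<lambda>q. f (fst q)) = X x f"
  by (simp add: lift_base_def pushforward_def smooth_PM_base)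

lemma hl_fibre: "X \<in> vector_fields B \<Longrightarrow> f \<in> smooth_funs (F j) \<Longrightarrow> hl X (x, y) (\<lambda>q. f (snd q j)) = 0"
  using B.tangent_const[OF vfB[OF _ xp]] by (simp add: lift_base_def pushforward_def smooth_PM_fibre)

lemma vl_base: "V \<in> vector_fields (F j) \<Longrightarrow> f \<in> smooth_funs B \<Longrightarrow> vl j V (x, y) (\<lambda>q. f (fst q)) = 0"
  using manifold.tangent_const[OF fib vfF[OF _ yp]] by (simp add: lift_fibre_def pushforward_def smooth_PM_base)

lemma vl_fibre: "V \<in> vector_fields (F j) \<Longrightarrow> f \<in> smooth_funs (F i) \<Longrightarrow>
    vl j V (x, y) (\<lambda>q. f (snd q i)) = (if i = j then V (y j) f else 0)"
  using manifold.tangent_const[OF fib vfF[OF _ yp]] by (simp add: lift_fibre_def pushforward_def smooth_PM_fibre)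

text \<open>Metric coefficients and values of the Koszul forms on lifts are sums of such products.
  The two fibre functions are needed for the terms containing P, where g(W,P) multiplies another
  fibre metric.\<close>

lemma hl_prod:
  assumes X: "X \<in> vector_fields B" and u: "u \<in> smooth_funs B" and w: "w \<in> smooth_funs (F j)" and w': "w' \<in> smooth_funs (F k)"
    and f: "\<And>x y. (x, y) \<in> points PM \<Longrightarrow> f (x, y) = u x * w (y j) * w' (y k)"
  shows "dir_deriv (hl X) f (x, y) = X x u * w (y j) * w' (y k)"
proof -
  note T = hl_tangent[OF X]
  note s = smooth_PM_base[OF u] smooth_PM_fibre[OF w] smooth_PM_fibre[OF w']
  have "hl X (x, y) f = hl X (x, y) (\<lambda>q. u (fst q) * w (snd q j) * w' (snd q k))"
    by (rule P.tangent_cong[OF T p]) (use f in auto)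
  then show ?thesis
    using P.tangent_mult[OF T P.smooth_funs_mult[OF s(1,2)] s(3)] P.tangent_mult[OF T s(1,2)]
    by (simp add: dir_deriv_def hl_base[OF u] hl_fibre[OF X w] hl_fibre[OF X w'] algebra_simps)
qed

lemma vl_prod:
  assumes V: "V \<in> vector_fields (F i)" and u: "u \<in> smooth_funs B" and w: "w \<in> smooth_funs (F j)" and w': "w' \<in> smooth_funs (F k)"
    and f: "\<And>x y. (x, y) \<in> points PM \<Longrightarrow> f (x, y) = u x * w (y j) * w' (y k)"
  shows "dir_deriv (vl i V) f (x, y) = u x * ((if j = i then V (y i) w else 0) * w' (y k) + w (y j) * (if k = i then V (y i) w' else 0))"
proof -
  note T = vl_tangent[OF V]
  note s = smooth_PM_base[OF u] smooth_PM_fibre[OF w] smooth_PM_fibre[OF w']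
  have "vl i V (x, y) f = vl i V (x, y) (\<lambda>q. u (fst q) * w (snd q j) * w' (snd q k))"
    by (rule P.tangent_cong[OF T p]) (use f in auto)
  then show ?thesis
    using P.tangent_mult[OF T P.smooth_funs_mult[OF s(1,2)] s(3)] P.tangent_mult[OF T s(1,2)]
    by (simp add: dir_deriv_def vl_base[OF V u] vl_fibre[OF V w] vl_fibre[OF V w'] algebra_simps)
qed

lemma dir_zero:
  assumes "A \<in> vector_fields PM" "\<And>x y. (x, y) \<in> points PM \<Longrightarrow> f (x, y) = 0"
  shows "dir_deriv A f (x, y) = 0"
proof -
  have "A (x, y) f = A (x, y) (\<lambda>q. 0)"
    by (rule P.tangent_cong[OF P.vector_fieldsD[OF assms(1) p] p]) (use assms(2) in auto)
  then show ?thesis using P.tangent_const[OF P.vector_fieldsD[OF assms(1) p]] by (simp add: dir_deriv_def)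
qed

lemma hl_dir:
  assumes X: "X \<in> vector_fields B" and u: "u \<in> smooth_funs B" and f: "\<And>x y. (x, y) \<in> points PM \<Longrightarrow> f (x, y) = u x"
  shows "dir_deriv (hl X) f (x, y) = dir_deriv X u x"
  using hl_prod[OF X u manifold.smooth_funs_const[OF fib, of 1] manifold.smooth_funs_const[OF fib, of 1], of f] f
  by (simp add: dir_deriv_def)

lemma vl_dir:
  assumes V: "V \<in> vector_fields (F i)" and u: "u \<in> smooth_funs B" and f: "\<And>x y. (x, y) \<in> points PM \<Longrightarrow> f (x, y) = u x"
  shows "dir_deriv (vl i V) f (x, y) = 0"
  using vl_prod[OF V u manifold.smooth_funs_const[OF fib, of 1] manifold.smooth_funs_const[OF fib, of 1], of f i i]
    manifold.tangent_const[OF fib vfF[OF V yp]] f by simp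

lemma hl_prod2:
  assumes X: "X \<in> vector_fields B" and u: "u \<in> smooth_funs B" and w: "w \<in> smooth_funs (F j)"
    and f: "\<And>x y. (x, y) \<in> points PM \<Longrightarrow> f (x, y) = u x * w (y j)"
  shows "dir_deriv (hl X) f (x, y) = dir_deriv X u x * w (y j)"
  using hl_prod[OF X u w manifold.smooth_funs_const[OF fib, of 1], of f] f by (simp add: dir_deriv_def)

lemma vl_prod2:
  assumes V: "V \<in> vector_fields (F i)" and u: "u \<in> smooth_funs B" and w: "w \<in> smooth_funs (F j)"
    and f: "\<And>x y. (x, y) \<in> points PM \<Longrightarrow> f (x, y) = u x * w (y j)"
  shows "dir_deriv (vl i V) f (x, y) = (if j = i then u x * dir_deriv V w (y i) else 0)"
  using vl_prod[OF V u w manifold.smooth_funs_const[OF fib, of 1], of f i] manifold.tangent_const[OF fib vfF[OF V yp]] f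
  by (simp add: dir_deriv_def)

lemma dir_square: "X \<in> vector_fields B \<Longrightarrow> dir_deriv X (\<lambda>x. (b j x)\<^sup>2) x = 2 * b j x * dir_deriv X (b j) x"
  using B.tangent_mult[OF vfB[OF _ xp] b_smooth[of j] b_smooth[of j]] by (simp add: power2_eq_square dir_deriv_def mult.assoc)

text \<open>A tangent vector of the product is determined by its projections. Brackets of lifts
  therefore need to be tested only on functions pulled back from one factor, where the inner
  derivative is again a pulled back function.\<close>

lemma tangent_PM_eqI:
  assumes "u \<in> tangent_space PM (x, y)" "v \<in> tangent_space PM (x, y)"
    and "\<And>f. f \<in> smooth_funs B \<Longrightarrow> u (\<lambda>q. f (fst q)) = v (\<lambda>q. f (fst q))"
    and "\<And>j f. f \<in> smooth_funs (F j) \<Longrightarrow> u (\<lambda>q. f (snd q j)) = v (\<lambda>q. f (snd q j))"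
  shows "u = v"
proof -
  have "dB u = dB v" "\<And>j. dF j u = dF j v" using assms(3,4) by (auto simp: pushforward_def)
  then show ?thesis using tangent_split[OF p assms(1)] tangent_split[OF p assms(2)] by simp
qed

end

lemma b2_smooth: "(\<lambda>x. (b j x)\<^sup>2) \<in> smooth_funs B"
  by (intro B.smooth_funs_power b_smooth)

lemma dir_hl_base: "(x, y) \<in> points PM \<Longrightarrow> f \<in> smooth_funs B \<Longrightarrow> dir_deriv (hl X) (\<lambda>q. f (fst q)) (x, y) = dir_deriv X f x"
  by (simp add: dir_deriv_def hl_base)

lemma dir_hl_fibre: "(x, y) \<in> points PM \<Longrightarrow> X \<in> vector_fields B \<Longrightarrow> f \<in> smooth_funs (F j) \<Longrightarrow> dir_deriv (hl X) (\<lambda>q. f (snd q j)) (x, y) = 0"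
  by (simp add: dir_deriv_def hl_fibre)

lemma dir_vl_base: "(x, y) \<in> points PM \<Longrightarrow> V \<in> vector_fields (F j) \<Longrightarrow> f \<in> smooth_funs B \<Longrightarrow> dir_deriv (vl j V) (\<lambda>q. f (fst q)) (x, y) = 0"
  by (simp add: dir_deriv_def vl_base)

lemma dir_vl_fibre: "(x, y) \<in> points PM \<Longrightarrow> V \<in> vector_fields (F j) \<Longrightarrow> f \<in> smooth_funs (F i) \<Longrightarrow>
    dir_deriv (vl j V) (\<lambda>q. f (snd q i)) (x, y) = (if i = j then dir_deriv V f (y j) else 0)"
  by (simp add: dir_deriv_def vl_fibre)

section \<open>Lie brackets of lifts and the Koszul form on lifts\<close>

context
  fixes x y assumes p: "(x, y) \<in> points PM"
begin

lemma lie_HH: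
  assumes X: "X \<in> vector_fields B" and Y: "Y \<in> vector_fields B"
  shows "lie_bracket (hl X) (hl Y) (x, y) = hl (lie_bracket X Y) (x, y)"
proof (rule tangent_PM_eqI[OF p])
  note XY = B.lie_bracket_vf[OF X Y]
  show "lie_bracket (hl X) (hl Y) (x, y) \<in> tangent_space PM (x, y)"
    by (rule P.vector_fieldsD[OF P.lie_bracket_vf[OF lift_base_vf[OF X] lift_base_vf[OF Y]] p])
  show "hl (lie_bracket X Y) (x, y) \<in> tangent_space PM (x, y)" by (rule hl_tangent[OF p XY])
  show "lie_bracket (hl X) (hl Y) (x, y) (\<lambda>q. f (fst q)) = hl (lie_bracket X Y) (x, y) (\<lambda>q. f (fst q))" if f: "f \<in> smooth_funs B" for f
  proof -
    have "dir_deriv (hl X) (dir_deriv (hl Y) (\<lambda>q. f (fst q))) (x, y) = dir_deriv X (dir_deriv Y f) x"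
      by (rule hl_dir[OF p X B.vector_fields_smooth[OF Y f]]) (rule dir_hl_base[OF _ f])
    moreover have "dir_deriv (hl Y) (dir_deriv (hl X) (\<lambda>q. f (fst q))) (x, y) = dir_deriv Y (dir_deriv X f) x"
      by (rule hl_dir[OF p Y B.vector_fields_smooth[OF X f]]) (rule dir_hl_base[OF _ f])
    ultimately show ?thesis unfolding hl_base[OF p f] by (simp add: lie_bracket_def dir_deriv_def)
  qed
  show "lie_bracket (hl X) (hl Y) (x, y) (\<lambda>q. f (snd q j)) = hl (lie_bracket X Y) (x, y) (\<lambda>q. f (snd q j))" if f: "f \<in> smooth_funs (F j)" for f j
  proof -
    have "dir_deriv (hl X) (dir_deriv (hl Y) (\<lambda>q. f (snd q j))) (x, y) = 0"
      by (rule dir_zero[OF p lift_base_vf[OF X]]) (rule dir_hl_fibre[OF _ Y f])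
    moreover have "dir_deriv (hl Y) (dir_deriv (hl X) (\<lambda>q. f (snd q j))) (x, y) = 0"
      by (rule dir_zero[OF p lift_base_vf[OF Y]]) (rule dir_hl_fibre[OF _ X f])
    ultimately show ?thesis unfolding hl_fibre[OF p XY f] by (simp add: lie_bracket_def dir_deriv_def)
  qed
qed

lemma lie_HV:
  assumes X: "X \<in> vector_fields B" and V: "V \<in> vector_fields (F j)"
  shows "lie_bracket (hl X) (vl j V) (x, y) = (\<lambda>f. 0)"
proof (rule tangent_PM_eqI[OF p])
  show "lie_bracket (hl X) (vl j V) (x, y) \<in> tangent_space PM (x, y)"
    by (rule P.vector_fieldsD[OF P.lie_bracket_vf[OF lift_base_vf[OF X] lift_fibre_vf[OF V]] p])
  show "(\<lambda>f. 0) \<in> tangent_space PM (x, y)" by (rule P.tangent_zero)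
  show "lie_bracket (hl X) (vl j V) (x, y) (\<lambda>q. f (fst q)) = 0" if f: "f \<in> smooth_funs B" for f
  proof -
    have "dir_deriv (hl X) (dir_deriv (vl j V) (\<lambda>q. f (fst q))) (x, y) = 0"
      by (rule dir_zero[OF p lift_base_vf[OF X]]) (rule dir_vl_base[OF _ V f])
    moreover have "dir_deriv (vl j V) (dir_deriv (hl X) (\<lambda>q. f (fst q))) (x, y) = 0"
      by (rule vl_dir[OF p V B.vector_fields_smooth[OF X f]]) (rule dir_hl_base[OF _ f])
    ultimately show ?thesis by (simp add: lie_bracket_def dir_deriv_def)
  qed
  show "lie_bracket (hl X) (vl j V) (x, y) (\<lambda>q. f (snd q i)) = 0" if f: "f \<in> smooth_funs (F i)" for f i
  proof -
    have "dir_deriv (hl X) (dir_deriv (vl j V) (\<lambda>q. f (snd q i))) (x, y) = 0"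
    proof (cases "i = j")
      case True
      have "dir_deriv (hl X) (dir_deriv (vl j V) (\<lambda>q. f (snd q i))) (x, y) = dir_deriv X (\<lambda>_. 1) x * dir_deriv V f (y j)"
        by (rule hl_prod2[OF p X B.smooth_funs_const manifold.vector_fields_smooth[OF fib V]])
           (use True f dir_vl_fibre[OF _ V f] in auto)
      then show ?thesis using B.tangent_const[OF vfB[OF X]] p by (simp add: dir_deriv_def)
    next
      case False
      show ?thesis
        by (rule dir_zero[OF p lift_base_vf[OF X]]) (use False dir_vl_fibre[OF _ V f] in simp)
    qed
    moreover have "dir_deriv (vl j V) (dir_deriv (hl X) (\<lambda>q. f (snd q i))) (x, y) = 0"
      by (rule dir_zero[OF p lift_fibre_vf[OF V]]) (rule dir_hl_fibre[OF _ X f])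
    ultimately show ?thesis by (simp add: lie_bracket_def dir_deriv_def)
  qed
qed

lemma lie_VH:
  assumes X: "X \<in> vector_fields B" and V: "V \<in> vector_fields (F j)"
  shows "lie_bracket (vl j V) (hl X) (x, y) = (\<lambda>f. 0)"
  using lie_HV[OF assms] unfolding G.lie_bracket_swap[of "vl j V" "hl X"] by (simp add: fun_eq_iff)

lemma lie_VV:
  assumes V: "V \<in> vector_fields (F i)" and W: "W \<in> vector_fields (F j)"
  shows "lie_bracket (vl i V) (vl j W) (x, y) = (if i = j then vl j (lie_bracket V W) (x, y) else (\<lambda>f. 0))"
proof (rule tangent_PM_eqI[OF p])
  have L: "lie_bracket V W \<in> vector_fields (F j)" if "i = j" using manifold.lie_bracket_vf[OF fib _ W] V that by simp
  show "lie_bracket (vl i V) (vl j W) (x, y) \<in> tangent_space PM (x, y)"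
    by (rule P.vector_fieldsD[OF P.lie_bracket_vf[OF lift_fibre_vf[OF V] lift_fibre_vf[OF W]] p])
  show "(if i = j then vl j (lie_bracket V W) (x, y) else (\<lambda>f. 0)) \<in> tangent_space PM (x, y)"
    using P.tangent_zero vl_tangent[OF p L] by auto
  show "lie_bracket (vl i V) (vl j W) (x, y) (\<lambda>q. f (fst q)) = (if i = j then vl j (lie_bracket V W) (x, y) else (\<lambda>f. 0)) (\<lambda>q. f (fst q))" if f: "f \<in> smooth_funs B" for f
  proof -
    have "dir_deriv (vl i V) (dir_deriv (vl j W) (\<lambda>q. f (fst q))) (x, y) = 0"
      by (rule dir_zero[OF p lift_fibre_vf[OF V]]) (rule dir_vl_base[OF _ W f])
    moreover have "dir_deriv (vl j W) (dir_deriv (vl i V) (\<lambda>q. f (fst q))) (x, y) = 0"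
      by (rule dir_zero[OF p lift_fibre_vf[OF W]]) (rule dir_vl_base[OF _ V f])
    ultimately show ?thesis using vl_base[OF p L f] by (simp add: lie_bracket_def dir_deriv_def)
  qed
  have 1: "dir_deriv (vl i V) (dir_deriv (vl j W) (\<lambda>q. f (snd q k))) (x, y) = (if i = j \<and> k = j then dir_deriv V (dir_deriv W f) (y j) else 0)"
    if V: "V \<in> vector_fields (F i)" and W: "W \<in> vector_fields (F j)" and f: "f \<in> smooth_funs (F k)" for f i j k V W
  proof (cases "k = j")
    case True
    have "dir_deriv (vl i V) (dir_deriv (vl j W) (\<lambda>q. f (snd q k))) (x, y) = (if j = i then (\<lambda>_. 1) x * dir_deriv V (dir_deriv W f) (y i) else 0)"
      by (rule vl_prod2[OF p V B.smooth_funs_const manifold.vector_fields_smooth[OF fib W]])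
         (use True f dir_vl_fibre[OF _ W f] in auto)
    then show ?thesis using True by auto
  next
    case False
    have "dir_deriv (vl i V) (dir_deriv (vl j W) (\<lambda>q. f (snd q k))) (x, y) = 0"
      by (rule dir_zero[OF p lift_fibre_vf[OF V]]) (use False dir_vl_fibre[OF _ W f] in simp)
    then show ?thesis using False by simp
  qed
  show "lie_bracket (vl i V) (vl j W) (x, y) (\<lambda>q. f (snd q k)) = (if i = j then vl j (lie_bracket V W) (x, y) else (\<lambda>f. 0)) (\<lambda>q. f (snd q k))" if f: "f \<in> smooth_funs (F k)" for f k
    using 1[OF V W f] 1[OF W V f] vl_fibre[OF p L f] by (auto simp: lie_bracket_def dir_deriv_def)
qed

lemma metric_zero_right: "C (x, y) = (\<lambda>f. 0) \<Longrightarrow> A \<in> vector_fields PM \<Longrightarrow> metric_fun g A C (x, y) = 0"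
  using G.g_zero[OF p P.vector_fieldsD[OF _ p]] by (simp add: metric_fun_def)

lemma metric_cong_right: "C (x, y) = C' (x, y) \<Longrightarrow> metric_fun g A C (x, y) = metric_fun g A C' (x, y)"
  by (simp add: metric_fun_def)

lemma m_H_HH: "X \<in> vector_fields B \<Longrightarrow> Y \<in> vector_fields B \<Longrightarrow> Z \<in> vector_fields B \<Longrightarrow>
    metric_fun g (hl X) (lie_bracket (hl Y) (hl Z)) (x, y) = metric_fun gB X (lie_bracket Y Z) x"
  using metric_cong_right[where C="lie_bracket (hl Y) (hl Z)" and C'="hl (lie_bracket Y Z)" and A="hl X", OF lie_HH]
  by (simp add: m_HH[OF p] B.lie_bracket_vf)

lemma m_V_HH: "W \<in> vector_fields (F j) \<Longrightarrow> Y \<in> vector_fields B \<Longrightarrow> Z \<in> vector_fields B \<Longrightarrow>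
    metric_fun g (vl j W) (lie_bracket (hl Y) (hl Z)) (x, y) = 0"
  using metric_cong_right[where C="lie_bracket (hl Y) (hl Z)" and C'="hl (lie_bracket Y Z)" and A="vl j W", OF lie_HH]
  by (simp add: m_VH[OF p] B.lie_bracket_vf)

lemma m_A_HV: "A \<in> vector_fields PM \<Longrightarrow> W \<in> vector_fields (F j) \<Longrightarrow> Y \<in> vector_fields B \<Longrightarrow>
    metric_fun g A (lie_bracket (hl Y) (vl j W)) (x, y) = 0"
  and m_A_VH: "A \<in> vector_fields PM \<Longrightarrow> W \<in> vector_fields (F j) \<Longrightarrow> Y \<in> vector_fields B \<Longrightarrow>
    metric_fun g A (lie_bracket (vl j W) (hl Y)) (x, y) = 0"
  by (auto intro!: metric_zero_right lie_HV lie_VH)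

lemma m_H_VV:
  assumes "X \<in> vector_fields B" "V \<in> vector_fields (F i)" "W \<in> vector_fields (F j)"
  shows "metric_fun g (hl X) (lie_bracket (vl i V) (vl j W)) (x, y) = 0"
proof (cases "i = j")
  case True
  then have L: "lie_bracket V W \<in> vector_fields (F j)" using manifold.lie_bracket_vf[OF fib _ assms(3)] assms(2) by simp
  have "lie_bracket (vl i V) (vl j W) (x, y) = vl j (lie_bracket V W) (x, y)" using lie_VV[OF assms(2,3)] True by simp
  from metric_cong_right[where C="lie_bracket (vl i V) (vl j W)" and C'="vl j (lie_bracket V W)", OF this] show ?thesis by (simp add: m_HV[OF p assms(1) L])
next
  case False
  then show ?thesis using lie_VV[OF assms(2,3)] by (intro metric_zero_right lift_base_vf assms) simp
qed

lemma m_V_VV: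
  assumes "U \<in> vector_fields (F k)" "V \<in> vector_fields (F i)" "W \<in> vector_fields (F j)"
  shows "metric_fun g (vl k U) (lie_bracket (vl i V) (vl j W)) (x, y) =
      (if i = j \<and> k = j then (b j x)\<^sup>2 * metric_fun (gF j) U (lie_bracket V W) (y j) else 0)"
proof (cases "i = j")
  case True
  then have L: "lie_bracket V W \<in> vector_fields (F j)" using manifold.lie_bracket_vf[OF fib _ assms(3)] assms(2) by simp
  have "lie_bracket (vl i V) (vl j W) (x, y) = vl j (lie_bracket V W) (x, y)" using lie_VV[OF assms(2,3)] True by simp
  from metric_cong_right[where C="lie_bracket (vl i V) (vl j W)" and C'="vl j (lie_bracket V W)", OF this] show ?thesis using True by (simp add: m_VV[OF p assms(1) L])
next
  case False
  then have "metric_fun g (vl k U) (lie_bracket (vl i V) (vl j W)) (x, y) = 0"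
    using lie_VV[OF assms(2,3)] by (intro metric_zero_right lift_fibre_vf assms) simp
  then show ?thesis using False by simp
qed

lemma d_H_HH: "X \<in> vector_fields B \<Longrightarrow> Y \<in> vector_fields B \<Longrightarrow> Z \<in> vector_fields B \<Longrightarrow>
    dir_deriv (hl X) (metric_fun g (hl Y) (hl Z)) (x, y) = dir_deriv X (metric_fun gB Y Z) x"
  by (rule hl_dir[OF p _ BG.g_smooth]) (auto simp: m_HH)

lemma d_V_HH: "W \<in> vector_fields (F j) \<Longrightarrow> Y \<in> vector_fields B \<Longrightarrow> Z \<in> vector_fields B \<Longrightarrow>
    dir_deriv (vl j W) (metric_fun g (hl Y) (hl Z)) (x, y) = 0"
  by (rule vl_dir[OF p _ BG.g_smooth]) (auto simp: m_HH)

lemma d_A_HV: "A \<in> vector_fields PM \<Longrightarrow> X \<in> vector_fields B \<Longrightarrow> W \<in> vector_fields (F j) \<Longrightarrow>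
    dir_deriv A (metric_fun g (hl X) (vl j W)) (x, y) = 0"
  and d_A_VH: "A \<in> vector_fields PM \<Longrightarrow> X \<in> vector_fields B \<Longrightarrow> W \<in> vector_fields (F j) \<Longrightarrow>
    dir_deriv A (metric_fun g (vl j W) (hl X)) (x, y) = 0"
  by (auto intro!: dir_zero[OF p] simp: m_HV m_VH)

lemma d_H_VV:
  assumes "X \<in> vector_fields B" "V \<in> vector_fields (F i)" "W \<in> vector_fields (F j)"
  shows "dir_deriv (hl X) (metric_fun g (vl i V) (vl j W)) (x, y) =
      (if i = j then 2 * b j x * dir_deriv X (b j) x * metric_fun (gF j) V W (y j) else 0)"
proof (cases "i = j")
  case True
  then have V: "V \<in> vector_fields (F j)" using assms by simp
  have "dir_deriv (hl X) (metric_fun g (vl i V) (vl j W)) (x, y) = dir_deriv X (\<lambda>x. (b j x)\<^sup>2) x * metric_fun (gF j) V W (y j)"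
    by (rule hl_prod2[OF p assms(1) b2_smooth semi_riem.g_smooth[OF FG V assms(3)]]) (simp add: True m_VV[OF _ V assms(3)])
  then show ?thesis using True dir_square[OF p assms(1)] by simp
next
  case False
  have "dir_deriv (hl X) (metric_fun g (vl i V) (vl j W)) (x, y) = 0"
    by (rule dir_zero[OF p lift_base_vf[OF assms(1)]]) (simp add: False m_VV[OF _ assms(2,3)])
  then show ?thesis using False by simp
qed

lemma d_V_VV:
  assumes "U \<in> vector_fields (F k)" "V \<in> vector_fields (F i)" "W \<in> vector_fields (F j)"
  shows "dir_deriv (vl k U) (metric_fun g (vl i V) (vl j W)) (x, y) =
      (if i = j \<and> k = j then (b j x)\<^sup>2 * dir_deriv U (metric_fun (gF j) V W) (y j) else 0)"
proof (cases "i = j")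
  case True
  then have V: "V \<in> vector_fields (F j)" using assms by simp
  have "dir_deriv (vl k U) (metric_fun g (vl i V) (vl j W)) (x, y) = (if j = k then (b j x)\<^sup>2 * dir_deriv U (metric_fun (gF j) V W) (y k) else 0)"
    by (rule vl_prod2[OF p assms(1) b2_smooth semi_riem.g_smooth[OF FG V assms(3)]]) (simp add: True m_VV[OF _ V assms(3)])
  then show ?thesis using True by auto
next
  case False
  have "dir_deriv (vl k U) (metric_fun g (vl i V) (vl j W)) (x, y) = 0"
    by (rule dir_zero[OF p lift_fibre_vf[OF assms(1)]]) (simp add: False m_VV[OF _ assms(2,3)])
  then show ?thesis using False by simp
qed

lemmas koszul_rules = m_H_HH m_V_HH m_A_HV m_A_VH m_H_VV m_V_VV d_H_HH d_V_HH d_A_HV d_A_VH d_H_VV d_V_VV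
  lift_base_vf lift_fibre_vf

lemma koszul_HHH: "X \<in> vector_fields B \<Longrightarrow> Y \<in> vector_fields B \<Longrightarrow> Z \<in> vector_fields B \<Longrightarrow>
    koszul g (hl X) (hl Y) (hl Z) (x, y) = koszul gB X Y Z x"
  unfolding koszul_def by (simp add: koszul_rules)

lemma koszul_HHV: "X \<in> vector_fields B \<Longrightarrow> Y \<in> vector_fields B \<Longrightarrow> W \<in> vector_fields (F j) \<Longrightarrow>
    koszul g (hl X) (hl Y) (vl j W) (x, y) = 0"
  and koszul_HVH: "X \<in> vector_fields B \<Longrightarrow> Y \<in> vector_fields B \<Longrightarrow> W \<in> vector_fields (F j) \<Longrightarrow>
    koszul g (hl X) (vl j W) (hl Y) (x, y) = 0"
  and koszul_VHH: "X \<in> vector_fields B \<Longrightarrow> Y \<in> vector_fields B \<Longrightarrow> W \<in> vector_fields (F j) \<Longrightarrow>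
    koszul g (vl j W) (hl X) (hl Y) (x, y) = 0"
  unfolding koszul_def by (simp_all add: koszul_rules)

lemma metric_F_sym: "V \<in> vector_fields (F j) \<Longrightarrow> W \<in> vector_fields (F j) \<Longrightarrow> metric_fun (gF j) V W (y j) = metric_fun (gF j) W V (y j)"
  by (rule semi_riem.metric_fun_sym[OF FG]) (use p in auto)

lemma koszul_HVV:
  assumes "X \<in> vector_fields B" "V \<in> vector_fields (F i)" "W \<in> vector_fields (F j)"
  shows "koszul g (hl X) (vl i V) (vl j W) (x, y) = (if i = j then b j x * dir_deriv X (b j) x * metric_fun (gF j) V W (y j) else 0)"
  unfolding koszul_def using assms by (simp add: koszul_rules)

lemma koszul_VHV:
  assumes "X \<in> vector_fields B" "V \<in> vector_fields (F i)" "W \<in> vector_fields (F j)"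
  shows "koszul g (vl i V) (hl X) (vl j W) (x, y) = (if i = j then b j x * dir_deriv X (b j) x * metric_fun (gF j) V W (y j) else 0)"
  unfolding koszul_def using assms metric_F_sym[of V j W] by (auto simp: koszul_rules)

lemma koszul_VVH:
  assumes "X \<in> vector_fields B" "V \<in> vector_fields (F i)" "W \<in> vector_fields (F j)"
  shows "koszul g (vl i V) (vl j W) (hl X) (x, y) = (if i = j then - (b j x * dir_deriv X (b j) x * metric_fun (gF j) V W (y j)) else 0)"
  unfolding koszul_def using assms by (simp add: koszul_rules)

lemma koszul_VVV:
  assumes "U \<in> vector_fields (F k)" "V \<in> vector_fields (F i)" "W \<in> vector_fields (F j)"
  shows "koszul g (vl k U) (vl i V) (vl j W) (x, y) = (if i = j \<and> k = j then (b j x)\<^sup>2 * koszul (gF j) U V W (y j) else 0)"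
  unfolding koszul_def using assms by (auto simp: koszul_rules algebra_simps)

end

end

section \<open>The semi-symmetric non-metric Koszul form\<close>

locale warped_vector = warped B gB F gF b
  for B :: "('b, 'k) mfd" and gB :: "'b metric" and F :: "'i::finite \<Rightarrow> ('f, 'l) mfd" and gF b +
  fixes l :: 'i and P :: "'f vfield"
  assumes P_vf: "P \<in> vector_fields (F l)"
begin

abbreviation KH where "KH \<equiv> ssnm_koszul g (vl l P)"
abbreviation mF where "mF j V W \<equiv> metric_fun (gF j) V W"
abbreviation kF where "kF j U V W \<equiv> koszul (gF j) U V W"
abbreviation dbX where "dbX j X \<equiv> dir_deriv X (b j)"

text \<open>\<open>\<pi> j W\<close> is the function \<open>g(W, P)\<close> for the lift of \<open>W \<in> \<Gamma>(TF\<^sub>j)\<close>.\<close>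

definition \<pi> where
  "\<pi> j W q = (if j = l then (b j (fst q))\<^sup>2 * mF j W P (snd q j) else 0)"

lemma mF_smooth: "V \<in> vector_fields (F j) \<Longrightarrow> W \<in> vector_fields (F j) \<Longrightarrow> mF j V W \<in> smooth_funs (F j)"
  by (rule semi_riem.g_smooth[OF FG])

lemma kF_smooth: "U \<in> vector_fields (F j) \<Longrightarrow> V \<in> vector_fields (F j) \<Longrightarrow> W \<in> vector_fields (F j) \<Longrightarrow> kF j U V W \<in> smooth_funs (F j)"
  by (rule semi_riem.koszul_smooth[OF FG])

lemma dbX_smooth: "X \<in> vector_fields B \<Longrightarrow> dbX j X \<in> smooth_funs B"
  by (rule B.vector_fields_smooth[OF _ b_smooth])

lemma \<pi>_smooth:
  assumes "W \<in> vector_fields (F j)"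
  shows "\<pi> j W \<in> smooth_funs PM"
proof (cases "j = l")
  case True
  then have "mF j W P \<in> smooth_funs (F j)" using mF_smooth assms P_vf by simp
  then have "(\<lambda>q. (b j (fst q))\<^sup>2 * mF j W P (snd q j)) \<in> smooth_funs PM"
    by (intro P.smooth_funs_mult P.smooth_funs_power smooth_PM_base b_smooth smooth_PM_fibre)
  then show ?thesis using True by (simp add: \<pi>_def[abs_def])
qed (simp add: \<pi>_def[abs_def])

context
  fixes x y assumes p: "(x, y) \<in> points PM"
begin

lemma pi_V: "W \<in> vector_fields (F j) \<Longrightarrow> metric_fun g (vl j W) (vl l P) (x, y) = \<pi> j W (x, y)"
  using m_VV[OF p _ P_vf, of W j] by (simp add: \<pi>_def)

lemma pi_H: "X \<in> vector_fields B \<Longrightarrow> metric_fun g (hl X) (vl l P) (x, y) = 0"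
  by (rule m_HV[OF p _ P_vf])

lemmas KH_rules = ssnm_koszul_def pi_V pi_H m_HH[OF p] m_HV[OF p] m_VH[OF p] m_VV[OF p]
  koszul_HHH[OF p] koszul_HHV[OF p] koszul_HVH[OF p] koszul_VHH[OF p] koszul_HVV[OF p] koszul_VHV[OF p] koszul_VVH[OF p] koszul_VVV[OF p]

lemma KH_HHH: "X \<in> vector_fields B \<Longrightarrow> Y \<in> vector_fields B \<Longrightarrow> Z \<in> vector_fields B \<Longrightarrow> KH (hl X) (hl Y) (hl Z) (x, y) = koszul gB X Y Z x"
  by (simp add: KH_rules)

lemma KH_HHV: "X \<in> vector_fields B \<Longrightarrow> Y \<in> vector_fields B \<Longrightarrow> W \<in> vector_fields (F j) \<Longrightarrow> KH (hl X) (hl Y) (vl j W) (x, y) = 0"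
  by (simp add: KH_rules)

lemma KH_HVH: "X \<in> vector_fields B \<Longrightarrow> Y \<in> vector_fields B \<Longrightarrow> W \<in> vector_fields (F j) \<Longrightarrow>
    KH (hl X) (vl j W) (hl Y) (x, y) = \<pi> j W (x, y) * metric_fun gB X Y x"
  by (simp add: KH_rules)

lemma KH_VHH: "X \<in> vector_fields B \<Longrightarrow> Y \<in> vector_fields B \<Longrightarrow> W \<in> vector_fields (F j) \<Longrightarrow> KH (vl j W) (hl X) (hl Y) (x, y) = 0"
  by (simp add: KH_rules)

lemma KH_HVV: "X \<in> vector_fields B \<Longrightarrow> V \<in> vector_fields (F i) \<Longrightarrow> W \<in> vector_fields (F j) \<Longrightarrow>
    KH (hl X) (vl i V) (vl j W) (x, y) = (if i = j then b j x * dbX j X x * mF j V W (y j) else 0)"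
  by (simp add: KH_rules)

lemma KH_VHV: "X \<in> vector_fields B \<Longrightarrow> V \<in> vector_fields (F i) \<Longrightarrow> W \<in> vector_fields (F j) \<Longrightarrow>
    KH (vl i V) (hl X) (vl j W) (x, y) = (if i = j then b j x * dbX j X x * mF j V W (y j) else 0)"
  by (simp add: KH_rules)

lemma KH_VVH: "X \<in> vector_fields B \<Longrightarrow> V \<in> vector_fields (F i) \<Longrightarrow> W \<in> vector_fields (F j) \<Longrightarrow>
    KH (vl i V) (vl j W) (hl X) (x, y) = (if i = j then - (b j x * dbX j X x * mF j V W (y j)) else 0)"
  by (simp add: KH_rules)

lemma KH_VVV: "U \<in> vector_fields (F k) \<Longrightarrow> V \<in> vector_fields (F i) \<Longrightarrow> W \<in> vector_fields (F j) \<Longrightarrow>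
    KH (vl k U) (vl i V) (vl j W) (x, y) = (if i = j \<and> k = j then (b j x)\<^sup>2 * kF j U V W (y j) else 0) +
      \<pi> i V (x, y) * (if k = j then (b j x)\<^sup>2 * mF j U W (y j) else 0)"
  by (simp add: KH_rules)

end

lemma KH_tensor: "A \<in> vector_fields PM \<Longrightarrow> C \<in> vector_fields PM \<Longrightarrow> P.tensor_form (KH A C)"
  by (rule G.tensor_form_ssnm[OF _ _ lift_fibre_vf[OF P_vf]])

text \<open>\<open>rep \<omega> x y s i c\<close>: the vector with base part \<open>s\<close> and \<open>F\<^sub>i\<close>-part \<open>c\<close> represents \<open>\<omega>\<close> at \<open>(x, y)\<close>.\<close>

definition rep where
  "rep \<omega> x y s i c \<longleftrightarrow> s \<in> tangent_space B x \<and> c \<in> tangent_space (F i) (y i) \<and>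
     form_at PM \<omega> (x, y) = flat_at PM g (x, y) (join x y s (\<lambda>j. if j = i then c else (\<lambda>f. 0)))"

lemma repI:
  assumes "P.tensor_form \<omega>" "(x, y) \<in> points PM" "s \<in> tangent_space B x" "c \<in> tangent_space (F i) (y i)"
    and H: "\<And>T. T \<in> vector_fields B \<Longrightarrow> \<omega> (hl T) (x, y) = gB x s (T x)"
    and V: "\<And>j Q. Q \<in> vector_fields (F j) \<Longrightarrow> \<omega> (vl j Q) (x, y) = (if j = i then (b j x)\<^sup>2 * gF j (y j) c (Q (y j)) else 0)"
  shows "rep \<omega> x y s i c"
  unfolding rep_def
proof (intro conjI assms rep_form_at)
  show "(if j = i then c else (\<lambda>f. 0)) \<in> tangent_space (F j) (y j)" for j
    using assms(4) manifold.tangent_zero[OF fib] by auto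
  show "\<omega> (vl j Q) (x, y) = (b j x)\<^sup>2 * gF j (y j) (if j = i then c else (\<lambda>f. 0)) (Q (y j))" if Q: "Q \<in> vector_fields (F j)" for j Q
    using V[OF Q] semi_riem.g_zero[OF FG _ vfF[OF Q]] assms(2) by auto
qed

text \<open>All contractions on the product pass through this rule: a function smooth on the whole
  product that has the right values at regular points proves existence and value of the extension at
  once. The fibre part counts only if both representatives live in the same fibre.\<close>

lemma contractionI:
  assumes h: "h \<in> smooth_funs PM" and p: "(x, y) \<in> points PM"
    and r: "\<And>x y. (x, y) \<in> regular_points PM g \<Longrightarrow> \<exists>s c s' c'. rep \<omega> x y s i c \<and> rep \<tau> x y s' i' c' \<and>
      h (x, y) = gB x s s' + (if i = i' then (b i x)\<^sup>2 * gF i (y i) c c' else 0)"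
  shows "contraction PM g \<omega> \<tau> (x, y) = h (x, y)"
proof (rule G.contraction_eq[OF _ p])
  show "extends_contraction PM g \<omega> \<tau> h"
    unfolding extends_contraction_def
  proof (intro conjI ballI h)
    fix q assume q: "q \<in> regular_points PM g"
    obtain x y where xy: "q = (x, y)" by (cases q) auto
    have p: "(x, y) \<in> points PM" using q xy G.regular_points_subset by blast
    obtain s c s' c' where *: "rep \<omega> x y s i c" "rep \<tau> x y s' i' c'"
      "h (x, y) = gB x s s' + (if i = i' then (b i x)\<^sup>2 * gF i (y i) c c' else 0)"
      using r[of x y] q unfolding xy by blast
    let ?t = "\<lambda>j. if j = i then c else (\<lambda>f. 0)" and ?t' = "\<lambda>j. if j = i' then c' else (\<lambda>f. 0)"
    have s: "s \<in> tangent_space B x" "s' \<in> tangent_space B x" and c: "c \<in> tangent_space (F i) (y i)" "c' \<in> tangent_space (F i') (y i')"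
      using * by (auto simp: rep_def)
    have t: "?t j \<in> tangent_space (F j) (y j)" "?t' j \<in> tangent_space (F j) (y j)" for j
      using c manifold.tangent_zero[OF fib] by auto
    have yj: "y j \<in> points (F j)" for j using p by auto
    have "bullet_inner PM g (x, y) (form_at PM \<omega> (x, y)) (form_at PM \<tau> (x, y)) = g (x, y) (join x y s ?t) (join x y s' ?t')"
      using * unfolding rep_def by (simp only: G.bullet_inner_flat[OF p join_tangent[OF p s(1) t(1)] join_tangent[OF p s(2) t(2)]])
    also have "\<dots> = gB x s s' + (\<Sum>j\<in>UNIV. (b j x)\<^sup>2 * gF j (y j) (?t j) (?t' j))"
      unfolding g_eval dB_join[OF s(1) t(1)] dB_join[OF s(2) t(2)] dF_join[OF s(1) t(1)] dF_join[OF s(2) t(2)] ..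
    also have "(\<Sum>j\<in>UNIV. (b j x)\<^sup>2 * gF j (y j) (?t j) (?t' j)) = (\<Sum>j\<in>UNIV. if j = i then (if i = i' then (b i x)\<^sup>2 * gF i (y i) c c' else 0) else 0)"
    proof (rule sum.cong[OF refl])
      fix j
      show "(b j x)\<^sup>2 * gF j (y j) (?t j) (?t' j) = (if j = i then (if i = i' then (b i x)\<^sup>2 * gF i (y i) c c' else 0) else 0)"
        using semi_riem.g_zero[OF FG yj t(2)[of j]] semi_riem.g_zero[OF FG yj t(1)[of j]] by (auto split: if_splits)
    qed
    also have "\<dots> = (if i = i' then (b i x)\<^sup>2 * gF i (y i) c c' else 0)" by simp
    finally show "h q = bullet_inner PM g q (form_at PM \<omega> q) (form_at PM \<tau> q)"
      unfolding xy using *(3) by simp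
  qed
qed

text \<open>The fibre part is 0, so the fibre index i is free; it is chosen later to match the form
  with which this one is contracted.\<close>

lemma rep_HH:
  assumes p: "(x, y) \<in> points PM" and X: "X \<in> vector_fields B" "Z \<in> vector_fields B"
  shows "\<exists>s. s \<in> tangent_space B x \<and> (\<forall>T\<in>vector_fields B. koszul gB X Z T x = gB x s (T x)) \<and> rep (KH (hl X) (hl Z)) x y s i (\<lambda>f. 0)"
proof -
  have x: "x \<in> points B" and y: "\<And>j. y j \<in> points (F j)" using p by auto
  obtain s where s: "s \<in> tangent_space B x" "\<And>T. T \<in> vector_fields B \<Longrightarrow> koszul gB X Z T x = gB x s (T x)"
    using BG.sharp_ex[OF x BG.tensor_form_koszul[OF X]] by blast
  have "rep (KH (hl X) (hl Z)) x y s i (\<lambda>f. 0)"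
  proof (rule repI[OF KH_tensor p s(1) manifold.tangent_zero[OF fib]])
    show "KH (hl X) (hl Z) (hl T) (x, y) = gB x s (T x)" if "T \<in> vector_fields B" for T
      using KH_HHH[OF p X that] s(2)[OF that] by simp
    show "KH (hl X) (hl Z) (vl j Q) (x, y) = (if j = i then (b j x)\<^sup>2 * gF j (y j) (\<lambda>f. 0) (Q (y j)) else 0)" if Q: "Q \<in> vector_fields (F j)" for j Q
      using KH_HHV[OF p X Q] semi_riem.g_zero[OF FG y vfF[OF Q y]] by (cases "j = i") auto
  qed (use X lift_base_vf in auto)
  then show ?thesis using s by blast
qed

text \<open>At a zero of b_j both sides are 0, by the convention that division by 0 gives 0.\<close>

lemma scaled_mult: "(b j x)\<^sup>2 * (d / b j x * m) = b j x * d * m" for d m :: real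
  by (cases "b j x = 0") (auto simp: power2_eq_square)

text \<open>Where \<open>b\<^sub>j\<close> vanishes, so does the form on \<open>TF\<^sub>j\<close>; there the quotient is \<open>0\<close>.\<close>

lemma rep_HV:
  assumes p: "(x, y) \<in> points PM" and X: "X \<in> vector_fields B" and W: "W \<in> vector_fields (F j)"
  shows "rep (KH (hl X) (vl j W)) x y (\<lambda>f. \<pi> j W (x, y) * X x f) j (\<lambda>f. dbX j X x / b j x * W (y j) f)"
proof -
  have x: "x \<in> points B" and y: "\<And>j. y j \<in> points (F j)" using p by auto
  note Xx = vfB[OF X x] and Wy = vfF[OF W y]
  show ?thesis
  proof (rule repI[OF KH_tensor p B.tangent_scale[OF Xx] manifold.tangent_scale[OF fib Wy]])
    show "KH (hl X) (vl j W) (hl T) (x, y) = gB x (\<lambda>f. \<pi> j W (x, y) * X x f) (T x)" if T: "T \<in> vector_fields B" for T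
      using KH_HVH[OF p X T W] BG.g_scale[OF x Xx vfB[OF T x]] by (simp add: metric_fun_def)
    show "KH (hl X) (vl j W) (vl i Q) (x, y) = (if i = j then (b i x)\<^sup>2 * gF i (y i) (\<lambda>f. dbX j X x / b j x * W (y j) f) (Q (y i)) else 0)"
      if Q: "Q \<in> vector_fields (F i)" for i Q
    proof (cases "i = j")
      case True
      then have Q2: "Q \<in> vector_fields (F j)" using Q by simp
      have "KH (hl X) (vl j W) (vl j Q) (x, y) = (b j x)\<^sup>2 * gF j (y j) (\<lambda>f. dbX j X x / b j x * W (y j) f) (Q (y j))"
        unfolding semi_riem.g_scale[OF FG y Wy vfF[OF Q2 y]] scaled_mult using KH_HVV[OF p X W Q2] by (simp add: metric_fun_def)
      then show ?thesis using True by simp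
    qed (use KH_HVV[OF p X W Q] in simp)
  qed (use X W lift_base_vf lift_fibre_vf in auto)
qed

lemma rep_VH:
  assumes p: "(x, y) \<in> points PM" and X: "X \<in> vector_fields B" and W: "W \<in> vector_fields (F j)"
  shows "rep (KH (vl j W) (hl X)) x y (\<lambda>f. 0) j (\<lambda>f. dbX j X x / b j x * W (y j) f)"
proof -
  have x: "x \<in> points B" and y: "\<And>j. y j \<in> points (F j)" using p by auto
  note Wy = vfF[OF W y]
  show ?thesis
  proof (rule repI[OF KH_tensor p B.tangent_zero manifold.tangent_scale[OF fib Wy]])
    show "KH (vl j W) (hl X) (hl T) (x, y) = gB x (\<lambda>f. 0) (T x)" if T: "T \<in> vector_fields B" for T
      using KH_VHH[OF p X T W] BG.g_zero[OF x vfB[OF T x]] by simp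
    show "KH (vl j W) (hl X) (vl i Q) (x, y) = (if i = j then (b i x)\<^sup>2 * gF i (y i) (\<lambda>f. dbX j X x / b j x * W (y j) f) (Q (y i)) else 0)"
      if Q: "Q \<in> vector_fields (F i)" for i Q
    proof (cases "i = j")
      case True
      then have Q2: "Q \<in> vector_fields (F j)" using Q by simp
      have "KH (vl j W) (hl X) (vl j Q) (x, y) = (b j x)\<^sup>2 * gF j (y j) (\<lambda>f. dbX j X x / b j x * W (y j) f) (Q (y j))"
        unfolding semi_riem.g_scale[OF FG y Wy vfF[OF Q2 y]] scaled_mult using KH_VHV[OF p X W Q2] by (simp add: metric_fun_def)
      then show ?thesis using True by simp
    qed (use KH_VHV[OF p X W Q] in simp)
  qed (use X W lift_base_vf lift_fibre_vf in auto)
qed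

text \<open>\<open>S\<close> represents \<open>\<K>\<close> of the fibre, by radical stationarity; \<open>\<sigma>\<close> is the gradient of \<open>b\<^sub>i\<close>.\<close>

lemma rep_VV:
  assumes p: "(x, y) \<in> points PM" and V: "V \<in> vector_fields (F i)" and W: "W \<in> vector_fields (F j)"
  shows "\<exists>\<sigma> S. \<sigma> \<in> tangent_space B x \<and> S \<in> tangent_space (F i) (y i) \<and>
    (\<forall>T\<in>vector_fields B. T x (b i) = gB x \<sigma> (T x)) \<and>
    (i = j \<longrightarrow> form_at (F i) (kF i V W) (y i) = flat_at (F i) (gF i) (y i) S \<and>
      (\<forall>Q\<in>vector_fields (F i). kF i V W Q (y i) = gF i (y i) S (Q (y i)))) \<and>
    rep (KH (vl i V) (vl j W)) x y (\<lambda>f. (if i = j then - (b i x * mF i V W (y i)) else 0) * \<sigma> f) i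
      (\<lambda>f. (if i = j then 1 else 0) * S f + \<pi> j W (x, y) * V (y i) f)"
proof -
  have x: "x \<in> points B" and y: "\<And>j. y j \<in> points (F j)" using p by auto
  obtain \<sigma> where \<sigma>: "\<sigma> \<in> tangent_space B x" "\<And>T. T \<in> vector_fields B \<Longrightarrow> differential (b i) T x = gB x \<sigma> (T x)"
    using BG.sharp_ex[OF x B.tensor_form_differential[OF b_smooth]] by blast
  \<comment> \<open>For different i and j no Koszul form of a fibre occurs; S is multiplied by 0
    below, and the zero vector serves.\<close>
  have "\<exists>S\<in>tangent_space (F i) (y i). i = j \<longrightarrow> form_at (F i) (kF i V W) (y i) = flat_at (F i) (gF i) (y i) S"
  proof (cases "i = j")
    case True
    then have "form_at (F i) (kF i V W) (y i) \<in> bullet_space (F i) (gF i) (y i)"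
      using radical_stationary_F[of i] V W y unfolding radical_stationary_def by auto
    then show ?thesis unfolding bullet_space_def by blast
  qed (use manifold.tangent_zero[OF fib] in blast)
  then obtain S where S: "S \<in> tangent_space (F i) (y i)" "i = j \<Longrightarrow> form_at (F i) (kF i V W) (y i) = flat_at (F i) (gF i) (y i) S" by blast
  have SQ: "kF i V W Q (y i) = gF i (y i) S (Q (y i))" if ij: "i = j" and Q: "Q \<in> vector_fields (F i)" for Q
  proof -
    have "form_at (F i) (kF i V W) (y i) (Q (y i)) = kF i V W Q (y i)"
      by (rule manifold.form_at_vf[OF fib semi_riem.tensor_form_koszul[OF FG] y Q]) (use V W ij in auto)
    then show ?thesis using S(2)[OF ij] vfF[OF Q y] by (simp add: flat_at_def)
  qed
  note Vy = vfF[OF V y]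
  have cT: "(\<lambda>f. (if i = j then 1 else 0) * S f + \<pi> j W (x, y) * V (y i) f) \<in> tangent_space (F i) (y i)"
    by (rule manifold.tangent_comb[OF fib S(1) Vy])
  have "rep (KH (vl i V) (vl j W)) x y (\<lambda>f. (if i = j then - (b i x * mF i V W (y i)) else 0) * \<sigma> f) i
      (\<lambda>f. (if i = j then 1 else 0) * S f + \<pi> j W (x, y) * V (y i) f)"
  proof (rule repI[OF KH_tensor p B.tangent_scale[OF \<sigma>(1)] cT])
    show "KH (vl i V) (vl j W) (hl T) (x, y) = gB x (\<lambda>f. (if i = j then - (b i x * mF i V W (y i)) else 0) * \<sigma> f) (T x)" if T: "T \<in> vector_fields B" for T
      using KH_VVH[OF p T V W] BG.g_scale[OF x \<sigma>(1) vfB[OF T x]] \<sigma>(2)[OF T] by (auto simp: differential_def)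
    show "KH (vl i V) (vl j W) (vl k Q) (x, y) = (if k = i then (b k x)\<^sup>2 * gF k (y k) (\<lambda>f. (if i = j then 1 else 0) * S f + \<pi> j W (x, y) * V (y i) f) (Q (y k)) else 0)"
      if Q: "Q \<in> vector_fields (F k)" for k Q
    proof (cases "k = i")
      case True
      then have Q'': "Q \<in> vector_fields (F i)" using Q by simp
      have "KH (vl i V) (vl j W) (vl i Q) (x, y) = (b i x)\<^sup>2 * gF i (y i) (\<lambda>f. (if i = j then 1 else 0) * S f + \<pi> j W (x, y) * V (y i) f) (Q (y i))"
        unfolding semi_riem.g_comb(1)[OF FG y S(1) Vy vfF[OF Q'' y]]
        using KH_VVV[OF p V W Q''] SQ[OF _ Q''] by (auto simp: metric_fun_def algebra_simps)
      then show ?thesis using True by simp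
    qed (use KH_VVV[OF p V W Q] in auto)
  qed (use V W lift_fibre_vf in auto)
  note rp = this
  have \<sigma>2: "T x (b i) = gB x \<sigma> (T x)" if "T \<in> vector_fields B" for T
    using \<sigma>(2)[OF that] by (simp add: differential_def dir_deriv_def)
  show ?thesis
    by (rule exI[of _ \<sigma>], rule exI[of _ S], intro conjI impI ballI \<sigma>(1) S \<sigma>2 SQ rp)
qed

end

section \<open>Contractions\<close>

context warped_vector
begin

abbreviation C where "C A1 A3 A2 A4 p \<equiv> contraction PM g (KH A1 A3) (KH A2 A4) p"
abbreviation gBs where "gBs \<omega> \<tau> \<equiv> inverse_metric B gB \<omega> \<tau>"

lemma regular_pt: "(x, y) \<in> regular_points PM g \<Longrightarrow> (x, y) \<in> points PM"
  using G.regular_points_subset by blast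

text \<open>Where b_j is nonzero, b_j^2 cancels the two denominators. At a zero of b_j the left side
  is 0, and so is the right side: either X(b_j) = 0, or \<open>regular_degenerate\<close> makes the
  fibre metric vanish. This is the only pairing in which both quotients meet.\<close>

lemma fibre_core:
  assumes r: "(x, y) \<in> regular_points PM g" and X: "X \<in> vector_fields B" "Y \<in> vector_fields B"
    and W: "W \<in> vector_fields (F j)" "Q \<in> vector_fields (F j)"
  shows "(b j x)\<^sup>2 * gF j (y j) (\<lambda>f. dbX j X x / b j x * W (y j) f) (\<lambda>f. dbX j Y x / b j x * Q (y j) f)
    = dbX j X x * dbX j Y x * mF j W Q (y j)"
proof -
  have x: "x \<in> points B" and y: "y j \<in> points (F j)" using regular_pt[OF r] by auto
  note Wy = vfF[OF W(1) y] and Qy = vfF[OF W(2) y]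
  have e: "gF j (y j) (\<lambda>f. c * W (y j) f) (\<lambda>f. d * Q (y j) f) = c * (d * mF j W Q (y j))" for c d
    unfolding semi_riem.g_scale[OF FG y Wy manifold.tangent_scale[OF fib Qy]] semi_riem.g_scale_right[OF FG y Qy Wy]
    by (simp add: metric_fun_def)
  show ?thesis
  proof (cases "b j x = 0 \<and> X x (b j) \<noteq> 0")
    case True
    then have "mF j W Q (y j) = 0"
      using regular_degenerate[OF r _ vfB[OF X(1) x] _ Wy Qy] by (simp add: metric_fun_def)
    then show ?thesis unfolding e by simp
  next
    case False
    then show ?thesis unfolding e by (cases "b j x = 0") (auto simp: dir_deriv_def power2_eq_square)
  qed
qed

lemmas PM_smooth = P.smooth_funs_mult P.smooth_funs_add P.smooth_funs_minus P.smooth_funs_const P.smooth_funs_power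
  smooth_PM_base smooth_PM_fibre \<pi>_smooth b_smooth dbX_smooth mF_smooth kF_smooth BG.koszul_smooth BG.g_smooth
  BG.inverse_metric_smooth BG.tensor_form_koszul B.tensor_form_differential

lemma smooth_if: "(c \<Longrightarrow> f \<in> smooth_funs PM) \<Longrightarrow> (\<lambda>q. if c then f q else 0) \<in> smooth_funs PM"
  by (cases c) auto

lemma C_HH_HH:
  assumes X_vf: "X \<in> vector_fields B" and Y_vf: "Y \<in> vector_fields B" and Z_vf: "Z \<in> vector_fields B" and T_vf: "T \<in> vector_fields B"
    and p: "(x, y) \<in> points PM"
  shows "C (hl X) (hl Z) (hl Y) (hl T) (x, y) = gBs (koszul gB X Z) (koszul gB Y T) x"
proof -
  have "C (hl X) (hl Z) (hl Y) (hl T) (x, y) = (\<lambda>q. gBs (koszul gB X Z) (koszul gB Y T) (fst q)) (x, y)"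
  \<comment> \<open>Both fibre parts are 0, so any common index will do.\<close>
  proof (rule contractionI[OF _ p, where i=l and i'=l])
    show "(\<lambda>q. gBs (koszul gB X Z) (koszul gB Y T) (fst q)) \<in> smooth_funs PM"
      by (intro PM_smooth X_vf Y_vf Z_vf T_vf)
    fix x y assume "(x, y) \<in> regular_points PM g"
    note p = regular_pt[OF this]
    have x: "x \<in> points B" and y: "y l \<in> points (F l)" using p by auto
    obtain s1 where s1: "s1 \<in> tangent_space B x" "\<forall>T\<in>vector_fields B. koszul gB X Z T x = gB x s1 (T x)" "rep (KH (hl X) (hl Z)) x y s1 l (\<lambda>f. 0)"
      using rep_HH[OF p X_vf Z_vf] by blast
    obtain s2 where s2: "s2 \<in> tangent_space B x" "\<forall>Z\<in>vector_fields B. koszul gB Y T Z x = gB x s2 (Z x)" "rep (KH (hl Y) (hl T)) x y s2 l (\<lambda>f. 0)"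
      using rep_HH[OF p Y_vf T_vf] by blast
    have "gBs (koszul gB X Z) (koszul gB Y T) x = gB x s1 s2"
      by (rule BG.inverse_metric_eq[OF x BG.tensor_form_koszul[OF X_vf Z_vf] BG.tensor_form_koszul[OF Y_vf T_vf] s1(1) _ s2(1)])
         (use s1(2) s2(2) in auto)
    moreover have "gF l (y l) (\<lambda>f. 0) (\<lambda>f. 0) = 0" by (rule semi_riem.g_zero[OF FG y manifold.tangent_zero[OF fib]])
    ultimately show "\<exists>s c s' c'. rep (KH (hl X) (hl Z)) x y s l c \<and> rep (KH (hl Y) (hl T)) x y s' l c' \<and>
        (\<lambda>q. gBs (koszul gB X Z) (koszul gB Y T) (fst q)) (x, y) = gB x s s' + (if l = l then (b l x)\<^sup>2 * gF l (y l) c c' else 0)"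
      using s1(3) s2(3) by (intro exI[of _ s1] exI[of _ s2] exI[of _ "\<lambda>f. 0"]) simp
  qed
  then show ?thesis by simp
qed

lemma C_HH_HV:
  assumes X_vf: "X \<in> vector_fields B" and Y_vf: "Y \<in> vector_fields B" and Z_vf: "Z \<in> vector_fields B" and W_vf: "W \<in> vector_fields (F j)"
    and p: "(x, y) \<in> points PM"
  shows "C (hl X) (hl Z) (hl Y) (vl j W) (x, y) = \<pi> j W (x, y) * koszul gB X Z Y x"
proof -
  have "C (hl X) (hl Z) (hl Y) (vl j W) (x, y) = (\<lambda>q. \<pi> j W q * koszul gB X Z Y (fst q)) (x, y)"
  proof (rule contractionI[OF _ p, where i=j and i'=j])
    show "(\<lambda>q. \<pi> j W q * koszul gB X Z Y (fst q)) \<in> smooth_funs PM"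
      by (intro PM_smooth X_vf Y_vf Z_vf W_vf)
    fix x y assume "(x, y) \<in> regular_points PM g"
    note p = regular_pt[OF this]
    have x: "x \<in> points B" and y: "y j \<in> points (F j)" using p by auto
    obtain s1 where s1: "s1 \<in> tangent_space B x" "\<forall>T\<in>vector_fields B. koszul gB X Z T x = gB x s1 (T x)" "rep (KH (hl X) (hl Z)) x y s1 j (\<lambda>f. 0)"
      using rep_HH[OF p X_vf Z_vf] by blast
    note r2 = rep_HV[OF p Y_vf W_vf]
    have "gB x s1 (\<lambda>f. \<pi> j W (x, y) * Y x f) = \<pi> j W (x, y) * koszul gB X Z Y x"
      using BG.g_scale_right[OF x vfB[OF Y_vf x] s1(1)] s1(2) Y_vf by simp
    moreover have "gF j (y j) (\<lambda>f. 0) (\<lambda>f. dbX j Y x / b j x * W (y j) f) = 0"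
      by (rule semi_riem.g_zero[OF FG y manifold.tangent_scale[OF fib vfF[OF W_vf y]]])
    ultimately show "\<exists>s c s' c'. rep (KH (hl X) (hl Z)) x y s j c \<and> rep (KH (hl Y) (vl j W)) x y s' j c' \<and>
        (\<lambda>q. \<pi> j W q * koszul gB X Z Y (fst q)) (x, y) = gB x s s' + (if j = j then (b j x)\<^sup>2 * gF j (y j) c c' else 0)"
      using s1(3) r2 by (intro exI conjI) (assumption, assumption, simp only: if_True, simp)
  qed
  then show ?thesis by simp
qed

lemma C_HH_VH:
  assumes X_vf: "X \<in> vector_fields B" and Y_vf: "Y \<in> vector_fields B" and Z_vf: "Z \<in> vector_fields B" and W_vf: "W \<in> vector_fields (F j)"
    and p: "(x, y) \<in> points PM"
  shows "C (hl X) (hl Z) (vl j W) (hl Y) (x, y) = 0"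
proof -
  have "C (hl X) (hl Z) (vl j W) (hl Y) (x, y) = (\<lambda>q. 0) (x, y)"
  proof (rule contractionI[OF _ p, where i=j and i'=j])
    fix x y assume "(x, y) \<in> regular_points PM g"
    note p = regular_pt[OF this]
    have x: "x \<in> points B" and y: "y j \<in> points (F j)" using p by auto
    obtain s1 where s1: "s1 \<in> tangent_space B x" "\<forall>T\<in>vector_fields B. koszul gB X Z T x = gB x s1 (T x)" "rep (KH (hl X) (hl Z)) x y s1 j (\<lambda>f. 0)"
      using rep_HH[OF p X_vf Z_vf] by blast
    note r2 = rep_VH[OF p Y_vf W_vf]
    have "gB x s1 (\<lambda>f. 0) = 0" by (rule BG.g_zero[OF x s1(1)])
    moreover have "gF j (y j) (\<lambda>f. 0) (\<lambda>f. dbX j Y x / b j x * W (y j) f) = 0"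
      by (rule semi_riem.g_zero[OF FG y manifold.tangent_scale[OF fib vfF[OF W_vf y]]])
    ultimately show "\<exists>s c s' c'. rep (KH (hl X) (hl Z)) x y s j c \<and> rep (KH (vl j W) (hl Y)) x y s' j c' \<and>
        (\<lambda>q. 0) (x, y) = gB x s s' + (if j = j then (b j x)\<^sup>2 * gF j (y j) c c' else 0)"
      using s1(3) r2 by (intro exI conjI) (assumption, assumption, simp only: if_True, simp)
  qed auto
  then show ?thesis by simp
qed

lemma C_HH_VV:
  assumes X_vf: "X \<in> vector_fields B" and Z_vf: "Z \<in> vector_fields B" and V_vf: "V \<in> vector_fields (F i)" and W_vf: "W \<in> vector_fields (F j)"
    and p: "(x, y) \<in> points PM"
  shows "C (hl X) (hl Z) (vl i V) (vl j W) (x, y) =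
    (if i = j then - (b i x * mF i V W (y i) * gBs (koszul gB X Z) (differential (b i)) x) else 0)"
proof -
  let ?h = "\<lambda>q. if i = j then - (b i (fst q) * mF i V W (snd q i) * gBs (koszul gB X Z) (differential (b i)) (fst q)) else 0"
  have "C (hl X) (hl Z) (vl i V) (vl j W) (x, y) = ?h (x, y)"
  proof (rule contractionI[OF _ p, where i=i and i'=i])
    show "?h \<in> smooth_funs PM"
    proof (cases "i = j")
      case True
      then have "W \<in> vector_fields (F i)" using V_vf W_vf by simp
      then have "(\<lambda>q. - (b i (fst q) * mF i V W (snd q i) * gBs (koszul gB X Z) (differential (b i)) (fst q))) \<in> smooth_funs PM"
        by (intro PM_smooth X_vf Z_vf V_vf W_vf)
      then show ?thesis using True by simp
    qed simp
    fix x y assume "(x, y) \<in> regular_points PM g"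
    note p = regular_pt[OF this]
    have x: "x \<in> points B" and y: "y i \<in> points (F i)" using p by auto
    obtain s1 where s1: "s1 \<in> tangent_space B x" "\<forall>T\<in>vector_fields B. koszul gB X Z T x = gB x s1 (T x)" "rep (KH (hl X) (hl Z)) x y s1 i (\<lambda>f. 0)"
      using rep_HH[OF p X_vf Z_vf] by blast
    let ?m = "if i = j then - (b i x * mF i V W (y i)) else 0"
    obtain \<sigma> S where \<sigma>: "\<sigma> \<in> tangent_space B x" "\<forall>T\<in>vector_fields B. T x (b i) = gB x \<sigma> (T x)"
      and r2: "rep (KH (vl i V) (vl j W)) x y (\<lambda>f. ?m * \<sigma> f) i (\<lambda>f. (if i = j then 1 else 0) * S f + \<pi> j W (x, y) * V (y i) f)"
      using rep_VV[OF p V_vf W_vf] by blast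
    have "gBs (koszul gB X Z) (differential (b i)) x = gB x s1 \<sigma>"
      by (rule BG.inverse_metric_eq[OF x BG.tensor_form_koszul[OF X_vf Z_vf] B.tensor_form_differential[OF b_smooth] s1(1) _ \<sigma>(1)])
         (use s1(2) \<sigma>(2) in \<open>auto simp: differential_def dir_deriv_def\<close>)
    then have "?h (x, y) = gB x s1 (\<lambda>f. ?m * \<sigma> f)"
      unfolding BG.g_scale_right[OF x \<sigma>(1) s1(1)] by auto
    moreover have "gF i (y i) (\<lambda>f. 0) (\<lambda>f. (if i = j then 1 else 0) * S f + \<pi> j W (x, y) * V (y i) f) = 0"
      by (rule semi_riem.g_zero[OF FG y]) (use r2 in \<open>simp add: rep_def\<close>)
    ultimately show "\<exists>s c s' c'. rep (KH (hl X) (hl Z)) x y s i c \<and> rep (KH (vl i V) (vl j W)) x y s' i c' \<and>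
        ?h (x, y) = gB x s s' + (if i = i then (b i x)\<^sup>2 * gF i (y i) c c' else 0)"
      using s1(3) r2 by (intro exI conjI) (assumption, assumption, simp only: if_True, simp)
  qed
  then show ?thesis by simp
qed

text \<open>The base parts g(W,P) X and g(Q,P) Y give the product of the two P-terms; the fibre
  parts give the derivatives of the warping function via \<open>fibre_core\<close>.\<close>

lemma C_HV_HV:
  assumes X_vf: "X \<in> vector_fields B" and Y_vf: "Y \<in> vector_fields B" and W_vf: "W \<in> vector_fields (F j)" and Q_vf: "Q \<in> vector_fields (F s)"
    and p: "(x, y) \<in> points PM"
  shows "C (hl X) (vl j W) (hl Y) (vl s Q) (x, y) = \<pi> j W (x, y) * \<pi> s Q (x, y) * metric_fun gB X Y x +
    (if j = s then dbX j X x * dbX j Y x * mF j W Q (y j) else 0)"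
proof -
  let ?h = "\<lambda>q. \<pi> j W q * \<pi> s Q q * metric_fun gB X Y (fst q) + (if j = s then dbX j X (fst q) * dbX j Y (fst q) * mF j W Q (snd q j) else 0)"
  have "C (hl X) (vl j W) (hl Y) (vl s Q) (x, y) = ?h (x, y)"
  proof (rule contractionI[OF _ p, where i=j and i'=s])
    have 1: "(\<lambda>q. \<pi> j W q * \<pi> s Q q * metric_fun gB X Y (fst q)) \<in> smooth_funs PM" by (intro PM_smooth X_vf Y_vf W_vf Q_vf)
    have 2: "(\<lambda>q. dbX j X (fst q) * dbX j Y (fst q) * mF j W Q (snd q j)) \<in> smooth_funs PM" if "j = s"
      by (intro PM_smooth X_vf Y_vf W_vf Q_vf) (use W_vf Q_vf that in simp)
    show "?h \<in> smooth_funs PM" using P.smooth_funs_add[OF 1 2] 1 by (cases "j = s") auto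
    fix x y assume r: "(x, y) \<in> regular_points PM g"
    note p = regular_pt[OF this]
    have x: "x \<in> points B" using p by auto
    note r1 = rep_HV[OF p X_vf W_vf] and r2 = rep_HV[OF p Y_vf Q_vf]
    note Xx = vfB[OF X_vf x] and Yx = vfB[OF Y_vf x]
    have "gB x (\<lambda>f. \<pi> j W (x, y) * X x f) (\<lambda>f. \<pi> s Q (x, y) * Y x f) = \<pi> j W (x, y) * (\<pi> s Q (x, y) * metric_fun gB X Y x)"
      unfolding BG.g_scale[OF x Xx B.tangent_scale[OF Yx]] BG.g_scale_right[OF x Yx Xx] by (simp add: metric_fun_def)
    moreover have "(if j = s then (b j x)\<^sup>2 * gF j (y j) (\<lambda>f. dbX j X x / b j x * W (y j) f) (\<lambda>f. dbX s Y x / b s x * Q (y s) f) else 0) =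
        (if j = s then dbX j X x * dbX j Y x * mF j W Q (y j) else 0)"
      using fibre_core[OF r X_vf Y_vf W_vf, of Q] Q_vf by (cases "j = s") auto
    ultimately show "\<exists>s' c s'' c'. rep (KH (hl X) (vl j W)) x y s' j c \<and> rep (KH (hl Y) (vl s Q)) x y s'' s c' \<and>
        ?h (x, y) = gB x s' s'' + (if j = s then (b j x)\<^sup>2 * gF j (y j) c c' else 0)"
      using r1 r2 by (intro exI conjI) (assumption, assumption, simp only: fst_conv snd_conv mult.assoc)
  qed
  then show ?thesis by simp
qed

lemma C_HV_VH:
  assumes X_vf: "X \<in> vector_fields B" and Y_vf: "Y \<in> vector_fields B" and V_vf: "V \<in> vector_fields (F i)" and W_vf: "W \<in> vector_fields (F j)"
    and p: "(x, y) \<in> points PM"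
  shows "C (hl X) (vl j W) (vl i V) (hl Y) (x, y) = (if j = i then dbX j X x * dbX j Y x * mF j W V (y j) else 0)"
proof -
  let ?h = "\<lambda>q. if j = i then dbX j X (fst q) * dbX j Y (fst q) * mF j W V (snd q j) else 0"
  have "C (hl X) (vl j W) (vl i V) (hl Y) (x, y) = ?h (x, y)"
  proof (rule contractionI[OF _ p, where i=j and i'=i])
    have 2: "(\<lambda>q. dbX j X (fst q) * dbX j Y (fst q) * mF j W V (snd q j)) \<in> smooth_funs PM" if "j = i"
      by (intro PM_smooth X_vf Y_vf V_vf W_vf) (use V_vf W_vf that in simp)
    show "?h \<in> smooth_funs PM" using 2 by (cases "j = i") auto
    fix x y assume r: "(x, y) \<in> regular_points PM g"
    note p = regular_pt[OF this]
    have x: "x \<in> points B" using p by auto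
    note r1 = rep_HV[OF p X_vf W_vf] and r2 = rep_VH[OF p Y_vf V_vf]
    have "gB x (\<lambda>f. \<pi> j W (x, y) * X x f) (\<lambda>f. 0) = 0"
      by (rule BG.g_zero[OF x B.tangent_scale[OF vfB[OF X_vf x]]])
    moreover have "(if j = i then (b j x)\<^sup>2 * gF j (y j) (\<lambda>f. dbX j X x / b j x * W (y j) f) (\<lambda>f. dbX i Y x / b i x * V (y i) f) else 0) =
        (if j = i then dbX j X x * dbX j Y x * mF j W V (y j) else 0)"
      using fibre_core[OF r X_vf Y_vf W_vf, of V] V_vf by (cases "j = i") auto
    ultimately show "\<exists>s' c s'' c'. rep (KH (hl X) (vl j W)) x y s' j c \<and> rep (KH (vl i V) (hl Y)) x y s'' i c' \<and>
        ?h (x, y) = gB x s' s'' + (if j = i then (b j x)\<^sup>2 * gF j (y j) c c' else 0)"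
      using r1 r2 by (intro exI conjI) (assumption, assumption, simp only: fst_conv snd_conv add_0)
  qed
  then show ?thesis by simp
qed

lemma C_VH_VH:
  assumes X_vf: "X \<in> vector_fields B" and Y_vf: "Y \<in> vector_fields B" and V_vf: "V \<in> vector_fields (F i)" and W_vf: "W \<in> vector_fields (F j)"
    and p: "(x, y) \<in> points PM"
  shows "C (vl j W) (hl X) (vl i V) (hl Y) (x, y) = (if j = i then dbX j X x * dbX j Y x * mF j W V (y j) else 0)"
proof -
  let ?h = "\<lambda>q. if j = i then dbX j X (fst q) * dbX j Y (fst q) * mF j W V (snd q j) else 0"
  have "C (vl j W) (hl X) (vl i V) (hl Y) (x, y) = ?h (x, y)"
  proof (rule contractionI[OF _ p, where i=j and i'=i])
    have 2: "(\<lambda>q. dbX j X (fst q) * dbX j Y (fst q) * mF j W V (snd q j)) \<in> smooth_funs PM" if "j = i"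
      by (intro PM_smooth X_vf Y_vf V_vf W_vf) (use V_vf W_vf that in simp)
    show "?h \<in> smooth_funs PM" using 2 by (cases "j = i") auto
    fix x y assume r: "(x, y) \<in> regular_points PM g"
    note p = regular_pt[OF this]
    have x: "x \<in> points B" using p by auto
    note r1 = rep_VH[OF p X_vf W_vf] and r2 = rep_VH[OF p Y_vf V_vf]
    have "gB x (\<lambda>f. 0) (\<lambda>f. 0) = 0"
      by (rule BG.g_zero[OF x B.tangent_zero])
    moreover have "(if j = i then (b j x)\<^sup>2 * gF j (y j) (\<lambda>f. dbX j X x / b j x * W (y j) f) (\<lambda>f. dbX i Y x / b i x * V (y i) f) else 0) =
        (if j = i then dbX j X x * dbX j Y x * mF j W V (y j) else 0)"
      using fibre_core[OF r X_vf Y_vf W_vf, of V] V_vf by (cases "j = i") auto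
    ultimately show "\<exists>s' c s'' c'. rep (KH (vl j W) (hl X)) x y s' j c \<and> rep (KH (vl i V) (hl Y)) x y s'' i c' \<and>
        ?h (x, y) = gB x s' s'' + (if j = i then (b j x)\<^sup>2 * gF j (y j) c c' else 0)"
      using r1 r2 by (intro exI conjI) (assumption, assumption, simp only: fst_conv snd_conv add_0)
  qed
  then show ?thesis by simp
qed

text \<open>Only one of the two vectors carries a quotient, so b_j^2 leaves one factor b_j. At a
  zero of b_j both sides vanish, and no information on the rank is needed.\<close>

lemma fibre_VV:
  assumes y: "y j \<in> points (F j)" and ji: "j = i" and S: "S \<in> tangent_space (F i) (y i)" and V: "V \<in> vector_fields (F i)" and W: "W \<in> vector_fields (F j)"
    and SQ: "i = k \<longrightarrow> (\<forall>Q\<in>vector_fields (F i). kF i V U Q (y i) = gF i (y i) S (Q (y i)))"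
  shows "(b j x)\<^sup>2 * gF j (y j) (\<lambda>f. dbX j X x / b j x * W (y j) f) (\<lambda>f. (if i = k then 1 else 0) * S f + c * V (y i) f) =
    b j x * dbX j X x * ((if i = k then kF j V U W (y j) else 0) + c * mF j W V (y j))"
proof -
  have V': "V \<in> vector_fields (F j)" and S': "S \<in> tangent_space (F j) (y j)" using V S ji by auto
  note Wy = vfF[OF W y] and Vy = vfF[OF V' y]
  have "gF j (y j) (W (y j)) S = gF j (y j) S (W (y j))" by (rule semi_riem.g_sym[OF FG y Wy S'])
  moreover have "gF j (y j) S (W (y j)) = kF j V U W (y j)" if "i = k" using SQ W ji that by auto
  ultimately have e: "gF j (y j) (W (y j)) (\<lambda>f. (if i = k then 1 else 0) * S f + c * V (y j) f) = (if i = k then kF j V U W (y j) else 0) + c * mF j W V (y j)"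
    unfolding semi_riem.g_comb(2)[OF FG y S' Vy Wy] by (simp add: metric_fun_def)
  show ?thesis
    unfolding semi_riem.g_scale[OF FG y Wy manifold.tangent_comb[OF fib S' Vy], folded ji] scaled_mult e[unfolded ji] ji[symmetric]
    using e semi_riem.g_scale[OF FG y Wy manifold.tangent_comb[OF fib S' Vy]] scaled_mult ji by simp
qed

lemma C_HV_VV:
  assumes X_vf: "X \<in> vector_fields B" and U_vf: "U \<in> vector_fields (F k)" and V_vf: "V \<in> vector_fields (F i)" and W_vf: "W \<in> vector_fields (F j)"
    and p: "(x, y) \<in> points PM"
  shows "C (hl X) (vl j W) (vl i V) (vl k U) (x, y) =
    \<pi> j W (x, y) * (if i = k then - (b i x * mF i V U (y i) * dbX i X x) else 0) +
    (if j = i then b j x * dbX j X x * ((if i = k then kF j V U W (y j) else 0) + \<pi> k U (x, y) * mF j W V (y j)) else 0)"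
proof -
  let ?h1 = "\<lambda>q. \<pi> j W q * (if i = k then - (b i (fst q) * mF i V U (snd q i) * dbX i X (fst q)) else 0)"
  let ?h2 = "\<lambda>q. if j = i then b j (fst q) * dbX j X (fst q) * ((if i = k then kF j V U W (snd q j) else 0) + \<pi> k U q * mF j W V (snd q j)) else 0"
  let ?h = "\<lambda>q. ?h1 q + ?h2 q"
  have "C (hl X) (vl j W) (vl i V) (vl k U) (x, y) = ?h (x, y)"
  proof (rule contractionI[OF _ p, where i=j and i'=i])
    have "?h1 \<in> smooth_funs PM"
    proof (cases "i = k")
      case True
      then have "U \<in> vector_fields (F i)" using U_vf V_vf W_vf by simp
      then have "(\<lambda>q. \<pi> j W q * (- (b i (fst q) * mF i V U (snd q i) * dbX i X (fst q)))) \<in> smooth_funs PM"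
        by (intro PM_smooth X_vf U_vf V_vf W_vf)
      then show ?thesis using True by simp
    qed simp
    moreover have "?h2 \<in> smooth_funs PM"
    proof (cases "j = i")
      case True
      then have V: "V \<in> vector_fields (F j)" using U_vf V_vf W_vf by simp
      have 1: "(\<lambda>q. if i = k then kF j V U W (snd q j) else 0) \<in> smooth_funs PM"
      proof (cases "i = k")
        case ik: True
        then have "U \<in> vector_fields (F j)" using True U_vf V_vf W_vf by simp
        then have "(\<lambda>q. kF j V U W (snd q j)) \<in> smooth_funs PM" by (intro PM_smooth V U_vf V_vf W_vf)
        then show ?thesis using ik by simp
      qed simp
      have "(\<lambda>q. b j (fst q) * dbX j X (fst q) * ((if i = k then kF j V U W (snd q j) else 0) + \<pi> k U q * mF j W V (snd q j))) \<in> smooth_funs PM"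
        by (intro PM_smooth 1 X_vf U_vf V_vf W_vf V)
      then show ?thesis using True by simp
    qed simp
    ultimately show "?h \<in> smooth_funs PM" by (rule P.smooth_funs_add)
    fix x y assume "(x, y) \<in> regular_points PM g"
    note p = regular_pt[OF this]
    have x: "x \<in> points B" and y: "\<And>j. y j \<in> points (F j)" using p by auto
    note r1 = rep_HV[OF p X_vf W_vf] and Xx = vfB[OF X_vf x]
    let ?m = "if i = k then - (b i x * mF i V U (y i)) else 0"
    obtain \<sigma> S where \<sigma>: "\<sigma> \<in> tangent_space B x" "\<forall>T\<in>vector_fields B. T x (b i) = gB x \<sigma> (T x)"
      and S: "S \<in> tangent_space (F i) (y i)" "i = k \<longrightarrow> (\<forall>Q\<in>vector_fields (F i). kF i V U Q (y i) = gF i (y i) S (Q (y i)))"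
      and r2: "rep (KH (vl i V) (vl k U)) x y (\<lambda>f. ?m * \<sigma> f) i (\<lambda>f. (if i = k then 1 else 0) * S f + \<pi> k U (x, y) * V (y i) f)"
      using rep_VV[OF p V_vf U_vf] by blast
    have "gB x (X x) \<sigma> = dbX i X x"
      using \<sigma>(2) X_vf BG.g_sym[OF x Xx \<sigma>(1)] by (simp add: dir_deriv_def)
    then have "gB x (\<lambda>f. \<pi> j W (x, y) * X x f) (\<lambda>f. ?m * \<sigma> f) = ?h1 (x, y)"
      unfolding BG.g_scale[OF x Xx B.tangent_scale[OF \<sigma>(1)]] BG.g_scale_right[OF x \<sigma>(1) Xx] by auto
    moreover have "(if j = i then (b j x)\<^sup>2 * gF j (y j) (\<lambda>f. dbX j X x / b j x * W (y j) f) (\<lambda>f. (if i = k then 1 else 0) * S f + \<pi> k U (x, y) * V (y i) f) else 0) = ?h2 (x, y)"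
      using fibre_VV[OF y _ S(1) V_vf W_vf S(2), where x=x and X=X and c="\<pi> k U (x, y)"] by (cases "j = i") auto
    ultimately show "\<exists>s' c s'' c'. rep (KH (hl X) (vl j W)) x y s' j c \<and> rep (KH (vl i V) (vl k U)) x y s'' i c' \<and>
        ?h (x, y) = gB x s' s'' + (if j = i then (b j x)\<^sup>2 * gF j (y j) c c' else 0)"
      using r1 r2 by (intro exI conjI) (assumption, assumption, simp only:)
  qed
  then show ?thesis by simp
qed

lemma C_VH_VV:
  assumes X_vf: "X \<in> vector_fields B" and U_vf: "U \<in> vector_fields (F k)" and V_vf: "V \<in> vector_fields (F i)" and W_vf: "W \<in> vector_fields (F j)"
    and p: "(x, y) \<in> points PM"
  shows "C (vl j W) (hl X) (vl i V) (vl k U) (x, y) =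
    (if j = i then b j x * dbX j X x * ((if i = k then kF j V U W (y j) else 0) + \<pi> k U (x, y) * mF j W V (y j)) else 0)"
proof -
  let ?h = "\<lambda>q. if j = i then b j (fst q) * dbX j X (fst q) * ((if i = k then kF j V U W (snd q j) else 0) + \<pi> k U q * mF j W V (snd q j)) else 0"
  have "C (vl j W) (hl X) (vl i V) (vl k U) (x, y) = ?h (x, y)"
  proof (rule contractionI[OF _ p, where i=j and i'=i])
    show "?h \<in> smooth_funs PM"
    proof (cases "j = i")
      case True
      then have V: "V \<in> vector_fields (F j)" using U_vf V_vf W_vf by simp
      have 1: "(\<lambda>q. if i = k then kF j V U W (snd q j) else 0) \<in> smooth_funs PM"
      proof (cases "i = k")
        case ik: True
        then have "U \<in> vector_fields (F j)" using True U_vf V_vf W_vf by simp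
        then have "(\<lambda>q. kF j V U W (snd q j)) \<in> smooth_funs PM" by (intro PM_smooth V U_vf V_vf W_vf)
        then show ?thesis using ik by simp
      qed simp
      have "(\<lambda>q. b j (fst q) * dbX j X (fst q) * ((if i = k then kF j V U W (snd q j) else 0) + \<pi> k U q * mF j W V (snd q j))) \<in> smooth_funs PM"
        by (intro PM_smooth 1 X_vf U_vf V_vf W_vf V)
      then show ?thesis using True by simp
    qed simp
    fix x y assume "(x, y) \<in> regular_points PM g"
    note p = regular_pt[OF this]
    have x: "x \<in> points B" and y: "\<And>j. y j \<in> points (F j)" using p by auto
    note r1 = rep_VH[OF p X_vf W_vf]
    let ?m = "if i = k then - (b i x * mF i V U (y i)) else 0"
    obtain \<sigma> S where \<sigma>: "\<sigma> \<in> tangent_space B x" "\<forall>T\<in>vector_fields B. T x (b i) = gB x \<sigma> (T x)"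
      and S: "S \<in> tangent_space (F i) (y i)" "i = k \<longrightarrow> (\<forall>Q\<in>vector_fields (F i). kF i V U Q (y i) = gF i (y i) S (Q (y i)))"
      and r2: "rep (KH (vl i V) (vl k U)) x y (\<lambda>f. ?m * \<sigma> f) i (\<lambda>f. (if i = k then 1 else 0) * S f + \<pi> k U (x, y) * V (y i) f)"
      using rep_VV[OF p V_vf U_vf] by blast
    have "gB x (\<lambda>f. 0) (\<lambda>f. ?m * \<sigma> f) = 0"
      by (rule BG.g_zero[OF x B.tangent_scale[OF \<sigma>(1)]])
    moreover have "(if j = i then (b j x)\<^sup>2 * gF j (y j) (\<lambda>f. dbX j X x / b j x * W (y j) f) (\<lambda>f. (if i = k then 1 else 0) * S f + \<pi> k U (x, y) * V (y i) f) else 0) = ?h (x, y)"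
      using fibre_VV[OF y _ S(1) V_vf W_vf S(2), where x=x and X=X and c="\<pi> k U (x, y)"] by (cases "j = i") auto
    ultimately show "\<exists>s' c s'' c'. rep (KH (vl j W) (hl X)) x y s' j c \<and> rep (KH (vl i V) (vl k U)) x y s'' i c' \<and>
        ?h (x, y) = gB x s' s'' + (if j = i then (b j x)\<^sup>2 * gF j (y j) c c' else 0)"
      using r1 r2 by (intro exI conjI) (assumption, assumption, simp only: add_0)
  qed
  then show ?thesis by simp
qed

lemma contraction_F:
  assumes U_vf: "U \<in> vector_fields (F k)" and V_vf: "V \<in> vector_fields (F i)" and W_vf: "W \<in> vector_fields (F j)" and Q_vf: "Q \<in> vector_fields (F s)"
    and "k = j" "k = i" "k = s"
  shows "extends_contraction (F k) (gF k) (kF k U W) (kF k V Q) (contraction (F k) (gF k) (kF k U W) (kF k V Q))"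
proof -
  have "\<exists>h. extends_contraction (F k) (gF k) (kF k U W) (kF k V Q) h"
    using sreg[of k] U_vf V_vf W_vf Q_vf assms unfolding semi_regular_def by blast
  then show ?thesis unfolding contraction_def by (rule someI_ex)
qed

lemma fibre_comb_comb:
  assumes U_vf: "U \<in> vector_fields (F k)"
    and y: "y k \<in> points (F k)" and S: "S \<in> tangent_space (F k) (y k)" "S' \<in> tangent_space (F k) (y k)"
    and V: "V' \<in> vector_fields (F k)"
  shows "gF k (y k) (\<lambda>f. \<alpha> * S f + c * U (y k) f) (\<lambda>f. \<beta> * S' f + d * V' (y k) f) =
    \<alpha> * \<beta> * gF k (y k) S S' + d * (\<alpha> * gF k (y k) S (V' (y k))) + c * (\<beta> * gF k (y k) S' (U (y k))) + c * d * mF k U V' (y k)"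
proof -
  note Uy = vfF[OF U_vf y] and Vy = vfF[OF V y]
  have "gF k (y k) (U (y k)) S' = gF k (y k) S' (U (y k))" by (rule semi_riem.g_sym[OF FG y Uy S(2)])
  then show ?thesis
    unfolding semi_riem.g_comb(1)[OF FG y S(1) Uy manifold.tangent_comb[OF fib S(2) Vy]]
      semi_riem.g_comb(2)[OF FG y S(2) Vy S(1)] semi_riem.g_comb(2)[OF FG y S(2) Vy Uy]
    by (simp add: metric_fun_def algebra_simps)
qed

text \<open>The inner product of S and S' is the contraction in the fibre where b_k is nonzero,
  since y_k is then a regular point of F_k. At a zero of b_k nothing is known about y_k, but both
  sides carry the factor b_k^2.\<close>

lemma fibre_VV_VV:
  assumes U_vf: "U \<in> vector_fields (F k)" and V_vf: "V \<in> vector_fields (F i)" and W_vf: "W \<in> vector_fields (F j)" and Q_vf: "Q \<in> vector_fields (F s)"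
    and r: "(x, y) \<in> regular_points PM g" and ki: "k = i"
    and S: "S \<in> tangent_space (F k) (y k)" "k = j \<longrightarrow> form_at (F k) (kF k U W) (y k) = flat_at (F k) (gF k) (y k) S \<and>
        (\<forall>Q\<in>vector_fields (F k). kF k U W Q (y k) = gF k (y k) S (Q (y k)))"
    and S': "S' \<in> tangent_space (F i) (y i)" "i = s \<longrightarrow> form_at (F i) (kF i V Q) (y i) = flat_at (F i) (gF i) (y i) S' \<and>
        (\<forall>U\<in>vector_fields (F i). kF i V Q U (y i) = gF i (y i) S' (U (y i)))"
  shows "(b k x)\<^sup>2 * gF k (y k) (\<lambda>f. (if k = j then 1 else 0) * S f + c * U (y k) f) (\<lambda>f. (if i = s then 1 else 0) * S' f + d * V (y i) f) =
    (b k x)\<^sup>2 * ((if k = j \<and> i = s then contraction (F k) (gF k) (kF k U W) (kF k V Q) (y k) else 0) +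
       d * (if k = j then kF k U W V (y k) else 0) + c * (if i = s then kF k V Q U (y k) else 0) + c * d * mF k U V (y k))"
proof -
  have y: "y k \<in> points (F k)" using regular_pt[OF r] by auto
  have V: "V \<in> vector_fields (F k)" and S'k: "S' \<in> tangent_space (F k) (y k)" using V_vf S'(1) ki by auto
  have US: "(if i = s then 1 else 0) * gF k (y k) S' (U (y k)) = (if i = s then kF k V Q U (y k) else 0)"
    using S'(2) U_vf ki by (cases "i = s") simp_all
  have SV: "(if k = j then 1 else 0) * gF k (y k) S (V (y k)) = (if k = j then kF k U W V (y k) else 0)"
    using S(2) V by (cases "k = j") simp_all
  have SS: "(b k x)\<^sup>2 * ((if k = j then 1 else 0) * (if i = s then 1 else 0) * gF k (y k) S S') =
    (b k x)\<^sup>2 * (if k = j \<and> i = s then contraction (F k) (gF k) (kF k U W) (kF k V Q) (y k) else 0)"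
  proof (cases "b k x \<noteq> 0 \<and> k = j \<and> i = s")
    case True
    then have b: "b k x \<noteq> 0" and kj: "k = j" and iss: "i = s" and ks: "k = s" using ki by auto
    have "y k \<in> regular_points (F k) (gF k)" by (rule regular_fibre[OF r b])
    then have "contraction (F k) (gF k) (kF k U W) (kF k V Q) (y k) =
        bullet_inner (F k) (gF k) (y k) (form_at (F k) (kF k U W) (y k)) (form_at (F k) (kF k V Q) (y k))"
      using contraction_F[OF U_vf V_vf W_vf Q_vf kj ki ks] unfolding extends_contraction_def by blast
    also have "\<dots> = bullet_inner (F k) (gF k) (y k) (flat_at (F k) (gF k) (y k) S) (flat_at (F k) (gF k) (y k) S')"
      using S(2) S'(2) kj iss unfolding ki[symmetric] by simp
    also have "\<dots> = gF k (y k) S S'" by (rule semi_riem.bullet_inner_flat[OF FG y S(1) S'k])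
    finally show ?thesis using kj iss by simp
  qed auto
  show ?thesis
    unfolding ki[symmetric] fibre_comb_comb[where y=y, OF U_vf y S(1) S'k V] ring_distribs SS[unfolded ki[symmetric]]
    using US SV by (simp only: ki[symmetric])
qed

lemma C_VV_VV:
  assumes U_vf: "U \<in> vector_fields (F k)" and V_vf: "V \<in> vector_fields (F i)" and W_vf: "W \<in> vector_fields (F j)" and Q_vf: "Q \<in> vector_fields (F s)"
    and p: "(x, y) \<in> points PM"
  shows "C (vl k U) (vl j W) (vl i V) (vl s Q) (x, y) =
    (if k = j \<and> i = s then b k x * b i x * mF k U W (y k) * mF i V Q (y i) * gBs (differential (b k)) (differential (b i)) x else 0) +
    (if k = i then (b k x)\<^sup>2 * ((if k = j \<and> i = s then contraction (F k) (gF k) (kF k U W) (kF k V Q) (y k) else 0) +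
       \<pi> s Q (x, y) * (if k = j then kF k U W V (y k) else 0) + \<pi> j W (x, y) * (if i = s then kF k V Q U (y k) else 0) +
       \<pi> j W (x, y) * \<pi> s Q (x, y) * mF k U V (y k)) else 0)"
proof -
  let ?c = "contraction (F k) (gF k) (kF k U W) (kF k V Q)"
  let ?h1 = "\<lambda>q. if k = j \<and> i = s then b k (fst q) * b i (fst q) * mF k U W (snd q k) * mF i V Q (snd q i) * gBs (differential (b k)) (differential (b i)) (fst q) else 0"
  let ?h2 = "\<lambda>q. if k = i then (b k (fst q))\<^sup>2 * ((if k = j \<and> i = s then ?c (snd q k) else 0) +
       \<pi> s Q q * (if k = j then kF k U W V (snd q k) else 0) + \<pi> j W q * (if i = s then kF k V Q U (snd q k) else 0) +
       \<pi> j W q * \<pi> s Q q * mF k U V (snd q k)) else 0"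
  let ?h = "\<lambda>q. ?h1 q + ?h2 q"
  have "C (vl k U) (vl j W) (vl i V) (vl s Q) (x, y) = ?h (x, y)"
  proof (rule contractionI[where h="?h" and i=k and i'=i, OF _ p])
    have "?h1 \<in> smooth_funs PM"
    proof (rule smooth_if)
      assume "k = j \<and> i = s"
      then have W: "W \<in> vector_fields (F k)" and Q: "Q \<in> vector_fields (F i)" using U_vf V_vf W_vf Q_vf by auto
      show "(\<lambda>q. b k (fst q) * b i (fst q) * mF k U W (snd q k) * mF i V Q (snd q i) * gBs (differential (b k)) (differential (b i)) (fst q)) \<in> smooth_funs PM"
        by (intro P.smooth_funs_mult smooth_PM_base smooth_PM_fibre b_smooth mF_smooth W Q U_vf V_vf W_vf Q_vf BG.inverse_metric_smooth B.tensor_form_differential)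
    qed
    moreover have "?h2 \<in> smooth_funs PM"
    proof (rule smooth_if)
      assume ki: "k = i"
      then have V: "V \<in> vector_fields (F k)" using U_vf V_vf W_vf Q_vf by simp
      have 1: "(\<lambda>q. if k = j \<and> i = s then ?c (snd q k) else 0) \<in> smooth_funs PM"
      proof (rule smooth_if)
        assume "k = j \<and> i = s"
        \<comment> \<open>Semi-regularity of the fibre supplies the smoothness of the extended
          contraction, at regular and singular points alike.\<close>
        then have "?c \<in> smooth_funs (F k)" using contraction_F[OF U_vf V_vf W_vf Q_vf] ki unfolding extends_contraction_def by blast
        then show "(\<lambda>q. ?c (snd q k)) \<in> smooth_funs PM" by (rule smooth_PM_fibre)
      qed
      have 2: "(\<lambda>q. if k = j then kF k U W V (snd q k) else 0) \<in> smooth_funs PM"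
        by (rule smooth_if, rule smooth_PM_fibre, rule kF_smooth) (use U_vf V_vf W_vf Q_vf ki in auto)
      have 3: "(\<lambda>q. if i = s then kF k V Q U (snd q k) else 0) \<in> smooth_funs PM"
        by (rule smooth_if, rule smooth_PM_fibre, rule kF_smooth) (use U_vf V_vf W_vf Q_vf ki in auto)
      show "(\<lambda>q. (b k (fst q))\<^sup>2 * ((if k = j \<and> i = s then ?c (snd q k) else 0) +
         \<pi> s Q q * (if k = j then kF k U W V (snd q k) else 0) + \<pi> j W q * (if i = s then kF k V Q U (snd q k) else 0) +
         \<pi> j W q * \<pi> s Q q * mF k U V (snd q k))) \<in> smooth_funs PM"
        by (intro P.smooth_funs_mult P.smooth_funs_add 1 2 3 P.smooth_funs_power smooth_PM_base b_smooth \<pi>_smooth U_vf V_vf W_vf Q_vf smooth_PM_fibre mF_smooth V)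
    qed
    ultimately show "?h \<in> smooth_funs PM" by (rule P.smooth_funs_add)
    fix x y assume r: "(x, y) \<in> regular_points PM g"
    note p = regular_pt[OF r]
    have x: "x \<in> points B" using p by auto
    let ?m = "if k = j then - (b k x * mF k U W (y k)) else 0" and ?m' = "if i = s then - (b i x * mF i V Q (y i)) else 0"
    obtain \<sigma> S where \<sigma>: "\<sigma> \<in> tangent_space B x" "\<forall>T\<in>vector_fields B. T x (b k) = gB x \<sigma> (T x)"
      and S: "S \<in> tangent_space (F k) (y k)" "k = j \<longrightarrow> form_at (F k) (kF k U W) (y k) = flat_at (F k) (gF k) (y k) S \<and>
        (\<forall>Q\<in>vector_fields (F k). kF k U W Q (y k) = gF k (y k) S (Q (y k)))"
      and r1: "rep (KH (vl k U) (vl j W)) x y (\<lambda>f. ?m * \<sigma> f) k (\<lambda>f. (if k = j then 1 else 0) * S f + \<pi> j W (x, y) * U (y k) f)"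
      using rep_VV[OF p U_vf W_vf] by (elim exE conjE)
    obtain \<sigma>' S' where \<sigma>': "\<sigma>' \<in> tangent_space B x" "\<forall>T\<in>vector_fields B. T x (b i) = gB x \<sigma>' (T x)"
      and S': "S' \<in> tangent_space (F i) (y i)" "i = s \<longrightarrow> form_at (F i) (kF i V Q) (y i) = flat_at (F i) (gF i) (y i) S' \<and>
        (\<forall>U\<in>vector_fields (F i). kF i V Q U (y i) = gF i (y i) S' (U (y i)))"
      and r2: "rep (KH (vl i V) (vl s Q)) x y (\<lambda>f. ?m' * \<sigma>' f) i (\<lambda>f. (if i = s then 1 else 0) * S' f + \<pi> s Q (x, y) * V (y i) f)"
      using rep_VV[OF p V_vf Q_vf] by (elim exE conjE)
    have "gBs (differential (b k)) (differential (b i)) x = gB x \<sigma> \<sigma>'"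
      by (rule BG.inverse_metric_eq[OF x B.tensor_form_differential[OF b_smooth] B.tensor_form_differential[OF b_smooth] \<sigma>(1) _ \<sigma>'(1)])
         (use \<sigma>(2) \<sigma>'(2) in \<open>simp_all add: differential_def dir_deriv_def\<close>)
    then have "gB x (\<lambda>f. ?m * \<sigma> f) (\<lambda>f. ?m' * \<sigma>' f) = ?h1 (x, y)"
      unfolding BG.g_scale[OF x \<sigma>(1) B.tangent_scale[OF \<sigma>'(1)]] BG.g_scale_right[OF x \<sigma>'(1) \<sigma>(1)] by auto
    moreover have "(if k = i then (b k x)\<^sup>2 * gF k (y k) (\<lambda>f. (if k = j then 1 else 0) * S f + \<pi> j W (x, y) * U (y k) f)
        (\<lambda>f. (if i = s then 1 else 0) * S' f + \<pi> s Q (x, y) * V (y i) f) else 0) = ?h2 (x, y)"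
      unfolding fst_conv snd_conv by (rule if_cong[OF refl fibre_VV_VV[OF U_vf V_vf W_vf Q_vf r _ S S'] refl])
    ultimately show "\<exists>s' c s'' c'. rep (KH (vl k U) (vl j W)) x y s' k c \<and> rep (KH (vl i V) (vl s Q)) x y s'' i c' \<and>
        ?h (x, y) = gB x s' s'' + (if k = i then (b k x)\<^sup>2 * gF k (y k) c c' else 0)"
      using r1 r2 by (intro exI conjI) (assumption, assumption, simp only:)
  qed
  then show ?thesis by simp
qed

end

section \<open>Curvature\<close>

context manifold
begin

lemma dir_deriv_mult:
  assumes "X \<in> vector_fields M" "p \<in> points M" "f \<in> smooth_funs M" "h \<in> smooth_funs M"
  shows "dir_deriv X (\<lambda>q. f q * h q) p = dir_deriv X f p * h p + f p * dir_deriv X h p"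
  using tangent_mult[OF vector_fieldsD[OF assms(1,2)] assms(3,4)] by (simp add: dir_deriv_def)

end

context semi_riem
begin

context
  fixes X Y Z p
  assumes X: "X \<in> vector_fields M" and Y: "Y \<in> vector_fields M" and Z: "Z \<in> vector_fields M" and p: "p \<in> points M"
begin

lemma metric_lie_swap: "metric_fun g X (lie_bracket Y Z) p = - metric_fun g X (lie_bracket Z Y) p"
  unfolding metric_fun_def lie_bracket_swap[of Y Z p]
  using g_scale_right[OF p vector_fieldsD[OF lie_bracket_vf[OF Z Y] p] vector_fieldsD[OF X p], of "-1"] by simp

lemma dir_metric_sym: "dir_deriv X (metric_fun g Y Z) p = dir_deriv X (metric_fun g Z Y) p"
  unfolding dir_deriv_def by (rule tangent_cong[OF vector_fieldsD[OF X p] p]) (rule metric_fun_sym[OF _ Y Z])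

end

context
  fixes X Y Z p
  assumes X: "X \<in> vector_fields M" and Y: "Y \<in> vector_fields M" and Z: "Z \<in> vector_fields M" and p: "p \<in> points M"
begin

lemma koszul_metric: "koszul g X Y Z p + koszul g X Z Y p = dir_deriv X (metric_fun g Y Z) p"
  unfolding koszul_def
  using metric_lie_swap[OF X Y Z p] metric_lie_swap[OF Y Z X p] metric_lie_swap[OF Z X Y p]
    dir_metric_sym[OF X Y Z p] dir_metric_sym[OF Y X Z p] dir_metric_sym[OF Z X Y p]
  by (simp add: field_simps)

lemma koszul_torsion: "koszul g X Y Z p - koszul g Y X Z p = metric_fun g (lie_bracket X Y) Z p"
  unfolding koszul_def
  using metric_lie_swap[OF X Y Z p] metric_lie_swap[OF Y Z X p] metric_lie_swap[OF Z X Y p]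
    dir_metric_sym[OF X Y Z p] dir_metric_sym[OF Y X Z p] dir_metric_sym[OF Z X Y p]
    metric_fun_sym[OF p lie_bracket_vf[OF X Y] Z]
  by (simp add: field_simps)

end

text \<open>Two instances of metric compatibility are subtracted and the torsion identity is
  inserted. In this form the derivatives of the metric and the bracket term of the curvature turn
  into exactly the Koszul values that the contractions contribute.\<close>

lemma koszul_cyclic:
  assumes "X \<in> vector_fields M" "Y \<in> vector_fields M" "Z \<in> vector_fields M" "p \<in> points M"
  shows "dir_deriv X (metric_fun g Y Z) p - dir_deriv Y (metric_fun g X Z) p - metric_fun g (lie_bracket X Y) Z p
    = koszul g X Z Y p - koszul g Y Z X p"
  using koszul_metric[OF assms] koszul_metric[OF assms(2,1,3,4)] koszul_torsion[OF assms] by simp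

lemma ssnm_cong1:
  assumes "\<And>q. q \<in> points M \<Longrightarrow> A q = A' q" "A \<in> vector_fields M" "A' \<in> vector_fields M" "C \<in> vector_fields M" "D \<in> vector_fields M" "p \<in> points M"
  shows "ssnm_koszul g P A C D p = ssnm_koszul g P A' C D p"
  using koszul_cong1[OF assms] assms(1)[OF assms(6)] by (simp add: ssnm_koszul_def metric_fun_def)

lemma ssnm_zero1:
  assumes "\<And>q. q \<in> points M \<Longrightarrow> A q = (\<lambda>f. 0)" "A \<in> vector_fields M" "C \<in> vector_fields M" "D \<in> vector_fields M" "p \<in> points M"
  shows "ssnm_koszul g P A C D p = 0"
proof -
  have "ssnm_koszul g P A C D p = ssnm_koszul g P (\<lambda>q f. 0) C D p"
    by (rule ssnm_cong1[OF assms(1,2) vf_zero assms(3,4,5)])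
  then show ?thesis
    using koszul_zero1[OF assms(3,4,5)] g_zero(1)[OF assms(5) vector_fieldsD[OF assms(4,5)]]
    by (simp add: ssnm_koszul_def metric_fun_def)
qed

lemma inverse_metric_sym: "p \<in> points M \<Longrightarrow> inverse_metric M g \<omega> \<tau> p = inverse_metric M g \<tau> \<omega> p"
  unfolding inverse_metric_def by (rule bullet_inner_sym)

end

context warped_vector
begin

abbreviation R where "R \<equiv> ssnm_curvature PM g (vl l P)"
abbreviation mB where "mB X Y \<equiv> metric_fun gB X Y"

lemma R_eq: "R A1 A2 A3 A4 p = dir_deriv A1 (KH A2 A3 A4) p - dir_deriv A2 (KH A1 A3 A4) p - KH (lie_bracket A1 A2) A3 A4 p
    + C A1 A3 A2 A4 p - C A2 A3 A1 A4 p"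
  by (simp add: ssnm_curvature_def curvature_of_def)

text \<open>Symmetry of the contraction brings the arguments into an order covered by the lemmas on
  contractions.\<close>

lemma C_swap: "C A2 A4 A1 A3 p = C A1 A3 A2 A4 p"
  by (rule fun_cong[OF G.contraction_sym])

context
  fixes x y assumes p: "(x, y) \<in> points PM"
begin

section \<open>Bracket terms and derivatives occurring in the curvature\<close>

lemma KH_brHH:
  assumes "X \<in> vector_fields B" "Y \<in> vector_fields B" "A \<in> vector_fields PM" "D \<in> vector_fields PM"
  shows "KH (lie_bracket (hl X) (hl Y)) A D (x, y) = KH (hl (lie_bracket X Y)) A D (x, y)"
  using assms p by (intro G.ssnm_cong1) (auto intro!: lie_HH P.lie_bracket_vf lift_base_vf B.lie_bracket_vf)

lemma KH_brHV:
  assumes "X \<in> vector_fields B" "W \<in> vector_fields (F j)" "A \<in> vector_fields PM" "D \<in> vector_fields PM"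
  shows "KH (lie_bracket (hl X) (vl j W)) A D (x, y) = 0" "KH (lie_bracket (vl j W) (hl X)) A D (x, y) = 0"
  using assms p by (auto intro!: G.ssnm_zero1 lie_HV lie_VH P.lie_bracket_vf lift_base_vf lift_fibre_vf)

lemma KH_brVV:
  assumes V: "V \<in> vector_fields (F i)" and W: "W \<in> vector_fields (F j)" and A: "A \<in> vector_fields PM" "D \<in> vector_fields PM"
  shows "KH (lie_bracket (vl i V) (vl j W)) A D (x, y) = (if i = j then KH (vl j (lie_bracket V W)) A D (x, y) else 0)"
proof (cases "i = j")
  case True
  then have "lie_bracket V W \<in> vector_fields (F j)" using manifold.lie_bracket_vf[OF fib _ W] V by simp
  then have "KH (lie_bracket (vl i V) (vl j W)) A D (x, y) = KH (vl j (lie_bracket V W)) A D (x, y)"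
    using assms p lie_VV[OF _ V W] True by (intro G.ssnm_cong1) (auto intro!: P.lie_bracket_vf lift_fibre_vf)
  then show ?thesis using True by simp
next
  case False
  then have "KH (lie_bracket (vl i V) (vl j W)) A D (x, y) = 0"
    using assms p lie_VV[OF _ V W] by (intro G.ssnm_zero1) (auto intro!: P.lie_bracket_vf lift_fibre_vf)
  then show ?thesis using False by simp
qed

text \<open>The constant c covers all three forms with one base and two fibre arguments: it is -1 if
  the base field is in the last place and 1 otherwise.\<close>

lemma D_H_bd:
  assumes X: "X \<in> vector_fields B" "Y \<in> vector_fields B" and V: "V \<in> vector_fields (F i)" "W \<in> vector_fields (F j)"
    and f: "\<And>x y. (x, y) \<in> points PM \<Longrightarrow> f (x, y) = (if i = j then c * (b j x * dbX j Y x) * mF j V W (y j) else 0)"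
  shows "dir_deriv (hl X) f (x, y) = (if i = j then c * (dbX j X x * dbX j Y x + b j x * dir_deriv X (dbX j Y) x) * mF j V W (y j) else 0)"
proof (cases "i = j")
  case True
  have x: "x \<in> points B" using p by auto
  have V': "V \<in> vector_fields (F j)" using V True by simp
  note s = b_smooth[of j] dbX_smooth[OF X(2), of j]
  have "dir_deriv (hl X) f (x, y) = dir_deriv X (\<lambda>x. c * (b j x * dbX j Y x)) x * mF j V W (y j)"
    by (rule hl_prod2[OF p X(1) B.smooth_funs_mult[OF B.smooth_funs_const B.smooth_funs_mult[OF s]] mF_smooth[OF V' V(2)]])
       (simp add: f True)
  moreover have "dir_deriv X (\<lambda>x. c * (b j x * dbX j Y x)) x = c * (dbX j X x * dbX j Y x + b j x * dir_deriv X (dbX j Y) x)"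
    using B.dir_deriv_mult[OF X(1) x B.smooth_funs_const B.smooth_funs_mult[OF s], of c] B.dir_deriv_mult[OF X(1) x s]
      B.tangent_const[OF vfB[OF X(1) x]] by (simp add: dir_deriv_def)
  ultimately show ?thesis using True by simp
next
  case False
  have "dir_deriv (hl X) f (x, y) = 0" by (rule dir_zero[OF p lift_base_vf[OF X(1)]]) (simp add: f False)
  then show ?thesis using False by simp
qed

lemma D_V_bd:
  assumes Y: "Y \<in> vector_fields B" and V: "U \<in> vector_fields (F k)" "V \<in> vector_fields (F i)" "W \<in> vector_fields (F j)"
    and f: "\<And>x y. (x, y) \<in> points PM \<Longrightarrow> f (x, y) = (if i = j then c * (b j x * dbX j Y x) * mF j V W (y j) else 0)"
  shows "dir_deriv (vl k U) f (x, y) = (if i = j \<and> k = j then c * (b j x * dbX j Y x) * dir_deriv U (mF j V W) (y j) else 0)"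
proof (cases "i = j")
  case True
  have V': "V \<in> vector_fields (F j)" using V True by simp
  have "dir_deriv (vl k U) f (x, y) = (if j = k then c * (b j x * dbX j Y x) * dir_deriv U (mF j V W) (y k) else 0)"
    by (rule vl_prod2[OF p V(1) B.smooth_funs_mult[OF B.smooth_funs_const B.smooth_funs_mult[OF b_smooth dbX_smooth[OF Y]]] mF_smooth[OF V' V(3)]])
       (simp add: f True)
  then show ?thesis using True by auto
next
  case False
  have "dir_deriv (vl k U) f (x, y) = 0" by (rule dir_zero[OF p lift_fibre_vf[OF V(1)]]) (simp add: f False)
  then show ?thesis using False by simp
qed

lemma D_H_HVH:
  assumes X: "X \<in> vector_fields B" "Y \<in> vector_fields B" "Z \<in> vector_fields B" and W: "W \<in> vector_fields (F j)"
  shows "dir_deriv (hl X) (KH (hl Y) (vl j W) (hl Z)) (x, y) =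
    (if j = l then 2 * b j x * dbX j X x * mF j W P (y j) else 0) * mB Y Z x + \<pi> j W (x, y) * dir_deriv X (mB Y Z) x"
proof (cases "j = l")
  case True
  have x: "x \<in> points B" using p by auto
  have P: "P \<in> vector_fields (F j)" using P_vf True by simp
  note s = b2_smooth[of j] BG.g_smooth[OF X(2,3)]
  have "dir_deriv (hl X) (KH (hl Y) (vl j W) (hl Z)) (x, y) = dir_deriv X (\<lambda>x. (b j x)\<^sup>2 * mB Y Z x) x * mF j W P (y j)"
    by (rule hl_prod2[OF p X(1) B.smooth_funs_mult[OF s] mF_smooth[OF W P]])
       (simp only: KH_HVH[OF _ X(2,3) W], simp add: \<pi>_def True)
  then show ?thesis
    using B.dir_deriv_mult[OF X(1) x s] dir_square[OF p X(1), of j] True by (simp add: \<pi>_def algebra_simps)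
next
  case False
  have "dir_deriv (hl X) (KH (hl Y) (vl j W) (hl Z)) (x, y) = 0"
    by (rule dir_zero[OF p lift_base_vf[OF X(1)]]) (simp add: KH_HVH[OF _ X(2,3) W] \<pi>_def False)
  then show ?thesis using False by (simp add: \<pi>_def)
qed

lemma D_V_HVH:
  assumes X: "X \<in> vector_fields B" "Y \<in> vector_fields B" and V: "V \<in> vector_fields (F i)" "W \<in> vector_fields (F j)"
  shows "dir_deriv (vl i V) (KH (hl X) (vl j W) (hl Y)) (x, y) =
    (if i = j \<and> j = l then (b j x)\<^sup>2 * dir_deriv V (mF j W P) (y j) else 0) * mB X Y x"
proof (cases "j = l")
  case True
  have P: "P \<in> vector_fields (F j)" using P_vf True by simp
  have "dir_deriv (vl i V) (KH (hl X) (vl j W) (hl Y)) (x, y) = (if j = i then (b j x)\<^sup>2 * mB X Y x * dir_deriv V (mF j W P) (y i) else 0)"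
    by (rule vl_prod2[OF p V(1) B.smooth_funs_mult[OF b2_smooth BG.g_smooth[OF X]] mF_smooth[OF V(2) P]])
       (simp only: KH_HVH[OF _ X V(2)], simp add: \<pi>_def True)
  then show ?thesis using True by auto
next
  case False
  have "dir_deriv (vl i V) (KH (hl X) (vl j W) (hl Y)) (x, y) = 0"
    by (rule dir_zero[OF p lift_fibre_vf[OF V(1)]]) (simp add: KH_HVH[OF _ X V(2)] \<pi>_def False)
  then show ?thesis using False by simp
qed

lemma R_swap_HV:
  assumes "X \<in> vector_fields B" "V \<in> vector_fields (F i)" "A \<in> vector_fields PM" "D \<in> vector_fields PM"
  shows "R (vl i V) (hl X) A D (x, y) = - R (hl X) (vl i V) A D (x, y)"
  unfolding R_eq KH_brHV[OF assms] by simp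

end

section \<open>Curvature components with at least two base fields\<close>

lemma R_HHHH:
  assumes X: "X \<in> vector_fields B" and Y: "Y \<in> vector_fields B" and Z: "Z \<in> vector_fields B" and T: "T \<in> vector_fields B"
    and p: "(x, y) \<in> points PM"
  shows "R (hl X) (hl Y) (hl Z) (hl T) (x, y) = riemann B gB X Y Z T x"
proof -
  have x: "x \<in> points B" using p by auto
  have 1: "dir_deriv (hl X) (KH (hl Y) (hl Z) (hl T)) (x, y) = dir_deriv X (koszul gB Y Z T) x"
    by (rule hl_dir[OF p X BG.koszul_smooth[OF Y Z T]]) (rule KH_HHH[OF _ Y Z T])
  have 2: "dir_deriv (hl Y) (KH (hl X) (hl Z) (hl T)) (x, y) = dir_deriv Y (koszul gB X Z T) x"
    by (rule hl_dir[OF p Y BG.koszul_smooth[OF X Z T]]) (rule KH_HHH[OF _ X Z T])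
  note t = BG.tensor_form_koszul
  show ?thesis
    unfolding R_eq 1 2 KH_brHH[OF p X Y lift_base_vf[OF Z] lift_base_vf[OF T]] KH_HHH[OF p B.lie_bracket_vf[OF X Y] Z T]
      C_HH_HH[OF X Y Z T p] C_HH_HH[OF Y X Z T p] riemann_def curvature_of_def
      BG.contraction_nondegenerate[OF t[OF X Z] t[OF Y T] x] BG.contraction_nondegenerate[OF t[OF Y Z] t[OF X T] x] ..
qed

lemma R_HHHV:
  assumes X: "X \<in> vector_fields B" and Y: "Y \<in> vector_fields B" and Z: "Z \<in> vector_fields B" and W: "W \<in> vector_fields (F j)"
    and p: "(x, y) \<in> points PM"
  shows "R (hl X) (hl Y) (hl Z) (vl j W) (x, y) = \<pi> j W (x, y) * (koszul gB X Z Y x - koszul gB Y Z X x)"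
proof -
  have 1: "dir_deriv (hl X) (KH (hl Y) (hl Z) (vl j W)) (x, y) = 0"
    by (rule dir_zero[OF p lift_base_vf[OF X]]) (rule KH_HHV[OF _ Y Z W])
  have 2: "dir_deriv (hl Y) (KH (hl X) (hl Z) (vl j W)) (x, y) = 0"
    by (rule dir_zero[OF p lift_base_vf[OF Y]]) (rule KH_HHV[OF _ X Z W])
  show ?thesis
    unfolding R_eq 1 2 KH_brHH[OF p X Y lift_base_vf[OF Z] lift_fibre_vf[OF W]] KH_HHV[OF p B.lie_bracket_vf[OF X Y] Z W]
      C_HH_HV[OF X Y Z W p] C_HH_HV[OF Y X Z W p] by (simp add: algebra_simps)
qed

text \<open>The terms in which g(W,P) is not differentiated cancel by \<open>koszul_cyclic\<close>
  in the base, against the two contractions; only the derivatives of b_l^2 remain.\<close>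

lemma R_HHVH:
  assumes X: "X \<in> vector_fields B" and Y: "Y \<in> vector_fields B" and Z: "Z \<in> vector_fields B" and W: "W \<in> vector_fields (F j)"
    and p: "(x, y) \<in> points PM"
  shows "R (hl X) (hl Y) (vl j W) (hl Z) (x, y) =
    (if j = l then 2 * b j x * mF j W P (y j) * (dbX j X x * mB Y Z x - dbX j Y x * mB X Z x) else 0)"
proof -
  have x: "x \<in> points B" using p by auto
  have "\<pi> j W (x, y) * (dir_deriv X (mB Y Z) x - dir_deriv Y (mB X Z) x - mB (lie_bracket X Y) Z x) =
      \<pi> j W (x, y) * (koszul gB X Z Y x - koszul gB Y Z X x)"
    unfolding BG.koszul_cyclic[OF X Y Z x] ..
  then show ?thesis
    unfolding R_eq D_H_HVH[OF p X Y Z W] D_H_HVH[OF p Y X Z W] KH_brHH[OF p X Y lift_fibre_vf[OF W] lift_base_vf[OF Z]]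
      KH_HVH[OF p B.lie_bracket_vf[OF X Y] Z W]
      C_swap[of "hl Y" "hl Z" "hl X" "vl j W", symmetric] C_swap[of "hl X" "hl Z" "hl Y" "vl j W", symmetric]
      C_HH_HV[OF X Y Z W p] C_HH_HV[OF Y X Z W p]
    by (cases "j = l") (simp_all add: algebra_simps)
qed

lemma R_HVHH:
  assumes X: "X \<in> vector_fields B" and Y: "Y \<in> vector_fields B" and Z: "Z \<in> vector_fields B" and W: "W \<in> vector_fields (F j)"
    and p: "(x, y) \<in> points PM"
  shows "R (hl X) (vl j W) (hl Y) (hl Z) (x, y) = 0"
proof -
  have 1: "dir_deriv (hl X) (KH (vl j W) (hl Y) (hl Z)) (x, y) = 0"
    by (rule dir_zero[OF p lift_base_vf[OF X]]) (rule KH_VHH[OF _ Y Z W])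
  have 2: "dir_deriv (vl j W) (KH (hl X) (hl Y) (hl Z)) (x, y) = 0"
    by (rule vl_dir[OF p W BG.koszul_smooth[OF X Y Z]]) (rule KH_HHH[OF _ X Y Z])
  have 3: "C (vl j W) (hl Y) (hl X) (hl Z) (x, y) = 0"
    by (rule trans[OF C_swap C_HH_VH[OF X Y Z W p]])
  show ?thesis
    unfolding R_eq 1 2 3 KH_brHV[OF p X W lift_base_vf[OF Y] lift_base_vf[OF Z]]
    using C_HH_VH[OF X Z Y W p] by simp
qed

text \<open>The second derivatives of b_j antisymmetrise to [X,Y](b_j), which the bracket term
  removes; all other terms are symmetric in X and Y.\<close>

lemma R_HHVV:
  assumes X: "X \<in> vector_fields B" and Y: "Y \<in> vector_fields B" and V: "V \<in> vector_fields (F i)" and W: "W \<in> vector_fields (F j)"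
    and p: "(x, y) \<in> points PM"
  shows "R (hl X) (hl Y) (vl i V) (vl j W) (x, y) = 0"
proof -
  have x: "x \<in> points B" using p by auto
  have 1: "dir_deriv (hl X) (KH (hl Y) (vl i V) (vl j W)) (x, y) =
      (if i = j then 1 * (dbX j X x * dbX j Y x + b j x * dir_deriv X (dbX j Y) x) * mF j V W (y j) else 0)"
    by (rule D_H_bd[OF p X Y V W]) (simp add: KH_HVV[OF _ Y V W])
  have 2: "dir_deriv (hl Y) (KH (hl X) (vl i V) (vl j W)) (x, y) =
      (if i = j then 1 * (dbX j Y x * dbX j X x + b j x * dir_deriv Y (dbX j X) x) * mF j V W (y j) else 0)"
    by (rule D_H_bd[OF p Y X V W]) (simp add: KH_HVV[OF _ X V W])
  have 3: "dbX j (lie_bracket X Y) x = dir_deriv X (dbX j Y) x - dir_deriv Y (dbX j X) x"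
    by (simp add: lie_bracket_def dir_deriv_def)
  show ?thesis
    unfolding R_eq 1 2 KH_brHH[OF p X Y lift_fibre_vf[OF V] lift_fibre_vf[OF W]] KH_HVV[OF p B.lie_bracket_vf[OF X Y] V W] 3
      C_HV_HV[OF X Y V W p] C_HV_HV[OF Y X V W p] BG.metric_fun_sym[OF x Y X]
    by (simp add: algebra_simps)
qed

text \<open>The form vanishes whenever a fibre argument is followed by two base arguments, and the
  two remaining contractions agree by symmetry of the fibre metric.\<close>

lemma R_VVHH:
  assumes X: "X \<in> vector_fields B" and Y: "Y \<in> vector_fields B" and V: "V \<in> vector_fields (F i)" and W: "W \<in> vector_fields (F j)"
    and p: "(x, y) \<in> points PM"
  shows "R (vl i V) (vl j W) (hl X) (hl Y) (x, y) = 0"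
proof -
  have 1: "dir_deriv (vl i V) (KH (vl j W) (hl X) (hl Y)) (x, y) = 0"
    by (rule dir_zero[OF p lift_fibre_vf[OF V]]) (rule KH_VHH[OF _ X Y W])
  have 2: "dir_deriv (vl j W) (KH (vl i V) (hl X) (hl Y)) (x, y) = 0"
    by (rule dir_zero[OF p lift_fibre_vf[OF W]]) (rule KH_VHH[OF _ X Y V])
  have 3: "KH (lie_bracket (vl i V) (vl j W)) (hl X) (hl Y) (x, y) = 0"
    unfolding KH_brVV[OF p V W lift_base_vf[OF X] lift_base_vf[OF Y]]
    using KH_VHH[OF p X Y manifold.lie_bracket_vf[OF fib _ W, of V]] V by auto
  have "mF j V W (y j) = mF j W V (y j)" if "i = j" using metric_F_sym[OF p _ W] V that by simp
  then show ?thesis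
    unfolding R_eq 1 2 3 C_VH_VH[OF X Y W V p] C_VH_VH[OF X Y V W p] by auto
qed

text \<open>The product X(b_j) Y(b_j) from the Leibniz rule cancels against the contraction of the
  mixed forms. What remains of the warping is XY(b_j) minus the pairing of db_j with the Koszul form
  of X and Y, that is, the Hessian of b_j.\<close>

lemma R_VHVH:
  assumes X: "X \<in> vector_fields B" and Y: "Y \<in> vector_fields B" and V: "V \<in> vector_fields (F i)" and W: "W \<in> vector_fields (F j)"
    and p: "(x, y) \<in> points PM"
  shows "R (vl i V) (hl X) (vl j W) (hl Y) (x, y) =
    (if i = j then b j x * dir_deriv X (dbX j Y) x * mF j V W (y j) - b j x * gBs (koszul gB X Y) (differential (b j)) x * mF j V W (y j) +
      (if j = l then (b j x)\<^sup>2 * dir_deriv V (mF j W P) (y j) * mB X Y x else 0) else 0)"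
proof -
  have 1: "dir_deriv (hl X) (KH (vl i V) (vl j W) (hl Y)) (x, y) =
      (if i = j then (-1) * (dbX j X x * dbX j Y x + b j x * dir_deriv X (dbX j Y) x) * mF j V W (y j) else 0)"
    by (rule D_H_bd[OF p X Y V W]) (simp add: KH_VVH[OF _ Y V W])
  have "mF j V W (y j) = mF j W V (y j)" if "i = j" using metric_F_sym[OF p _ W] V that by simp
  then show ?thesis
    unfolding R_eq 1 D_V_HVH[OF p X Y V W] KH_brHV[OF p X V lift_fibre_vf[OF W] lift_base_vf[OF Y]]
      C_swap[of "hl X" "hl Y" "vl i V" "vl j W", symmetric] C_HH_VV[OF X Y V W p] C_HV_VH[OF X Y V W p]
    by (cases "i = j") (simp_all add: algebra_simps)
qed

text \<open>Again the Hessian of b_j, with the opposite sign. No P-term survives: g(Y,P) = 0 for a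
  base field Y, and in the contractions each P-part meets a zero component.\<close>

lemma R_VHHV:
  assumes X: "X \<in> vector_fields B" and Y: "Y \<in> vector_fields B" and V: "V \<in> vector_fields (F i)" and W: "W \<in> vector_fields (F j)"
    and p: "(x, y) \<in> points PM"
  shows "R (vl i V) (hl X) (hl Y) (vl j W) (x, y) =
    (if i = j then - (b j x * dir_deriv X (dbX j Y) x * mF j V W (y j)) + b j x * gBs (koszul gB X Y) (differential (b j)) x * mF j V W (y j) else 0)"
proof -
  have 1: "dir_deriv (hl X) (KH (vl i V) (hl Y) (vl j W)) (x, y) =
      (if i = j then 1 * (dbX j X x * dbX j Y x + b j x * dir_deriv X (dbX j Y) x) * mF j V W (y j) else 0)"
    by (rule D_H_bd[OF p X Y V W]) (simp add: KH_VHV[OF _ Y V W])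
  have 2: "dir_deriv (vl i V) (KH (hl X) (hl Y) (vl j W)) (x, y) = 0"
    by (rule dir_zero[OF p lift_fibre_vf[OF V]]) (rule KH_HHV[OF _ X Y W])
  have "mF j V W (y j) = mF j W V (y j)" if "i = j" using metric_F_sym[OF p _ W] V that by simp
  then show ?thesis
    unfolding R_eq 1 2 KH_brHV[OF p X V lift_base_vf[OF Y] lift_fibre_vf[OF W]]
      C_swap[of "hl X" "vl j W" "vl i V" "hl Y", symmetric] C_HH_VV[OF X Y V W p] C_HV_VH[OF X Y V W p]
    by (cases "i = j") (simp_all add: algebra_simps)
qed

end

context warped_vector
begin

section \<open>Curvature components with at most one base field\<close>

lemma b4_smooth: "(\<lambda>x. (b j x)\<^sup>2 * (b k x)\<^sup>2) \<in> smooth_funs B"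
  by (intro B.smooth_funs_mult B.smooth_funs_power b_smooth)

context
  fixes V W U :: "'f vfield" and i j k :: 'i and x y
  assumes V: "V \<in> vector_fields (F i)" and W: "W \<in> vector_fields (F j)" and U: "U \<in> vector_fields (F k)"
    and p: "(x, y) \<in> points PM"
begin

text \<open>The form on three fibre fields, split into the Koszul part \<open>t1\<close> and the
  P-part \<open>t2\<close>. Each of them is a product of functions on single factors, to which the
  derivative rules apply.\<close>

abbreviation (input) t1 where "t1 \<equiv> \<lambda>q. if i = k \<and> j = k then (b k (fst q))\<^sup>2 * kF k V W U (snd q k) else 0"
abbreviation (input) t2 where "t2 \<equiv> \<lambda>q. \<pi> j W q * (if i = k then (b k (fst q))\<^sup>2 * mF k V U (snd q k) else 0)"

lemma t1_smooth: "t1 \<in> smooth_funs PM"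
proof (rule smooth_if)
  assume "i = k \<and> j = k"
  then have "V \<in> vector_fields (F k)" "W \<in> vector_fields (F k)" using V W by auto
  then show "(\<lambda>q. (b k (fst q))\<^sup>2 * kF k V W U (snd q k)) \<in> smooth_funs PM"
    by (intro P.smooth_funs_mult P.smooth_funs_power smooth_PM_base smooth_PM_fibre b_smooth kF_smooth U)
qed

lemma t2_smooth: "t2 \<in> smooth_funs PM"
proof (rule P.smooth_funs_mult[OF \<pi>_smooth[OF W] smooth_if])
  assume "i = k"
  then have "V \<in> vector_fields (F k)" using V by auto
  then show "(\<lambda>q. (b k (fst q))\<^sup>2 * mF k V U (snd q k)) \<in> smooth_funs PM"
    by (intro P.smooth_funs_mult P.smooth_funs_power smooth_PM_base smooth_PM_fibre b_smooth mF_smooth U)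
qed

lemma dir_VVV:
  assumes A: "A \<in> vector_fields PM"
  shows "dir_deriv A (KH (vl i V) (vl j W) (vl k U)) (x, y) = dir_deriv A t1 (x, y) + dir_deriv A t2 (x, y)"
proof -
  have "A (x, y) (KH (vl i V) (vl j W) (vl k U)) = A (x, y) (\<lambda>q. t1 q + t2 q)"
  proof (rule P.tangent_cong[OF P.vector_fieldsD[OF A p] p])
    fix q assume q: "q \<in> points PM"
    obtain x y where xy: "q = (x, y)" by (cases q) auto
    show "KH (vl i V) (vl j W) (vl k U) q = t1 q + t2 q"
      unfolding xy KH_VVV[OF q[unfolded xy] V W U] by auto
  qed
  then show ?thesis
    using P.tangent_add[OF P.vector_fieldsD[OF A p] t1_smooth t2_smooth] by (simp only: dir_deriv_def)
qed

lemma D_H_VVV: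
  assumes X: "X \<in> vector_fields B"
  shows "dir_deriv (hl X) (KH (vl i V) (vl j W) (vl k U)) (x, y) =
    (if i = k \<and> j = k then 2 * b k x * dbX k X x * kF k V W U (y k) else 0) +
    (if i = k then ((if j = l then 2 * b j x * dbX j X x * mF j W P (y j) else 0) * (b k x)\<^sup>2 +
      \<pi> j W (x, y) * (2 * b k x * dbX k X x)) * mF k V U (y k) else 0)"
proof -
  have x: "x \<in> points B" using p by auto
  have 1: "dir_deriv (hl X) t1 (x, y) = (if i = k \<and> j = k then 2 * b k x * dbX k X x * kF k V W U (y k) else 0)"
  proof (cases "i = k \<and> j = k")
    case True
    then have V': "V \<in> vector_fields (F k)" and W': "W \<in> vector_fields (F k)" using V W by auto
    have "dir_deriv (hl X) t1 (x, y) = dir_deriv X (\<lambda>x. (b k x)\<^sup>2) x * kF k V W U (y k)"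
      by (rule hl_prod2[OF p X b2_smooth kF_smooth[OF V' W' U]]) (simp only: if_P[OF True] fst_conv snd_conv)
    then show ?thesis using True dir_square[OF p X, of k] by simp
  next
    case False
    have "dir_deriv (hl X) t1 (x, y) = 0" by (rule dir_zero[OF p lift_base_vf[OF X]]) (simp only: if_not_P[OF False])
    then show ?thesis using False by auto
  qed
  have 2: "dir_deriv (hl X) t2 (x, y) = (if i = k then ((if j = l then 2 * b j x * dbX j X x * mF j W P (y j) else 0) * (b k x)\<^sup>2 +
      \<pi> j W (x, y) * (2 * b k x * dbX k X x)) * mF k V U (y k) else 0)"
  proof (cases "i = k \<and> j = l")
    case True
    then have V': "V \<in> vector_fields (F k)" and P: "P \<in> vector_fields (F j)" using V P_vf by auto
    have "dir_deriv (hl X) t2 (x, y) = X x (\<lambda>x. (b j x)\<^sup>2 * (b k x)\<^sup>2) * mF j W P (y j) * mF k V U (y k)"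
      by (rule hl_prod[OF p X b4_smooth mF_smooth[OF W P] mF_smooth[OF V' U]])
         (simp only: \<pi>_def conjunct1[OF True] conjunct2[OF True] if_True simp_thms fst_conv snd_conv mult_ac)
    moreover have "X x (\<lambda>x. (b j x)\<^sup>2 * (b k x)\<^sup>2) = 2 * b j x * dbX j X x * (b k x)\<^sup>2 + (b j x)\<^sup>2 * (2 * b k x * dbX k X x)"
      using B.dir_deriv_mult[OF X x b2_smooth[of j] b2_smooth[of k]] dir_square[OF p X, of k] dir_square[OF p X, of j]
      by (simp add: dir_deriv_def)
    ultimately show ?thesis using True by (simp add: \<pi>_def algebra_simps)
  next
    case False
    have "dir_deriv (hl X) t2 (x, y) = 0" by (rule dir_zero[OF p lift_base_vf[OF X]]) (use False in \<open>auto simp: \<pi>_def\<close>)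
    then show ?thesis using False by (auto simp: \<pi>_def)
  qed
  show ?thesis unfolding dir_VVV[OF lift_base_vf[OF X]] 1 2 ..
qed

lemma D_V_VVV:
  assumes N: "N \<in> vector_fields (F m)"
  shows "dir_deriv (vl m N) (KH (vl i V) (vl j W) (vl k U)) (x, y) =
    (if i = k \<and> j = k \<and> m = k then (b k x)\<^sup>2 * dir_deriv N (kF k V W U) (y k) else 0) +
    (if i = k then (b k x)\<^sup>2 * ((if j = l \<and> m = j then (b j x)\<^sup>2 * dir_deriv N (mF j W P) (y j) else 0) * mF k V U (y k) +
      \<pi> j W (x, y) * (if m = k then dir_deriv N (mF k V U) (y k) else 0)) else 0)"
proof -
  have 1: "dir_deriv (vl m N) t1 (x, y) = (if i = k \<and> j = k \<and> m = k then (b k x)\<^sup>2 * dir_deriv N (kF k V W U) (y k) else 0)"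
  proof (cases "i = k \<and> j = k")
    case True
    then have V': "V \<in> vector_fields (F k)" and W': "W \<in> vector_fields (F k)" using V W by auto
    have "dir_deriv (vl m N) t1 (x, y) = (if k = m then (b k x)\<^sup>2 * dir_deriv N (kF k V W U) (y m) else 0)"
      by (rule vl_prod2[OF p N b2_smooth kF_smooth[OF V' W' U]]) (simp only: if_P[OF True] fst_conv snd_conv)
    then show ?thesis using True by auto
  next
    case False
    have "dir_deriv (vl m N) t1 (x, y) = 0" by (rule dir_zero[OF p lift_fibre_vf[OF N]]) (simp only: if_not_P[OF False])
    then show ?thesis using False by auto
  qed
  have 2: "dir_deriv (vl m N) t2 (x, y) = (if i = k then (b k x)\<^sup>2 * ((if j = l \<and> m = j then (b j x)\<^sup>2 * dir_deriv N (mF j W P) (y j) else 0) * mF k V U (y k) +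
      \<pi> j W (x, y) * (if m = k then dir_deriv N (mF k V U) (y k) else 0)) else 0)"
  proof (cases "i = k \<and> j = l")
    case True
    then have V': "V \<in> vector_fields (F k)" and P: "P \<in> vector_fields (F j)" using V P_vf by auto
    have "dir_deriv (vl m N) t2 (x, y) = (b j x)\<^sup>2 * (b k x)\<^sup>2 *
        ((if j = m then N (y m) (mF j W P) else 0) * mF k V U (y k) + mF j W P (y j) * (if k = m then N (y m) (mF k V U) else 0))"
      by (rule vl_prod[OF p N b4_smooth mF_smooth[OF W P] mF_smooth[OF V' U]])
         (simp only: \<pi>_def conjunct1[OF True] conjunct2[OF True] if_True simp_thms fst_conv snd_conv mult_ac)
    then show ?thesis using True by (auto simp: \<pi>_def dir_deriv_def algebra_simps)
  next
    case False
    have "dir_deriv (vl m N) t2 (x, y) = 0" by (rule dir_zero[OF p lift_fibre_vf[OF N]]) (use False in \<open>auto simp: \<pi>_def\<close>)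
    then show ?thesis using False by (auto simp: \<pi>_def)
  qed
  show ?thesis unfolding dir_VVV[OF lift_fibre_vf[OF N]] 1 2 ..
qed

end

context
  fixes x y assumes p: "(x, y) \<in> points PM"
begin

lemma F_sym: "V \<in> vector_fields (F j) \<Longrightarrow> W \<in> vector_fields (F j) \<Longrightarrow> mF j V W (y j) = mF j W V (y j)"
  by (rule metric_F_sym[OF p])

lemma F_metric: "U \<in> vector_fields (F j) \<Longrightarrow> V \<in> vector_fields (F j) \<Longrightarrow> W \<in> vector_fields (F j) \<Longrightarrow>
    dir_deriv U (mF j V W) (y j) = kF j U V W (y j) + kF j U W V (y j)"
  using semi_riem.koszul_metric[OF FG] p by simp

text \<open>The identity \<open>koszul_cyclic\<close> of the fibre, solved for the bracket term so
  that the latter can be rewritten away.\<close>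

lemma F_cyclic: "U \<in> vector_fields (F j) \<Longrightarrow> V \<in> vector_fields (F j) \<Longrightarrow> W \<in> vector_fields (F j) \<Longrightarrow>
    mF j (lie_bracket U V) W (y j) =
    dir_deriv U (mF j V W) (y j) - dir_deriv V (mF j U W) (y j) - kF j U W V (y j) + kF j V W U (y j)"
  using semi_riem.koszul_cyclic[OF FG, of U j V W "y j"] p by simp

end

text \<open>When all indices agree, the Koszul values of the fibre cancel by metric compatibility.
  In the two summands left, half of each coefficient 2 comes from differentiating a warping factor
  or from the symmetric partner contraction, so they involve P throughout.\<close>

lemma R_HVVV:
  assumes X: "X \<in> vector_fields B" and U: "U \<in> vector_fields (F k)" and V: "V \<in> vector_fields (F i)" and W: "W \<in> vector_fields (F j)"
    and p: "(x, y) \<in> points PM"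
  shows "R (hl X) (vl i V) (vl j W) (vl k U) (x, y) =
    (if j = l \<and> i = k then 2 * b l x * (b i x)\<^sup>2 * dbX l X x * mF l W P (y l) * mF i V U (y i) else 0) +
    (if i = j \<and> k = l then 2 * b i x * (b l x)\<^sup>2 * dbX i X x * mF l U P (y l) * mF i V W (y i) else 0)"
proof -
  have 1: "dir_deriv (vl i V) (KH (hl X) (vl j W) (vl k U)) (x, y) =
      (if j = k \<and> i = k then 1 * (b k x * dbX k X x) * dir_deriv V (mF k W U) (y k) else 0)"
    by (rule D_V_bd[OF p X V W U]) (simp add: KH_HVV[OF _ X W U])
  have e: "R (hl X) (vl i V) (vl j W) (vl k U) (x, y) =
    (if i = k \<and> j = k then 2 * b k x * dbX k X x * kF k V W U (y k) else 0) +
    (if i = k then ((if j = l then 2 * b j x * dbX j X x * mF j W P (y j) else 0) * (b k x)\<^sup>2 +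
      \<pi> j W (x, y) * (2 * b k x * dbX k X x)) * mF k V U (y k) else 0) -
    (if j = k \<and> i = k then 1 * (b k x * dbX k X x) * dir_deriv V (mF k W U) (y k) else 0) +
    (\<pi> j W (x, y) * (if i = k then - (b i x * mF i V U (y i) * dbX i X x) else 0) +
     (if j = i then b j x * dbX j X x * ((if i = k then kF j V U W (y j) else 0) + \<pi> k U (x, y) * mF j W V (y j)) else 0)) -
    (\<pi> k U (x, y) * (if i = j then - (b i x * mF i V W (y i) * dbX i X x) else 0) +
     (if k = i then b k x * dbX k X x * ((if i = j then kF k V W U (y k) else 0) + \<pi> j W (x, y) * mF k U V (y k)) else 0))"
    unfolding R_eq 1 D_H_VVV[OF V W U p X] KH_brHV[OF p X V lift_fibre_vf[OF W] lift_fibre_vf[OF U]]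
      C_HV_VV[OF X U V W p] C_swap[of "hl X" "vl k U" "vl i V" "vl j W", symmetric]
      C_HV_VV[OF X W V U p] by simp
  show ?thesis
  proof (cases "i = j"; cases "i = k")
    assume ij: "i = j" and ik: "i = k"
    have V': "V \<in> vector_fields (F k)" and W': "W \<in> vector_fields (F k)" using V W ij ik by auto
    show ?thesis unfolding e using ij ik F_metric[OF p V' W' U] F_sym[OF p V' U] F_sym[OF p V' W']
      by (auto simp: \<pi>_def algebra_simps)
  next
    assume ij: "i = j" and ik: "i \<noteq> k"
    have V': "V \<in> vector_fields (F j)" using V ij by auto
    show ?thesis unfolding e using ij ik F_sym[OF p V' W]
      by (auto simp: \<pi>_def algebra_simps)
  next
    assume ij: "i \<noteq> j" and ik: "i = k"
    have V': "V \<in> vector_fields (F k)" using V ik by auto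
    show ?thesis unfolding e using ij ik F_sym[OF p V' U]
      by (auto simp: \<pi>_def algebra_simps)
  next
    assume ij: "i \<noteq> j" and ik: "i \<noteq> k"
    show ?thesis unfolding e using ij ik by auto
  qed
qed

text \<open>Up to the factor b_j X(b_j), the terms without P add up to the identity
  \<open>F_cyclic\<close>; those with g(W,P) cancel by symmetry of the fibre metric.\<close>

lemma R_VVVH:
  assumes X: "X \<in> vector_fields B" and U: "U \<in> vector_fields (F k)" and V: "V \<in> vector_fields (F i)" and W: "W \<in> vector_fields (F j)"
    and p: "(x, y) \<in> points PM"
  shows "R (vl k U) (vl i V) (vl j W) (hl X) (x, y) = 0"
proof -
  have 1: "dir_deriv (vl k U) (KH (vl i V) (vl j W) (hl X)) (x, y) =
      (if i = j \<and> k = j then (-1) * (b j x * dbX j X x) * dir_deriv U (mF j V W) (y j) else 0)"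
    by (rule D_V_bd[OF p X U V W]) (simp add: KH_VVH[OF _ X V W])
  have 2: "dir_deriv (vl i V) (KH (vl k U) (vl j W) (hl X)) (x, y) =
      (if k = j \<and> i = j then (-1) * (b j x * dbX j X x) * dir_deriv V (mF j U W) (y j) else 0)"
    by (rule D_V_bd[OF p X V U W]) (simp add: KH_VVH[OF _ X U W])
  have 3: "KH (lie_bracket (vl k U) (vl i V)) (vl j W) (hl X) (x, y) =
      (if k = i \<and> i = j then - (b j x * dbX j X x * mF j (lie_bracket U V) W (y j)) else 0)"
    unfolding KH_brVV[OF p U V lift_fibre_vf[OF W] lift_base_vf[OF X]]
    using KH_VVH[OF p X manifold.lie_bracket_vf[OF fib _ V, of U] W] U by auto
  have e: "R (vl k U) (vl i V) (vl j W) (hl X) (x, y) =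
    (if i = j \<and> k = j then (-1) * (b j x * dbX j X x) * dir_deriv U (mF j V W) (y j) else 0) -
    (if k = j \<and> i = j then (-1) * (b j x * dbX j X x) * dir_deriv V (mF j U W) (y j) else 0) -
    (if k = i \<and> i = j then - (b j x * dbX j X x * mF j (lie_bracket U V) W (y j)) else 0) +
    (if i = k then b i x * dbX i X x * ((if k = j then kF i U W V (y i) else 0) + \<pi> j W (x, y) * mF i V U (y i)) else 0) -
    (if k = i then b k x * dbX k X x * ((if i = j then kF k V W U (y k) else 0) + \<pi> j W (x, y) * mF k U V (y k)) else 0)"
    unfolding R_eq 1 2 3 C_swap[of "vl i V" "hl X" "vl k U" "vl j W", symmetric] C_swap[of "vl k U" "hl X" "vl i V" "vl j W", symmetric]
      C_VH_VV[OF X W U V p] C_VH_VV[OF X W V U p] ..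
  show ?thesis
  proof (cases "i = k")
    case ik: True
    then have V': "V \<in> vector_fields (F k)" using V by auto
    show ?thesis
    proof (cases "k = j")
      case kj: True
      then have W': "W \<in> vector_fields (F k)" using W by auto
      show ?thesis
        unfolding e using ik kj by (simp add: F_cyclic[OF p U V' W', unfolded kj] F_sym[OF p U V', unfolded kj] algebra_simps)
    next
      case False
      then show ?thesis unfolding e using ik F_sym[OF p U V'] by auto
    qed
  qed (use e in auto)
qed

text \<open>The same cancellation as for \<open>R_VVVH\<close>, with all signs reversed.\<close>

lemma R_VVHV:
  assumes X: "X \<in> vector_fields B" and U: "U \<in> vector_fields (F k)" and V: "V \<in> vector_fields (F i)" and W: "W \<in> vector_fields (F j)"
    and p: "(x, y) \<in> points PM"
  shows "R (vl k U) (vl i V) (hl X) (vl j W) (x, y) = 0"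
proof -
  have 1: "dir_deriv (vl k U) (KH (vl i V) (hl X) (vl j W)) (x, y) =
      (if i = j \<and> k = j then 1 * (b j x * dbX j X x) * dir_deriv U (mF j V W) (y j) else 0)"
    by (rule D_V_bd[OF p X U V W]) (simp add: KH_VHV[OF _ X V W])
  have 2: "dir_deriv (vl i V) (KH (vl k U) (hl X) (vl j W)) (x, y) =
      (if k = j \<and> i = j then 1 * (b j x * dbX j X x) * dir_deriv V (mF j U W) (y j) else 0)"
    by (rule D_V_bd[OF p X V U W]) (simp add: KH_VHV[OF _ X U W])
  have 3: "KH (lie_bracket (vl k U) (vl i V)) (hl X) (vl j W) (x, y) =
      (if k = i \<and> i = j then b j x * dbX j X x * mF j (lie_bracket U V) W (y j) else 0)"
    unfolding KH_brVV[OF p U V lift_base_vf[OF X] lift_fibre_vf[OF W]]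
    using KH_VHV[OF p X manifold.lie_bracket_vf[OF fib _ V, of U] W] U by auto
  have e: "R (vl k U) (vl i V) (hl X) (vl j W) (x, y) =
    (if i = j \<and> k = j then 1 * (b j x * dbX j X x) * dir_deriv U (mF j V W) (y j) else 0) -
    (if k = j \<and> i = j then 1 * (b j x * dbX j X x) * dir_deriv V (mF j U W) (y j) else 0) -
    (if k = i \<and> i = j then b j x * dbX j X x * mF j (lie_bracket U V) W (y j) else 0) +
    (if k = i then b k x * dbX k X x * ((if i = j then kF k V W U (y k) else 0) + \<pi> j W (x, y) * mF k U V (y k)) else 0) -
    (if i = k then b i x * dbX i X x * ((if k = j then kF i U W V (y i) else 0) + \<pi> j W (x, y) * mF i V U (y i)) else 0)"
    unfolding R_eq 1 2 3 C_VH_VV[OF X W U V p] C_VH_VV[OF X W V U p] ..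
  show ?thesis
  proof (cases "i = k")
    case ik: True
    then have V': "V \<in> vector_fields (F k)" using V by auto
    show ?thesis
    proof (cases "k = j")
      case kj: True
      then have W': "W \<in> vector_fields (F k)" using W by auto
      show ?thesis
        unfolding e using ik kj by (simp add: F_cyclic[OF p U V' W', unfolded kj] F_sym[OF p U V', unfolded kj] algebra_simps)
    next
      case False
      then show ?thesis unfolding e using ik F_sym[OF p U V'] by auto
    qed
  qed (use e in auto)
qed

text \<open>The summands have different origins: the curvature of the fibre; the pairings of the
  gradient parts of the representatives, in two orders; the derivatives of g(W,P) in the P-part of
  the form, also in two orders; and the contraction of the fibre Koszul form with the P-part g(Q,P)
  of the last argument. Each needs its own coincidence of indices.\<close>

lemma R_VVVV:
  assumes U: "U \<in> vector_fields (F k)" and V: "V \<in> vector_fields (F i)" and W: "W \<in> vector_fields (F j)" and Q: "Q \<in> vector_fields (F s)"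
    and p: "(x, y) \<in> points PM"
  shows "R (vl k U) (vl i V) (vl j W) (vl s Q) (x, y) =
    (if i = j \<and> j = k \<and> k = s then (b s x)\<^sup>2 * riemann (F s) (gF s) U V W Q (y s) else 0) +
    (if k = j \<and> i = s then b k x * b i x * mF k U W (y k) * mF i V Q (y i) * gBs (differential (b k)) (differential (b i)) x else 0) -
    (if i = j \<and> k = s then b i x * b k x * mF i V W (y i) * mF k U Q (y k) * gBs (differential (b i)) (differential (b k)) x else 0) +
    (if i = s \<and> j = l \<and> k = j then (b i x)\<^sup>2 * (b j x)\<^sup>2 * dir_deriv U (mF j W P) (y j) * mF i V Q (y i) else 0) -
    (if k = s \<and> j = l \<and> i = j then (b k x)\<^sup>2 * (b j x)\<^sup>2 * dir_deriv V (mF j W P) (y j) * mF k U Q (y k) else 0) +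
    (if k = i \<and> i = j then (b k x)\<^sup>2 * \<pi> s Q (x, y) * (kF k U W V (y k) - kF k V W U (y k)) else 0)"
proof -
  have 1: "KH (lie_bracket (vl k U) (vl i V)) (vl j W) (vl s Q) (x, y) =
      (if k = i then (if j = s \<and> i = s then (b s x)\<^sup>2 * kF s (lie_bracket U V) W Q (y s) else 0) +
        \<pi> j W (x, y) * (if i = s then (b s x)\<^sup>2 * mF s (lie_bracket U V) Q (y s) else 0) else 0)"
    unfolding KH_brVV[OF p U V lift_fibre_vf[OF W] lift_fibre_vf[OF Q]]
    by (rule if_cong[OF refl KH_VVV[OF p manifold.lie_bracket_vf[OF fib _ V] W Q] refl]) (use U in simp)
  note e = R_eq 1 D_V_VVV[OF V W Q p U] D_V_VVV[OF U W Q p V] C_VV_VV[OF U V W Q p] C_VV_VV[OF V U W Q p]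
  show ?thesis
  proof (cases "k = i")
    case ki: False
    show ?thesis
    proof (cases "i = s")
      case True
      then have "k \<noteq> s" using ki by simp
      then show ?thesis unfolding e using ki True by (cases "j = s"; cases "k = j") simp_all
    next
      case False
      then show ?thesis unfolding e using ki by (cases "k = s"; cases "i = j"; cases "j = s") simp_all
    qed
  next
    case ki: True
    show ?thesis
    proof (cases "i = s")
      case False
      have "mF i U V (y i) = mF i V U (y i)" using F_sym[OF p _ V, of U] U ki by simp
      then show ?thesis unfolding e using ki False by (cases "i = j") (simp_all add: algebra_simps)
    next
      case iss: True
      have U': "U \<in> vector_fields (F s)" and V': "V \<in> vector_fields (F s)" using U V ki iss by auto
      \<comment> \<open>These two identities remove the terms in which g(W,P) stands
        undifferentiated: the cyclic one those with derivatives or Koszul values, the symmetry those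
        quadratic in P.\<close>
      note f = F_cyclic[OF p U' V' Q] F_sym[OF p U' V']
      show ?thesis
      proof (cases "j = s")
        case True
        then show ?thesis unfolding e riemann_def curvature_of_def using ki iss by (simp add: f algebra_simps)
      next
        case False
        then show ?thesis unfolding e using ki iss by (simp add: f algebra_simps)
      qed
    qed
  qed
qed

end

text \<open>The components above hold for arbitrary indices and carry the coincidences of indices as
  conditions. Each claim is thus an instance, up to antisymmetry in the arguments that start with a
  base and a fibre field, and up to renaming of the fields.\<close>

theorem theorem3p8:
  fixes B :: "('b, 'k) mfd" and gB :: "'b metric"
    and F :: "'i::finite \<Rightarrow> ('f, 'l) mfd" and gF :: "'i \<Rightarrow> 'f metric"
    and b :: "'i \<Rightarrow> 'b \<Rightarrow> real"
    and l k i j s :: 'i and P U V W Q :: "'f vfield" and X Y Z T :: "'b vfield"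
    and x :: 'b and y :: "'i \<Rightarrow> 'f"
  assumes "nondegenerate_semi_riemannian B gB"
    and "\<And>j. semi_regular (F j) (gF j)"
    and "\<And>j. b j \<in> smooth_funs B"
    and "P \<in> vector_fields (F l)"
    and "X \<in> vector_fields B" and "Y \<in> vector_fields B"
    and "Z \<in> vector_fields B" and "T \<in> vector_fields B"
    and "U \<in> vector_fields (F k)" and "V \<in> vector_fields (F i)"
    and "W \<in> vector_fields (F j)" and "Q \<in> vector_fields (F s)"
    and "x \<in> points B" and "\<And>j. y j \<in> points (F j)"
  shows
    "let h = lift_base B F;
         v = lift_fibre B F;
         R = (\<lambda>A1 A2 A3 A4. ssnm_curvature (product_mfd B F) (warped_metric B gB F gF b) (v l P)
                              A1 A2 A3 A4 (x, y));
         gb = (\<lambda>A1 A2. metric_fun gB A1 A2 x);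
         gf = (\<lambda>n A1 A2. metric_fun (gF n) A1 A2 (y n));
         KB = (\<lambda>A1 A2 A3. koszul gB A1 A2 A3 x);
         KF = (\<lambda>n A1 A2 A3. koszul (gF n) A1 A2 A3 (y n));
         RB = (\<lambda>A1 A2 A3 A4. riemann B gB A1 A2 A3 A4 x);
         RF = (\<lambda>n A1 A2 A3 A4. riemann (F n) (gF n) A1 A2 A3 A4 (y n));
         Xb = (\<lambda>A n. dir_deriv A (b n) x);
         XYb = dir_deriv X (dir_deriv Y (b j)) x;
         nab = inverse_metric B gB (koszul gB X Y) (differential (b j)) x;
         dbdb = (\<lambda>n n'. inverse_metric B gB (differential (b n)) (differential (b n')) x);
         dgP = (\<lambda>n A1 A2. dir_deriv A1 (metric_fun (gF n) A2 P) (y n));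
         \<beta> = (\<lambda>n. b n x)
     in
      \<comment> \<open>(1)\<close>
      R (h X) (h Y) (h Z) (h T) = RB X Y Z T \<and>
      \<comment> \<open>(2)\<close>
      (j = l \<longrightarrow>
        R (h X) (h Y) (h Z) (v j W) = (\<beta> j)\<^sup>2 * gf j W P * (KB X Z Y - KB Y Z X)) \<and>
      \<comment> \<open>(3)\<close>
      (j = l \<longrightarrow>
        R (h X) (h Y) (v j W) (h Z) = 2 * \<beta> j * gf j W P * (Xb X j * gb Y Z - Xb Y j * gb X Z)) \<and>
      \<comment> \<open>(4)\<close>
      (j = l \<longrightarrow>
        R (h X) (v j W) (h Y) (h Z) = 0 \<and> R (v j W) (h X) (h Y) (h Z) = 0) \<and>
      \<comment> \<open>(5)\<close>
      (j \<noteq> l \<longrightarrow>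
        R (h X) (h Y) (h Z) (v j W) = 0 \<and> R (h X) (h Y) (v j W) (h Z) = 0 \<and>
        R (h X) (v j W) (h Y) (h Z) = 0 \<and> R (v j W) (h X) (h Y) (h Z) = 0) \<and>
      \<comment> \<open>(6)\<close>
      R (h X) (h Y) (v i V) (v j W) = 0 \<and> R (v i V) (v j W) (h X) (h Y) = 0 \<and>
      \<comment> \<open>(7)\<close>
      (i = j \<and> j = l \<longrightarrow>
        R (v i V) (h X) (v j W) (h Y) = - R (h X) (v i V) (v j W) (h Y) \<and>
        R (v i V) (h X) (v j W) (h Y) =
          \<beta> j * XYb * gf j V W - \<beta> j * nab * gf j V W + (\<beta> j)\<^sup>2 * dgP j V W * gb X Y) \<and>
      \<comment> \<open>(8)\<close>
      (i = j \<and> j \<noteq> l \<longrightarrow>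
        R (v i V) (h X) (v j W) (h Y) = - R (h X) (v i V) (v j W) (h Y) \<and>
        R (v i V) (h X) (v j W) (h Y) = \<beta> j * XYb * gf j V W - \<beta> j * nab * gf j V W) \<and>
      \<comment> \<open>(9)\<close>
      (i = j \<and> j = l \<or> i = j \<and> j \<noteq> l \<longrightarrow>
        R (v i V) (h X) (h Y) (v j W) = - R (h X) (v i V) (h Y) (v j W) \<and>
        R (v i V) (h X) (h Y) (v j W) = - (\<beta> j * XYb * gf j V W) + \<beta> j * nab * gf j V W) \<and>
      \<comment> \<open>(10)\<close>
      (\<not> (i = j \<and> j = l \<or> i = j \<and> j \<noteq> l) \<longrightarrow>
        R (v i V) (h X) (v j W) (h Y) = 0 \<and> R (v i V) (h X) (h Y) (v j W) = 0) \<and>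
      \<comment> \<open>(11)\<close>
      (i = j \<and> j = k \<and> k = l \<longrightarrow>
        R (h X) (v i V) (v j W) (v k U) =
          2 * (\<beta> j) ^ 3 * Xb X j * (gf j V U * gf j W P + gf j V W * gf j U P)) \<and>
      \<comment> \<open>(12)\<close>
      (i = j \<and> j \<noteq> k \<and> k = l \<longrightarrow>
        R (h X) (v i V) (v j W) (v k U) =
          2 * \<beta> j * (\<beta> k)\<^sup>2 * Xb X j * gf j V W * gf k U P) \<and>
      \<comment> \<open>(13)\<close>
      (i = j \<and> j \<noteq> k \<and> k = l \<longrightarrow>
        R (h X) (v i V) (v k U) (v j W) =
          2 * \<beta> k * (\<beta> j)\<^sup>2 * Xb X k * gf j V W * gf k U P) \<and>
      \<comment> \<open>(14); the third excluded case is (13) with the last two vector fields renamed\<close>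
      (\<not> (i = j \<and> j = k \<and> k = l) \<and> \<not> (i = j \<and> j \<noteq> k \<and> k = l) \<and> \<not> (i = k \<and> k \<noteq> j \<and> j = l) \<longrightarrow>
        R (h X) (v i V) (v j W) (v k U) = 0) \<and>
      R (v j W) (v k U) (h X) (v i V) = 0 \<and> R (v j W) (v k U) (v i V) (h X) = 0 \<and>
      \<comment> \<open>(15)\<close>
      (i = j \<and> j = k \<and> k = s \<and> s = l \<longrightarrow>
        R (v k U) (v i V) (v j W) (v s Q) =
          (\<beta> j)\<^sup>2 * RF j U V W Q
          + (\<beta> j)\<^sup>2 * dbdb j j * (gf j U W * gf j V Q - gf j V W * gf j U Q)
          + (\<beta> j) ^ 4 * gf j Q P * (KF j U W V - KF j V W U)
          + (\<beta> j) ^ 4 * dgP j U W * gf j V Q - (\<beta> j) ^ 4 * dgP j V W * gf j U Q) \<and>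
      \<comment> \<open>(16)\<close>
      (i = j \<and> j = k \<and> k = s \<and> s \<noteq> l \<longrightarrow>
        R (v k U) (v i V) (v j W) (v s Q) =
          (\<beta> j)\<^sup>2 * RF j U V W Q
          + (\<beta> j)\<^sup>2 * dbdb j j * (gf j U W * gf j V Q - gf j V W * gf j U Q)) \<and>
      \<comment> \<open>(17)\<close>
      (j = k \<and> k \<noteq> i \<and> i = s \<and> s = l \<or> k = j \<and> i = s \<and> j \<noteq> i \<and> j \<noteq> l \<and> i \<noteq> l \<longrightarrow>
        R (v k U) (v i V) (v j W) (v s Q) = \<beta> i * \<beta> j * dbdb i j * gf i V Q * gf j U W) \<and>
      \<comment> \<open>(18)\<close>
      (l = j \<and> j = k \<and> k \<noteq> i \<and> i = s \<longrightarrow>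
        R (v k U) (v i V) (v j W) (v s Q) =
          \<beta> i * \<beta> j * dbdb i j * gf i V Q * gf j U W
          + (\<beta> i)\<^sup>2 * (\<beta> j)\<^sup>2 * dgP j U W * gf i V Q) \<and>
      \<comment> \<open>(19)\<close>
      (k = s \<and> s \<noteq> i \<and> i = j \<and> j = l \<longrightarrow>
        R (v k U) (v i V) (v j W) (v s Q) =
          - (\<beta> j * \<beta> k * dbdb j k * gf j V W * gf k U Q)
          - (\<beta> j)\<^sup>2 * (\<beta> k)\<^sup>2 * dgP j V W * gf k U Q) \<and>
      \<comment> \<open>(20)\<close>
      (l = k \<and> k = s \<and> s \<noteq> i \<and> i = j \<or> k = s \<and> i = j \<and> k \<noteq> i \<and> k \<noteq> l \<and> i \<noteq> l \<longrightarrow>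
        R (v k U) (v i V) (v j W) (v s Q) =
          - (\<beta> j * \<beta> k * dbdb j k * gf j V W * gf k U Q)) \<and>
      \<comment> \<open>(21)\<close>
      (l = k \<and> k \<noteq> i \<and> i = j \<and> j = s \<longrightarrow>
        R (v i V) (v j W) (v s Q) (v k U) =
          (\<beta> j)\<^sup>2 * (\<beta> k)\<^sup>2 * gf k U P * (KF j V Q W - KF j W Q V)) \<and>
      \<comment> \<open>(22); the excluded cases are (15)-(21) in this order, (21) with renamed vector fields\<close>
      (\<not> (i = j \<and> j = k \<and> k = s \<and> s = l) \<and>
       \<not> (i = j \<and> j = k \<and> k = s \<and> s \<noteq> l) \<and>
       \<not> (j = k \<and> k \<noteq> i \<and> i = s \<and> s = l \<or> k = j \<and> i = s \<and> j \<noteq> i \<and> j \<noteq> l \<and> i \<noteq> l) \<and>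
       \<not> (l = j \<and> j = k \<and> k \<noteq> i \<and> i = s) \<and>
       \<not> (k = s \<and> s \<noteq> i \<and> i = j \<and> j = l) \<and>
       \<not> (l = k \<and> k = s \<and> s \<noteq> i \<and> i = j \<or> k = s \<and> i = j \<and> k \<noteq> i \<and> k \<noteq> l \<and> i \<noteq> l) \<and>
       \<not> (l = s \<and> s \<noteq> k \<and> k = i \<and> i = j) \<longrightarrow>
        R (v k U) (v i V) (v j W) (v s Q) = 0)"
proof -
  have nd: "nondegenerate B gB" by (rule nondegenerate_semi_riemannian_imp[OF assms(1)])
  interpret warped_vector B gB F gF b l P
  proof (intro warped_vector.intro warped.intro manifold_product.intro warped_axioms.intro warped_vector_axioms.intro
      manifold_product_axioms.intro nd assms(2-4))
    show "manifold B" using nd by (simp add: nondegenerate_def semi_riem_def)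
    show "manifold (F n)" for n
      using assms(2)[of n] smooth_manifold_manifold
      by (auto simp: semi_regular_def radical_stationary_def singular_semi_riemannian_def)
  qed
  note X = assms(5) and Y = assms(6) and Z = assms(7) and T = assms(8)
    and U = assms(9) and V = assms(10) and W = assms(11) and Q = assms(12)
  have p: "(x, y) \<in> points PM" using assms(13,14) by simp
  have sym: "gBs (differential (b n)) (differential (b n')) x = gBs (differential (b n')) (differential (b n)) x" for n n'
    by (rule BG.inverse_metric_sym[OF assms(13)])
  \<comment> \<open>\<open>H2\<close> exchanges the last two fields of \<open>H1\<close>, and
    \<open>V4\<close> shifts the four fields of \<open>V3\<close> cyclically; they serve the claims
    stated with these orders.\<close>
  note R1 = R_HHHH[OF X Y Z T p] and R2 = R_HHHV[OF X Y Z W p] and R3 = R_HHVH[OF X Y Z W p]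
    and R4 = R_HVHH[OF X Y Z W p] and R5 = R_HHVV[OF X Y V W p] and R6 = R_VVHH[OF X Y V W p]
    and R7 = R_VHVH[OF X Y V W p] and R8 = R_VHHV[OF X Y V W p]
    and S1 = R_swap_HV[OF p X W lift_base_vf[OF Y] lift_base_vf[OF Z]]
    and S2 = R_swap_HV[OF p X V lift_fibre_vf[OF W] lift_base_vf[OF Y]]
    and S3 = R_swap_HV[OF p X V lift_base_vf[OF Y] lift_fibre_vf[OF W]]
    and H1 = R_HVVV[OF X U V W p] and H2 = R_HVVV[OF X W V U p]
    and V1 = R_VVHV[OF X W U V p] and V2 = R_VVVH[OF X W U V p]
    and V3 = R_VVVV[OF U V W Q p] and V4 = R_VVVV[OF V W Q U p]
  show ?thesis
    unfolding Let_def
  proof (intro conjI impI, goal_cases)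
    case 1
    show ?case by (rule R1)
  next
    case 2
    then show ?case unfolding R2 by (simp add: \<pi>_def)
  next
    case 3
    then show ?case unfolding R3 by simp
  next
    case 4
    show ?case by (rule R4)
  next
    case 5
    show ?case by (simp only: S1 R4 minus_zero)
  next
    case 6
    then show ?case unfolding R2 by (simp add: \<pi>_def)
  next
    case 7
    then show ?case unfolding R3 by simp
  next
    case 8
    show ?case by (rule R4)
  next
    case 9
    show ?case by (simp only: S1 R4 minus_zero)
  next
    case 10
    show ?case by (rule R5)
  next
    case 11
    show ?case by (rule R6)
  next
    case 12
    show ?case by (rule S2)
  next
    case 13
    then show ?case unfolding R7 by simp
  next
    case 14
    show ?case by (rule S2)
  next
    case 15
    then show ?case unfolding R7 by simp
  next
    case 16
    show ?case by (rule S3)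
  next
    case 17
    then show ?case unfolding R8 by auto
  next
    case 18
    then show ?case unfolding R7 by auto
  next
    case 19
    then show ?case unfolding R8 by auto
  next
    case 20
    then show ?case unfolding H1 by (simp add: algebra_simps power3_eq_cube power2_eq_square)
  next
    case 21
    then show ?case unfolding H1 by auto
  next
    case 22
    then show ?case unfolding H2 by auto
  next
    case 23
    then show ?case unfolding H1 by auto
  next
    case 24
    show ?case by (rule V1)
  next
    case 25
    show ?case by (rule V2)
  next
    case 26
    then have "i = j" "k = j" "s = j" "l = j" by auto
    then show ?case unfolding V3 \<pi>_def by (simp add: algebra_simps power4_eq_xxxx power2_eq_square)
  next
    case 27
    then have "i = j" "k = j" "s = j" "j \<noteq> l" by auto
    then show ?case unfolding V3 \<pi>_def by (simp add: algebra_simps power2_eq_square)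
  next
    case 28
    then have "k = j" "s = i" "i \<noteq> j" "j \<noteq> i" "j \<noteq> l" by auto
    then show ?case unfolding V3 \<pi>_def sym[of k i] by simp
  next
    case 29
    then have "k = j" "s = i" "i \<noteq> j" "j \<noteq> i" "l = j" by auto
    then show ?case unfolding V3 \<pi>_def sym[of k i] by simp
  next
    case 30
    then have "s = k" "i = j" "k \<noteq> j" "j \<noteq> k" "l = j" by auto
    then show ?case unfolding V3 \<pi>_def by simp
  next
    case 31
    then have "s = k" "i = j" "k \<noteq> j" "j \<noteq> k" "j \<noteq> l" by auto
    then show ?case unfolding V3 \<pi>_def by simp
  next
    case 32
    then have "i = j" "s = j" "l = k" "j \<noteq> k" "k \<noteq> j" by auto
    then show ?case unfolding V4 \<pi>_def by simp
  next
    case 33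
    \<comment> \<open>Every summand of \<open>V3\<close> presupposes one of these patterns of
      indices. Splitting each pattern by which of its indices equal l, or each other, leads to one
      of the excluded configurations.\<close>
    have 1: "\<not> (i = j \<and> j = k \<and> k = s)" using 33 by argo
    have 2: "\<not> (k = j \<and> i = s)" using 33 by (smt (verit))
    have 3: "\<not> (i = j \<and> k = s)" using 33 by argo
    have 4: "\<not> (k = i \<and> i = j \<and> s = l)" using 33 by argo
    have 5: "\<not> (i = s \<and> j = l \<and> k = j)" "\<not> (k = s \<and> j = l \<and> i = j)" using 2 3 by auto
    show ?case
      unfolding V3 \<pi>_def if_not_P[OF 1] if_not_P[OF 2] if_not_P[OF 3] if_not_P[OF 5(1)] if_not_P[OF 5(2)]
      using 4 by auto
  qed
qed

end
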